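(* Given a set $P$ of $n$ weighted points in the plane (weights are arbitrary reals, possibly negative), a set $Q$ of $m$ unweighted points in the plane, and a positive integer $k$, the maxDominance problem can be solved in $O\!\left(k\min\{n+m,\ \tfrac{n}{k}+m^2\}\log m\right)$ time and $O(n+m)$ space.
   Context: For a point $q$, $dom(q)=(-\infty,x(q)]\times(-\infty,y(q)]$; for $Q'\subseteq Q$, $dom(Q')=\bigcup_{q\in Q'}dom(q)$. For a region $R$, $w(R)$ is the sum of the weights of the points of $P$ lying in $R$ (zero if none). The maxDominance problem asks to compute $\mathrm{maxDominance}(P,Q,k)=\max\{w(dom(Q')):Q'\subseteq Q,\ |Q'|\le k\}$ and a subset $Q'\subseteq Q$ with $|Q'|\le k$ attaining this maximum. *)

theory Defs
  imports Complex_Main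
begin

section \<open>The maxDominance problem\<close>

type_synonym point = "real \<times> real"

definition dom_point :: "point \<Rightarrow> point set" where
  "dom_point q = {..fst q} \<times> {..snd q}"

definition dom_set :: "point set \<Rightarrow> point set" where
  "dom_set Q' = (\<Union>q\<in>Q'. dom_point q)"

definition region_weight :: "point set \<Rightarrow> (point \<Rightarrow> real) \<Rightarrow> point set \<Rightarrow> real" where
  "region_weight P w R = (\<Sum>p\<in>P \<inter> R. w p)"

definition maxDominance :: "point set \<Rightarrow> (point \<Rightarrow> real) \<Rightarrow> point set \<Rightarrow> nat \<Rightarrow> real" where
  "maxDominance P w Q k =
     Max {region_weight P w (dom_set Q') | Q'. Q' \<subseteq> Q \<and> card Q' \<le> k}"

section \<open>A real RAM with bounded words and bounded memory\<close>

text \<open>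
  Running times and space refer to programs of a small imperative language over two
  kinds of data: machine words (natural numbers, used for indices and counters) and exact
  reals. Each kind has scalar variables and named arrays. The language is a deep embedding,
  so every operation has to be spelled out and is charged for. On reals only addition,
  subtraction and comparison are available; a real can never be converted into a word.

  Two resource limits are parameters of the machine: all word values have to be smaller
  than W, and the total length of all arrays may never exceed S. A program that
  violates a limit, or accesses an array out of bounds, gets stuck and then has no
  execution. The scalar variables are not counted in the space: their number is a constant
  determined by the program text.
\<close>

type_synonym vname = string

datatype nexp =
    NLit nat
  | NVar vname
  | NGet vname nexp
  | NAdd nexp nexp
  | NSub nexp nexp
  | NMul nexp nexp
  | NDiv nexp nexp
  | NMod nexp nexp

datatype rexp =
    RZero
  | RVar vname
  | RGet vname nexp
  | RAdd rexp rexp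
  | RSub rexp rexp

datatype bexp =
    NLess nexp nexp
  | RLess rexp rexp
  | BNot bexp
  | BAnd bexp bexp

datatype com =
    Skip
  | NSet vname nexp
  | RSet vname rexp
  | NPut vname nexp nexp
  | RPut vname nexp rexp
  | NNew vname nexp
  | RNew vname nexp
  | Seq com com
  | If bexp com com
  | While bexp com

record state =
  nvar :: "vname \<Rightarrow> nat"
  rvar :: "vname \<Rightarrow> real"
  narr :: "vname \<Rightarrow> nat list"
  rarr :: "vname \<Rightarrow> real list"

text \<open>
  In every state reachable from an input only finitely many arrays are nonempty, so the
  sums below are genuine.
\<close>

definition space :: "state \<Rightarrow> nat" where
  "space s = (\<Sum>a | narr s a \<noteq> []. length (narr s a)) + (\<Sum>a | rarr s a \<noteq> []. length (rarr s a))"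

definition word :: "nat \<Rightarrow> nat \<Rightarrow> nat option" where
  "word W v = (if v < W then Some v else None)"

definition fetch :: "'a list \<Rightarrow> nat \<Rightarrow> 'a option" where
  "fetch xs i = (if i < length xs then Some (xs ! i) else None)"

definition lift2 :: "('a \<Rightarrow> 'a \<Rightarrow> 'b) \<Rightarrow> 'a option \<Rightarrow> 'a option \<Rightarrow> 'b option" where
  "lift2 f x y = Option.bind x (\<lambda>u. map_option (f u) y)"

fun neval :: "nat \<Rightarrow> state \<Rightarrow> nexp \<Rightarrow> nat option" where
  "neval W s (NLit v) = word W v"
| "neval W s (NVar x) = Some (nvar s x)"
| "neval W s (NGet a e) = Option.bind (neval W s e) (fetch (narr s a))"
| "neval W s (NAdd e f) = Option.bind (lift2 (+) (neval W s e) (neval W s f)) (word W)"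
| "neval W s (NSub e f) = Option.bind (lift2 (-) (neval W s e) (neval W s f)) (word W)"
| "neval W s (NMul e f) = Option.bind (lift2 (*) (neval W s e) (neval W s f)) (word W)"
| "neval W s (NDiv e f) = Option.bind (lift2 (div) (neval W s e) (neval W s f)) (word W)"
| "neval W s (NMod e f) = Option.bind (lift2 (mod) (neval W s e) (neval W s f)) (word W)"

fun reval :: "nat \<Rightarrow> state \<Rightarrow> rexp \<Rightarrow> real option" where
  "reval W s RZero = Some 0"
| "reval W s (RVar x) = Some (rvar s x)"
| "reval W s (RGet a e) = Option.bind (neval W s e) (fetch (rarr s a))"
| "reval W s (RAdd e f) = lift2 (+) (reval W s e) (reval W s f)"
| "reval W s (RSub e f) = lift2 (-) (reval W s e) (reval W s f)"

text \<open>Conjunction is evaluated lazily, so that it can guard an array access.\<close>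

fun beval :: "nat \<Rightarrow> state \<Rightarrow> bexp \<Rightarrow> bool option" where
  "beval W s (NLess e f) = lift2 (<) (neval W s e) (neval W s f)"
| "beval W s (RLess e f) = lift2 (<) (reval W s e) (reval W s f)"
| "beval W s (BNot b) = map_option Not (beval W s b)"
| "beval W s (BAnd b c) = Option.bind (beval W s b) (\<lambda>v. if v then beval W s c else Some False)"

fun ncost :: "nexp \<Rightarrow> nat" where
  "ncost (NLit v) = 1"
| "ncost (NVar x) = 1"
| "ncost (NGet a e) = 1 + ncost e"
| "ncost (NAdd e f) = 1 + ncost e + ncost f"
| "ncost (NSub e f) = 1 + ncost e + ncost f"
| "ncost (NMul e f) = 1 + ncost e + ncost f"
| "ncost (NDiv e f) = 1 + ncost e + ncost f"
| "ncost (NMod e f) = 1 + ncost e + ncost f"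

fun rcost :: "rexp \<Rightarrow> nat" where
  "rcost RZero = 1"
| "rcost (RVar x) = 1"
| "rcost (RGet a e) = 1 + ncost e"
| "rcost (RAdd e f) = 1 + rcost e + rcost f"
| "rcost (RSub e f) = 1 + rcost e + rcost f"

fun bcost :: "bexp \<Rightarrow> nat" where
  "bcost (NLess e f) = 1 + ncost e + ncost f"
| "bcost (RLess e f) = 1 + rcost e + rcost f"
| "bcost (BNot b) = 1 + bcost b"
| "bcost (BAnd b c) = 1 + bcost b + bcost c"

text \<open>
  \<open>exec W S c s t s'\<close>: on the machine with limits \<open>W\<close> and \<open>S\<close>, the program \<open>c\<close> started in
  \<open>s\<close> halts in \<open>s'\<close> after time \<open>t\<close>. Creating an array of length \<open>l\<close> (which replaces, and so
  frees, the previous array of that name) fills it with zeros and is charged \<open>l\<close>.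
\<close>

inductive exec :: "nat \<Rightarrow> nat \<Rightarrow> com \<Rightarrow> state \<Rightarrow> nat \<Rightarrow> state \<Rightarrow> bool" for W S :: nat where
  exec_Skip: "exec W S Skip s 1 s"
| exec_NSet: "neval W s e = Some v \<Longrightarrow>
    exec W S (NSet x e) s (1 + ncost e) (s\<lparr>nvar := (nvar s)(x := v)\<rparr>)"
| exec_RSet: "reval W s e = Some v \<Longrightarrow>
    exec W S (RSet x e) s (1 + rcost e) (s\<lparr>rvar := (rvar s)(x := v)\<rparr>)"
| exec_NPut: "neval W s i = Some j \<Longrightarrow> j < length (narr s a) \<Longrightarrow> neval W s e = Some v \<Longrightarrow>
    exec W S (NPut a i e) s (1 + ncost i + ncost e)
      (s\<lparr>narr := (narr s)(a := (narr s a)[j := v])\<rparr>)"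
| exec_RPut: "neval W s i = Some j \<Longrightarrow> j < length (rarr s a) \<Longrightarrow> reval W s e = Some v \<Longrightarrow>
    exec W S (RPut a i e) s (1 + ncost i + rcost e)
      (s\<lparr>rarr := (rarr s)(a := (rarr s a)[j := v])\<rparr>)"
| exec_NNew: "neval W s e = Some l \<Longrightarrow> s' = s\<lparr>narr := (narr s)(a := replicate l 0)\<rparr> \<Longrightarrow>
    space s' \<le> S \<Longrightarrow> exec W S (NNew a e) s (1 + ncost e + l) s'"
| exec_RNew: "neval W s e = Some l \<Longrightarrow> s' = s\<lparr>rarr := (rarr s)(a := replicate l 0)\<rparr> \<Longrightarrow>
    space s' \<le> S \<Longrightarrow> exec W S (RNew a e) s (1 + ncost e + l) s'"
| exec_Seq: "exec W S c s t s' \<Longrightarrow> exec W S d s' t' s'' \<Longrightarrow>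
    exec W S (Seq c d) s (t + t') s''"
| exec_IfTrue: "beval W s b = Some True \<Longrightarrow> exec W S c s t s' \<Longrightarrow>
    exec W S (If b c d) s (1 + bcost b + t) s'"
| exec_IfFalse: "beval W s b = Some False \<Longrightarrow> exec W S d s t s' \<Longrightarrow>
    exec W S (If b c d) s (1 + bcost b + t) s'"
| exec_WhileFalse: "beval W s b = Some False \<Longrightarrow>
    exec W S (While b c) s (1 + bcost b) s"
| exec_WhileTrue: "beval W s b = Some True \<Longrightarrow> exec W S c s t s' \<Longrightarrow>
    exec W S (While b c) s' t' s'' \<Longrightarrow>
    exec W S (While b c) s (1 + bcost b + t + t') s''"

text \<open>Hence an execution is \<^emph>\<open>the\<close> execution.\<close>

inductive_cases exec_SkipE: "exec W S Skip s t s'"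
inductive_cases exec_NSetE: "exec W S (NSet x e) s t s'"
inductive_cases exec_RSetE: "exec W S (RSet x r) s t s'"
inductive_cases exec_NPutE: "exec W S (NPut a i e) s t s'"
inductive_cases exec_RPutE: "exec W S (RPut a i r) s t s'"
inductive_cases exec_NNewE: "exec W S (NNew a e) s t s'"
inductive_cases exec_RNewE: "exec W S (RNew a e) s t s'"
inductive_cases exec_SeqE: "exec W S (Seq c d) s t s'"
inductive_cases exec_IfE: "exec W S (If b c d) s t s'"
inductive_cases exec_WhileE: "exec W S (While b c) s t s'"

lemma exec_deterministic:
  "exec W S c s t s' \<Longrightarrow> exec W S c s u s'' \<Longrightarrow> t = u \<and> s' = s''"
proof (induction arbitrary: u s'' rule: exec.induct)
  case (exec_Skip s)
  then show ?case by (rule exec_SkipE) simp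
next
  case (exec_NSet s e v x)
  from exec_NSet(2) show ?case by (rule exec_NSetE) (use exec_NSet(1) in simp)
next
  case (exec_RSet s e v x)
  from exec_RSet(2) show ?case by (rule exec_RSetE) (use exec_RSet(1) in simp)
next
  case (exec_NPut s i j a e v)
  from exec_NPut(4) show ?case by (rule exec_NPutE) (use exec_NPut(1,3) in simp)
next
  case (exec_RPut s i j a e v)
  from exec_RPut(4) show ?case by (rule exec_RPutE) (use exec_RPut(1,3) in simp)
next
  case (exec_NNew s e l s' a)
  from exec_NNew(4) show ?case by (rule exec_NNewE) (use exec_NNew(1,2) in simp)
next
  case (exec_RNew s e l s' a)
  from exec_RNew(4) show ?case by (rule exec_RNewE) (use exec_RNew(1,2) in simp)
next
  case (exec_Seq c s t s' d t' s1)
  from exec_Seq.prems show ?case by (rule exec_SeqE) (simp, use exec_Seq.IH in blast)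
next
  case (exec_IfTrue s b c t s' d)
  from exec_IfTrue.prems show ?case
  proof (rule exec_IfE)
    fix r assume "u = Suc (bcost b + r)" "exec W S c s r s''"
    with exec_IfTrue.IH[of r s''] show ?thesis by simp
  next
    assume "beval W s b = Some False"
    with exec_IfTrue.hyps show ?thesis by simp
  qed
next
  case (exec_IfFalse s b d t s' c)
  from exec_IfFalse.prems show ?case
  proof (rule exec_IfE)
    assume "beval W s b = Some True"
    with exec_IfFalse.hyps show ?thesis by simp
  next
    fix r assume "u = Suc (bcost b + r)" "exec W S d s r s''"
    with exec_IfFalse.IH[of r s''] show ?thesis by simp
  qed
next
  case (exec_WhileFalse s b c)
  from exec_WhileFalse.prems show ?case
    by (rule exec_WhileE) (use exec_WhileFalse.hyps in simp_all)
next
  case (exec_WhileTrue s b c t s' t' s1)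
  from exec_WhileTrue.prems show ?case
  proof (rule exec_WhileE)
    assume "beval W s b = Some False"
    with exec_WhileTrue.hyps show ?thesis by simp
  next
    fix r r' v
    assume "u = Suc (bcost b + r + r')" "exec W S c s r v" "exec W S (While b c) v r' s''"
    with exec_WhileTrue.IH(1)[of r v] exec_WhileTrue.IH(2)[of r' s''] show ?thesis by simp
  qed
qed

section \<open>Encoding of instances and solutions\<close>

text \<open>The points of P and of Q are given in arbitrary order.\<close>

definition input_state :: "point list \<Rightarrow> (point \<Rightarrow> real) \<Rightarrow> point list \<Rightarrow> nat \<Rightarrow> state" where
  "input_state ps w qs k = \<lparr>
     nvar = (\<lambda>_. 0)(''n'' := length ps, ''m'' := length qs, ''k'' := k),
     rvar = (\<lambda>_. 0),
     narr = (\<lambda>_. []),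
     rarr = (\<lambda>_. [])(''px'' := map fst ps, ''py'' := map snd ps, ''pw'' := map w ps,
                     ''qx'' := map fst qs, ''qy'' := map snd qs)\<rparr>"

definition output_value :: "state \<Rightarrow> real" where
  "output_value s = rvar s ''value''"

definition output_indices :: "state \<Rightarrow> nat list" where
  "output_indices s = narr s ''out''"

definition output_set :: "point list \<Rightarrow> state \<Rightarrow> point set" where
  "output_set qs s = (\<lambda>i. qs ! i) ` set (output_indices s)"

text \<open>The maximum, and a duplicate-free list of indices of a subset attaining it.\<close>

definition correct_output ::
    "point set \<Rightarrow> (point \<Rightarrow> real) \<Rightarrow> point set \<Rightarrow> point list \<Rightarrow> nat \<Rightarrow> state \<Rightarrow> bool" where
  "correct_output P w Q qs k s \<longleftrightarrow>
     output_value s = maxDominance P w Q k \<and>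
     distinct (output_indices s) \<and> (\<forall>i\<in>set (output_indices s). i < length qs) \<and>
     card (output_set qs s) \<le> k \<and>
     region_weight P w (dom_set (output_set qs s)) = maxDominance P w Q k"

text \<open>
  The additive 1 and the shift inside the logarithm only matter for m = 0 and m = 1, where
  the usual expression would vanish although no program halts in time 0. For m at least 2
  both are absorbed by the constant factor, as then k * min (n + m) (n / k + m^2) is at
  least 1 and log (m + 1) is at most 2 * log m.
\<close>

definition time_bound :: "nat \<Rightarrow> nat \<Rightarrow> nat \<Rightarrow> real" where
  "time_bound n m k =
     1 + real k * min (real n + real m) (real n / real k + (real m)^2) * log 2 (real m + 1)"

text \<open>Words have O(log (n + m + k)) bits, i.e. are bounded by a fixed power of the parameters.\<close>

definition word_limit :: "nat \<Rightarrow> nat \<Rightarrow> nat \<Rightarrow> nat \<Rightarrow> nat" where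
  "word_limit d n m k = (n + m + k + 2) ^ d"

definition space_limit :: "nat \<Rightarrow> nat \<Rightarrow> nat \<Rightarrow> nat" where
  "space_limit C n m = C * (n + m + 1)"

end

theory Submission
  imports Defs
begin

text \<open>
  Sorted by increasing y-coordinate, the maximal points of a subset of Q form a staircase, i.e. a walk
  towards smaller x whose steps collect the weights of the points of P below them. If the points of Q
  and P arrive by decreasing x-coordinate, then the weights of optimal walks with one more step are
  obtained by one sweep over a segment tree: an arriving point of P changes the values of all walks
  ending at or above its rank, and an arriving point of Q asks for the best walk ending at or below it.
  The k steps thus take time k (n + m) log m. If n exceeds m^2, the points of P are first merged into
  the (m + 1) (m + 2) cells of the rank grid of Q, which replaces n by m^2. To recover an optimal walk
  in linear space, the sweeps only record the node after half of the steps, and the two halves are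
  solved separately; as these occupy disjoint time intervals, the total time only doubles.
\<close>

section \<open>A weakest-precondition calculus with time\<close>

text \<open>Sorting P itself would cost n log n, more than the bound allows when m is small. Hence
  only Q is sorted; each point of P merely gets its ranks among the coordinates of Q by binary
  search, in log m time, and no two points of P are ever compared. With negative weights the best
  subset may have fewer than k points, so walks have at most the allowed number of steps, not
  exactly that many. Replacing k by \<open>min k m\<close> keeps the arrays that store a walk linear
  in m, however large k is. An arriving point changes a whole suffix of values. As values are prefix
  sums of leaf weights plus offsets, one leaf update achieves this without lazy propagation. The
  language has no recursion. The bisection therefore runs as a loop over linked positions of the
  walk, and a potential replaces the recursion tree in the time bound. Clearing the segment tree
  recurs at every depth of the bisection; the extra logarithm is affordable because the tree has
  only O(m) nodes, so that clearing costs O(m) per round where O(m log m) is allowed.\<close>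

definition wp :: "nat \<Rightarrow> nat \<Rightarrow> com \<Rightarrow> state \<Rightarrow> (nat \<Rightarrow> state \<Rightarrow> bool) \<Rightarrow> bool" where
  "wp W S c s Q \<longleftrightarrow> (\<exists>t s'. exec W S c s t s' \<and> Q t s')"

lemma wp_Seq:
  "wp W S c s (\<lambda>t s'. wp W S d s' (\<lambda>t'. Q (t + t'))) \<Longrightarrow> wp W S (Seq c d) s Q"
  unfolding wp_def using exec_Seq by blast

lemma wp_If:
  assumes "beval W s b = Some v"
    and "v \<Longrightarrow> wp W S c s (\<lambda>t. Q (1 + bcost b + t))"
    and "\<not> v \<Longrightarrow> wp W S d s (\<lambda>t. Q (1 + bcost b + t))"
  shows "wp W S (If b c d) s Q"
proof (cases v)
  case True
  then show ?thesis using assms(1,2) exec_IfTrue unfolding wp_def by metis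
next
  case False
  then show ?thesis using assms(1,3) exec_IfFalse unfolding wp_def by metis
qed

text \<open>\<open>\<phi>\<close> bounds the time still to be spent and thereby proves termination
  too: every iteration has positive cost, so it strictly lowers \<open>\<phi>\<close>. Meant for
  loops whose iterations have very uneven costs, such as the bisection.\<close>

lemma wp_potential:
  assumes "I \<phi> s"
    and step: "\<And>\<phi> s. I \<phi> s \<Longrightarrow> beval W s b = Some False \<or> beval W s b = Some True \<and>
      wp W S c s (\<lambda>t s'. \<exists>\<phi>'. I \<phi>' s' \<and> t + 1 + bcost b + \<phi>' \<le> \<phi>)"
  shows "wp W S (While b c) s
    (\<lambda>t s'. t \<le> \<phi> + 1 + bcost b \<and> beval W s' b = Some False \<and> (\<exists>\<phi>. I \<phi> s'))"
  using assms(1)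
proof (induction \<phi> arbitrary: s rule: less_induct)
  case (less \<phi>)
  show ?case
  proof (cases "beval W s b = Some False")
    case True
    then show ?thesis unfolding wp_def using exec_WhileFalse[OF True] less.prems
      by (metis add.commute le_add2 add.assoc)
  next
    case False
    then obtain t s' \<phi>' where b: "beval W s b = Some True" and c: "exec W S c s t s'"
      and i: "I \<phi>' s'" and le: "t + 1 + bcost b + \<phi>' \<le> \<phi>"
      using step[OF less.prems] unfolding wp_def by auto
    have "\<phi>' < \<phi>" using le by simp
    from less.IH[OF this i] obtain t' s'' where w: "exec W S (While b c) s' t' s''"
      and t': "t' \<le> \<phi>' + 1 + bcost b" and rest: "beval W s'' b = Some False \<and> (\<exists>\<phi>. I \<phi> s'')"
      unfolding wp_def by auto
    have "exec W S (While b c) s (1 + bcost b + t + t') s''"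
      by (rule exec_WhileTrue[OF b c w])
    then show ?thesis unfolding wp_def using t' rest le
      by (intro exI[of _ "1 + bcost b + t + t'"] exI[of _ s'']) auto
  qed
qed

lemma wp_count:
  assumes "I 0 s"
    and step: "\<And>i s. I i s \<Longrightarrow> i < N \<Longrightarrow> beval W s b = Some True \<and>
      wp W S c s (\<lambda>t s'. t \<le> T i \<and> I (Suc i) s')"
    and fin: "\<And>s. I N s \<Longrightarrow> beval W s b = Some False"
  shows "wp W S (While b c) s
    (\<lambda>t s'. t \<le> (\<Sum>i<N. T i) + (N + 1) * (1 + bcost b) \<and> I N s')"
proof -
  \<comment> \<open>The claim for the iterations from \<open>j\<close> on, so that the induction on
    \<open>N - j\<close> can restart the loop in a later state.\<close>
  have *: "wp W S (While b c) s
    (\<lambda>t s'. t \<le> (\<Sum>i=j..<N. T i) + (N - j + 1) * (1 + bcost b) \<and> I N s')"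
    if "I j s" "j \<le> N" for j s
    using that
  proof (induction "N - j" arbitrary: j s)
    case 0
    then have "j = N" by simp
    with 0 have "exec W S (While b c) s (1 + bcost b) s" using exec_WhileFalse[OF fin] by blast
    then show ?case unfolding wp_def using \<open>j = N\<close> 0 by auto
  next
    case (Suc x)
    then have j: "j < N" by simp
    from step[OF Suc.prems(1) j] obtain t s' where b: "beval W s b = Some True"
      and c: "exec W S c s t s'" and i: "I (Suc j) s'" and t: "t \<le> T j"
      unfolding wp_def by auto
    from Suc.hyps(1)[OF _ i] j Suc.hyps(2) obtain t' s'' where w: "exec W S (While b c) s' t' s''"
      and t': "t' \<le> (\<Sum>i=Suc j..<N. T i) + (N - Suc j + 1) * (1 + bcost b)" and rest: "I N s''"
      unfolding wp_def by fastforce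
    have "exec W S (While b c) s (1 + bcost b + t + t') s''"
      by (rule exec_WhileTrue[OF b c w])
    moreover have "(\<Sum>i=j..<N. T i) = T j + (\<Sum>i=Suc j..<N. T i)"
      using j by (rule sum.atLeast_Suc_lessThan)
    moreover have "N - j + 1 = Suc (N - Suc j + 1)" using j by simp
    then have "(N - j + 1) * (1 + bcost b) = (1 + bcost b) + (N - Suc j + 1) * (1 + bcost b)"
      by (metis mult_Suc)
    ultimately show ?case unfolding wp_def using t t' rest
      by (intro exI[of _ "1 + bcost b + t + t'"] exI[of _ s'']) simp
  qed
  show ?thesis using *[OF assms(1)] by (simp add: atLeast0LessThan)
qed

section \<open>Frame conditions: what a program can change\<close>

fun nvars :: "com \<Rightarrow> vname set" where
  "nvars (NSet x e) = {x}"
| "nvars (Seq c d) = nvars c \<union> nvars d"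
| "nvars (If b c d) = nvars c \<union> nvars d"
| "nvars (While b c) = nvars c"
| "nvars _ = {}"

fun rvars :: "com \<Rightarrow> vname set" where
  "rvars (RSet x e) = {x}"
| "rvars (Seq c d) = rvars c \<union> rvars d"
| "rvars (If b c d) = rvars c \<union> rvars d"
| "rvars (While b c) = rvars c"
| "rvars _ = {}"

fun narrs :: "com \<Rightarrow> vname set" where
  "narrs (NPut a i e) = {a}"
| "narrs (NNew a e) = {a}"
| "narrs (Seq c d) = narrs c \<union> narrs d"
| "narrs (If b c d) = narrs c \<union> narrs d"
| "narrs (While b c) = narrs c"
| "narrs _ = {}"

fun rarrs :: "com \<Rightarrow> vname set" where
  "rarrs (RPut a i e) = {a}"
| "rarrs (RNew a e) = {a}"
| "rarrs (Seq c d) = rarrs c \<union> rarrs d"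
| "rarrs (If b c d) = rarrs c \<union> rarrs d"
| "rarrs (While b c) = rarrs c"
| "rarrs _ = {}"

definition frame :: "com \<Rightarrow> state \<Rightarrow> state \<Rightarrow> bool" where
  "frame c s s' \<longleftrightarrow> (\<forall>x. x \<notin> nvars c \<longrightarrow> nvar s' x = nvar s x) \<and>
     (\<forall>x. x \<notin> rvars c \<longrightarrow> rvar s' x = rvar s x) \<and>
     (\<forall>x. x \<notin> narrs c \<longrightarrow> narr s' x = narr s x) \<and>
     (\<forall>x. x \<notin> rarrs c \<longrightarrow> rarr s' x = rarr s x)"

lemma exec_frame: "exec W S c s t s' \<Longrightarrow> frame c s s'"
  by (induction rule: exec.induct) (auto simp: frame_def)

lemma frameD:
  assumes "frame c s s'"
  shows "x \<notin> nvars c \<Longrightarrow> nvar s' x = nvar s x"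
    "x \<notin> rvars c \<Longrightarrow> rvar s' x = rvar s x"
    "x \<notin> narrs c \<Longrightarrow> narr s' x = narr s x"
    "x \<notin> rarrs c \<Longrightarrow> rarr s' x = rarr s x"
  using assms by (auto simp: frame_def)

text \<open>The postcondition is weakened under the syntactic frame of \<open>c\<close>, so
  specifications need not list the variables and arrays that \<open>c\<close> never assigns.\<close>

lemma wp_conseq:
  assumes "wp W S c s Q" "\<And>t s'. frame c s s' \<Longrightarrow> Q t s' \<Longrightarrow> R t s'"
  shows "wp W S c s R"
  using assms exec_frame unfolding wp_def by blast

text \<open>Replacing an array by one of the same length leaves the space unchanged, so the
  checks at later allocations only have to account for arrays that are new.\<close>

definition lens :: "state \<Rightarrow> state \<Rightarrow> bool" where
  "lens s s' \<longleftrightarrow> (\<forall>a. length (narr s' a) = length (narr s a)) \<and> (\<forall>a. length (rarr s' a) = length (rarr s a))"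

lemma space_lens: "lens s s' \<Longrightarrow> space s' = space s"
proof -
  assume l: "lens s s'"
  then have "{a. narr s' a \<noteq> []} = {a. narr s a \<noteq> []}" "{a. rarr s' a \<noteq> []} = {a. rarr s a \<noteq> []}"
    unfolding lens_def by (metis length_0_conv)+
  with l show ?thesis by (simp add: space_def lens_def)
qed

fun no_new :: "com \<Rightarrow> bool" where
  "no_new (NNew a e) = False"
| "no_new (RNew a e) = False"
| "no_new (Seq c d) \<longleftrightarrow> no_new c \<and> no_new d"
| "no_new (If b c d) \<longleftrightarrow> no_new c \<and> no_new d"
| "no_new (While b c) \<longleftrightarrow> no_new c"
| "no_new _ = True"

lemma exec_no_new: "exec W S c s t s' \<Longrightarrow> no_new c \<Longrightarrow> lens s s'"
  by (induction rule: exec.induct) (auto simp: lens_def)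

lemma wp_no_new:
  assumes "wp W S c s Q" "no_new c"
  shows "wp W S c s (\<lambda>t s'. Q t s' \<and> lens s s' \<and> space s' = space s)"
  using assms exec_no_new space_lens unfolding wp_def by blast

text \<open>Sums over infinite index sets are 0. The last summand keeps the inequality true in that
  case, so no invariant has to state that only finitely many arrays are nonempty.\<close>

lemma sum_lengths_upd:
  fixes f :: "vname \<Rightarrow> 'a list"
  shows "(\<Sum>a | (f(x := ys)) a \<noteq> []. length ((f(x := ys)) a)) + length (f x) \<le>
     (\<Sum>a | f a \<noteq> []. length (f a)) + length ys + (if finite {a. f a \<noteq> []} then 0 else length (f x))"
proof (cases "finite {a. f a \<noteq> []}")
  case True
  \<comment> \<open>The supports before and after the update differ at most in \<open>x\<close>;
    both sums are compared over this common finite index set.\<close>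
  let ?A = "insert x {a. f a \<noteq> []}"
  have "(\<Sum>a | (f(x := ys)) a \<noteq> []. length ((f(x := ys)) a)) = (\<Sum>a\<in>?A. length ((f(x := ys)) a))"
    using True by (intro sum.mono_neutral_left) auto
  also have "\<dots> = length ys + (\<Sum>a\<in>?A - {x}. length ((f(x := ys)) a))"
    using True by (subst sum.remove[of _ x]) auto
  also have "(\<Sum>a\<in>?A - {x}. length ((f(x := ys)) a)) = (\<Sum>a\<in>?A - {x}. length (f a))"
    by (rule sum.cong) auto
  finally have 1: "(\<Sum>a | (f(x := ys)) a \<noteq> []. length ((f(x := ys)) a)) =
    length ys + (\<Sum>a\<in>?A - {x}. length (f a))" .
  have "(\<Sum>a | f a \<noteq> []. length (f a)) = (\<Sum>a\<in>?A. length (f a))"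
    using True by (intro sum.mono_neutral_left) auto
  also have "\<dots> = length (f x) + (\<Sum>a\<in>?A - {x}. length (f a))"
    using True by (subst sum.remove[of _ x]) auto
  finally show ?thesis using 1 True by simp
next
  case False
  have "{a. f a \<noteq> []} \<subseteq> insert x {a. (f(x := ys)) a \<noteq> []}" by auto
  then have "infinite {a. (f(x := ys)) a \<noteq> []}"
    using False finite_subset by blast
  then show ?thesis using False by simp
qed

text \<open>The replaced array is not credited, so this is one-sided; \<open>space_NNew_same\<close>
  is the exact form for re-allocation at unchanged length.\<close>

lemma space_NNew: "space (s\<lparr>narr := (narr s)(a := replicate l v)\<rparr>) \<le> space s + l"
  using sum_lengths_upd[of "narr s" a "replicate l v"]
  by (auto simp: space_def simp del: fun_upd_apply split: if_splits)

lemma space_RNew: "space (s\<lparr>rarr := (rarr s)(a := replicate l v)\<rparr>) \<le> space s + l"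
  using sum_lengths_upd[of "rarr s" a "replicate l v"]
  by (auto simp: space_def simp del: fun_upd_apply split: if_splits)

lemma space_NNew_same:
  "length (narr s a) = l \<Longrightarrow> space (s\<lparr>narr := (narr s)(a := replicate l v)\<rparr>) = space s"
  by (rule space_lens) (auto simp: lens_def)

lemma word_Some: "v < W \<Longrightarrow> word W v = Some v"
  by (simp add: word_def)

lemma fetch_Some: "i < length xs \<Longrightarrow> fetch xs i = Some (xs ! i)"
  by (simp add: fetch_def)

lemma lift2_Some: "lift2 f (Some a) (Some b) = Some (f a b)"
  by (simp add: lift2_def)

lemma if_Some: "(if b then Some x else Some y) = Some (if b then x else y)"
  by simp

lemmas eval_simps = word_Some fetch_Some lift2_Some if_Some

section \<open>Weakest preconditions as rewrite rules\<close>

lemma wp_Skip_eq: "wp W S Skip s Q \<longleftrightarrow> Q 1 s"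
  unfolding wp_def by (metis exec_Skip exec_SkipE)

lemma wp_NSet_eq: "wp W S (NSet x e) s Q \<longleftrightarrow> (case neval W s e of None \<Rightarrow> False
    | Some v \<Rightarrow> Q (1 + ncost e) (s\<lparr>nvar := (nvar s)(x := v)\<rparr>))"
  (is "?A \<longleftrightarrow> ?B")
proof
  assume "?A"
  then obtain t s' where "exec W S (NSet x e) s t s'" "Q t s'" unfolding wp_def by blast
  then show "?B" by (auto elim: exec_NSetE)
next
  assume "?B"
  then show "?A" unfolding wp_def by (auto split: option.splits intro!: exI conjI exec_NSet)
qed

lemma wp_RSet_eq: "wp W S (RSet x e) s Q \<longleftrightarrow> (case reval W s e of None \<Rightarrow> False
    | Some v \<Rightarrow> Q (1 + rcost e) (s\<lparr>rvar := (rvar s)(x := v)\<rparr>))"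
  (is "?A \<longleftrightarrow> ?B")
proof
  assume "?A"
  then obtain t s' where "exec W S (RSet x e) s t s'" "Q t s'" unfolding wp_def by blast
  then show "?B" by (auto elim: exec_RSetE)
next
  assume "?B"
  then show "?A" unfolding wp_def by (auto split: option.splits intro!: exI conjI exec_RSet)
qed

lemma wp_NPut_eq: "wp W S (NPut a i e) s Q \<longleftrightarrow> (case neval W s i of None \<Rightarrow> False
    | Some j \<Rightarrow> j < length (narr s a) \<and> (case neval W s e of None \<Rightarrow> False
    | Some v \<Rightarrow> Q (1 + ncost i + ncost e) (s\<lparr>narr := (narr s)(a := (narr s a)[j := v])\<rparr>)))"
  (is "?A \<longleftrightarrow> ?B")
proof
  assume "?A"
  then obtain t s' where "exec W S (NPut a i e) s t s'" "Q t s'" unfolding wp_def by blast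
  then show "?B" by (auto elim: exec_NPutE)
next
  assume "?B"
  then show "?A" unfolding wp_def by (auto split: option.splits intro!: exI conjI exec_NPut)
qed

lemma wp_RPut_eq: "wp W S (RPut a i e) s Q \<longleftrightarrow> (case neval W s i of None \<Rightarrow> False
    | Some j \<Rightarrow> j < length (rarr s a) \<and> (case reval W s e of None \<Rightarrow> False
    | Some v \<Rightarrow> Q (1 + ncost i + rcost e) (s\<lparr>rarr := (rarr s)(a := (rarr s a)[j := v])\<rparr>)))"
  (is "?A \<longleftrightarrow> ?B")
proof
  assume "?A"
  then obtain t s' where "exec W S (RPut a i e) s t s'" "Q t s'" unfolding wp_def by blast
  then show "?B" by (auto elim: exec_RPutE)
next
  assume "?B"
  then show "?A" unfolding wp_def by (auto split: option.splits intro!: exI conjI exec_RPut)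
qed

lemma wp_NNew_eq: "wp W S (NNew a e) s Q \<longleftrightarrow> (case neval W s e of None \<Rightarrow> False
    | Some l \<Rightarrow> space (s\<lparr>narr := (narr s)(a := replicate l 0)\<rparr>) \<le> S \<and>
        Q (1 + ncost e + l) (s\<lparr>narr := (narr s)(a := replicate l 0)\<rparr>))"
  (is "?A \<longleftrightarrow> ?B")
proof
  assume "?A"
  then obtain t s' where "exec W S (NNew a e) s t s'" "Q t s'" unfolding wp_def by blast
  then show "?B" by (auto elim: exec_NNewE)
next
  assume "?B"
  then show "?A" unfolding wp_def by (auto split: option.splits intro!: exI conjI exec_NNew)
qed

lemma wp_RNew_eq: "wp W S (RNew a e) s Q \<longleftrightarrow> (case neval W s e of None \<Rightarrow> False
    | Some l \<Rightarrow> space (s\<lparr>rarr := (rarr s)(a := replicate l 0)\<rparr>) \<le> S \<and>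
        Q (1 + ncost e + l) (s\<lparr>rarr := (rarr s)(a := replicate l 0)\<rparr>))"
  (is "?A \<longleftrightarrow> ?B")
proof
  assume "?A"
  then obtain t s' where "exec W S (RNew a e) s t s'" "Q t s'" unfolding wp_def by blast
  then show "?B" by (auto elim: exec_RNewE)
next
  assume "?B"
  then show "?A" unfolding wp_def by (auto split: option.splits intro!: exI conjI exec_RNew)
qed

lemma wp_Seq_eq: "wp W S (Seq c d) s Q \<longleftrightarrow> wp W S c s (\<lambda>t s'. wp W S d s' (\<lambda>t'. Q (t + t')))"
proof
  assume "wp W S (Seq c d) s Q"
  then obtain t s' where "exec W S (Seq c d) s t s'" "Q t s'" unfolding wp_def by blast
  then show "wp W S c s (\<lambda>t s'. wp W S d s' (\<lambda>t'. Q (t + t')))"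
    unfolding wp_def by (auto elim!: exec_SeqE)
qed (rule wp_Seq)

lemma wp_If_eq: "wp W S (If b c d) s Q \<longleftrightarrow> (case beval W s b of None \<Rightarrow> False
    | Some v \<Rightarrow> if v then wp W S c s (\<lambda>t. Q (1 + bcost b + t)) else wp W S d s (\<lambda>t. Q (1 + bcost b + t)))"
  (is "?A \<longleftrightarrow> ?B")
proof
  assume "?A"
  then obtain t s' where "exec W S (If b c d) s t s'" "Q t s'" unfolding wp_def by blast
  then show "?B"
  proof (cases rule: exec_IfE[consumes 1, case_names T F])
    case (T u)
    then show ?thesis using \<open>Q t s'\<close> by (auto simp: wp_def)
  next
    case (F u)
    then show ?thesis using \<open>Q t s'\<close> by (auto simp: wp_def)
  qed
next
  assume "?B"
  then show "?A" by (auto split: option.splits if_splits intro: wp_If)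
qed

lemma wp_Seq_assoc: "wp W S (Seq c (Seq d e)) s Q \<longleftrightarrow> wp W S (Seq (Seq c d) e) s Q"
  by (simp add: wp_Seq_eq add.assoc)

lemma wp_seqI:
  assumes "wp W S c s (\<lambda>t s'. t \<le> T \<and> P s')" "\<And>s'. P s' \<Longrightarrow> wp W S d s' (\<lambda>t s''. t \<le> U \<and> R s'')"
  shows "wp W S (Seq c d) s (\<lambda>t s'. t \<le> T + U \<and> R s')"
  unfolding wp_Seq_eq
proof (rule wp_conseq[OF assms(1)])
  fix t s' assume a: "t \<le> T \<and> P s'"
  show "wp W S d s' (\<lambda>t' s''. t + t' \<le> T + U \<and> R s'')"
    by (rule wp_conseq[OF assms(2)]) (use a in auto)
qed

text \<open>As a congruence rule it confines the simplifier to the state: neither the remaining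
  program nor the postcondition is rewritten. Where sequences inside postconditions have to be
  re-associated, it is switched off.\<close>

lemma wp_cong: "s = s' \<Longrightarrow> wp W S c s Q = wp W S c s' Q"
  by simp

lemmas wp_simps = wp_Skip_eq wp_NSet_eq wp_RSet_eq wp_NPut_eq wp_RPut_eq wp_NNew_eq wp_RNew_eq
  wp_Seq_eq wp_If_eq

declare wp_cong [cong]

section \<open>Segment trees with sums and maximal prefix sums\<close>

text \<open>What the node above the leaves from \<open>a\<close> to \<open>b - 1\<close> stores: their sum, and the maximal prefix sum plus
  offset of an active leaf together with the tag of that leaf.\<close>

definition rep :: "(nat \<Rightarrow> real) \<Rightarrow> (nat \<Rightarrow> real) \<Rightarrow> (nat \<Rightarrow> nat) \<Rightarrow> nat \<Rightarrow> nat \<Rightarrow> real \<Rightarrow> real \<Rightarrow> nat \<Rightarrow> bool" where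
  "rep sl ml gl a b s v g \<longleftrightarrow> s = sum sl {a..<b} \<and>
     (if g = 0 then \<forall>i\<in>{a..<b}. gl i = 0
      else (\<exists>i\<in>{a..<b}. gl i = g \<and> v = sum sl {a..<i} + ml i) \<and>
           (\<forall>i\<in>{a..<b}. gl i \<noteq> 0 \<longrightarrow> sum sl {a..<i} + ml i \<le> v))"

lemma rep_leaf: "rep sl ml gl a (Suc a) (sl a) (ml a) (gl a)"
  by (auto simp: rep_def)

lemma rep_cong:
  assumes "rep sl ml gl a b s v g"
    "\<And>i. a \<le> i \<Longrightarrow> i < b \<Longrightarrow> sl' i = sl i \<and> ml' i = ml i \<and> gl' i = gl i"
  shows "rep sl' ml' gl' a b s v g"
proof -
  have "sum sl' {a..<i} = sum sl {a..<i}" if "i \<le> b" for i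
    using assms(2) that by (intro sum.cong) auto
  then show ?thesis using assms unfolding rep_def by (auto split: if_splits)
qed

text \<open>Prefix sums that reach into the right block are those of that block shifted by
  \<open>s1\<close>, so its candidate competes with the value \<open>s1 + v2\<close>. The condition
  is literally the test made by the programs; ties stay left.\<close>

lemma rep_comb:
  assumes "rep sl ml gl a b s1 v1 g1" "rep sl ml gl b c s2 v2 g2" "a \<le> b" "b \<le> c"
  shows "if 0 < g2 \<and> \<not> (0 < g1 \<and> \<not> v1 < s1 + v2)
    then rep sl ml gl a c (s1 + s2) (s1 + v2) g2 else rep sl ml gl a c (s1 + s2) v1 g1"
proof -
  have split: "sum sl {a..<i} = s1 + sum sl {b..<i}" if "b \<le> i" for i
    using assms(1) \<open>a \<le> b\<close> that by (simp add: rep_def sum.atLeastLessThan_concat)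
  have s: "s1 + s2 = sum sl {a..<c}"
    using assms(2) split[OF assms(4)] by (simp add: rep_def)
  have "{a..<c} = {a..<b} \<union> {b..<c}"
    using assms(3,4) by auto
  then have un: "(\<forall>i\<in>{a..<c}. P i) \<longleftrightarrow> (\<forall>i\<in>{a..<b}. P i) \<and> (\<forall>i\<in>{b..<c}. P i)"
    "(\<exists>i\<in>{a..<c}. P i) \<longleftrightarrow> (\<exists>i\<in>{a..<b}. P i) \<or> (\<exists>i\<in>{b..<c}. P i)" for P
    by blast+
  show ?thesis
  proof (cases "g2 = 0")
    case True
    then have "\<forall>i\<in>{b..<c}. gl i = 0" using assms(2) by (simp add: rep_def)
    then have z: "gl i = 0" if "i \<in> {b..<c}" for i using that by blast
    have "rep sl ml gl a c (s1 + s2) v1 g1"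
    proof (cases "g1 = 0")
      case True
      then have "\<forall>i\<in>{a..<b}. gl i = 0" using assms(1) by (simp add: rep_def)
      then show ?thesis unfolding rep_def un using True s z by simp
    next
      case False
      then have "\<exists>i\<in>{a..<b}. gl i = g1 \<and> v1 = sum sl {a..<i} + ml i"
          "\<forall>i\<in>{a..<b}. gl i \<noteq> 0 \<longrightarrow> sum sl {a..<i} + ml i \<le> v1"
        using assms(1) by (auto simp: rep_def)
      then show ?thesis unfolding rep_def un using False s z by simp
    qed
    then show ?thesis using True by simp
  next
    case g2: False
    then have 2: "\<exists>i\<in>{b..<c}. gl i = g2 \<and> v2 = sum sl {b..<i} + ml i"
        "\<forall>i\<in>{b..<c}. gl i \<noteq> 0 \<longrightarrow> sum sl {b..<i} + ml i \<le> v2"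
      using assms(2) by (auto simp: rep_def)
    have 2: "\<exists>i\<in>{b..<c}. gl i = g2 \<and> s1 + v2 = sum sl {a..<i} + ml i"
        "\<forall>i\<in>{b..<c}. gl i \<noteq> 0 \<longrightarrow> sum sl {a..<i} + ml i \<le> s1 + v2"
      using 2 split by auto
    show ?thesis
    proof (cases "g1 = 0")
      case True
      then have "\<forall>i\<in>{a..<b}. gl i = 0" using assms(1) by (simp add: rep_def)
      then have "rep sl ml gl a c (s1 + s2) (s1 + v2) g2"
        using 2 s g2 unfolding rep_def un by simp
      then show ?thesis using True g2 by simp
    next
      case g1: False
      then have 1: "\<exists>i\<in>{a..<b}. gl i = g1 \<and> v1 = sum sl {a..<i} + ml i"
          "\<forall>i\<in>{a..<b}. gl i \<noteq> 0 \<longrightarrow> sum sl {a..<i} + ml i \<le> v1"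
        using assms(1) by (auto simp: rep_def)
      show ?thesis
      proof (cases "v1 < s1 + v2")
        case True
        have "rep sl ml gl a c (s1 + s2) (s1 + v2) g2"
          unfolding rep_def un using 1 2 s g2 True by (simp, meson less_imp_le order_trans)
        then show ?thesis using g1 g2 True by simp
      next
        case False
        have "rep sl ml gl a c (s1 + s2) v1 g1"
          unfolding rep_def un using 1 2 s g1 False by (simp, meson not_less order_trans)
        then show ?thesis using g1 g2 False by simp
      qed
    qed
  qed
qed

text \<open>Nodes are numbered as in a heap. \<open>X\<close> selects the nodes, by number and height, that are known to be
  consistent: while an update climbs to the root, only the nodes above the current one are not.\<close>

definition nodes_ok :: "nat \<Rightarrow> real list \<Rightarrow> real list \<Rightarrow> nat list \<Rightarrow> (nat \<Rightarrow> nat \<Rightarrow> bool) \<Rightarrow> bool" where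
  "nodes_ok N S M G X \<longleftrightarrow> length S = 2 * N \<and> length M = 2 * N \<and> length G = 2 * N \<and>
     (\<forall>j h. X j h \<longrightarrow> N \<le> j * 2 ^ h \<longrightarrow> j * 2 ^ h < 2 * N \<longrightarrow>
        rep (\<lambda>i. S ! (N + i)) (\<lambda>i. M ! (N + i)) (\<lambda>i. G ! (N + i))
          (j * 2 ^ h - N) (j * 2 ^ h + 2 ^ h - N) (S ! j) (M ! j) (G ! j))"

text \<open>The range condition ties the height \<open>h\<close> to the number \<open>j\<close>. As
  \<open>N\<close> is a power of two, \<open>2 * N\<close> is a multiple of \<open>2 ^ h\<close>, so
  an aligned block that starts below \<open>2 * N\<close> does not reach beyond it.\<close>

lemma node_bound:
  fixes N :: nat
  assumes "N = 2 ^ L" "N \<le> j * 2 ^ h" "j * 2 ^ h < 2 * N"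
  shows "h \<le> L" "j * 2 ^ h + 2 ^ h \<le> 2 * N"
proof -
  have "0 < j" using assms by (cases j) auto
  then have "(2::nat) ^ h \<le> j * 2 ^ h" by simp
  also have "\<dots> < 2 ^ Suc L" using assms by simp
  finally have "(2::nat) ^ h < 2 ^ Suc L" .
  then have "h < Suc L" by (rule power_less_imp_less_exp[rotated]) simp
  then show "h \<le> L" by simp
  then have "2 * N = 2 ^ (Suc L - h) * 2 ^ h" using assms(1) by (simp flip: power_add)
  then obtain q where q: "2 * N = q * 2 ^ h" by blast
  then have "j < q" using assms(3) by simp
  then have "(j + 1) * 2 ^ h \<le> q * 2 ^ h" by (intro mult_le_mono1) simp
  then show "j * 2 ^ h + 2 ^ h \<le> 2 * N" using q by simp
qed

text \<open>Only blocks containing leaf \<open>i\<close> are affected, and those belong to the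
  ancestors \<open>(N + i) div 2 ^ h\<close>. Height 0 is exempt because a leaf describes
  itself.\<close>

lemma nodes_ok_leaf_change:
  assumes "nodes_ok N S M G (\<lambda>_ _. True)" "i < N"
    and "length S' = 2 * N" "length M' = 2 * N" "length G' = 2 * N"
    and "\<And>x. x < 2 * N \<Longrightarrow> x \<noteq> N + i \<Longrightarrow> S' ! x = S ! x \<and> M' ! x = M ! x \<and> G' ! x = G ! x"
    and "N = 2 ^ L"
  shows "nodes_ok N S' M' G' (\<lambda>j h. h = 0 \<or> j \<noteq> (N + i) div 2 ^ h)"
  unfolding nodes_ok_def
proof (intro conjI allI impI)
  fix j h :: nat
  assume a: "h = 0 \<or> j \<noteq> (N + i) div 2 ^ h" "N \<le> j * 2 ^ h" "j * 2 ^ h < 2 * N"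
  show "rep (\<lambda>i. S' ! (N + i)) (\<lambda>i. M' ! (N + i)) (\<lambda>i. G' ! (N + i))
     (j * 2 ^ h - N) (j * 2 ^ h + 2 ^ h - N) (S' ! j) (M' ! j) (G' ! j)"
  proof (cases "h = 0")
    case True
    then obtain x where "j = N + x" using a by (auto simp: le_iff_add)
    then show ?thesis using True rep_leaf[of "\<lambda>i. S' ! (N + i)" "\<lambda>i. M' ! (N + i)" "\<lambda>i. G' ! (N + i)" x]
      by simp
  next
    case False
    then have ne: "j \<noteq> (N + i) div 2 ^ h" using a by simp
    \<comment> \<open>A block containing \<open>N + i\<close> would have the number
      \<open>(N + i) div 2 ^ h\<close>.\<close>
    have out: "N + i < j * 2 ^ h \<or> j * 2 ^ h + 2 ^ h \<le> N + i"
    proof (rule ccontr)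
      assume "\<not> ?thesis"
      then have "(N + i) div 2 ^ h = j" by (intro div_nat_eqI) (auto simp: algebra_simps)
      with ne show False by simp
    qed
    have "j < 2 * N" using a(3) by (metis le_less_trans mult.right_neutral mult_le_mono2 one_le_numeral one_le_power)
    have "j \<noteq> N + i"
    proof
      assume "j = N + i"
      moreover have "2 * j \<le> j * 2 ^ h" using False by (cases h) auto
      ultimately show False using a(3) by simp
    qed
    have r: "rep (\<lambda>i. S ! (N + i)) (\<lambda>i. M ! (N + i)) (\<lambda>i. G ! (N + i))
     (j * 2 ^ h - N) (j * 2 ^ h + 2 ^ h - N) (S ! j) (M ! j) (G ! j)"
      using assms(1) a(2,3) by (simp add: nodes_ok_def)
    have "2 ^ h dvd (2::nat) ^ h" by simp
    have *: "S' ! j = S ! j" "M' ! j = M ! j" "G' ! j = G ! j"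
      using assms(6) \<open>j < 2 * N\<close> \<open>j \<noteq> N + i\<close> by auto
    show ?thesis unfolding *
    proof (rule rep_cong[OF r], goal_cases)
      case (1 x)
      then have "x \<noteq> i" using out a(2) by auto
      show ?case
      proof -
        have "N + x < 2 * N" using 1 node_bound[OF assms(7) a(2,3)] by auto
        then show ?thesis using assms(6)[of "N + x"] \<open>x \<noteq> i\<close> by auto
      qed
    qed
  qed
qed (use assms in auto)

text \<open>One level of the repair: all nodes up to height \<open>it\<close> are consistent, in
  particular both children of the ancestor \<open>j\<close> at height \<open>Suc it\<close>, so
  \<open>rep_comb\<close> applies to \<open>j\<close>. The last two assumptions describe the effect
  of \<open>recompute\<close>.\<close>

lemma nodes_ok_step:
  assumes ok: "nodes_ok N S M G (\<lambda>j h. h \<le> it \<or> j \<noteq> (N + i) div 2 ^ h)" and "i < N" "N = 2 ^ L" "it < L"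
    and j: "j = (N + i) div 2 ^ Suc it"
    and S': "S' = S[j := S ! (2 * j) + S ! (2 * j + 1)]"
    and MG: "if 0 < G ! (2 * j + 1) \<and> \<not> (0 < G ! (2 * j) \<and> \<not> M ! (2 * j) < S ! (2 * j) + M ! (2 * j + 1))
      then M' = M[j := S ! (2 * j) + M ! (2 * j + 1)] \<and> G' = G[j := G ! (2 * j + 1)]
      else M' = M[j := M ! (2 * j)] \<and> G' = G[j := G ! (2 * j)]"
  shows "nodes_ok N S' M' G' (\<lambda>j h. h \<le> Suc it \<or> j \<noteq> (N + i) div 2 ^ h)"
proof -
  obtain r where r: "N = r * 2 ^ Suc it"
    using \<open>it < L\<close> assms(3) by (metis Suc_leI le_imp_power_dvd dvd_def mult.commute)
  have "j * 2 ^ Suc it \<le> N + i" using j by simp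
  then have jlt: "j * 2 ^ Suc it < 2 * N" using \<open>i < N\<close> by simp
  have "r \<le> j" unfolding j using r by (simp del: power_Suc add: less_eq_div_iff_mult_less_eq)
  then have jge: "N \<le> j * 2 ^ Suc it" using r by simp
  have "2 * j \<le> j * 2 ^ Suc it" by simp
  then have jN: "j < N" using jlt by linarith
  have c1: "N \<le> (2 * j) * 2 ^ it" "(2 * j) * 2 ^ it < 2 * N" using jlt jge by (simp_all add: ac_simps)
  have "j * 2 ^ Suc it + 2 ^ Suc it \<le> 2 * N" by (rule node_bound[OF assms(3) jge jlt])
  then have c2: "N \<le> (2 * j + 1) * 2 ^ it" "(2 * j + 1) * 2 ^ it < 2 * N"
    using jge less_le_trans[of "(2 * j + 1) * 2 ^ it" "j * 2 ^ Suc it + 2 ^ Suc it" "2 * N"]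
    by (auto simp: algebra_simps)
  let ?rep = "\<lambda>S M G. rep (\<lambda>i. S ! (N + i)) (\<lambda>i. M ! (N + i)) (\<lambda>i. G ! (N + i))"
  have e0: "(2 * j) * 2 ^ it = j * 2 ^ Suc it" by simp
  have e: "(2 * j + 1) * 2 ^ it = j * 2 ^ Suc it + 2 ^ it" "(2 * j + 1) * 2 ^ it + 2 ^ it = j * 2 ^ Suc it + 2 ^ Suc it"
    by (simp_all add: algebra_simps)
  have rep1: "?rep S M G (j * 2 ^ Suc it - N) (j * 2 ^ Suc it + 2 ^ it - N) (S ! (2 * j)) (M ! (2 * j)) (G ! (2 * j))"
    using ok c1 unfolding nodes_ok_def e0[symmetric] by blast
  have rep2: "?rep S M G (j * 2 ^ Suc it + 2 ^ it - N) (j * 2 ^ Suc it + 2 ^ Suc it - N) (S ! (2 * j + 1)) (M ! (2 * j + 1)) (G ! (2 * j + 1))"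
    using ok c2 unfolding nodes_ok_def e[symmetric] by blast
  have len: "length S = 2 * N" "length M = 2 * N" "length G = 2 * N" using ok by (auto simp: nodes_ok_def)
  have len': "length S' = 2 * N" "length M' = 2 * N" "length G' = 2 * N"
    using len S' MG by (auto split: if_splits)
  have same: "S' ! x = S ! x \<and> M' ! x = M ! x \<and> G' ! x = G ! x" if "x \<noteq> j" for x
    using that S' MG by (auto split: if_splits)
  have cong: "?rep S' M' G' a b u v g" if "?rep S M G a b u v g" for a b u v g
    by (rule rep_cong[OF that]) (use same jN in auto)
  have "S' ! j = S ! (2 * j) + S ! (2 * j + 1)" using S' len jN by simp
  then have repj: "?rep S M G (j * 2 ^ Suc it - N) (j * 2 ^ Suc it + 2 ^ Suc it - N) (S' ! j) (M' ! j) (G' ! j)"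
    using rep_comb[OF rep1 rep2] MG len jN by (auto split: if_splits)
  show ?thesis unfolding nodes_ok_def
  proof (intro conjI allI impI)
    fix x h :: nat
    assume a: "h \<le> Suc it \<or> x \<noteq> (N + i) div 2 ^ h" "N \<le> x * 2 ^ h" "x * 2 ^ h < 2 * N"
    show "?rep S' M' G' (x * 2 ^ h - N) (x * 2 ^ h + 2 ^ h - N) (S' ! x) (M' ! x) (G' ! x)"
    proof (cases "x = j")
      case True
      have "0 < j" using jge assms(3) by (cases j) auto
      \<comment> \<open>The node \<open>j\<close> is in range at one height only: a smaller height
        puts its block below \<open>N\<close>, a larger one beyond \<open>2 * N\<close>.\<close>
      have "h = Suc it"
      proof (rule ccontr)
        assume "h \<noteq> Suc it"
        then consider "Suc h \<le> Suc it" | "Suc (Suc it) \<le> h" by linarith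
        then show False
        proof cases
          case 1
          then have "(2::nat) ^ Suc h \<le> 2 ^ Suc it" by (rule power_increasing) simp
          then have "j * 2 ^ Suc h \<le> j * 2 ^ Suc it" by (rule mult_le_mono2)
          moreover have "j * 2 ^ Suc h = 2 * (j * 2 ^ h)" by simp
          ultimately show False using a(2)[unfolded True] jlt by linarith
        next
          case 2
          then have "(2::nat) ^ Suc (Suc it) \<le> 2 ^ h" by (rule power_increasing) simp
          then have "j * 2 ^ Suc (Suc it) \<le> j * 2 ^ h" by (rule mult_le_mono2)
          moreover have "j * 2 ^ Suc (Suc it) = 2 * (j * 2 ^ Suc it)" by simp
          ultimately show False using a(3)[unfolded True] jge by linarith
        qed
      qed
      then show ?thesis using True cong[OF repj] by simp
    next
      case False
      then have "h \<le> it \<or> x \<noteq> (N + i) div 2 ^ h" using a(1) False j by (cases "h = Suc it") (auto simp del: power_Suc)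
      then have "?rep S M G (x * 2 ^ h - N) (x * 2 ^ h + 2 ^ h - N) (S ! x) (M ! x) (G ! x)"
        using ok a(2,3) by (auto simp: nodes_ok_def)
      then show ?thesis using cong same[OF False] by simp
    qed
  qed (use len' in auto)
qed

text \<open>Normal form with the record updates in field order, so that a state computed by
  simplification is syntactically the one written down in a proof.\<close>

lemma update_order:
  "nvar_update f (rvar_update g s) = rvar_update g (nvar_update f s)"
  "nvar_update f (narr_update h s) = narr_update h (nvar_update f s)"
  "nvar_update f (rarr_update k s) = rarr_update k (nvar_update f s)"
  "rvar_update g (narr_update h s) = narr_update h (rvar_update g s)"
  "rvar_update g (rarr_update k s) = rarr_update k (rvar_update g s)"
  "narr_update h (rarr_update k s) = rarr_update k (narr_update h s)"
  by simp_all

lemmas wps = wp_simps eval_simps update_order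

section \<open>Repairing the path to the root\<close>

definition lchild :: nexp where "lchild = NAdd (NVar ''j'') (NVar ''j'')"
definition rchild :: nexp where "rchild = NAdd lchild (NLit 1)"

definition recompute :: com where
  "recompute =
    Seq (RPut ''S'' (NVar ''j'') (RAdd (RGet ''S'' lchild) (RGet ''S'' rchild)))
    (If (BAnd (NLess (NLit 0) (NGet ''G'' rchild))
         (BNot (BAnd (NLess (NLit 0) (NGet ''G'' lchild))
           (BNot (RLess (RGet ''M'' lchild) (RAdd (RGet ''S'' lchild) (RGet ''M'' rchild)))))))
      (Seq (RPut ''M'' (NVar ''j'') (RAdd (RGet ''S'' lchild) (RGet ''M'' rchild)))
           (NPut ''G'' (NVar ''j'') (NGet ''G'' rchild)))
      (Seq (RPut ''M'' (NVar ''j'') (RGet ''M'' lchild))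
           (NPut ''G'' (NVar ''j'') (NGet ''G'' lchild))))"

definition halve :: com where "halve = NSet ''j'' (NDiv (NVar ''j'') (NLit 2))"

definition pull :: com where
  "pull = While (NLess (NLit 1) (NVar ''j'')) (Seq halve recompute)"

lemma wp_recompute:
  assumes "nvar s ''j'' = j" "2 * j + 1 < N" "N < W" "length S = N" "length M = N"
    "length G = N" "rarr s ''S'' = S" "rarr s ''M'' = M" "narr s ''G'' = G" "2 < W" "0 < j"
  shows "wp W Sp recompute s (\<lambda>t s'. t \<le> 70 \<and> nvar s' = nvar s \<and> 
      rarr s' ''S'' = S[j := S ! (2 * j) + S ! (2 * j + 1)] \<and>
     (if 0 < G ! (2 * j + 1) \<and> \<not> (0 < G ! (2 * j) \<and> \<not> M ! (2 * j) < S ! (2 * j) + M ! (2 * j + 1))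
      then rarr s' ''M'' = M[j := S ! (2 * j) + M ! (2 * j + 1)] \<and> narr s' ''G'' = G[j := G ! (2 * j + 1)]
      else rarr s' ''M'' = M[j := M ! (2 * j)] \<and> narr s' ''G'' = G[j := G ! (2 * j)]))"
proof -
  note [simp] = assms(1,4-9)
  \<comment> \<open>As \<open>j\<close> is positive, neither child is \<open>j\<close> itself;
    \<open>recompute\<close> overwrites the sum at \<open>j\<close> before it reads the children
    again.\<close>
  have [simp]: "j + j < W" "Suc (j + j) < W" "2 < W" "0 < W" "Suc 0 < W" "0 < j" "j < N" "j + j < N" "Suc (j + j) < N" "2 * j = j + j"
    "j \<noteq> j + j" "j \<noteq> Suc (j + j)" using assms(2,3,10,11) by auto
  show ?thesis unfolding recompute_def lchild_def rchild_def
    by (cases "G ! (j + j) = 0"; cases "G ! Suc (j + j) = 0"; cases "M ! (j + j) < S ! (j + j) + M ! Suc (j + j)";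
      simp add: wps)

qed

lemma wp_pull:
  assumes "N = 2 ^ L" "nvar s ''j'' = N + i" "i < N" "2 * N < W" "2 < W"
    and ok: "nodes_ok N (rarr s ''S'') (rarr s ''M'') (narr s ''G'') (\<lambda>j h. h = 0 \<or> j \<noteq> (N + i) div 2 ^ h)"
  shows "wp W Sp pull s (\<lambda>t s'. t \<le> 80 * L + 4 \<and>
    nodes_ok N (rarr s' ''S'') (rarr s' ''M'') (narr s' ''G'') (\<lambda>_ _. True) \<and>
    (\<forall>x\<ge>N. rarr s' ''S'' ! x = rarr s ''S'' ! x \<and> rarr s' ''M'' ! x = rarr s ''M'' ! x
       \<and> narr s' ''G'' ! x = narr s ''G'' ! x))"
proof -
  define I where "I it s' \<longleftrightarrow> nvar s' ''j'' = (N + i) div 2 ^ it \<and>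
    nodes_ok N (rarr s' ''S'') (rarr s' ''M'') (narr s' ''G'') (\<lambda>j h. h \<le> it \<or> j \<noteq> (N + i) div 2 ^ h) \<and>
    (\<forall>x\<ge>N. rarr s' ''S'' ! x = rarr s ''S'' ! x \<and> rarr s' ''M'' ! x = rarr s ''M'' ! x
       \<and> narr s' ''G'' ! x = narr s ''G'' ! x)" for it and s' :: state
  \<comment> \<open>\<open>2 ^ it\<close> divides \<open>N\<close>, so the quotient splits. Hence it
    exceeds 1 before round \<open>L\<close> and is the root 1 at round \<open>L\<close>.\<close>
  have div: "(N + i) div 2 ^ it = 2 ^ (L - it) + i div 2 ^ it" if "it \<le> L" for it
  proof -
    have "N = 2 ^ (L - it) * 2 ^ it" using that assms(1) by (simp flip: power_add)
    then show ?thesis by simp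
  qed
  have top: "(N + i) div 2 ^ L = 1" using div[of L] assms(1,3) by simp
  have gt: "1 < (N + i) div 2 ^ it" if "it < L" for it
  proof -
    have "(1::nat) < 2 ^ (L - it)" using that by (intro one_less_power) auto
    then show ?thesis using div[of it] that by simp
  qed
  have [simp]: "0 < W" "Suc 0 < W" "2 < W" using assms(5) by auto
  have "I 0 s" using assms by (simp add: I_def)
  have "wp W Sp pull s (\<lambda>t s'. t \<le> (\<Sum>i<L. 74) + (L + 1) * (1 + bcost (NLess (NLit 1) (NVar ''j''))) \<and> I L s')"
    unfolding pull_def
  proof (rule wp_count[where I = I, OF \<open>I 0 s\<close>], goal_cases)
    case (1 it s1)
    define j where "j = (N + i) div 2 ^ Suc it"
    have ok1: "nodes_ok N (rarr s1 ''S'') (rarr s1 ''M'') (narr s1 ''G'') (\<lambda>j h. h \<le> it \<or> j \<noteq> (N + i) div 2 ^ h)"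
      and nj: "nvar s1 ''j'' = (N + i) div 2 ^ it"
      using 1(1) by (auto simp: I_def)
    have j2: "nvar s1 ''j'' div 2 = j" unfolding nj j_def by (simp flip: div_mult2_eq add: mult.commute)
    have jpos: "0 < j" using j2 gt[OF 1(2)] nj by simp
    have "j \<le> (N + i) div 2" unfolding j_def by (rule div_le_mono2) auto
    then have jN: "j < N" using assms(3) by simp
    have "wp W Sp recompute (s1\<lparr>nvar := (nvar s1)(''j'' := j)\<rparr>) (\<lambda>t s'. t \<le> 70 \<and> I (Suc it) s')"
    proof (rule wp_conseq[OF wp_recompute[where j = j and N = "2 * N", OF _ _ _ _ _ _ refl refl refl]], goal_cases)
      case (9 t s2)
      note f = frameD[OF 9(1), unfolded recompute_def, simplified]
      have "nodes_ok N (rarr s2 ''S'') (rarr s2 ''M'') (narr s2 ''G'') (\<lambda>j h. h \<le> Suc it \<or> j \<noteq> (N + i) div 2 ^ h)"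
        by (rule nodes_ok_step[OF ok1 assms(3,1) 1(2) j_def]) (use 9(2) in \<open>simp_all\<close>)
      moreover have "rarr s2 ''S'' ! x = rarr s1 ''S'' ! x \<and> rarr s2 ''M'' ! x = rarr s1 ''M'' ! x
         \<and> narr s2 ''G'' ! x = narr s1 ''G'' ! x" if "x \<ge> N" for x
        using 9(2) that jN by (auto split: if_splits)
      ultimately show ?case using 9(2) 1(1) by (auto simp: I_def j_def)
    qed (use ok1 jN jpos assms(4) in \<open>auto simp: nodes_ok_def\<close>)
    then have "wp W Sp (Seq halve recompute) s1 (\<lambda>t s'. t \<le> 74 \<and> I (Suc it) s')"
      using j2 jN assms(4) unfolding halve_def by (auto simp: wps elim!: wp_conseq)
    then show ?case using gt[OF 1(2)] nj by (simp add: eval_simps)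
  next
    case (2 s1)
    then show ?case using top by (simp add: I_def eval_simps)
  qed
  then show ?thesis
  proof (rule wp_conseq, goal_cases)
    case (1 t s')
    have "nodes_ok N (rarr s' ''S'') (rarr s' ''M'') (narr s' ''G'') (\<lambda>j h. h \<le> L \<or> j \<noteq> (N + i) div 2 ^ h)"
      using 1 by (simp add: I_def)
    \<comment> \<open>Consistency up to height \<open>L\<close> is consistency everywhere, since
      \<open>node_bound\<close> admits no greater height.\<close>
    then have "nodes_ok N (rarr s' ''S'') (rarr s' ''M'') (narr s' ''G'') (\<lambda>_ _. True)"
      unfolding nodes_ok_def using node_bound[OF assms(1)] by blast
    then show ?case using 1(2) by (auto simp: I_def)
  qed
qed

section \<open>The tree as a structure for suffix additions and prefix maxima\<close>

definition sl :: "state \<Rightarrow> nat \<Rightarrow> nat \<Rightarrow> real" where "sl s N i = rarr s ''S'' ! (N + i)"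

text \<open>The tree as an abstract data type: a prefix sum \<open>T i\<close>, a value \<open>F i\<close> and a tag \<open>G i\<close> for
  every leaf \<open>i\<close>; the tag 0 marks an inactive leaf, whose value is meaningless.\<close>

definition tree :: "nat \<Rightarrow> state \<Rightarrow> (nat \<Rightarrow> real) \<Rightarrow> (nat \<Rightarrow> real) \<Rightarrow> (nat \<Rightarrow> nat) \<Rightarrow> bool" where
  "tree L s T F G \<longleftrightarrow> nvar s ''N'' = 2 ^ L \<and>
    nodes_ok (2 ^ L) (rarr s ''S'') (rarr s ''M'') (narr s ''G'') (\<lambda>_ _. True) \<and>
    (\<forall>i<2 ^ L. T i = sum (sl s (2 ^ L)) {..<Suc i} \<and>
      F i = sum (sl s (2 ^ L)) {..<i} + rarr s ''M'' ! (2 ^ L + i) \<and> G i = narr s ''G'' ! (2 ^ L + i))"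

definition leaf :: com where "leaf = NSet ''j'' (NAdd (NVar ''N'') (NVar ''j''))"

text \<open>The value of a leaf uses the weights strictly before it. Adding \<open>v\<close> to the
  weight therefore raises later leaves only; adding it to the offset too makes the leaf itself
  follow.\<close>

definition tree_add :: com where
  "tree_add = Seq leaf
    (Seq (RPut ''S'' (NVar ''j'') (RAdd (RGet ''S'' (NVar ''j'')) (RVar ''v'')))
    (Seq (RPut ''M'' (NVar ''j'') (RAdd (RGet ''M'' (NVar ''j'')) (RVar ''v''))) pull))"

definition tree_set :: com where
  "tree_set = Seq leaf
    (Seq (RPut ''M'' (NVar ''j'') (RVar ''v''))
    (Seq (NPut ''G'' (NVar ''j'') (NVar ''g'')) pull))"

lemma wp_tree_add:
  assumes tr: "tree L s T F G" and i: "nvar s ''j'' = i" "i < 2 ^ L" and W: "2 * 2 ^ L < W" "2 < W"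
    and v: "rvar s ''v'' = v"
  shows "wp W Sp tree_add s (\<lambda>t s'. t \<le> 80 * L + 30 \<and>
    tree L s' (\<lambda>x. T x + (if i \<le> x then v else 0)) (\<lambda>x. F x + (if i \<le> x then v else 0)) G)"
proof -
  define N :: nat where "N = 2 ^ L"
  note tr' = tr[unfolded tree_def, folded N_def]
  let ?S = "rarr s ''S''" and ?M = "rarr s ''M''" and ?G = "narr s ''G''"
  have len[simp]: "length ?S = 2 * N" "length ?M = 2 * N" "length ?G = 2 * N" using tr' by (auto simp: nodes_ok_def)
  have iN[simp]: "i < N" "N + i < 2 * N" using i by (auto simp: N_def)
  have [simp]: "nvar s ''N'' = N" "N + i < W" using tr' W iN by (auto simp: N_def)
  define s1 where "s1 = s\<lparr>nvar := (nvar s)(''j'' := N + i),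
      rarr := (rarr s)(''S'' := ?S[N + i := ?S ! (N + i) + v], ''M'' := ?M[N + i := ?M ! (N + i) + v])\<rparr>"
  have ok: "nodes_ok N (rarr s1 ''S'') (rarr s1 ''M'') (narr s1 ''G'') (\<lambda>j h. h = 0 \<or> j \<noteq> (N + i) div 2 ^ h)"
    by (rule nodes_ok_leaf_change[of N ?S ?M ?G]) (use tr' iN in \<open>auto simp: s1_def N_def\<close>)
  have "wp W Sp pull s1 (\<lambda>t s'. t \<le> 80 * L + 4 \<and>
    tree L s' (\<lambda>x. T x + (if i \<le> x then v else 0)) (\<lambda>x. F x + (if i \<le> x then v else 0)) G)"
  proof (rule wp_conseq[OF wp_pull[OF N_def _ iN(1) _ W(2) ok]], goal_cases)
    case (3 t s')
    have sl: "sl s' N x = sl s N x + (if x = i then v else 0)" if "x < N" for x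
      using 3(2) that by (auto simp: sl_def s1_def nth_list_update)
    have M: "rarr s' ''M'' ! (N + x) = ?M ! (N + x) + (if x = i then v else 0)" if "x < N" for x
      using 3(2) that by (auto simp: s1_def nth_list_update)
    have sum: "sum (sl s' N) {..<x} = sum (sl s N) {..<x} + (if i < x then v else 0)" if "x \<le> N" for x
    proof -
      have "sum (sl s' N) {..<x} = sum (\<lambda>y. sl s N y + (if y = i then v else 0)) {..<x}"
        using that by (intro sum.cong) (auto simp: sl)
      then show ?thesis by (simp add: sum.distrib)
    qed
    have n: "nvar s' ''N'' = N"
      using frameD(1)[OF 3(1), of "''N''"] by (simp add: pull_def halve_def recompute_def s1_def)
    have "narr s' ''G'' ! (N + x) = ?G ! (N + x)" for x using 3(2) by (simp add: s1_def)
    moreover have "T x + (if i \<le> x then v else 0) = sum (sl s' N) {..<Suc x} \<and>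
        F x + (if i \<le> x then v else 0) = sum (sl s' N) {..<x} + rarr s' ''M'' ! (N + x) \<and>
        G x = ?G ! (N + x)" if x: "x < N" for x
    proof -
      have "T x = sum (sl s N) {..<Suc x}" "F x = sum (sl s N) {..<x} + ?M ! (N + x)" "G x = ?G ! (N + x)"
        using tr' x by blast+
      then show ?thesis using x by (simp add: sum[of x] sum[of "Suc x"] M less_Suc_eq_le del: sum.lessThan_Suc)
    qed
    ultimately show ?case using 3(2) n unfolding tree_def N_def[symmetric] by simp
  qed (use W in \<open>auto simp: s1_def N_def\<close>)
  then show ?thesis
    unfolding tree_add_def leaf_def using i v by (auto simp: wps s1_def elim!: wp_conseq)
qed

text \<open>\<open>T i\<close> includes the weight of leaf \<open>i\<close> while the value of the
  leaf does not, hence the subtracted entry of \<open>S\<close>. A caller that subtracts the same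
  quantity from the intended value obtains exactly that value.\<close>

lemma wp_tree_set:
  assumes tr: "tree L s T F G" and i: "nvar s ''j'' = i" "i < 2 ^ L" and W: "2 * 2 ^ L < W" "2 < W"
    and v: "rvar s ''v'' = v" "nvar s ''g'' = g"
  shows "wp W Sp tree_set s (\<lambda>t s'. t \<le> 80 * L + 30 \<and>
    tree L s' T (F(i := T i - rarr s ''S'' ! (2 ^ L + i) + v)) (G(i := g)))"
proof -
  define N :: nat where "N = 2 ^ L"
  note tr' = tr[unfolded tree_def, folded N_def]
  let ?S = "rarr s ''S''" and ?M = "rarr s ''M''" and ?G = "narr s ''G''"
  have len[simp]: "length ?S = 2 * N" "length ?M = 2 * N" "length ?G = 2 * N" using tr' by (auto simp: nodes_ok_def)
  have iN[simp]: "i < N" "N + i < 2 * N" using i by (auto simp: N_def)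
  have [simp]: "nvar s ''N'' = N" "N + i < W" using tr' W iN by (auto simp: N_def)
  define s1 where "s1 = s\<lparr>nvar := (nvar s)(''j'' := N + i),
      narr := (narr s)(''G'' := ?G[N + i := g]), rarr := (rarr s)(''M'' := ?M[N + i := v])\<rparr>"
  have ok: "nodes_ok N (rarr s1 ''S'') (rarr s1 ''M'') (narr s1 ''G'') (\<lambda>j h. h = 0 \<or> j \<noteq> (N + i) div 2 ^ h)"
    by (rule nodes_ok_leaf_change[of N ?S ?M ?G]) (use tr' iN in \<open>auto simp: s1_def N_def\<close>)
  have "wp W Sp pull s1 (\<lambda>t s'. t \<le> 80 * L + 4 \<and>
    tree L s' T (F(i := T i - rarr s ''S'' ! (2 ^ L + i) + v)) (G(i := g)))"
  proof (rule wp_conseq[OF wp_pull[OF N_def _ iN(1) _ W(2) ok]], goal_cases)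
    case (3 t s')
    have sl: "sl s' N x = sl s N x" if "x < N" for x
      using 3(2) that by (auto simp: sl_def s1_def nth_list_update)
    have M: "rarr s' ''M'' ! (N + x) = (if x = i then v else ?M ! (N + x))" if "x < N" for x
      using 3(2) that by (auto simp: s1_def nth_list_update)
    have G: "narr s' ''G'' ! (N + x) = (if x = i then g else ?G ! (N + x))" if "x < N" for x
      using 3(2) that by (auto simp: s1_def nth_list_update)
    have sum: "sum (sl s' N) {..<x} = sum (sl s N) {..<x}" if "x \<le> N" for x
      using that by (intro sum.cong) (auto simp: sl)
    have n: "nvar s' ''N'' = N"
      using frameD(1)[OF 3(1), of "''N''"] by (simp add: pull_def halve_def recompute_def s1_def)
    have "T i = sum (sl s N) {..<i} + ?S ! (N + i)" using tr' by (simp add: sl_def)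
    moreover have "T x = sum (sl s' N) {..<Suc x} \<and>
        (F(i := T i - ?S ! (N + i) + v)) x = sum (sl s' N) {..<x} + rarr s' ''M'' ! (N + x) \<and>
        (G(i := g)) x = narr s' ''G'' ! (N + x)" if x: "x < N" for x
    proof -
      have "T x = sum (sl s N) {..<Suc x}" "F x = sum (sl s N) {..<x} + ?M ! (N + x)" "G x = ?G ! (N + x)"
        using tr' x by blast+
      then show ?thesis using x calculation by (simp add: sum[of x] sum[of "Suc x"] M G del: sum.lessThan_Suc)
    qed
    ultimately have "\<forall>x<N. T x = sum (sl s' N) {..<Suc x} \<and>
        (F(i := T i - ?S ! (N + i) + v)) x = sum (sl s' N) {..<x} + rarr s' ''M'' ! (N + x) \<and>
        (G(i := g)) x = narr s' ''G'' ! (N + x)" by blast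
    then show ?case using 3(2) n unfolding tree_def N_def[symmetric] by blast
  qed (use W in \<open>auto simp: s1_def N_def\<close>)
  then show ?thesis
    unfolding tree_set_def leaf_def using i v by (auto simp: wps s1_def elim!: wp_conseq)
qed

lemma tree_zero:
  assumes "nvar s ''N'' = 2 ^ L" "rarr s ''S'' = replicate (2 * 2 ^ L) 0" "rarr s ''M'' = replicate (2 * 2 ^ L) 0"
    "narr s ''G'' = replicate (2 * 2 ^ L) 0"
  shows "tree L s (\<lambda>_. 0) (\<lambda>_. 0) (\<lambda>_. 0)"
proof -
  have "nodes_ok (2 ^ L) (rarr s ''S'') (rarr s ''M'') (narr s ''G'') (\<lambda>_ _. True)"
    unfolding nodes_ok_def
  proof (intro conjI allI impI)
    fix j h :: nat
    assume a: "2 ^ L \<le> j * 2 ^ h" "j * 2 ^ h < 2 * 2 ^ L"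
    have "j \<le> j * 2 ^ h" by simp
    then have j: "j < 2 * 2 ^ L" using a by linarith
    show "rep (\<lambda>i. rarr s ''S'' ! (2 ^ L + i)) (\<lambda>i. rarr s ''M'' ! (2 ^ L + i)) (\<lambda>i. narr s ''G'' ! (2 ^ L + i))
        (j * 2 ^ h - 2 ^ L) (j * 2 ^ h + 2 ^ h - 2 ^ L) (rarr s ''S'' ! j) (rarr s ''M'' ! j) (narr s ''G'' ! j)"
      using j node_bound[OF refl a] assms by (auto simp: rep_def intro!: sum.neutral[symmetric] sum.neutral)
  qed (use assms in auto)
  then show ?thesis using assms by (auto simp: tree_def sl_def)
qed

lemma tree_frame:
  assumes "tree L s T F G" "nvar s' ''N'' = nvar s ''N''" "rarr s' ''S'' = rarr s ''S''" "rarr s' ''M'' = rarr s ''M''"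
    "narr s' ''G'' = narr s ''G''"
  shows "tree L s' T F G"
  using assms by (simp add: tree_def sl_def)

definition best :: "nat \<Rightarrow> (nat \<Rightarrow> real) \<Rightarrow> (nat \<Rightarrow> nat) \<Rightarrow> real \<Rightarrow> nat \<Rightarrow> bool" where
  "best i F G v g \<longleftrightarrow> (if g = 0 then \<forall>x\<le>i. G x = 0
     else (\<exists>x\<le>i. G x = g \<and> v = F x) \<and> (\<forall>x\<le>i. G x \<noteq> 0 \<longrightarrow> F x \<le> v))"

lemma nodes_okD:
  assumes "nodes_ok N S M G (\<lambda>_ _. True)" "N \<le> j * 2 ^ h" "j * 2 ^ h < 2 * N"
  shows "rep (\<lambda>i. S ! (N + i)) (\<lambda>i. M ! (N + i)) (\<lambda>i. G ! (N + i))
     (j * 2 ^ h - N) (j * 2 ^ h + 2 ^ h - N) (S ! j) (M ! j) (G ! j)"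
  using assms by (simp add: nodes_ok_def)

text \<open>Node 1 covers all leaves, which gives the sort its maximum in constant time, without a
  query.\<close>

lemma tree_root:
  assumes "tree L s T F G"
  shows "best (2 ^ L - 1) F G (rarr s ''M'' ! 1) (narr s ''G'' ! 1)"
proof -
  have "rep (\<lambda>i. rarr s ''S'' ! (2 ^ L + i)) (\<lambda>i. rarr s ''M'' ! (2 ^ L + i)) (\<lambda>i. narr s ''G'' ! (2 ^ L + i))
      (1 * 2 ^ L - 2 ^ L) (1 * 2 ^ L + 2 ^ L - 2 ^ L) (rarr s ''S'' ! 1) (rarr s ''M'' ! 1) (narr s ''G'' ! 1)"
    by (rule nodes_okD) (use assms in \<open>auto simp: tree_def\<close>)
  then have r: "rep (sl s (2 ^ L)) (\<lambda>i. rarr s ''M'' ! (2 ^ L + i)) (\<lambda>i. narr s ''G'' ! (2 ^ L + i))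
      0 (2 ^ L) (rarr s ''S'' ! 1) (rarr s ''M'' ! 1) (narr s ''G'' ! 1)"
    by (simp add: sl_def[abs_def])
  have le: "x \<le> 2 ^ L - 1 \<longleftrightarrow> x \<in> {0..<2 ^ L}" for x :: nat
    by (auto simp: Suc_le_eq less_Suc_eq_le[symmetric])
  show ?thesis using r assms(1) unfolding best_def le rep_def tree_def
    by (auto simp: atLeast0LessThan lessThan_iff split: if_splits)
qed

text \<open>While climbing from leaf \<open>i\<close>, the registers describe the leaves from the
  left end of the current subtree up to \<open>i\<close>. An odd node is a right child, so its left
  sibling is prepended.\<close>

definition query_step :: com where
  "query_step = (let p = NSub (NVar ''j'') (NLit 1) in
    If (NLess (NLit 0) (NMod (NVar ''j'') (NLit 2)))
      (Seq (If (BAnd (NLess (NLit 0) (NVar ''rg''))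
              (BNot (BAnd (NLess (NLit 0) (NGet ''G'' p))
                (BNot (RLess (RGet ''M'' p) (RAdd (RGet ''S'' p) (RVar ''rm'')))))))
        (RSet ''rm'' (RAdd (RGet ''S'' p) (RVar ''rm'')))
        (Seq (RSet ''rm'' (RGet ''M'' p)) (NSet ''rg'' (NGet ''G'' p))))
      (RSet ''rs'' (RAdd (RGet ''S'' p) (RVar ''rs''))))
      Skip)"

definition tree_query :: com where
  "tree_query = Seq leaf
    (Seq (RSet ''rs'' (RGet ''S'' (NVar ''j'')))
    (Seq (RSet ''rm'' (RGet ''M'' (NVar ''j'')))
    (Seq (NSet ''rg'' (NGet ''G'' (NVar ''j'')))
    (While (NLess (NLit 1) (NVar ''j'')) (Seq query_step halve)))))"

lemma wp_query_step:
  assumes "nvar s ''j'' = j" "j < N" "N < W" "length S = N" "length M = N" "length G = N"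
    "rarr s ''S'' = S" "rarr s ''M'' = M" "narr s ''G'' = G" "2 < W" "0 < j"
    "rvar s ''rs'' = rs" "rvar s ''rm'' = rm" "nvar s ''rg'' = rg"
  shows "wp W Sp query_step s (\<lambda>t s'. t \<le> 50 \<and> nvar s' ''j'' = j \<and>
    (if odd j then rvar s' ''rs'' = S ! (j - 1) + rs \<and>
      (if 0 < rg \<and> \<not> (0 < G ! (j - 1) \<and> \<not> M ! (j - 1) < S ! (j - 1) + rm)
       then rvar s' ''rm'' = S ! (j - 1) + rm \<and> nvar s' ''rg'' = rg
       else rvar s' ''rm'' = M ! (j - 1) \<and> nvar s' ''rg'' = G ! (j - 1))
     else rvar s' ''rs'' = rs \<and> rvar s' ''rm'' = rm \<and> nvar s' ''rg'' = rg))"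
proof -
  note [simp] = assms(1,4-9,12-14)
  have [simp]: "2 < W" "0 < W" "Suc 0 < W" "j mod 2 < W" "0 < j" "j < N" "j - Suc 0 < W" "j - Suc 0 < N" using assms(2,3,10,11) by auto
  show ?thesis
  proof (cases "odd j")
    case True
    then have "j mod 2 = 1" by presburger
    then show ?thesis using True unfolding query_step_def Let_def by (auto simp: wps)
  next
    case False
    then have "j mod 2 = 0" by presburger
    then show ?thesis using False unfolding query_step_def Let_def by (auto simp: wps)
  qed
qed

lemma wp_tree_query:
  assumes tr: "tree L s T F G" and i: "nvar s ''j'' = i" "i < 2 ^ L" and W: "2 * 2 ^ L < W" "2 < W"
  shows "wp W Sp tree_query s (\<lambda>t s'. t \<le> 80 * L + 30 \<and>
    rvar s' ''rs'' = T i \<and> best i F G (rvar s' ''rm'') (nvar s' ''rg''))"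
proof -
  define N :: nat where "N = 2 ^ L"
  note tr' = tr[unfolded tree_def, folded N_def]
  let ?S = "rarr s ''S''" and ?M = "rarr s ''M''" and ?G = "narr s ''G''"
  let ?rep = "rep (\<lambda>i. ?S ! (N + i)) (\<lambda>i. ?M ! (N + i)) (\<lambda>i. ?G ! (N + i))"
  have len[simp]: "length ?S = 2 * N" "length ?M = 2 * N" "length ?G = 2 * N" using tr' by (auto simp: nodes_ok_def)
  have iN[simp]: "i < N" "N + i < 2 * N" using i by (auto simp: N_def)
  have [simp]: "nvar s ''N'' = N" "N + i < W" using tr' W iN by (auto simp: N_def)
  have [simp]: "0 < W" "Suc 0 < W" "2 < W" using W by auto
  define s1 where "s1 = s\<lparr>nvar := (nvar s)(''j'' := N + i, ''rg'' := ?G ! (N + i)),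
      rvar := (rvar s)(''rs'' := ?S ! (N + i), ''rm'' := ?M ! (N + i))\<rparr>"
  define I where "I it s' \<longleftrightarrow> nvar s' ''j'' = (N + i) div 2 ^ it \<and>
    rarr s' ''S'' = ?S \<and> rarr s' ''M'' = ?M \<and> narr s' ''G'' = ?G \<and>
    ?rep ((N + i) div 2 ^ it * 2 ^ it - N) (Suc i) (rvar s' ''rs'') (rvar s' ''rm'') (nvar s' ''rg'')" for it and s' :: state
  have div: "(N + i) div 2 ^ it = 2 ^ (L - it) + i div 2 ^ it" if "it \<le> L" for it
  proof -
    have "N = 2 ^ (L - it) * 2 ^ it" using that N_def by (simp flip: power_add)
    then show ?thesis by simp
  qed
  have top: "(N + i) div 2 ^ L = 1" using div[of L] iN by (simp add: N_def)
  have gt: "1 < (N + i) div 2 ^ it" if "it < L" for it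
  proof -
    have "(1::nat) < 2 ^ (L - it)" using that by (intro one_less_power) auto
    then show ?thesis using div[of it] that by simp
  qed
  have "I 0 s1" using rep_leaf[of "\<lambda>i. ?S ! (N + i)" "\<lambda>i. ?M ! (N + i)" "\<lambda>i. ?G ! (N + i)" i]
    by (simp add: I_def s1_def)
  have "wp W Sp (While (NLess (NLit 1) (NVar ''j'')) (Seq query_step halve)) s1
     (\<lambda>t s'. t \<le> (\<Sum>i<L. 60) + (L + 1) * (1 + bcost (NLess (NLit 1) (NVar ''j''))) \<and> I L s')"
  proof (rule wp_count[where I = I, OF \<open>I 0 s1\<close>], goal_cases)
    case (1 it s1)
    define j where "j = (N + i) div 2 ^ it"
    have nj: "nvar s1 ''j'' = j" and a: "rarr s1 ''S'' = ?S" "rarr s1 ''M'' = ?M" "narr s1 ''G'' = ?G"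
      and r: "?rep (j * 2 ^ it - N) (Suc i) (rvar s1 ''rs'') (rvar s1 ''rm'') (nvar s1 ''rg'')"
      using 1(1) by (auto simp: I_def j_def)
    have j1: "1 < j" using gt[OF 1(2)] by (simp add: j_def)
    have "j \<le> N + i" unfolding j_def by simp
    then have jN: "j < 2 * N" using iN(1) by linarith
    have jd: "j div 2 = (N + i) div 2 ^ Suc it" unfolding j_def by (simp flip: div_mult2_eq add: mult.commute)
    have "wp W Sp query_step s1 (\<lambda>t s'. t \<le> 50 \<and> nvar s' ''j'' = j \<and>
      rarr s' ''S'' = ?S \<and> rarr s' ''M'' = ?M \<and> narr s' ''G'' = ?G \<and>
      ?rep (j div 2 * 2 ^ Suc it - N) (Suc i) (rvar s' ''rs'') (rvar s' ''rm'') (nvar s' ''rg''))"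
    proof (rule wp_conseq[OF wp_query_step[OF nj jN _ len a _ _ refl refl refl]], goal_cases)
      case (4 t s2)
      have fr: "rarr s2 ''S'' = ?S" "rarr s2 ''M'' = ?M" "narr s2 ''G'' = ?G"
        using frameD[OF 4(1)] a by (auto simp: query_step_def Let_def)
      have "?rep (j div 2 * 2 ^ Suc it - N) (Suc i) (rvar s2 ''rs'') (rvar s2 ''rm'') (nvar s2 ''rg'')"
      proof (cases "odd j")
        case False
        then have e: "j div 2 * 2 ^ Suc it = j * 2 ^ it" by (auto elim!: evenE)
        show ?thesis unfolding e using 4(2) False r by simp
      next
        case True
        then obtain h where h: "j = 2 * h + 1" by (auto elim!: oddE)
        have e: "j div 2 * 2 ^ Suc it = (j - 1) * 2 ^ it" using h by simp
        \<comment> \<open>\<open>N\<close> is a multiple of \<open>2 ^ Suc it\<close>, so the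
          current level starts at an even number and the left sibling of an odd node lies on the
          same level.\<close>
        obtain q where q: "N = q * 2 ^ Suc it" using 1(2) N_def by (metis Suc_leI le_imp_power_dvd dvd_def mult.commute)
        have "q \<le> j div 2" unfolding jd using q by (simp del: power_Suc add: less_eq_div_iff_mult_less_eq)
        then have "q * 2 ^ Suc it \<le> j div 2 * 2 ^ Suc it" by (rule mult_le_mono1)
        then have ge: "N \<le> (j - 1) * 2 ^ it" unfolding e q[symmetric] .
        have le: "j * 2 ^ it \<le> N + i" by (simp add: j_def)
        have je: "(j - 1) * 2 ^ it + 2 ^ it = j * 2 ^ it" using j1 by (cases j) auto
        have lt: "(j - 1) * 2 ^ it < 2 * N" using le iN(1) je by linarith
        have r1: "?rep ((j - 1) * 2 ^ it - N) ((j - 1) * 2 ^ it + 2 ^ it - N) (?S ! (j - 1)) (?M ! (j - 1)) (?G ! (j - 1))"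
          using tr' ge lt unfolding nodes_ok_def by blast
        have "(j - 1) * 2 ^ it - N \<le> j * 2 ^ it - N" "j * 2 ^ it - N \<le> Suc i" using le je by linarith+
        from rep_comb[OF r1[unfolded je] r this] show ?thesis unfolding e using 4(2) True
          by (auto split: if_splits)
      qed
      then show ?case using 4(2) fr by auto
    qed (use W j1 in \<open>auto simp: N_def\<close>)
    then have "wp W Sp (Seq query_step halve) s1 (\<lambda>t s'. t \<le> 60 \<and> I (Suc it) s')"
      unfolding wp_Seq_eq
    proof (rule wp_conseq, goal_cases)
      case (1 t s')
      then show ?case unfolding halve_def using jN W jd by (auto simp: wps I_def N_def)
    qed
    then show ?case using j1 nj by (simp add: eval_simps)
  next
    case (2 s1)
    then show ?case using top by (simp add: I_def eval_simps)
  qed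
  then have "wp W Sp (While (NLess (NLit 1) (NVar ''j'')) (Seq query_step halve)) s1
     (\<lambda>t s'. t \<le> 80 * L + 10 \<and> rvar s' ''rs'' = T i \<and> best i F G (rvar s' ''rm'') (nvar s' ''rg''))"
  proof (rule wp_conseq, goal_cases)
    case (1 t s')
    then have r: "?rep 0 (Suc i) (rvar s' ''rs'') (rvar s' ''rm'') (nvar s' ''rg'')"
      using top by (simp add: I_def N_def)
    have "rvar s' ''rs'' = T i" using r tr' by (simp add: rep_def sl_def[abs_def] atLeast0LessThan)
    moreover have "best i F G (rvar s' ''rm'') (nvar s' ''rg'')"
    proof -
      have FG: "F x = sum (sl s N) {..<x} + ?M ! (N + x)" "G x = ?G ! (N + x)" if "x \<le> i" for x
        using that tr' le_less_trans[OF that iN(1)] by auto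
      show ?thesis using r unfolding best_def rep_def
        by (auto simp: FG sl_def[abs_def] atLeast0LessThan less_Suc_eq_le split: if_splits)
    qed
    ultimately show ?case using 1 by auto
  qed
  then show ?thesis
    unfolding tree_query_def leaf_def s1_def using i
    apply (simp add: wps)
    apply (erule wp_conseq)
    apply simp
    done
qed

lemma tree_mods [simp]:
  "nvars pull = {''j''}" "rvars pull = {}" "narrs pull = {''G''}" "rarrs pull = {''S'', ''M''}" "no_new pull"
  "nvars tree_add = {''j''}" "rvars tree_add = {}" "narrs tree_add = {''G''}" "rarrs tree_add = {''S'', ''M''}" "no_new tree_add"
  "nvars tree_set = {''j''}" "rvars tree_set = {}" "narrs tree_set = {''G''}" "rarrs tree_set = {''S'', ''M''}" "no_new tree_set"
  "nvars tree_query = {''j'', ''rg''}" "rvars tree_query = {''rs'', ''rm''}" "narrs tree_query = {}" "rarrs tree_query = {}"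
  "no_new tree_query"
  by (auto simp: pull_def halve_def recompute_def tree_add_def tree_set_def tree_query_def leaf_def query_step_def Let_def)

section \<open>Clearing the tree\<close>

definition tree_init :: com where
  "tree_init = Seq (RNew ''S'' (NAdd (NVar ''N'') (NVar ''N''))) (Seq (RNew ''M'' (NAdd (NVar ''N'') (NVar ''N'')))
     (NNew ''G'' (NAdd (NVar ''N'') (NVar ''N''))))"

lemma tree_init_mods [simp]:
  "nvars tree_init = {}" "rvars tree_init = {}" "narrs tree_init = {''G''}" "rarrs tree_init = {''S'', ''M''}"
  by (auto simp: tree_init_def)

lemma lens_refl [simp]: "lens s s"
  by (simp add: lens_def)

lemma lens_trans: "lens s s' \<Longrightarrow> lens s' s'' \<Longrightarrow> lens s s''"
  by (simp add: lens_def)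

lemma lensD: "lens s s' \<Longrightarrow> length (narr s' a) = length (narr s a)" "lens s s' \<Longrightarrow> length (rarr s' a) = length (rarr s a)"
  by (simp_all add: lens_def)

lemma lens_upd [simp]:
  "lens s (nvar_update f s') = lens s s'" "lens s (rvar_update g s') = lens s s'"
  "lens (nvar_update f s') s = lens s' s" "lens (rvar_update g s') s = lens s' s"
  "lens s (s'\<lparr>narr := (narr s')(a := (narr s' a)[i := v])\<rparr>) = lens s s'"
  "lens s (s'\<lparr>rarr := (rarr s')(b := (rarr s' b)[i := w])\<rparr>) = lens s s'"
  by (auto simp: lens_def)

text \<open>The three arrays are re-allocated at their old lengths, so clearing takes no additional
  space.\<close>

lemma wp_tree_init:
  assumes "nvar s ''N'' = 2 ^ L" "2 * 2 ^ L < W" "space s \<le> Sp"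
    and l: "length (rarr s ''S'') = 2 * 2 ^ L" "length (rarr s ''M'') = 2 * 2 ^ L" "length (narr s ''G'') = 2 * 2 ^ L"
  shows "wp W Sp tree_init s (\<lambda>t s'. t \<le> 6 * 2 ^ L + 12 \<and> lens s s' \<and> tree L s' (\<lambda>_. 0) (\<lambda>_. 0) (\<lambda>_. 0))"
proof -
  have "lens s (s\<lparr>rarr := (rarr s)(''S'' := replicate (2 ^ L + 2 ^ L) 0)\<rparr>)"
    "lens s (s\<lparr>rarr := (rarr s)(''S'' := replicate (2 ^ L + 2 ^ L) 0, ''M'' := replicate (2 ^ L + 2 ^ L) 0)\<rparr>)"
    "lens s (s\<lparr>narr := (narr s)(''G'' := replicate (2 ^ L + 2 ^ L) 0),
        rarr := (rarr s)(''S'' := replicate (2 ^ L + 2 ^ L) 0, ''M'' := replicate (2 ^ L + 2 ^ L) 0)\<rparr>)"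
    using l by (auto simp: lens_def)
  moreover note calculation[THEN space_lens]
  ultimately show ?thesis unfolding tree_init_def using assms
    by (simp add: wps tree_zero[unfolded mult_2])
qed

text \<open>Without weights the correction term in \<open>wp_tree_set\<close> vanishes, and values
  are the plain offsets.\<close>

lemma tree_zero_sums:
  assumes "tree L s (\<lambda>_. 0) F G" "i < 2 ^ L"
  shows "rarr s ''S'' ! (2 ^ L + i) = 0"
proof -
  have z: "sum (sl s (2 ^ L)) {..<Suc x} = 0" if "x < 2 ^ L" for x
    using assms(1) that by (metis tree_def)
  have "sum (sl s (2 ^ L)) {..<i} = 0"
    using z assms(2) by (cases i) (auto simp del: sum.lessThan_Suc)
  then show ?thesis using z[OF assms(2)] by (simp add: sl_def)
qed

section \<open>Sorting with a tournament tree\<close>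

text \<open>In a tree without weights the root shows the largest offset of an active leaf, i.e. the
  winner of a tournament. Leaf \<open>i\<close> carries the tag \<open>i + 1\<close>, since tag 0
  means inactive.\<close>

definition insert_step :: "vname \<Rightarrow> com" where
  "insert_step ka = Seq (NSet ''j'' (NVar ''i'')) (Seq (RSet ''v'' (RGet ka (NVar ''i'')))
     (Seq (NSet ''g'' (NAdd (NVar ''i'') (NLit 1))) (Seq tree_set (NSet ''i'' (NAdd (NVar ''i'') (NLit 1))))))"

text \<open>The winner is the largest remaining key, so both arrays are filled from the back:
  \<open>oa\<close> with its index, \<open>sa\<close> with the key.\<close>

definition extract_step :: "vname \<Rightarrow> vname \<Rightarrow> com" where
  "extract_step oa sa = Seq (NSet ''i'' (NSub (NVar ''i'') (NLit 1)))
    (Seq (NSet ''j'' (NSub (NGet ''G'' (NLit 1)) (NLit 1)))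
    (Seq (NPut oa (NVar ''i'') (NVar ''j''))
    (Seq (RPut sa (NVar ''i'') (RGet ''M'' (NLit 1)))
    (Seq (RSet ''v'' RZero) (Seq (NSet ''g'' (NLit 0)) tree_set)))))"

definition tournament_sort :: "vname \<Rightarrow> vname \<Rightarrow> vname \<Rightarrow> com" where
  "tournament_sort ka oa sa = Seq tree_init
    (Seq (NSet ''i'' (NLit 0))
    (Seq (While (NLess (NVar ''i'') (NVar ''m'')) (insert_step ka))
         (While (NLess (NLit 0) (NVar ''i'')) (extract_step oa sa))))"

lemma tournament_sort_mods [simp]:
  "nvars (tournament_sort ka oa sa) = {''i'', ''j'', ''g''}" "rvars (tournament_sort ka oa sa) = {''v''}"
  "narrs (tournament_sort ka oa sa) = {''G'', oa}" "rarrs (tournament_sort ka oa sa) = {''S'', ''M'', sa}"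
  by (auto simp: tournament_sort_def insert_step_def extract_step_def)

lemma step_mods [simp]:
  "nvars (insert_step ka) = {''i'', ''j'', ''g''}" "rvars (insert_step ka) = {''v''}"
  "narrs (insert_step ka) = {''G''}" "rarrs (insert_step ka) = {''S'', ''M''}"
  "nvars (extract_step oa sa) = {''i'', ''j'', ''g''}" "rvars (extract_step oa sa) = {''v''}"
  "narrs (extract_step oa sa) = {''G'', oa}" "rarrs (extract_step oa sa) = {''S'', ''M'', sa}"
  by (auto simp: insert_step_def extract_step_def)

lemma wp_insert_step:
  assumes tr: "tree L s (\<lambda>_. 0) F G" and "nvar s ''i'' = i" "i < 2 ^ L" "2 * 2 ^ L + 2 < W" "i < length (rarr s ka)"
    and ka: "ka \<noteq> ''S''" "ka \<noteq> ''M''"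
  shows "wp W Sp (insert_step ka) s (\<lambda>t s'. t \<le> 80 * L + 50 \<and> nvar s' ''i'' = Suc i \<and> lens s s' \<and>
    tree L s' (\<lambda>_. 0) (F(i := rarr s ka ! i)) (G(i := Suc i)))"
proof -
  define s1 where "s1 = s\<lparr>nvar := (nvar s)(''j'' := i, ''g'' := Suc i), rvar := (rvar s)(''v'' := rarr s ka ! i)\<rparr>"
  have tr1: "tree L s1 (\<lambda>_. 0) F G" by (rule tree_frame[OF tr]) (auto simp: s1_def)
  have z: "rarr s1 ''S'' ! (2 ^ L + i) = 0" by (rule tree_zero_sums[OF tr1 assms(3)])
  have [simp]: "Suc i < W" "Suc 0 < W" "i < W" using assms(3,4) by auto
  note w = wp_no_new[OF wp_tree_set[OF tr1, of i W "rarr s ka ! i" "Suc i" Sp]]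
  have "wp W Sp tree_set s1 (\<lambda>t s'. t \<le> 80 * L + 30 \<and> lens s s' \<and> nvar s' ''i'' = i \<and>
    tree L s' (\<lambda>_. 0) (F(i := rarr s ka ! i)) (G(i := Suc i)))"
    by (rule wp_conseq[OF w]) (use assms z in \<open>auto simp: s1_def dest: frameD(1)[where x = "''i''"]\<close>)
  then have "wp W Sp tree_set s1 (\<lambda>t s'. wp W Sp (NSet ''i'' (NAdd (NVar ''i'') (NLit 1))) s'
     (\<lambda>t' s'. t + t' \<le> 80 * L + 40 \<and> nvar s' ''i'' = Suc i \<and> lens s s' \<and>
    tree L s' (\<lambda>_. 0) (F(i := rarr s ka ! i)) (G(i := Suc i))))"
    by (rule wp_conseq) (auto simp: wps elim!: tree_frame)
  then show ?thesis unfolding insert_step_def s1_def using assms(2,5)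
    by (simp add: wps) (erule wp_conseq, erule wp_conseq, auto)
qed

lemma wp_extract_step:
  assumes tr: "tree L s (\<lambda>_. 0) F (\<lambda>x. if x \<in> A then Suc x else 0)" and "A \<noteq> {}" "A \<subseteq> {..<m}"
    and FA: "\<And>x. x \<in> A \<Longrightarrow> F x = key x"
    and "nvar s ''i'' = Suc i" "Suc i \<le> m" "m \<le> 2 ^ L" "2 * 2 ^ L + 2 < W"
    and o: "narr s oa = ol" "length ol = m" "rarr s sa = sal" "length sal = m" "oa \<noteq> ''G''" "sa \<noteq> ''S''" "sa \<noteq> ''M''"
  shows "wp W Sp (extract_step oa sa) s (\<lambda>t s'. t \<le> 80 * L + 60 \<and> nvar s' ''i'' = i \<and> lens s s' \<and>
    (\<exists>x F'. x \<in> A \<and> (\<forall>y\<in>A. key y \<le> key x) \<and> narr s' oa = ol[i := x] \<and> rarr s' sa = sal[i := key x] \<and>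
      (\<forall>y\<in>A - {x}. F' y = key y) \<and>
      tree L s' (\<lambda>_. 0) F' (\<lambda>y. if y \<in> A - {x} then Suc y else 0)))"
proof -
  define G where "G = (\<lambda>x. if x \<in> A then Suc x else 0)"
  have AL: "x < 2 ^ L" if "x \<in> A" for x using that assms(3,7) by auto
  then have lep: "x \<le> 2 ^ L - 1" if "x \<in> A" for x using that by (simp add: le_diff_conv2 Suc_le_eq)
  have b: "best (2 ^ L - 1) F G (rarr s ''M'' ! 1) (narr s ''G'' ! 1)"
    using tree_root[OF tr] by (simp add: G_def)
  obtain a where a: "a \<in> A" using assms(2) by blast
  have "narr s ''G'' ! 1 \<noteq> 0"
  proof
    assume "narr s ''G'' ! 1 = 0"
    then have "G a = 0" using b lep[OF a] by (simp add: best_def)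
    then show False using a by (simp add: G_def)
  qed
  then obtain x where x: "G x = narr s ''G'' ! 1" "rarr s ''M'' ! 1 = F x" "narr s ''G'' ! 1 \<noteq> 0"
    and mx: "\<forall>y\<le>2 ^ L - 1. G y \<noteq> 0 \<longrightarrow> F y \<le> F x" using b by (auto simp: best_def)
  then have xA: "x \<in> A" and g1: "narr s ''G'' ! 1 = Suc x" by (auto simp: G_def split: if_splits)
  have m1: "rarr s ''M'' ! 1 = key x" using x FA xA by simp
  have mx: "key y \<le> key x" if "y \<in> A" for y
    using mx lep[OF that] that FA xA by (auto simp: G_def)
  have len: "length (narr s ''G'') = 2 * 2 ^ L" "length (rarr s ''M'') = 2 * 2 ^ L"
    using tr by (auto simp: tree_def nodes_ok_def)
  define s1 where "s1 = s\<lparr>nvar := (nvar s)(''i'' := i, ''j'' := x, ''g'' := 0), rvar := (rvar s)(''v'' := 0),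
     narr := (narr s)(oa := ol[i := x]), rarr := (rarr s)(sa := sal[i := key x])\<rparr>"
  have tr1: "tree L s1 (\<lambda>_. 0) F G"
    unfolding G_def by (rule tree_frame[OF tr]) (use o in \<open>auto simp: s1_def\<close>)
  have xL: "x < 2 ^ L" by (rule AL[OF xA])
  have z: "rarr s1 ''S'' ! (2 ^ L + x) = 0" by (rule tree_zero_sums[OF tr1 xL])
  have [simp]: "Suc 0 < W" "0 < W" "i < W" "x < W" "i < m" "Suc 0 < 2 * 2 ^ L" "Suc x < W" using assms(6-8) xL
    by (auto simp: less_le_trans[OF _ mult_le_mono2[OF one_le_power]])
  have "lens s s1" using o by (auto simp: lens_def s1_def)
  have G': "G(x := 0) = (\<lambda>y. if y \<in> A - {x} then Suc y else 0)" by (auto simp: G_def)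
  note w = wp_no_new[OF wp_tree_set[OF tr1, of x W 0 0 Sp]]
  have "wp W Sp tree_set s1 (\<lambda>t s'. t \<le> 80 * L + 30 \<and> nvar s' ''i'' = i \<and> lens s s' \<and>
    narr s' oa = ol[i := x] \<and> rarr s' sa = sal[i := key x] \<and>
    tree L s' (\<lambda>_. 0) (F(x := 0)) (\<lambda>y. if y \<in> A - {x} then Suc y else 0))"
    by (rule wp_conseq[OF w]) (use assms z xL \<open>lens s s1\<close> G' in 
      \<open>auto simp: s1_def frameD(1)[where x = "''i''"] frameD(3)[where x = oa] frameD(4)[where x = sa] intro: lens_trans\<close>)
  then have "wp W Sp tree_set s1 (\<lambda>t s'. t \<le> 80 * L + 30 \<and> nvar s' ''i'' = i \<and> lens s s' \<and>
    (\<exists>x F'. x \<in> A \<and> (\<forall>y\<in>A. key y \<le> key x) \<and> narr s' oa = ol[i := x] \<and> rarr s' sa = sal[i := key x] \<and>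
      (\<forall>y\<in>A - {x}. F' y = key y) \<and>
      tree L s' (\<lambda>_. 0) F' (\<lambda>y. if y \<in> A - {x} then Suc y else 0)))"
  proof (rule wp_conseq, goal_cases)
    case (1 t s')
    then show ?case using xA mx FA by (intro conjI exI[of _ x] exI[of _ "F(x := 0)"]) auto
  qed
  then show ?thesis unfolding extract_step_def s1_def using o assms(5) g1 m1
    by (simp add: wps len) (erule wp_conseq, auto)
qed

lemma wp_sort:
  assumes "nvar s ''N'' = 2 ^ L" "nvar s ''m'' = m" "m \<le> 2 ^ L" "2 * 2 ^ L + 2 < W" "space s \<le> Sp"
    and l: "length (rarr s ''S'') = 2 * 2 ^ L" "length (rarr s ''M'') = 2 * 2 ^ L" "length (narr s ''G'') = 2 * 2 ^ L"
    and k: "rarr s ka = key" "length key = m" "length (narr s oa) = m" "length (rarr s sa) = m"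
    and ne: "ka \<noteq> ''S''" "ka \<noteq> ''M''" "oa \<noteq> ''G''" "sa \<noteq> ''S''" "sa \<noteq> ''M''"
  shows "wp W Sp (tournament_sort ka oa sa) s (\<lambda>t s'. t \<le> 6 * 2 ^ L + 40 + m * (160 * L + 120) \<and> lens s s' \<and>
     bij_betw ((!) (narr s' oa)) {..<m} {..<m} \<and>
     (\<forall>i<m. rarr s' sa ! i = key ! (narr s' oa ! i)) \<and>
     (\<forall>i j. i \<le> j \<longrightarrow> j < m \<longrightarrow> rarr s' sa ! i \<le> rarr s' sa ! j))"
proof -
  define I where "I i s' \<longleftrightarrow> nvar s' ''i'' = i \<and> nvar s' ''m'' = m \<and> lens s s' \<and> rarr s' ka = key \<and>
    tree L s' (\<lambda>_. 0) (\<lambda>x. if x < i then key ! x else 0) (\<lambda>x. if x < i then Suc x else 0)" for i and s' :: state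
  \<comment> \<open>After \<open>t\<close> extractions the last \<open>t\<close> positions are
    final: they enumerate the removed indices in ascending order of keys, and no remaining key
    exceeds theirs. Equal keys may appear in any order.\<close>
  define J where "J t s' \<longleftrightarrow> t \<le> m \<and> nvar s' ''i'' = m - t \<and> lens s s' \<and> (\<exists>A F ol sal. A \<subseteq> {..<m} \<and> card A = m - t \<and>
    (\<forall>x\<in>A. F x = key ! x) \<and> tree L s' (\<lambda>_. 0) F (\<lambda>x. if x \<in> A then Suc x else 0) \<and>
    narr s' oa = ol \<and> rarr s' sa = sal \<and>
    bij_betw ((!) ol) {m - t..<m} ({..<m} - A) \<and> (\<forall>i\<in>{m - t..<m}. sal ! i = key ! (ol ! i)) \<and>
    (\<forall>i\<in>{m - t..<m}. \<forall>j\<in>{i..<m}. sal ! i \<le> sal ! j) \<and>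
    (\<forall>a\<in>A. \<forall>i\<in>{m - t..<m}. key ! a \<le> sal ! i))" for t and s' :: state
  have [simp]: "0 < W" using assms(4) by simp
  have 1: "wp W Sp (Seq tree_init (NSet ''i'' (NLit 0))) s (\<lambda>t s'. t \<le> 6 * 2 ^ L + 16 \<and> I 0 s')"
    unfolding wp_Seq_eq
  proof (rule wp_conseq[OF wp_tree_init[where L = L]], goal_cases)
    case (7 t s')
    then show ?case using k(1) ne assms(2) frameD[OF 7(1)] by (auto simp: wps I_def elim!: tree_frame)
  qed (use assms in auto)
  have 2: "wp W Sp (While (NLess (NVar ''i'') (NVar ''m'')) (insert_step ka)) s1
      (\<lambda>t s'. t \<le> m * (80 * L + 54) + 4 \<and> I m s')" if "I 0 s1" for s1
  proof (rule wp_conseq[OF wp_count[where I = I and N = m and T = "\<lambda>_. 80 * L + 50", OF that]], goal_cases)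
    case (1 i s2)
    then have iL: "i < 2 ^ L" using assms(3) by simp
    have tr: "tree L s2 (\<lambda>_. 0) (\<lambda>x. if x < i then key ! x else 0) (\<lambda>x. if x < i then Suc x else 0)"
      and s2: "nvar s2 ''i'' = i" "nvar s2 ''m'' = m" "rarr s2 ka = key" "lens s s2"
      using 1 by (auto simp: I_def)
    have "wp W Sp (insert_step ka) s2 (\<lambda>t s'. t \<le> 80 * L + 50 \<and> I (Suc i) s')"
    proof (rule wp_conseq[OF wp_insert_step[OF tr s2(1) iL assms(4) _ ne(1,2)]], goal_cases)
      case 1
      then show ?case using s2 k \<open>i < m\<close> by simp
    next
      case (2 t s')
      have "(\<lambda>x. if x < i then key ! x else 0)(i := rarr s2 ka ! i) = (\<lambda>x. if x < Suc i then key ! x else 0)"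
        "(\<lambda>x. if x < i then Suc x else 0)(i := Suc i) = (\<lambda>x. if x < Suc i then Suc x else 0)"
        using s2 by (auto simp: less_Suc_eq)
      then show ?case using 2(2) s2 ne frameD[OF 2(1)] by (auto simp: I_def intro: lens_trans)
    qed
    then show ?case using 1 s2 by (simp add: eval_simps)
  next
    case (2 s2)
    then show ?case by (simp add: I_def eval_simps)
  next
    case (3 t s')
    then show ?case by (simp add: algebra_simps)
  qed
  have 3: "wp W Sp (While (NLess (NLit 0) (NVar ''i'')) (extract_step oa sa)) s1
      (\<lambda>t s'. t \<le> m * (80 * L + 64) + 4 \<and> J m s')" if "J 0 s1" for s1
  proof (rule wp_conseq[OF wp_count[where I = J and N = m and T = "\<lambda>_. 80 * L + 60", OF that]], goal_cases)
    case (1 t s2)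
    from 1(1)[unfolded J_def] obtain A F ol sal where A: "A \<subseteq> {..<m}" "card A = m - t" "\<forall>x\<in>A. F x = key ! x"
      and tr: "tree L s2 (\<lambda>_. 0) F (\<lambda>x. if x \<in> A then Suc x else 0)"
      and o: "narr s2 oa = ol" "rarr s2 sa = sal" "bij_betw ((!) ol) {m - t..<m} ({..<m} - A)"
      "\<forall>i\<in>{m - t..<m}. sal ! i = key ! (ol ! i)" "\<forall>i\<in>{m - t..<m}. \<forall>j\<in>{i..<m}. sal ! i \<le> sal ! j"
      "\<forall>a\<in>A. \<forall>i\<in>{m - t..<m}. key ! a \<le> sal ! i"
      and s2: "nvar s2 ''i'' = m - t" "lens s s2"
      by (elim conjE exE) (rule that; assumption)
    have len: "length ol = m" "length sal = m" using lensD[OF s2(2)] k(3,4) o(1,2) by auto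
    define i where "i = m - Suc t"
    have i: "m - t = Suc i" "i < m" "Suc i \<le> m" using 1(2) by (auto simp: i_def)
    have "A \<noteq> {}" using A(2) i by auto
    have "wp W Sp (extract_step oa sa) s2 (\<lambda>t' s'. t' \<le> 80 * L + 60 \<and> J (Suc t) s')"
    proof (rule wp_conseq[OF wp_extract_step[where key = "(!) key", OF tr \<open>A \<noteq> {}\<close> A(1) A(3)[rule_format] s2(1)[unfolded i(1)] i(3) assms(3,4) o(1) len(1) o(2) len(2) ne(3-5)]], goal_cases)
      case (2 t' s')
      then obtain x F' where x: "x \<in> A" "\<forall>y\<in>A. key ! y \<le> key ! x" "narr s' oa = ol[i := x]"
        "rarr s' sa = sal[i := key ! x]" "\<forall>y\<in>A - {x}. F' y = key ! y"
        "tree L s' (\<lambda>_. 0) F' (\<lambda>y. if y \<in> A - {x} then Suc y else 0)" and s': "nvar s' ''i'' = i" "lens s2 s'" "t' \<le> 80 * L + 60"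
        by blast
      have "finite A" using A(1) finite_subset by blast
      have ivl: "{i..<m} = insert i {Suc i..<m}" using i by auto
      have b: "bij_betw ((!) (ol[i := x])) {i..<m} ({..<m} - (A - {x}))"
      proof -
        have "bij_betw ((!) (ol[i := x])) {Suc i..<m} ({..<m} - A)"
          using o(3) by (subst bij_betw_cong[where g = "(!) ol"]) (auto simp: i)
        moreover have "{..<m} - (A - {x}) = ({..<m} - A) \<union> {x}" using x(1) A(1) by auto
        ultimately show ?thesis unfolding ivl
          using notIn_Un_bij_betw[of i "{Suc i..<m}" "(!) (ol[i := x])" "{..<m} - A"] x(1) i len by simp
      qed
      have s1: "\<forall>p\<in>{i..<m}. sal[i := key ! x] ! p = key ! (ol[i := x] ! p)"
        using o(4) i len by (auto simp: ivl)
      have s2': "\<forall>p\<in>{i..<m}. \<forall>q\<in>{p..<m}. sal[i := key ! x] ! p \<le> sal[i := key ! x] ! q"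
      proof (intro ballI)
        fix p q assume pq: "p \<in> {i..<m}" "q \<in> {p..<m}"
        show "sal[i := key ! x] ! p \<le> sal[i := key ! x] ! q"
        proof (cases "p = i")
          case True
          then show ?thesis using pq o(6) x(1) i len by (cases "q = i") auto
        next
          case False
          then show ?thesis using pq o(5) i len by auto
        qed
      qed
      have s3: "\<forall>a\<in>A - {x}. \<forall>p\<in>{i..<m}. key ! a \<le> sal[i := key ! x] ! p"
        using o(6) i len x(2) by (auto simp: ivl)
      have c: "card (A - {x}) = i" using A(2) i x(1) \<open>finite A\<close> by simp
      have "J (Suc t) s'" unfolding J_def i_def[symmetric]
        using x b s1 s2' s3 c s' A(1) 1(2) lens_trans[OF s2(2)]
        by (intro conjI exI[of _ "A - {x}"] exI[of _ F'] exI[of _ "ol[i := x]"] exI[of _ "sal[i := key ! x]"]) auto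
      then show ?case using s' by simp
    qed
    then show ?case using s2 i by (simp add: eval_simps)
  next
    case (2 s2)
    then show ?case by (simp add: J_def eval_simps)
  next
    case (3 t s')
    then show ?case by (simp add: algebra_simps)
  qed
  have J0: "J 0 s1" if "I m s1" for s1
    unfolding J_def using that
    by (auto simp: I_def bij_betw_def intro!: exI[of _ "{..<m}"] exI[of _ "\<lambda>x. if x < m then key ! x else 0"])
  have fin: "bij_betw ((!) (narr s' oa)) {..<m} {..<m} \<and>
     (\<forall>i<m. rarr s' sa ! i = key ! (narr s' oa ! i)) \<and>
     (\<forall>i j. i \<le> j \<longrightarrow> j < m \<longrightarrow> rarr s' sa ! i \<le> rarr s' sa ! j)" if J: "J m s'" for s'
  proof -
    obtain A where A: "A \<subseteq> {..<m}" "card A = 0" "bij_betw ((!) (narr s' oa)) {0..<m} ({..<m} - A)"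
      "\<forall>i\<in>{0..<m}. rarr s' sa ! i = key ! (narr s' oa ! i)" "\<forall>i\<in>{0..<m}. \<forall>j\<in>{i..<m}. rarr s' sa ! i \<le> rarr s' sa ! j"
      using J by (auto simp: J_def)
    then have "A = {}" using finite_subset by fastforce
    then show ?thesis using A by (auto simp: atLeast0LessThan)
  qed
  have "wp W Sp (Seq tree_init (Seq (NSet ''i'' (NLit 0))
    (Seq (While (NLess (NVar ''i'') (NVar ''m'')) (insert_step ka))
         (While (NLess (NLit 0) (NVar ''i'')) (extract_step oa sa))))) s
    (\<lambda>t s'. t \<le> 6 * 2 ^ L + 16 + (m * (80 * L + 54) + 4) + (m * (80 * L + 64) + 4) \<and> J m s')"
    by (subst wp_Seq_assoc, rule wp_conseq[OF wp_seqI[OF 1 wp_seqI[OF 2 3]]]) (auto intro: J0)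
  then show ?thesis unfolding tournament_sort_def
  proof (rule wp_conseq, goal_cases)
    case (1 t s')
    then have "J m s'" and t: "t \<le> 6 * 2 ^ L + 16 + (m * (80 * L + 54) + 4) + (m * (80 * L + 64) + 4)" by auto
    moreover from \<open>J m s'\<close> have "lens s s'" unfolding J_def by blast
    moreover have "t \<le> 6 * 2 ^ L + 40 + m * (160 * L + 120)" using t by (simp add: algebra_simps)
    ultimately show ?case using fin by blast
  qed
qed

section \<open>Staircases as walks of a sweep\<close>

text \<open>A layered view of staircases: node 0 is the start, the nodes 1, ..., m are the points of Q by
  increasing y-coordinate, node m + 1 is the end. A staircase moves to higher nodes at later times.
  \<open>wt t u\<close> is the weight of the points of P that arrive at time \<open>t\<close> below node \<open>u\<close>.\<close>

locale sweep =
  fixes m :: nat and node :: "nat \<Rightarrow> nat" and pos :: "nat \<Rightarrow> nat" and wt :: "nat \<Rightarrow> nat \<Rightarrow> real"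
  assumes pos_0 [simp]: "pos 0 = 0" and pos_end [simp]: "pos (Suc m) = Suc m"
    and pos_node: "t \<le> Suc m \<Longrightarrow> node t \<le> Suc m \<and> pos (node t) = t"
    and node_pos: "u \<le> Suc m \<Longrightarrow> pos u \<le> Suc m \<and> node (pos u) = u"
begin

text \<open>The weight collected while \<open>u\<close> is the top of the staircase, from its own
  arrival until just before the arrival of \<open>v\<close>.\<close>

definition cost :: "nat \<Rightarrow> nat \<Rightarrow> real" where
  "cost u v = (\<Sum>t\<in>{pos u..<pos v}. wt t u)"

definition edge :: "nat \<Rightarrow> nat \<Rightarrow> bool" where
  "edge u v \<longleftrightarrow> u < v \<and> v \<le> Suc m \<and> pos u < pos v"

fun path :: "nat \<Rightarrow> nat \<Rightarrow> nat \<Rightarrow> real \<Rightarrow> bool" where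
  "path 0 u v x \<longleftrightarrow> u = v \<and> x = 0"
| "path (Suc i) u v x \<longleftrightarrow> (\<exists>z y. path i u z y \<and> edge z v \<and> x = y + cost z v)"

text \<open>At most \<open>j\<close> steps: with negative weights a smaller subset can be better,
  and so \<open>j\<close> is only a budget.\<close>

definition walk :: "nat \<Rightarrow> nat \<Rightarrow> nat \<Rightarrow> real \<Rightarrow> bool" where
  "walk j u v x \<longleftrightarrow> (\<exists>i\<le>j. path i u v x)"

lemma path_append: "path i u v x \<Longrightarrow> path j v z y \<Longrightarrow> path (i + j) u z (x + y)"
proof (induction j arbitrary: z y)
  case (Suc j)
  from Suc.prems(2) obtain z' y' where "path j v z' y'" "edge z' z" "y = y' + cost z' z" by auto
  with Suc.IH[OF Suc.prems(1)] show ?case by (auto simp: add.assoc intro!: exI[of _ z'] exI[of _ "x + y'"])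
qed simp

lemma walk_append: "walk i u v x \<Longrightarrow> walk j v z y \<Longrightarrow> walk (i + j) u z (x + y)"
  unfolding walk_def by (meson add_mono path_append)

lemma walk_mono: "walk i u v x \<Longrightarrow> i \<le> j \<Longrightarrow> walk j u v x"
  unfolding walk_def by (meson order_trans)

lemma walk_refl [simp]: "walk j u u 0"
  unfolding walk_def by (intro exI[of _ 0]) simp

lemma walk_0 [simp]: "walk 0 u v x \<longleftrightarrow> u = v \<and> x = 0"
  by (simp add: walk_def)

lemma path_le: "path i u v x \<Longrightarrow> u \<le> v \<and> pos u \<le> pos v \<and> (u = v \<longleftrightarrow> i = 0)"
proof (induction i arbitrary: v x)
  case (Suc i)
  then obtain z y where "path i u z y" "edge z v" by auto
  with Suc.IH show ?case by (fastforce simp: edge_def)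
qed auto

lemma walk_le: "walk i u v x \<Longrightarrow> u \<le> v \<and> pos u \<le> pos v"
  unfolding walk_def using path_le by blast

lemma walk_self: "walk i u u x \<Longrightarrow> x = 0"
  unfolding walk_def using path_le by (metis path.simps(1))

lemma walk_Suc_step: "walk j u z y \<Longrightarrow> edge z v \<Longrightarrow> walk (Suc j) u v (y + cost z v)"
  unfolding walk_def by (metis Suc_le_mono path.simps(2))

lemma walk_Suc_cases:
  assumes "walk (Suc j) u v x" "u \<noteq> v"
  obtains z y where "walk j u z y" "edge z v" "x = y + cost z v"
proof -
  from assms obtain i where "i \<le> Suc j" "path i u v x" by (auto simp: walk_def)
  moreover from this assms(2) obtain i' where "i = Suc i'" by (cases i) auto
  ultimately show ?thesis using that unfolding walk_def by auto
qed

text \<open>In a trace of single steps each one is either idle or a genuine edge; idle steps fill up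
  walks that do not exhaust the budget.\<close>

lemma walk_1: "walk (Suc 0) u v x \<longleftrightarrow> u = v \<and> x = 0 \<or> edge u v \<and> x = cost u v"
proof
  assume a: "walk (Suc 0) u v x"
  show "u = v \<and> x = 0 \<or> edge u v \<and> x = cost u v"
  proof (cases "u = v")
    case True
    then show ?thesis using a walk_self by blast
  next
    case False
    from walk_Suc_cases[OF a False] show ?thesis by auto
  qed
next
  assume "u = v \<and> x = 0 \<or> edge u v \<and> x = cost u v"
  then show "walk (Suc 0) u v x"
    using walk_Suc_step[of 0 u u 0 v] by auto
qed

lemma pos_inj: "u \<le> Suc m \<Longrightarrow> v \<le> Suc m \<Longrightarrow> pos u = pos v \<Longrightarrow> u = v"
  using node_pos by metis

text \<open>The tag of a node \<open>v\<close> after \<open>j\<close> rounds encodes (as its successor) the node reached after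
  \<open>mid\<close> steps on an optimal walk.\<close>

definition sol :: "nat \<Rightarrow> nat \<Rightarrow> nat \<Rightarrow> nat \<Rightarrow> real \<Rightarrow> nat \<Rightarrow> bool" where
  "sol mid u j v x g \<longleftrightarrow> (if g = 0 then \<forall>y. \<not> walk j u v y
     else (\<exists>x1 x2. walk (min j mid) u (g - 1) x1 \<and> walk (j - mid) (g - 1) v x2 \<and> x = x1 + x2) \<and>
          (\<forall>y. walk j u v y \<longrightarrow> y \<le> x))"

lemma sol_start: "sol mid u j u 0 (Suc u)"
  unfolding sol_def using walk_self by (auto intro!: exI[of _ 0])

lemma sol_0: "u \<noteq> v \<Longrightarrow> sol mid u 0 v x 0"
  by (simp add: sol_def)

text \<open>Bellman's principle for the last edge into \<open>v\<close>. Up to round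
  \<open>mid\<close> the node after \<open>mid\<close> steps is \<open>v\<close> itself, so the tag
  is renewed; afterwards it is inherited from the predecessor. The leaf of \<open>v\<close> is
  inactive here, because predecessors arrive strictly earlier.\<close>

lemma sol_step:
  assumes v: "v \<le> Suc m" "pos u < pos v" and u: "u \<le> Suc m"
    and b: "best v F G x g"
    and G: "\<And>i. i \<le> v \<Longrightarrow> G i \<noteq> 0 \<longleftrightarrow> (\<exists>y. walk j u i y) \<and> pos i < pos v"
    and S: "\<And>i. i \<le> v \<Longrightarrow> G i \<noteq> 0 \<Longrightarrow> \<exists>y. sol mid u j i y (G i) \<and> F i = y + cost i v"
  shows "sol mid u (Suc j) v x (if g = 0 then 0 else if j < mid then Suc v else g)"
proof (cases "g = 0")
  case True
  have "\<not> walk (Suc j) u v y" for y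
  proof
    assume w: "walk (Suc j) u v y"
    have "u \<noteq> v" using v by auto
    from walk_Suc_cases[OF w this] obtain z y' where z: "walk j u z y'" "edge z v" .
    then have "G z \<noteq> 0" using G[of z] by (auto simp: edge_def)
    moreover have "z \<le> v" using z by (simp add: edge_def)
    ultimately show False using b True by (simp add: best_def)
  qed
  then show ?thesis using True by (simp add: sol_def)
next
  case False
  then obtain i where i: "i \<le> v" "G i = g" "x = F i" and mx: "\<And>z. z \<le> v \<Longrightarrow> G z \<noteq> 0 \<Longrightarrow> F z \<le> x"
    using b by (auto simp: best_def)
  from S[OF i(1)] i False obtain y where y: "sol mid u j i y g" "x = y + cost i v" by auto
  have "pos i < pos v" using G[OF i(1)] i False by auto
  then have e: "edge i v" using i(1) v(1) by (auto simp: edge_def order_le_less)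
  obtain x1 x2 where w: "walk (min j mid) u (g - 1) x1" "walk (j - mid) (g - 1) i x2" "y = x1 + x2"
    using y(1) False by (auto simp: sol_def)
  have up: "y' \<le> x" if wy: "walk (Suc j) u v y'" for y'
  proof -
    have "u \<noteq> v" using v by auto
    from walk_Suc_cases[OF wy this] obtain z y'' where z: "walk j u z y''" "edge z v" "y' = y'' + cost z v" .
    have zv: "z \<le> v" "pos z < pos v" using z(2) by (auto simp: edge_def)
    have Gz: "G z \<noteq> 0" using G[OF zv(1)] z(1) zv by blast
    from S[OF zv(1) Gz] obtain yz where "sol mid u j z yz (G z)" "F z = yz + cost z v" by blast
    then have "y'' \<le> yz" "F z = yz + cost z v" using z(1) Gz by (auto simp: sol_def)
    then show ?thesis using mx[OF zv(1) Gz] z(3) by simp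
  qed
  have "\<exists>x1 x2. walk (min (Suc j) mid) u (g' - 1) x1 \<and> walk (Suc j - mid) (g' - 1) v x2 \<and> x = x1 + x2"
    if g': "g' = (if j < mid then Suc v else g)" for g'
  proof (cases "j < mid")
    case True
    then have "walk j u i y" using w by auto
    then have "walk (Suc j) u v x" using walk_Suc_step[OF _ e] y(2) by simp
    then show ?thesis using True g' by (auto intro!: exI[of _ x] exI[of _ 0])
  next
    case False
    then have "walk (Suc j - mid) (g - 1) v (x2 + cost i v)"
      using walk_Suc_step[OF w(2) e] by (simp add: Suc_diff_le)
    then show ?thesis using w False g' y(2)
      by - (rule exI[of _ x1], rule exI[of _ "x2 + cost i v"], simp add: min_absorb2)
  qed
  then show ?thesis using False up unfolding sol_def by (auto split: if_splits)
qed

end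

section \<open>Optimal walks by sweeping\<close>

text \<open>Values of leaves are prefix sums plus offsets, so adding a weight at the leaf \<open>er ! e\<close> raises the values
  of all leaves from there on. A node is inserted with its value of the previous round, before \<open>A\<close> and \<open>B\<close>
  are overwritten by those of the next one; hence one pair of arrays suffices for all rounds.\<close>

definition event_step :: com where
  "event_step = Seq (NSet ''j'' (NGet ''er'' (NVar ''e''))) (Seq (RSet ''v'' (RGet ''ew'' (NVar ''e'')))
     (Seq tree_add (NSet ''e'' (NAdd (NVar ''e'') (NLit 1)))))"

text \<open>The inserted offset is the old value minus the weights already present strictly before
  the leaf, so that only later arrivals count for this node. Here \<open>rs\<close> includes the
  weight of the leaf itself, which the entry of \<open>S\<close> takes out again.\<close>

definition node_step :: com where
  "node_step = Seq (NSet ''t'' (NAdd (NVar ''t'') (NLit 1)))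
    (Seq (NSet ''x'' (NGet ''nd'' (NVar ''t'')))
    (Seq (NSet ''j'' (NVar ''x''))
    (Seq tree_query
    (Seq (NSet ''g'' (NGet ''B'' (NVar ''x'')))
    (Seq (If (NLess (NLit 0) (NVar ''g''))
           (Seq (NSet ''j'' (NVar ''x''))
           (Seq (RSet ''v'' (RSub (RGet ''A'' (NVar ''x'')) (RSub (RVar ''rs'') (RGet ''S'' (NAdd (NVar ''N'') (NVar ''x''))))))
             tree_set))
           Skip)
    (Seq (RPut ''A'' (NVar ''x'') (RVar ''rm''))
     (If (NLess (NLit 0) (NVar ''rg''))
        (If (NLess (NVar ''lv'') (NVar ''md''))
           (NPut ''B'' (NVar ''x'') (NAdd (NVar ''x'') (NLit 1)))
           (NPut ''B'' (NVar ''x'') (NVar ''rg'')))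
        (NPut ''B'' (NVar ''x'') (NLit 0)))))))))"

definition sweep_step :: com where
  "sweep_step = Seq (While (NLess (NVar ''e'') (NGet ''of'' (NAdd (NVar ''t'') (NLit 1)))) event_step) node_step"

text \<open>One round. The sweep is confined to the times between \<open>u0\<close> and
  \<open>u1\<close>, so a subproblem of the bisection pays only for its own interval.\<close>

definition level_step :: com where
  "level_step = Seq tree_init
    (Seq (NSet ''j'' (NVar ''u0'')) (Seq (RSet ''v'' RZero) (Seq (NSet ''g'' (NAdd (NVar ''u0'') (NLit 1)))
    (Seq tree_set
    (Seq (NSet ''t'' (NGet ''ps'' (NVar ''u0'')))
    (Seq (NSet ''e'' (NGet ''of'' (NVar ''t'')))
    (Seq (While (NLess (NVar ''t'') (NGet ''ps'' (NVar ''u1''))) sweep_step)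
      (NSet ''lv'' (NAdd (NVar ''lv'') (NLit 1))))))))))"

definition solve :: com where
  "solve = Seq (NNew ''B'' (NAdd (NVar ''m'') (NLit 2)))
    (Seq (NPut ''B'' (NVar ''u0'') (NAdd (NVar ''u0'') (NLit 1)))
    (Seq (RPut ''A'' (NVar ''u0'') RZero)
    (Seq (NSet ''lv'' (NLit 0))
      (While (NLess (NVar ''lv'') (NVar ''l'')) level_step))))"

lemma solve_mods [simp]:
  "nvars event_step = {''j'', ''e''}" "rvars event_step = {''v''}" "narrs event_step = {''G''}" "rarrs event_step = {''S'', ''M''}"
  "nvars node_step = {''t'', ''x'', ''j'', ''rg'', ''g''}" "rvars node_step = {''rs'', ''rm'', ''v''}"
  "narrs node_step = {''G'', ''B''}" "rarrs node_step = {''S'', ''M'', ''A''}"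
  "nvars level_step = {''j'', ''g'', ''t'', ''e'', ''x'', ''rg'', ''lv''}" "rvars level_step = {''v'', ''rs'', ''rm''}"
  "narrs level_step = {''G'', ''B''}" "rarrs level_step = {''S'', ''M'', ''A''}"
  "nvars solve = {''j'', ''g'', ''t'', ''e'', ''x'', ''rg'', ''lv''}" "rvars solve = {''v'', ''rs'', ''rm''}"
  "narrs solve = {''G'', ''B''}" "rarrs solve = {''S'', ''M'', ''A''}"
  "no_new event_step" "no_new node_step"
  by (auto simp: event_step_def node_step_def sweep_step_def level_step_def solve_def)

lemma sweep_step_mods [simp]:
  "nvars sweep_step = {''j'', ''g'', ''t'', ''e'', ''x'', ''rg''}" "rvars sweep_step = {''v'', ''rs'', ''rm''}"
  "narrs sweep_step = {''G'', ''B''}" "rarrs sweep_step = {''S'', ''M'', ''A''}" "no_new sweep_step"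
  by (auto simp: sweep_step_def)

lemma tree_upd [simp]:
  "nv ''N'' = nvar s ''N'' \<Longrightarrow> tree L (s\<lparr>nvar := nv\<rparr>) = tree L s"
  "tree L (rvar_update f s) = tree L s"
  by (auto simp: tree_def sl_def[abs_def] fun_eq_iff)

section \<open>Correctness of one round\<close>

definition gain :: "nat list \<Rightarrow> real list \<Rightarrow> nat \<Rightarrow> nat \<Rightarrow> nat \<Rightarrow> real" where
  "gain er ew a b u = (\<Sum>e\<in>{a..<b}. if er ! e \<le> u then ew ! e else 0)"

text \<open>The events of time \<open>t\<close> occupy the slots from \<open>off ! t\<close> to just
  before \<open>off ! Suc t\<close>. Taking their accumulated weights as the weight function of
  \<open>sweep\<close> makes the development independent of whether slots hold single points or grid
  cells.\<close>

locale dp_data = sweep m "(!) nd" "(!) ps" "\<lambda>t. gain er ew (off ! t) (off ! Suc t)"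
  for m :: nat and nd ps off er :: "nat list" and ew :: "real list" +
  fixes L W Sp :: nat
  assumes len: "length nd = m + 2" "length ps = m + 2" "length off = m + 2" "length ew = length er"
    and off: "t \<le> t' \<Longrightarrow> t' \<le> Suc m \<Longrightarrow> off ! t \<le> off ! t'" "off ! Suc m \<le> length er"
    and er: "e < length er \<Longrightarrow> er ! e < 2 ^ L"
    and mL: "m + 2 \<le> 2 ^ L" and W: "2 * 2 ^ L + 2 < W" "length er < W"
begin

definition ctx :: "state \<Rightarrow> bool" where
  "ctx s \<longleftrightarrow> nvar s ''N'' = 2 ^ L \<and> nvar s ''m'' = m \<and> narr s ''nd'' = nd \<and> narr s ''ps'' = ps \<and>
    narr s ''of'' = off \<and> narr s ''er'' = er \<and> rarr s ''ew'' = ew \<and>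
    length (narr s ''B'') = m + 2 \<and> length (rarr s ''A'') = m + 2 \<and>
    length (rarr s ''S'') = 2 * 2 ^ L \<and> length (rarr s ''M'') = 2 * 2 ^ L \<and> length (narr s ''G'') = 2 * 2 ^ L \<and>
    space s \<le> Sp"

lemma ctx_mono:
  assumes "ctx s" "lens s s'" "nvar s' ''N'' = nvar s ''N''" "nvar s' ''m'' = nvar s ''m''" "narr s' ''nd'' = narr s ''nd''"
   "narr s' ''ps'' = narr s ''ps''" "narr s' ''of'' = narr s ''of''" "narr s' ''er'' = narr s ''er''" "rarr s' ''ew'' = rarr s ''ew''"
  shows "ctx s'"
  using assms space_lens[OF assms(2)] by (simp add: ctx_def lens_def)

lemma ctx_upd [simp]:
  "nv ''N'' = nvar s ''N'' \<Longrightarrow> nv ''m'' = nvar s ''m'' \<Longrightarrow> ctx (s\<lparr>nvar := nv\<rparr>) = ctx s"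
  "ctx (rvar_update f s) = ctx s"
  by (auto simp: ctx_def space_def)

lemma wp_event_step:
  assumes "ctx s" and tr: "tree L s T F G" and e: "nvar s ''e'' = e" "e < length er"
  shows "wp W Sp event_step s (\<lambda>t s'. t \<le> 80 * L + 45 \<and> ctx s' \<and> lens s s' \<and> nvar s' ''e'' = Suc e \<and>
    (\<exists>T. tree L s' T (\<lambda>i. F i + (if er ! e \<le> i then ew ! e else 0)) G))"
proof -
  have c: "narr s ''er'' = er" "rarr s ''ew'' = ew" "nvar s ''N'' = 2 ^ L" using assms(1) by (auto simp: ctx_def)
  have [simp]: "Suc e < W" "e < length er" "e < length ew" "Suc 0 < W" using e W len by auto
  define s1 where "s1 = s\<lparr>nvar := (nvar s)(''j'' := er ! e), rvar := (rvar s)(''v'' := ew ! e)\<rparr>"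
  have tr1: "tree L s1 T F G" by (rule tree_frame[OF tr]) (auto simp: s1_def)
  have "wp W Sp tree_add s1 (\<lambda>t s'. t \<le> 80 * L + 30 \<and> ctx s' \<and> lens s s' \<and> nvar s' ''e'' = e \<and>
    (\<exists>T. tree L s' T (\<lambda>i. F i + (if er ! e \<le> i then ew ! e else 0)) G))"
  proof (rule wp_conseq[OF wp_no_new[OF wp_tree_add[OF tr1, of "er ! e" W "ew ! e" Sp]]], goal_cases)
    case (7 t s')
    have l: "lens s s'" using 7(2) by (simp add: s1_def)
    have "ctx s'" by (rule ctx_mono[OF assms(1) l]) (use frameD[OF 7(1)] in \<open>auto simp: s1_def\<close>)
    moreover have "nvar s' ''e'' = e" using frameD(1)[OF 7(1)] e by (simp add: s1_def)
    ultimately show ?case using 7(2) l by blast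
  qed (use W er[OF e(2)] in \<open>auto simp: s1_def\<close>)
  then show ?thesis unfolding event_step_def s1_def using c e
    apply (simp add: wps)
    apply (erule wp_conseq)
    apply (simp add: wps)
    done
qed

lemma wp_events:
  assumes "ctx s" and tr: "tree L s T F G" and e: "nvar s ''e'' = off ! t" and t: "nvar s ''t'' = t" "t \<le> m"
  shows "wp W Sp (While (NLess (NVar ''e'') (NGet ''of'' (NAdd (NVar ''t'') (NLit 1)))) event_step) s
    (\<lambda>tm s'. tm \<le> (off ! Suc t - off ! t) * (80 * L + 52) + 7 \<and> ctx s' \<and> lens s s' \<and> nvar s' ''e'' = off ! Suc t \<and>
    (\<exists>T. tree L s' T (\<lambda>i. F i + gain er ew (off ! t) (off ! Suc t) i) G))"
proof -
  define n where "n = off ! Suc t - off ! t"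
  have le: "off ! t \<le> off ! Suc t" "off ! Suc t \<le> length er" using off(1)[of t "Suc t"] off(1)[of "Suc t" "Suc m"] off(2) t by auto
  have n: "off ! Suc t = off ! t + n" using le by (simp add: n_def)
  have [simp]: "Suc 0 < W" "Suc t < W" "Suc t < length off" "1 < W" using W mL len t by auto
  define I where "I i s' \<longleftrightarrow> ctx s' \<and> lens s s' \<and> nvar s' ''t'' = t \<and> nvar s' ''e'' = off ! t + i \<and>
    (\<exists>T. tree L s' T (\<lambda>x. F x + gain er ew (off ! t) (off ! t + i) x) G)" for i and s' :: state
  have "I 0 s" using assms by (auto simp: I_def gain_def)
  show ?thesis
  proof (rule wp_conseq[OF wp_count[where I = I and N = n and T = "\<lambda>_. 80 * L + 45", OF \<open>I 0 s\<close>]], goal_cases)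
    case (1 i s1)
    then obtain T' where c: "ctx s1" "lens s s1" "nvar s1 ''t'' = t" and e1: "nvar s1 ''e'' = off ! t + i"
      and tr1: "tree L s1 T' (\<lambda>x. F x + gain er ew (off ! t) (off ! t + i) x) G" by (auto simp: I_def)
    have elt: "off ! t + i < length er" using 1(2) le n by simp
    have "wp W Sp event_step s1 (\<lambda>t s'. t \<le> 80 * L + 45 \<and> I (Suc i) s')"
    proof (rule wp_conseq[OF wp_event_step[OF c(1) tr1 e1 elt]], goal_cases)
      case (1 tm s')
      have "gain er ew (off ! t) (off ! t + Suc i) x = gain er ew (off ! t) (off ! t + i) x + (if er ! (off ! t + i) \<le> x then ew ! (off ! t + i) else 0)" for x
        by (simp add: gain_def)
      then show ?case using 1(2) c frameD(1)[OF 1(1)] lens_trans[OF c(2)] unfolding I_def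
        by (auto simp: add.assoc)
    qed
    moreover have "narr s1 ''of'' = off" using c by (simp add: ctx_def)
    ultimately show ?case using c e1 1(2) n by (simp add: eval_simps)
  next
    case (2 s1)
    then have "narr s1 ''of'' = off" by (simp add: I_def ctx_def)
    then show ?case using 2 n by (simp add: I_def eval_simps)
  next
    case (3 tm s')
    have "tm \<le> n * (80 * L + 52) + 7" using 3(2) by (simp add: algebra_simps)
    then show ?case using 3(2) unfolding n_def[symmetric] by (auto simp: I_def n)
  qed
qed

lemma wp_node_step:
  assumes c: "ctx s" and tr: "tree L s T F G" and t: "nvar s ''t'' = t" "t \<le> m" "nd ! Suc t = x"
    and A: "rarr s ''A'' = A" "narr s ''B'' = B"
    and lv: "nvar s ''lv'' = lv" "nvar s ''md'' = md"
  shows "wp W Sp node_step s (\<lambda>tm s'. tm \<le> 160 * L + 150 \<and> ctx s' \<and> lens s s' \<and> nvar s' ''t'' = Suc t \<and>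
    (\<exists>T F' G' rm rg. tree L s' T F' G' \<and>
      (\<forall>i. i \<noteq> x \<longrightarrow> F' i = F i \<and> G' i = G i) \<and> (G x = 0 \<longrightarrow> G' x = B ! x \<and> (B ! x \<noteq> 0 \<longrightarrow> F' x = A ! x)) \<and>
      best x F G rm rg \<and>
      rarr s' ''A'' = A[x := rm] \<and> narr s' ''B'' = B[x := if rg = 0 then 0 else if lv < md then Suc x else rg]))"
proof -
  have c': "narr s ''nd'' = nd" "nvar s ''N'' = 2 ^ L" using c by (auto simp: ctx_def)
  have "x \<le> Suc m" using pos_node[of "Suc t"] t by simp
  then have [simp]: "x < 2 ^ L" "x < W" "Suc x < W" "Suc 0 < W" "0 < W" "Suc t < W" "t < W" "1 < W" "2 ^ L + x < W" using mL W t by auto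
  have lens': "length A = m + 2" "length B = m + 2" using c A by (auto simp: ctx_def)
  have [simp]: "x < length A" "x < length B" "Suc t < length nd" using lens' \<open>x \<le> Suc m\<close> len t by auto
  define s1 where "s1 = s\<lparr>nvar := (nvar s)(''t'' := Suc t, ''x'' := x, ''j'' := x)\<rparr>"
  define body where "body = Seq (NSet ''g'' (NGet ''B'' (NVar ''x'')))
    (Seq (If (NLess (NLit 0) (NVar ''g''))
           (Seq (NSet ''j'' (NVar ''x''))
           (Seq (RSet ''v'' (RSub (RGet ''A'' (NVar ''x'')) (RSub (RVar ''rs'') (RGet ''S'' (NAdd (NVar ''N'') (NVar ''x''))))))
             tree_set))
           Skip)
    (Seq (RPut ''A'' (NVar ''x'') (RVar ''rm''))
     (If (NLess (NLit 0) (NVar ''rg''))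
        (If (NLess (NVar ''lv'') (NVar ''md''))
           (NPut ''B'' (NVar ''x'') (NAdd (NVar ''x'') (NLit 1)))
           (NPut ''B'' (NVar ''x'') (NVar ''rg'')))
        (NPut ''B'' (NVar ''x'') (NLit 0)))))"
  have tr1: "tree L s1 T F G" by (rule tree_frame[OF tr]) (auto simp: s1_def)
  define P where "P s' \<longleftrightarrow> ctx s' \<and> lens s s' \<and> nvar s' ''t'' = Suc t \<and>
    (\<exists>T F' G' rm rg. tree L s' T F' G' \<and>
      (\<forall>i. i \<noteq> x \<longrightarrow> F' i = F i \<and> G' i = G i) \<and> (G x = 0 \<longrightarrow> G' x = B ! x \<and> (B ! x \<noteq> 0 \<longrightarrow> F' x = A ! x)) \<and>
      best x F G rm rg \<and>
      rarr s' ''A'' = A[x := rm] \<and> narr s' ''B'' = B[x := if rg = 0 then 0 else if lv < md then Suc x else rg])" for s'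
  \<comment> \<open>The common tail of both branches: storing the query result, once the old value
    has been inserted or found absent.\<close>
  have fin: "wp W Sp (Seq (RPut ''A'' (NVar ''x'') (RVar ''rm''))
     (If (NLess (NLit 0) (NVar ''rg''))
        (If (NLess (NVar ''lv'') (NVar ''md''))
           (NPut ''B'' (NVar ''x'') (NAdd (NVar ''x'') (NLit 1)))
           (NPut ''B'' (NVar ''x'') (NVar ''rg'')))
        (NPut ''B'' (NVar ''x'') (NLit 0)))) s2 (\<lambda>tm s'. tm \<le> 30 \<and> P s')"
    if s2: "ctx s2" "lens s s2" "nvar s2 ''t'' = Suc t" "nvar s2 ''x'' = x" "nvar s2 ''lv'' = lv" "nvar s2 ''md'' = md"
      "rarr s2 ''A'' = A" "narr s2 ''B'' = B" "best x F G (rvar s2 ''rm'') (nvar s2 ''rg'')"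
      and tr2: "tree L s2 T F' G'" "\<forall>i. i \<noteq> x \<longrightarrow> F' i = F i \<and> G' i = G i"
      "G x = 0 \<longrightarrow> G' x = B ! x \<and> (B ! x \<noteq> 0 \<longrightarrow> F' x = A ! x)" for s2 F' G'
  proof -
    define b where "b = (if nvar s2 ''rg'' = 0 then 0 else if lv < md then Suc x else nvar s2 ''rg'')"
    define s3 where "s3 = s2\<lparr>narr := (narr s2)(''B'' := B[x := b]), rarr := (rarr s2)(''A'' := A[x := rvar s2 ''rm''])\<rparr>"
    have l: "lens s2 s3" using s2 by (auto simp: lens_def s3_def)
    have "tree L s3 T F' G'" by (rule tree_frame[OF tr2(1)]) (auto simp: s3_def)
    moreover have "ctx s3" by (rule ctx_mono[OF s2(1) l]) (auto simp: s3_def)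
    moreover have "rarr s3 ''A'' = A[x := rvar s2 ''rm'']" "narr s3 ''B'' = B[x := b]" "nvar s3 ''t'' = Suc t"
      using s2 by (auto simp: s3_def)
    ultimately have "P s3" unfolding P_def b_def using lens_trans[OF s2(2) l] s2(9) tr2(2,3)
      by (intro conjI exI[of _ T] exI[of _ F'] exI[of _ G'] exI[of _ "rvar s2 ''rm''"] exI[of _ "nvar s2 ''rg''"])
    then show ?thesis unfolding s3_def b_def using s2
      by (cases "nvar s2 ''rg'' = 0"; cases "lv < md"; simp add: wps)
  qed
  have "wp W Sp body s2 (\<lambda>tm s'. tm \<le> 80 * L + 110 \<and> P s')"
    if s2: "frame tree_query s1 s2" "lens s1 s2" "rvar s2 ''rs'' = T x" "best x F G (rvar s2 ''rm'') (nvar s2 ''rg'')" for s2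
  proof -
    note fr = frameD[OF s2(1), simplified]
    have l: "lens s s2" using s2 by (simp add: s1_def)
    have ctx2: "ctx s2" by (rule ctx_mono[OF c l]) (use fr in \<open>auto simp: s1_def\<close>)
    have v: "nvar s2 ''t'' = Suc t" "nvar s2 ''x'' = x" "nvar s2 ''lv'' = lv" "nvar s2 ''md'' = md"
      "rarr s2 ''A'' = A" "narr s2 ''B'' = B" "nvar s2 ''N'' = 2 ^ L"
      using fr lv A t c' by (auto simp: s1_def)
    have tr2: "tree L s2 T F G" by (rule tree_frame[OF tr1]) (use fr in auto)
    have lS: "length (rarr s2 ''S'') = 2 * 2 ^ L" using ctx2 by (simp add: ctx_def)
    show ?thesis
    proof (cases "B ! x = 0")
      case True
      define s3 where "s3 = s2\<lparr>nvar := (nvar s2)(''g'' := 0)\<rparr>"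
      obtain G' where G': "G' = G" by simp
      have tr3: "tree L s3 T F G" by (rule tree_frame[OF tr2]) (auto simp: s3_def)
      have ctx3: "ctx s3" by (rule ctx_mono[OF ctx2]) (auto simp: s3_def)
      have "wp W Sp (Seq (RPut ''A'' (NVar ''x'') (RVar ''rm''))
     (If (NLess (NLit 0) (NVar ''rg''))
        (If (NLess (NVar ''lv'') (NVar ''md''))
           (NPut ''B'' (NVar ''x'') (NAdd (NVar ''x'') (NLit 1)))
           (NPut ''B'' (NVar ''x'') (NVar ''rg'')))
        (NPut ''B'' (NVar ''x'') (NLit 0)))) s3 (\<lambda>tm s'. tm \<le> 30 \<and> P s')"
        by (rule fin[OF ctx3 _ _ _ _ _ _ _ _ tr3]) (use v l s2 True in \<open>auto simp: s3_def\<close>)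
      then show ?thesis unfolding body_def using v True unfolding s3_def
        apply (subst wp_Seq_eq)
        apply (simp add: wp_NSet_eq eval_simps)
        apply (subst wp_Seq_eq)
        apply (simp add: wp_If_eq wp_Skip_eq eval_simps)
        apply (erule wp_conseq)
        apply simp
        done
    next
      case False
      define b where "b = B ! x"
      \<comment> \<open>\<open>rs\<close> holds \<open>T x\<close>, so with this offset
        \<open>wp_tree_set\<close> gives leaf \<open>x\<close> the value
        \<open>A ! x\<close>.\<close>
      define val where "val = A ! x - (T x - rarr s2 ''S'' ! (2 ^ L + x))"
      define s3 where "s3 = s2\<lparr>nvar := (nvar s2)(''g'' := b, ''j'' := x), rvar := (rvar s2)(''v'' := val)\<rparr>"
      have tr3: "tree L s3 T F G" by (rule tree_frame[OF tr2]) (auto simp: s3_def)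
      have "wp W Sp tree_set s3 (\<lambda>tm s4. tm \<le> 80 * L + 30 \<and>
         wp W Sp (Seq (RPut ''A'' (NVar ''x'') (RVar ''rm''))
     (If (NLess (NLit 0) (NVar ''rg''))
        (If (NLess (NVar ''lv'') (NVar ''md''))
           (NPut ''B'' (NVar ''x'') (NAdd (NVar ''x'') (NLit 1)))
           (NPut ''B'' (NVar ''x'') (NVar ''rg'')))
        (NPut ''B'' (NVar ''x'') (NLit 0)))) s4 (\<lambda>tm s'. tm \<le> 30 \<and> P s'))"
      proof (rule wp_conseq[OF wp_no_new[OF wp_tree_set[OF tr3, of x W val b Sp]]], goal_cases)
        case (8 tm s4)
        have val: "T x - rarr s3 ''S'' ! (2 ^ L + x) + val = A ! x" by (simp add: s3_def val_def)
        have tr4: "tree L s4 T (F(x := A ! x)) (G(x := b))" using 8(2) unfolding val by simp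
        note fr4 = frameD[OF 8(1), simplified]
        have l4: "lens s2 s4" using 8(2) by (simp add: s3_def)
        have ctx4: "ctx s4" by (rule ctx_mono[OF ctx2 l4]) (use fr4 in \<open>auto simp: s3_def\<close>)
        have "wp W Sp (Seq (RPut ''A'' (NVar ''x'') (RVar ''rm''))
     (If (NLess (NLit 0) (NVar ''rg''))
        (If (NLess (NVar ''lv'') (NVar ''md''))
           (NPut ''B'' (NVar ''x'') (NAdd (NVar ''x'') (NLit 1)))
           (NPut ''B'' (NVar ''x'') (NVar ''rg'')))
        (NPut ''B'' (NVar ''x'') (NLit 0)))) s4 (\<lambda>tm s'. tm \<le> 30 \<and> P s')"
          by (rule fin[OF ctx4 lens_trans[OF l l4] _ _ _ _ _ _ _ tr4]) (use v s2 fr4 in \<open>auto simp: s3_def b_def\<close>)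
        then show ?case using 8(2) by blast
      qed (use W in \<open>auto simp: s3_def\<close>)
      then show ?thesis unfolding body_def using v False s2(3) lS unfolding s3_def b_def val_def
        apply (subst wp_Seq_eq)
        apply (simp add: wp_NSet_eq eval_simps)
        apply (subst wp_Seq_eq)
        apply (simp add: wp_If_eq wp_Seq_eq[where d = "Seq x y" for x y] wp_Seq_eq[where d = tree_set] wp_NSet_eq wp_RSet_eq eval_simps update_order)
        apply (erule wp_conseq)
        apply (elim conjE)
        apply (erule wp_conseq)
        apply simp
        done
    qed
  qed
  then have "wp W Sp tree_query s1 (\<lambda>tm s2. tm \<le> 80 * L + 30 \<and> wp W Sp body s2 (\<lambda>tm s'. tm \<le> 80 * L + 110 \<and> P s'))"
    by (intro wp_conseq[OF wp_no_new[OF wp_tree_query[OF tr1, of x W Sp]]]) (use W in \<open>auto simp: s1_def\<close>)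
  then have "wp W Sp (Seq (NSet ''t'' (NAdd (NVar ''t'') (NLit 1)))
    (Seq (NSet ''x'' (NGet ''nd'' (NVar ''t'')))
    (Seq (NSet ''j'' (NVar ''x''))
    (Seq tree_query body)))) s (\<lambda>tm s'. tm \<le> 160 * L + 150 \<and> P s')"
    unfolding s1_def using t c'
    apply (simp add: wp_Seq_eq[where d = body] wp_Seq_eq[where d = "Seq x y" for x y] wp_NSet_eq eval_simps)
    apply (erule wp_conseq)
    apply (elim conjE)
    apply (erule wp_conseq)
    apply simp
    done
  then show ?thesis unfolding node_step_def body_def P_def .
qed

text \<open>The two halves behind a nonzero tag concatenate to a walk within the budget, because
  \<open>min j mid + (j - mid) = j\<close>.\<close>

lemma sol_walk: "sol mid u j v x g \<Longrightarrow> g \<noteq> 0 \<longleftrightarrow> (\<exists>y. walk j u v y)"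
proof
  assume a: "sol mid u j v x g" "g \<noteq> 0"
  then obtain x1 x2 where "walk (min j mid) u (g - 1) x1" "walk (j - mid) (g - 1) v x2"
    by (auto simp: sol_def)
  from walk_append[OF this] have "walk j u v (x1 + x2)" by (simp add: min_def split: if_splits)
  then show "\<exists>y. walk j u v y" by blast
qed (auto simp: sol_def split: if_splits)

text \<open>Round \<open>j\<close> works in place. At time \<open>t\<close> the nodes that have
  arrived since \<open>u\<close> already hold their values for \<open>Suc j\<close> steps, those
  arriving later, up to \<open>b\<close>, still the ones for \<open>j\<close>.\<close>

definition frontier :: "nat \<Rightarrow> nat \<Rightarrow> nat \<Rightarrow> nat \<Rightarrow> nat \<Rightarrow> real list \<Rightarrow> nat list \<Rightarrow> bool" where
  "frontier mid u j t b A B \<longleftrightarrow> A ! u = 0 \<and> B ! u = Suc u \<and>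
    (\<forall>v\<le>Suc m. ps ! u < ps ! v \<longrightarrow> ps ! v \<le> t \<longrightarrow> sol mid u (Suc j) v (A ! v) (B ! v)) \<and>
    (\<forall>v\<le>Suc m. ps ! u < ps ! v \<longrightarrow> t < ps ! v \<longrightarrow> ps ! v \<le> b \<longrightarrow> sol mid u j v (A ! v) (B ! v))"

text \<open>Two times are needed because insertions and events alternate: nodes are present up to
  time \<open>t\<close>, weights for the times before \<open>t'\<close>.\<close>

definition active :: "nat \<Rightarrow> nat \<Rightarrow> nat \<Rightarrow> nat \<Rightarrow> nat \<Rightarrow> (nat \<Rightarrow> real) \<Rightarrow> (nat \<Rightarrow> nat) \<Rightarrow> bool" where
  "active mid u j t t' F G \<longleftrightarrow> (\<forall>i\<le>Suc m. (G i \<noteq> 0 \<longleftrightarrow> (\<exists>y. walk j u i y) \<and> ps ! i \<le> t) \<and>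
    (G i \<noteq> 0 \<longrightarrow> (\<exists>y. sol mid u j i y (G i) \<and>
      F i = y + (\<Sum>x\<in>{ps ! i..<t'}. gain er ew (off ! x) (off ! Suc x) i))))"

lemma active_events:
  assumes "active mid u j t t F G"
  shows "active mid u j t (Suc t) (\<lambda>i. F i + gain er ew (off ! t) (off ! Suc t) i) G"
  unfolding active_def
proof (intro allI impI conjI)
  fix i assume i: "i \<le> Suc m"
  then show "G i \<noteq> 0 \<longleftrightarrow> (\<exists>y. walk j u i y) \<and> ps ! i \<le> t" using assms by (simp add: active_def)
  assume "G i \<noteq> 0"
  with assms i obtain y where "sol mid u j i y (G i)" "ps ! i \<le> t"
    "F i = y + (\<Sum>x\<in>{ps ! i..<t}. gain er ew (off ! x) (off ! Suc x) i)"
    unfolding active_def by blast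
  then show "\<exists>y. sol mid u j i y (G i) \<and> F i + gain er ew (off ! t) (off ! Suc t) i =
      y + (\<Sum>x\<in>{ps ! i..<Suc t}. gain er ew (off ! x) (off ! Suc x) i)"
    by (intro exI[of _ y]) simp
qed

lemma frontier_step:
  assumes act: "active mid u j t (Suc t) F G" and fr: "frontier mid u j t b A B"
    and t: "ps ! u \<le> t" "t < b" "b \<le> Suc m" and u: "u \<le> Suc m" and x: "nd ! Suc t = x"
    and F': "\<forall>i. i \<noteq> x \<longrightarrow> F' i = F i \<and> G' i = G i"
    and F'x: "G x = 0 \<longrightarrow> G' x = B ! x \<and> (B ! x \<noteq> 0 \<longrightarrow> F' x = A ! x)"
    and b: "best x F G rm rg" and len: "length A = m + 2" "length B = m + 2"
  shows "active mid u j (Suc t) (Suc t) F' G'"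
    "frontier mid u j (Suc t) b (A[x := rm]) (B[x := if rg = 0 then 0 else if j < mid then Suc x else rg])"
proof -
  have xm: "x \<le> Suc m" and px: "ps ! x = Suc t" using pos_node[of "Suc t"] x t by auto
  have ux: "u \<noteq> x" using px t by auto
  \<comment> \<open>Positions are injective, so \<open>x\<close> is the only node that arrives at
    \<open>Suc t\<close>.\<close>
  have other: "ps ! v \<le> t \<longleftrightarrow> ps ! v \<le> Suc t" if "v \<noteq> x" "v \<le> Suc m" for v
    using pos_inj[OF that(2) xm] that px by (auto simp: le_Suc_eq)
  have old: "sol mid u j x (A ! x) (B ! x)" using fr xm px t by (auto simp: frontier_def)
  have Gx: "G x = 0" using act xm px by (auto simp: active_def)
  \<comment> \<open>With the weights of all times up to \<open>t\<close> added, the value of an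
    active leaf is its optimum plus the cost of the edge to \<open>x\<close>, as
    \<open>sol_step\<close> requires.\<close>
  have sx: "sol mid u (Suc j) x rm (if rg = 0 then 0 else if j < mid then Suc x else rg)"
  proof (rule sol_step[OF xm _ u b])
    show "ps ! u < ps ! x" using px t by simp
    fix i assume i: "i \<le> x"
    then have im: "i \<le> Suc m" using xm by simp
    show "G i \<noteq> 0 \<longleftrightarrow> (\<exists>y. walk j u i y) \<and> ps ! i < ps ! x" using act im px by (auto simp: active_def)
    assume "G i \<noteq> 0"
    then show "\<exists>y. sol mid u j i y (G i) \<and> F i = y + cost i x"
      using act im px unfolding active_def cost_def by auto
  qed
  show "active mid u j (Suc t) (Suc t) F' G'"
    unfolding active_def
  proof (intro allI impI)
    fix i assume i: "i \<le> Suc m"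
    show "(G' i \<noteq> 0 \<longleftrightarrow> (\<exists>y. walk j u i y) \<and> ps ! i \<le> Suc t) \<and>
    (G' i \<noteq> 0 \<longrightarrow> (\<exists>y. sol mid u j i y (G' i) \<and>
      F' i = y + (\<Sum>x\<in>{ps ! i..<Suc t}. gain er ew (off ! x) (off ! Suc x) i)))"
    proof (cases "i = x")
      case True
      then show ?thesis using F'x Gx old sol_walk[OF old] px by auto
    next
      case False
      then show ?thesis using act F' other[OF False i] i by (auto simp: active_def)
    qed
  qed
  show "frontier mid u j (Suc t) b (A[x := rm]) (B[x := if rg = 0 then 0 else if j < mid then Suc x else rg])"
    unfolding frontier_def
  proof (intro conjI allI impI)
    fix v assume v: "v \<le> Suc m" "ps ! u < ps ! v" "ps ! v \<le> Suc t"
    show "sol mid u (Suc j) v (A[x := rm] ! v) (B[x := if rg = 0 then 0 else if j < mid then Suc x else rg] ! v)"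
    proof (cases "v = x")
      case True
      then show ?thesis using sx len xm by simp
    next
      case False
      then show ?thesis using fr v other[OF False v(1)] by (auto simp: frontier_def)
    qed
  next
    fix v assume v: "v \<le> Suc m" "ps ! u < ps ! v" "Suc t < ps ! v" "ps ! v \<le> b"
    then have "v \<noteq> x" using px by auto
    then show "sol mid u j v (A[x := rm] ! v) (B[x := if rg = 0 then 0 else if j < mid then Suc x else rg] ! v)"
      using fr v by (auto simp: frontier_def)
  qed (use fr ux in \<open>auto simp: frontier_def\<close>)
qed

section \<open>A whole sweep, and the iteration of rounds\<close>

definition swept :: "nat \<Rightarrow> nat \<Rightarrow> nat \<Rightarrow> nat \<Rightarrow> nat \<Rightarrow> state \<Rightarrow> bool" where
  "swept mid u j b t s \<longleftrightarrow> ctx s \<and> nvar s ''t'' = t \<and> nvar s ''e'' = off ! t \<and> nvar s ''lv'' = j \<and> nvar s ''md'' = mid \<and>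
    frontier mid u j t b (rarr s ''A'') (narr s ''B'') \<and> (\<exists>T F G. tree L s T F G \<and> active mid u j t t F G)"

lemma wp_sweep_step:
  assumes s: "swept mid u j b t s" and t: "ps ! u \<le> t" "t < b" "b \<le> Suc m" and u: "u \<le> Suc m"
  shows "wp W Sp sweep_step s (\<lambda>tm s'. tm \<le> (off ! Suc t - off ! t) * (80 * L + 52) + (160 * L + 160) \<and>
    lens s s' \<and> swept mid u j b (Suc t) s')"
proof -
  obtain T F G where c: "ctx s" and v: "nvar s ''t'' = t" "nvar s ''e'' = off ! t" "nvar s ''lv'' = j" "nvar s ''md'' = mid"
    and fr: "frontier mid u j t b (rarr s ''A'') (narr s ''B'')" and tr: "tree L s T F G" and act: "active mid u j t t F G"
    using s by (auto simp: swept_def)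
  have tm: "t \<le> m" using t by simp
  let ?F = "\<lambda>i. F i + gain er ew (off ! t) (off ! Suc t) i"
  have act1: "active mid u j t (Suc t) ?F G" by (rule active_events[OF act])
  have "wp W Sp (While (NLess (NVar ''e'') (NGet ''of'' (NAdd (NVar ''t'') (NLit 1)))) event_step) s
    (\<lambda>tm s'. tm \<le> (off ! Suc t - off ! t) * (80 * L + 52) + 7 \<and>
      (ctx s' \<and> lens s s' \<and> nvar s' ''e'' = off ! Suc t \<and> nvar s' ''t'' = t \<and> nvar s' ''lv'' = j \<and> nvar s' ''md'' = mid \<and>
       rarr s' ''A'' = rarr s ''A'' \<and> narr s' ''B'' = narr s ''B'' \<and> (\<exists>T. tree L s' T ?F G)))"
  proof (rule wp_conseq[OF wp_events[OF c tr v(2,1) tm]], goal_cases)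
    case (1 tm s')
    then show ?case using v frameD[OF 1(1)] by simp
  qed
  then have "wp W Sp sweep_step s (\<lambda>tm s'. tm \<le> ((off ! Suc t - off ! t) * (80 * L + 52) + 7) + (160 * L + 150) \<and>
    (lens s s' \<and> swept mid u j b (Suc t) s'))"
    unfolding sweep_step_def
  proof (rule wp_seqI, goal_cases)
    case (1 s1)
    then obtain T1 where c1: "ctx s1" and l1: "lens s s1" and v1: "nvar s1 ''e'' = off ! Suc t" "nvar s1 ''t'' = t" "nvar s1 ''lv'' = j" "nvar s1 ''md'' = mid"
       and A1: "rarr s1 ''A'' = rarr s ''A''" "narr s1 ''B'' = narr s ''B''" and tr1: "tree L s1 T1 ?F G" by blast
    show ?case
    proof (rule wp_conseq[OF wp_node_step[OF c1 tr1 v1(2) tm refl A1 v1(3,4)]], goal_cases)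
      case (1 tm s2)
      let ?x = "nd ! Suc t"
      from 1(2) obtain T' F' G' rm rg where r: "tree L s2 T' F' G'"
        "\<forall>i. i \<noteq> ?x \<longrightarrow> F' i = ?F i \<and> G' i = G i"
        "G ?x = 0 \<longrightarrow> G' ?x = narr s ''B'' ! ?x \<and> (narr s ''B'' ! ?x \<noteq> 0 \<longrightarrow> F' ?x = rarr s ''A'' ! ?x)"
        "best ?x ?F G rm rg"
        "rarr s2 ''A'' = (rarr s ''A'')[?x := rm]"
        "narr s2 ''B'' = (narr s ''B'')[?x := if rg = 0 then 0 else if j < mid then Suc ?x else rg]"
        and s2: "ctx s2" "lens s1 s2" "nvar s2 ''t'' = Suc t" "tm \<le> 160 * L + 150"
        by (elim conjE exE) (rule that; assumption)
      have len: "length (rarr s ''A'') = m + 2" "length (narr s ''B'') = m + 2" using c by (auto simp: ctx_def)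
      note st = frontier_step[OF act1 fr t u refl r(2,3,4) len]
      have "swept mid u j b (Suc t) s2" unfolding swept_def r(5,6)
        using st r(1) s2 v1 frameD(1)[OF 1(1)] by auto
      then show ?case using s2 lens_trans[OF l1] by blast
    qed
  qed
  then show ?thesis by (rule wp_conseq) auto
qed

lemma wp_sweep:
  assumes s: "swept mid u j b (ps ! u) s" and b: "ps ! u \<le> b" "b \<le> Suc m" and u: "u \<le> Suc m"
    and u1: "u1 \<le> Suc m" "ps ! u1 = b" "nvar s ''u1'' = u1"
  shows "wp W Sp (While (NLess (NVar ''t'') (NGet ''ps'' (NVar ''u1''))) sweep_step) s
    (\<lambda>tm s'. tm \<le> (off ! b - off ! (ps ! u)) * (80 * L + 52) + (b - ps ! u) * (160 * L + 170) + 10 \<and>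
      lens s s' \<and> swept mid u j b b s')"
proof -
  define a where "a = ps ! u"
  define I where "I i s' \<longleftrightarrow> lens s s' \<and> nvar s' ''u1'' = u1 \<and> swept mid u j b (a + i) s'" for i and s' :: state
  have I0: "I 0 s" using s u1 by (simp add: I_def a_def)
  have ev_b: "beval W s' (NLess (NVar ''t'') (NGet ''ps'' (NVar ''u1''))) = Some (a + i < b)" if "I i s'" for i s'
  proof -
    have "narr s' ''ps'' = ps" "nvar s' ''t'' = a + i" "nvar s' ''u1'' = u1" using that by (auto simp: I_def swept_def ctx_def)
    then show ?thesis using u1 len by (simp add: eval_simps)
  qed
  \<comment> \<open>The event counts telescope, so the sweep is charged once for each event and each
    node of its interval.\<close>
  have tele: "(\<Sum>i<n. off ! Suc (a + i) - off ! (a + i)) = off ! (a + n) - off ! a" if "a + n \<le> Suc m" for n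
    using that
  proof (induction n)
    case (Suc n)
    then show ?case using off(1)[of a "a + n"] off(1)[of "a + n" "Suc (a + n)"] by simp
  qed simp
  show ?thesis
  proof (rule wp_conseq[OF wp_count[where I = I and N = "b - a" and
      T = "\<lambda>i. (off ! Suc (a + i) - off ! (a + i)) * (80 * L + 52) + (160 * L + 160)", OF I0]], goal_cases)
    case (1 i s1)
    then have sw: "swept mid u j b (a + i) s1" by (simp add: I_def)
    have "wp W Sp sweep_step s1 (\<lambda>t s'. t \<le> (off ! Suc (a + i) - off ! (a + i)) * (80 * L + 52) + (160 * L + 160) \<and> I (Suc i) s')"
    proof (rule wp_conseq[OF wp_sweep_step[OF sw _ _ b(2) u]], goal_cases)
      case (3 t s')
      then show ?case using 1(1) frameD(1)[OF 3(1)] unfolding I_def by (auto intro: lens_trans)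
    qed (use 1(2) a_def in auto)
    then show ?case using ev_b[OF 1(1)] 1(2) by simp
  next
    case (2 s1)
    then show ?case using ev_b[OF 2] b a_def by simp
  next
    case (3 tm s')
    have "(\<Sum>i<b - a. (off ! Suc (a + i) - off ! (a + i)) * (80 * L + 52) + (160 * L + 160)) =
      (off ! b - off ! a) * (80 * L + 52) + (b - a) * (160 * L + 160)"
      using tele[of "b - a"] b unfolding a_def[symmetric] by (simp add: sum.distrib flip: sum_distrib_right)
    moreover have "tm \<le> e * (80 * L + 52) + d * (160 * L + 170) + 10"
      if "tm \<le> e * (80 * L + 52) + d * (160 * L + 160) + (d + 1) * 5" for d e
      using that by (simp add: algebra_simps)
    ultimately have "tm \<le> (off ! b - off ! a) * (80 * L + 52) + (b - a) * (160 * L + 170) + 10"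
      using 3(2) by simp
    moreover have "a + (b - a) = b" using b a_def by simp
    ultimately show ?case using 3(2) unfolding I_def a_def[symmetric] by auto
  qed
qed

definition solved :: "nat \<Rightarrow> nat \<Rightarrow> nat \<Rightarrow> nat \<Rightarrow> state \<Rightarrow> bool" where
  "solved mid u v j s \<longleftrightarrow> ctx s \<and> nvar s ''lv'' = j \<and> nvar s ''md'' = mid \<and> nvar s ''u0'' = u \<and> nvar s ''u1'' = v \<and>
    frontier mid u j (ps ! u) (ps ! v) (rarr s ''A'') (narr s ''B'')"

text \<open>A completed round is the start of the next: the new values are reread as old ones, and
  nothing beyond \<open>u\<close> has been updated yet.\<close>

lemma frontier_next: "frontier mid u j b b A B \<Longrightarrow> frontier mid u (Suc j) (ps ! u) b A B"
  unfolding frontier_def by auto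

text \<open>Walks go forward in time, so at the arrival of \<open>u\<close> nothing but
  \<open>u\<close> itself is reachable.\<close>

lemma active_start:
  assumes "u \<le> Suc m"
  shows "active mid u j (ps ! u) (ps ! u) (\<lambda>_. 0) ((\<lambda>_. 0)(u := Suc u))"
  unfolding active_def
proof (intro allI impI)
  fix i assume i: "i \<le> Suc m"
  have "i = u" if "walk j u i y" "ps ! i \<le> ps ! u" for y
    using walk_le[OF that(1)] that(2) pos_inj[OF i assms] by simp
  moreover have "\<exists>y. walk j u u y" using walk_refl by blast
  ultimately show "(((\<lambda>_. 0)(u := Suc u)) i \<noteq> 0) = ((\<exists>y. walk j u i y) \<and> ps ! i \<le> ps ! u) \<and>
     (((\<lambda>_. 0)(u := Suc u)) i \<noteq> 0 \<longrightarrow> (\<exists>y. sol mid u j i y (((\<lambda>_. 0)(u := Suc u)) i) \<and>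
        0 = y + (\<Sum>x = ps ! i..<ps ! u. gain er ew (off ! x) (off ! Suc x) i)))"
    using sol_start[of mid u j] by (auto intro!: exI[of _ 0])
qed

lemma wp_level_step:
  assumes s: "solved mid u v j s" and u: "u \<le> Suc m" and v: "v \<le> Suc m" and le: "ps ! u \<le> ps ! v" and jW: "Suc j < W"
  shows "wp W Sp level_step s (\<lambda>tm s'. tm \<le> 86 * 2 ^ L + 100 +
      (off ! (ps ! v) - off ! (ps ! u) + (ps ! v - ps ! u)) * (160 * L + 170) \<and> lens s s' \<and> solved mid u v (Suc j) s')"
proof -
  let ?a = "ps ! u" and ?b = "ps ! v"
  have c: "ctx s" and v0: "nvar s ''lv'' = j" "nvar s ''md'' = mid" "nvar s ''u0'' = u" "nvar s ''u1'' = v"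
    and fr: "frontier mid u j ?a ?b (rarr s ''A'') (narr s ''B'')" using s by (auto simp: solved_def)
  have bm: "?b \<le> Suc m" "?a \<le> Suc m" using node_pos[OF v] node_pos[OF u] by auto
  have [simp]: "Suc u < W" "u < W" "Suc 0 < W" "u < 2 ^ L" "Suc j < W" using u mL W jW by auto
  define set where "set = Seq (NSet ''j'' (NVar ''u0'')) (Seq (RSet ''v'' RZero) (Seq (NSet ''g'' (NAdd (NVar ''u0'') (NLit 1))) tree_set))"
  define start where "start = Seq (NSet ''t'' (NGet ''ps'' (NVar ''u0''))) (NSet ''e'' (NGet ''of'' (NVar ''t'')))"
  define P where "P s' \<longleftrightarrow> ctx s' \<and> lens s s' \<and> nvar s' ''lv'' = j \<and> nvar s' ''md'' = mid \<and> nvar s' ''u0'' = u \<and> nvar s' ''u1'' = v \<and>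
     rarr s' ''A'' = rarr s ''A'' \<and> narr s' ''B'' = narr s ''B''" for s'
  have 1: "wp W Sp tree_init s (\<lambda>t s'. t \<le> 6 * 2 ^ L + 12 \<and> (P s' \<and> tree L s' (\<lambda>_. 0) (\<lambda>_. 0) (\<lambda>_. 0)))"
  proof (rule wp_conseq[OF wp_tree_init[where L = L]], goal_cases)
    case (7 t s')
    note f = frameD[OF 7(1), simplified]
    have "ctx s'" by (rule ctx_mono[OF c]) (use 7(2) f in auto)
    then show ?case using 7(2) f v0 by (simp add: P_def)
  qed (use c W in \<open>auto simp: ctx_def\<close>)
  have 2: "wp W Sp set s1 (\<lambda>t s'. t \<le> 80 * L + 50 \<and> (P s' \<and> tree L s' (\<lambda>_. 0) (\<lambda>_. 0) ((\<lambda>_. 0)(u := Suc u))))"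
    if P1: "P s1 \<and> tree L s1 (\<lambda>_. 0) (\<lambda>_. 0) (\<lambda>_. 0)" for s1
  proof -
    define s2 where "s2 = s1\<lparr>nvar := (nvar s1)(''j'' := u, ''g'' := Suc u), rvar := (rvar s1)(''v'' := 0)\<rparr>"
    have c1: "ctx s1" using P1 by (simp add: P_def)
    have tr2: "tree L s2 (\<lambda>_. 0) (\<lambda>_. 0) (\<lambda>_. 0)" by (rule tree_frame[of L s1]) (use P1 in \<open>auto simp: s2_def\<close>)
    have z: "0 - rarr s2 ''S'' ! (2 ^ L + u) + 0 = 0" using tree_zero_sums[OF tr2, of u] by simp
    have "wp W Sp tree_set s2 (\<lambda>t s'. t \<le> 80 * L + 30 \<and> (P s' \<and> tree L s' (\<lambda>_. 0) (\<lambda>_. 0) ((\<lambda>_. 0)(u := Suc u))))"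
    proof (rule wp_conseq[OF wp_no_new[OF wp_tree_set[OF tr2, of u W 0 "Suc u" Sp]]], goal_cases)
      case (8 t s')
      note f = frameD[OF 8(1), simplified]
      have l: "lens s1 s'" using 8(2) by (simp add: s2_def)
      have "ctx s'" by (rule ctx_mono[OF c1 l]) (use f in \<open>auto simp: s2_def\<close>)
      then have "P s'" using P1 l f unfolding P_def by (auto simp: s2_def intro: lens_trans)
      moreover have "tree L s' (\<lambda>_. 0) (\<lambda>_. 0) ((\<lambda>_. 0)(u := Suc u))"
        using 8(2) unfolding z by (simp add: fun_upd_idem)
      ultimately show ?case using 8(2) by blast
    qed (use W in \<open>auto simp: s2_def\<close>)
    then show ?thesis unfolding set_def s2_def using P1
      by (simp add: P_def wps) (erule wp_conseq, simp)
  qed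
  have 3: "wp W Sp start s1 (\<lambda>t s'. t \<le> 10 \<and> (lens s s' \<and> nvar s' ''u0'' = u \<and> nvar s' ''u1'' = v \<and> swept mid u j ?b ?a s'))"
    if P1: "P s1 \<and> tree L s1 (\<lambda>_. 0) (\<lambda>_. 0) ((\<lambda>_. 0)(u := Suc u))" for s1
  proof -
    have a: "narr s1 ''ps'' = ps" "narr s1 ''of'' = off" using P1 by (auto simp: P_def ctx_def)
    have ex: "\<exists>T F G. tree L s1 T F G \<and> active mid u j ?a ?a F G"
      using P1 active_start[OF u, of mid j] by blast
    show ?thesis using P1 a fr ex u bm len unfolding start_def
      by (simp add: wps P_def swept_def)
  qed
  have 4: "wp W Sp (Seq (While (NLess (NVar ''t'') (NGet ''ps'' (NVar ''u1''))) sweep_step)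
      (NSet ''lv'' (NAdd (NVar ''lv'') (NLit 1)))) s1
     (\<lambda>t s'. t \<le> ((off ! ?b - off ! ?a) * (80 * L + 52) + (?b - ?a) * (160 * L + 170) + 10) + 5 \<and> (lens s s' \<and> solved mid u v (Suc j) s'))"
    if P1: "lens s s1 \<and> nvar s1 ''u0'' = u \<and> nvar s1 ''u1'' = v \<and> swept mid u j ?b ?a s1" for s1
  proof -
    have "wp W Sp (While (NLess (NVar ''t'') (NGet ''ps'' (NVar ''u1''))) sweep_step) s1
       (\<lambda>t s'. t \<le> (off ! ?b - off ! ?a) * (80 * L + 52) + (?b - ?a) * (160 * L + 170) + 10 \<and>
         (lens s s' \<and> nvar s' ''u0'' = u \<and> nvar s' ''u1'' = v \<and> swept mid u j ?b ?b s'))"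
    proof (rule wp_conseq[OF wp_sweep[of mid u j ?b s1 v]], goal_cases)
      case (8 t s')
      note f = frameD(1)[OF 8(1), simplified]
      have "nvar s' ''u0'' = u \<and> nvar s' ''u1'' = v" using f P1 by simp
      then show ?case using 8(2) P1 lens_trans by blast
    qed (use P1 bm le u v in auto)
    then show ?thesis
    proof (rule wp_seqI, goal_cases)
      case (1 s')
      then show ?case using frontier_next[of mid u j ?b] by (simp add: wps solved_def swept_def)
    qed
  qed
  have "wp W Sp (Seq tree_init (Seq set (Seq start (Seq (While (NLess (NVar ''t'') (NGet ''ps'' (NVar ''u1''))) sweep_step)
      (NSet ''lv'' (NAdd (NVar ''lv'') (NLit 1))))))) s
     (\<lambda>t s'. t \<le> (6 * 2 ^ L + 12) + ((80 * L + 50) + (10 +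
        (((off ! ?b - off ! ?a) * (80 * L + 52) + (?b - ?a) * (160 * L + 170) + 10) + 5))) \<and> (lens s s' \<and> solved mid u v (Suc j) s'))"
    by (rule wp_seqI[OF 1 wp_seqI[OF 2 wp_seqI[OF 3 4]]])
  then have "wp W Sp level_step s
     (\<lambda>t s'. t \<le> (6 * 2 ^ L + 12) + ((80 * L + 50) + (10 +
        (((off ! ?b - off ! ?a) * (80 * L + 52) + (?b - ?a) * (160 * L + 170) + 10) + 5))) \<and> (lens s s' \<and> solved mid u v (Suc j) s'))"
    unfolding level_step_def set_def start_def by (simp only: wp_Seq_eq add.assoc cong del: wp_cong)
  then show ?thesis
  proof (rule wp_conseq, goal_cases)
    case (1 t s')
    \<comment> \<open>Merges the initial leaf update, \<open>80 * L\<close>, into the clearing cost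
      \<open>6 * 2 ^ L\<close>; hence the factor 86.\<close>
    have "L \<le> 2 ^ L" using less_exp[of L] by simp
    moreover have "(off ! ?b - off ! ?a) * (80 * L + 52) \<le> (off ! ?b - off ! ?a) * (160 * L + 170)" by simp
    ultimately have "t \<le> 86 * 2 ^ L + 100 + (off ! ?b - off ! ?a + (?b - ?a)) * (160 * L + 170)"
      using 1(2) unfolding add_mult_distrib by linarith
    then show ?case using 1(2) by blast
  qed
qed

lemma wp_solve:
  assumes c: "ctx s" and vars: "nvar s ''u0'' = u" "nvar s ''u1'' = v" "nvar s ''l'' = l" "nvar s ''md'' = mid"
    and u: "u \<le> Suc m" and v: "v \<le> Suc m" and le: "ps ! u \<le> ps ! v" and lW: "l < W"
  shows "wp W Sp solve s (\<lambda>tm s'. tm \<le> 30 + m + l * (86 * 2 ^ L + 110 +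
      (off ! (ps ! v) - off ! (ps ! u) + (ps ! v - ps ! u)) * (160 * L + 170)) \<and> lens s s' \<and> ctx s' \<and>
      sol mid u l v (rarr s' ''A'' ! v) (narr s' ''B'' ! v))"
proof -
  let ?T = "86 * 2 ^ L + 100 + (off ! (ps ! v) - off ! (ps ! u) + (ps ! v - ps ! u)) * (160 * L + 170)"
  have [simp]: "Suc u < W" "u < W" "Suc 0 < W" "0 < W" "2 < W" "Suc (Suc m) < W" using u mL W by auto
  have cc: "nvar s ''m'' = m" "length (narr s ''B'') = Suc (Suc m)" "length (rarr s ''A'') = Suc (Suc m)" "space s \<le> Sp"
    using c by (auto simp: ctx_def)
  define B where "B = (replicate (Suc (Suc m)) 0)[u := Suc u]"
  define A where "A = (rarr s ''A'')[u := 0]"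
  define s1 where "s1 = s\<lparr>nvar := (nvar s)(''lv'' := 0), narr := (narr s)(''B'' := B), rarr := (rarr s)(''A'' := A)\<rparr>"
  have l1: "lens s s1" using cc by (auto simp: lens_def s1_def A_def B_def simp del: replicate.simps)
  have "ctx s1" by (rule ctx_mono[OF c l1]) (auto simp: s1_def)
  \<comment> \<open>With 0 steps only \<open>u\<close> is reachable, which the fresh zero tags
    express for all other nodes.\<close>
  moreover have "frontier mid u 0 (ps ! u) (ps ! v) A B"
    unfolding frontier_def using u cc(2,3) by (auto simp: A_def B_def nth_list_update simp del: replicate.simps intro: sol_0)
  ultimately have s1: "solved mid u v 0 s1" using vars by (simp add: solved_def s1_def)
  have 1: "wp W Sp (Seq (NNew ''B'' (NAdd (NVar ''m'') (NLit 2)))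
    (Seq (NPut ''B'' (NVar ''u0'') (NAdd (NVar ''u0'') (NLit 1)))
    (Seq (RPut ''A'' (NVar ''u0'') RZero) (NSet ''lv'' (NLit 0))))) s (\<lambda>t s'. t \<le> m + 20 \<and> s' = s1)"
    using cc u vars space_NNew_same[of s "''B''" "Suc (Suc m)" 0]
    by (simp add: wps s1_def A_def B_def del: replicate.simps)
  define I where "I i s' \<longleftrightarrow> lens s s' \<and> nvar s' ''l'' = l \<and> solved mid u v i s'" for i and s' :: state
  have 2: "wp W Sp (While (NLess (NVar ''lv'') (NVar ''l'')) level_step) s1 (\<lambda>t s'. t \<le> l * (?T + 4) + 4 \<and> I l s')"
  proof (rule wp_conseq[OF wp_count[where I = I and N = l and T = "\<lambda>_. ?T"]], goal_cases)
    case 1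
    then show ?case using s1 l1 vars by (simp add: I_def s1_def)
  next
    case (2 i s2)
    then have s2: "solved mid u v i s2" "lens s s2" "nvar s2 ''l'' = l" by (auto simp: I_def)
    have "wp W Sp level_step s2 (\<lambda>t s'. t \<le> ?T \<and> I (Suc i) s')"
      by (rule wp_conseq[OF wp_level_step[OF s2(1) u v le]])
        (use 2 lW s2 in \<open>auto simp: I_def frameD(1)[where x = "''l''"] intro: lens_trans\<close>)
    then show ?case using s2 2(2) by (simp add: eval_simps solved_def)
  next
    case (3 s2)
    then show ?case by (simp add: I_def solved_def eval_simps)
  next
    case (4 t s')
    then show ?case by (simp add: algebra_simps)
  qed
  have "wp W Sp solve s (\<lambda>t s'. t \<le> (m + 20) + (l * (?T + 4) + 4) \<and> I l s')"
    using wp_seqI[OF 1, of "While (NLess (NVar ''lv'') (NVar ''l'')) level_step" "l * (?T + 4) + 4" "I l"] 2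
    unfolding solve_def by (simp only: wp_Seq_eq add.assoc cong del: wp_cong)
  then show ?thesis
  proof (rule wp_conseq, goal_cases)
    case (1 t s')
    then have s': "solved mid u v l s'" "lens s s'" by (auto simp: I_def)
    have "sol mid u l v (rarr s' ''A'' ! v) (narr s' ''B'' ! v)"
    proof (cases "u = v")
      case True
      then show ?thesis using s'(1) sol_start[of mid u l] by (simp add: solved_def frontier_def)
    next
      case False
      then have "ps ! u < ps ! v" using le pos_inj[OF u v] by (auto simp: order_le_less)
      then show ?thesis using s'(1) v by (simp add: solved_def frontier_def)
    qed
    moreover have "t \<le> 30 + m + l * (?T + 10)" using 1(2) by (simp add: algebra_simps)
    ultimately show ?case using s' by (simp add: solved_def algebra_simps)
  qed
qed

end

section \<open>Recovering an optimal walk in linear space\<close>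

text \<open>The total length of all segments split by the bisection, added up over its
  depths.\<close>

fun halving :: "nat \<Rightarrow> nat" where
  "halving l = (if l < 2 then 0 else halving (l div 2) + halving (l - l div 2) + l)"

declare halving.simps [simp del]

text \<open>Each of at most \<open>d\<close> depths contributes at most \<open>l\<close>, since the
  two parts of a segment have its length together.\<close>

lemma halving_le: "l \<le> 2 ^ d \<Longrightarrow> halving l \<le> l * d"
proof (induction d arbitrary: l)
  case 0
  then show ?case by (subst halving.simps) simp
next
  case (Suc d)
  show ?case
  proof (cases "l < 2")
    case False
    have "l div 2 \<le> 2 ^ d" "l - l div 2 \<le> 2 ^ d" using Suc.prems by auto
    from this[THEN Suc.IH] have "halving l \<le> l div 2 * d + (l - l div 2) * d + l"
      using False by (subst halving.simps) simp
    also have "l div 2 * d + (l - l div 2) * d = l * d" by (simp flip: add_mult_distrib)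
    finally show ?thesis by simp
  qed (subst halving.simps, simp)
qed

text \<open>The array \<open>nx\<close> links each determined position of the walk \<open>cu\<close> to the next determined one and thereby
  replaces a recursion stack.\<close>

definition split_step :: com where
  "split_step = Seq (NSet ''u0'' (NGet ''cu'' (NVar ''i''))) (Seq (NSet ''u1'' (NGet ''cu'' (NVar ''h'')))
    (Seq (NSet ''l'' (NSub (NVar ''h'') (NVar ''i''))) (Seq (NSet ''md'' (NDiv (NVar ''l'') (NLit 2)))
    (Seq solve
    (Seq (NPut ''cu'' (NAdd (NVar ''i'') (NVar ''md'')) (NSub (NGet ''B'' (NVar ''u1'')) (NLit 1)))
    (Seq (NPut ''nx'' (NAdd (NVar ''i'') (NVar ''md'')) (NVar ''h''))
    (NPut ''nx'' (NVar ''i'') (NAdd (NVar ''i'') (NVar ''md'')))))))))"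

definition bisect_step :: com where
  "bisect_step = Seq (NSet ''h'' (NGet ''nx'' (NVar ''i'')))
    (If (NLess (NVar ''h'') (NAdd (NVar ''i'') (NLit 2))) (NSet ''i'' (NVar ''h'')) split_step)"

text \<open>The first run of \<open>solve\<close>, with \<open>md = 0\<close>, is for the optimal
  value only. All midpoints come from the runs inside the loop, including a second one over the
  whole walk.\<close>

definition bisect :: com where
  "bisect = Seq (NPut ''cu'' (NVar ''c'') (NAdd (NVar ''m'') (NLit 1)))
    (Seq (NPut ''nx'' (NLit 0) (NVar ''c''))
    (Seq (NSet ''u0'' (NLit 0)) (Seq (NSet ''u1'' (NAdd (NVar ''m'') (NLit 1)))
    (Seq (NSet ''l'' (NVar ''c'')) (Seq (NSet ''md'' (NLit 0))
    (Seq solve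
    (Seq (RSet ''value'' (RGet ''A'' (NVar ''u1'')))
    (Seq (NSet ''i'' (NLit 0))
      (While (NLess (NVar ''i'') (NVar ''c'')) bisect_step)))))))))"

lemma bisect_mods [simp]:
  "nvars split_step = {''u0'', ''u1'', ''l'', ''md'', ''j'', ''g'', ''t'', ''e'', ''x'', ''rg'', ''lv''}"
  "rvars split_step = {''v'', ''rs'', ''rm''}"
  "narrs split_step = {''G'', ''B'', ''cu'', ''nx''}" "rarrs split_step = {''S'', ''M'', ''A''}"
  "nvars bisect_step = {''i'', ''h'', ''u0'', ''u1'', ''l'', ''md'', ''j'', ''g'', ''t'', ''e'', ''x'', ''rg'', ''lv''}"
  "rvars bisect_step = {''v'', ''rs'', ''rm''}"
  "narrs bisect_step = {''G'', ''B'', ''cu'', ''nx''}" "rarrs bisect_step = {''S'', ''M'', ''A''}"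
  "nvars bisect = {''i'', ''h'', ''u0'', ''u1'', ''l'', ''md'', ''j'', ''g'', ''t'', ''e'', ''x'', ''rg'', ''lv''}"
  "rvars bisect = {''v'', ''rs'', ''rm'', ''value''}"
  "narrs bisect = {''G'', ''B'', ''cu'', ''nx''}" "rarrs bisect = {''S'', ''M'', ''A''}"
  by (auto simp: split_step_def bisect_step_def bisect_def)

context dp_data
begin

lemma ctx_put [simp]:
  "a \<notin> {''nd'', ''ps'', ''of'', ''er''} \<Longrightarrow> ctx (s\<lparr>narr := (narr s)(a := (narr s a)[i := v])\<rparr>) = ctx s"
proof -
  assume "a \<notin> {''nd'', ''ps'', ''of'', ''er''}"
  moreover have "space (s\<lparr>narr := (narr s)(a := (narr s a)[i := v])\<rparr>) = space s"
    by (rule space_lens) (simp add: lens_def)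
  ultimately show ?thesis by (auto simp: ctx_def)
qed

section \<open>The potential of the bisection\<close>

definition width :: "nat \<Rightarrow> nat \<Rightarrow> nat" where
  "width u v = off ! (ps ! v) - off ! (ps ! u) + (ps ! v - ps ! u)"

lemma width_add:
  assumes "ps ! u \<le> ps ! g" "ps ! g \<le> ps ! v" "ps ! v \<le> Suc m"
  shows "width u v = width u g + width g v"
proof -
  have "off ! (ps ! u) \<le> off ! (ps ! g)" "off ! (ps ! g) \<le> off ! (ps ! v)"
    using assms off(1) by auto
  then show ?thesis using assms by (simp add: width_def)
qed

text \<open>The cost of a round apart from its events and nodes: \<open>86 * 2 ^ L\<close> for the
  tree, one more \<open>2 ^ L\<close> because re-allocating \<open>B\<close> costs
  \<open>m \<le> 2 ^ L\<close>, and the constants of a split.\<close>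

definition lin :: nat where "lin = 87 * 2 ^ L + 300"
definition lg :: nat where "lg = 160 * L + 170"

text \<open>Potential of a segment of \<open>l\<close> steps and width \<open>z\<close>. The cost \<open>l * lin\<close> of clearing the tree recurs at every
  depth of the bisection, but the cost \<open>l * z * lg\<close> of the sweeps halves with \<open>l\<close>, as the widths of the parts add up to \<open>z\<close>.\<close>

definition seg_pot :: "nat \<Rightarrow> nat \<Rightarrow> nat" where
  "seg_pot l z = 30 * l + halving l * lin + 3 * l * z * lg"

text \<open>The factor 3 in \<open>seg_pot\<close> is chosen for this: both halves of
  \<open>l \<ge> 2\<close> satisfy \<open>3 * (half) \<le> 2 * l\<close>, with equality for the
  larger half of 3. So the sweep part of the two new potentials is at most \<open>2 * l * z\<close>,
  and one \<open>l * z\<close> remains to pay for the current run.\<close>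

lemma seg_pot_split:
  assumes "2 \<le> l"
  shows "30 + l * lin + l * (z1 + z2) * lg + seg_pot (l div 2) z1 + seg_pot (l - l div 2) z2 \<le> seg_pot l (z1 + z2) + 30"
proof -
  have "30 * (l div 2) + 30 * (l - l div 2) = 30 * l" by simp
  moreover have "halving l * lin = halving (l div 2) * lin + halving (l - l div 2) * lin + l * lin"
    using assms by (subst halving.simps) (simp add: add_mult_distrib)
  moreover have "l * (z1 + z2) * lg + 3 * (l div 2) * z1 * lg + 3 * (l - l div 2) * z2 * lg \<le> 3 * l * (z1 + z2) * lg"
  proof -
    have a: "3 * (l div 2) \<le> 2 * l" "3 * (l - l div 2) \<le> 2 * l" using assms by presburger+
    have "3 * (l div 2) * z1 \<le> 2 * l * z1" "3 * (l - l div 2) * z2 \<le> 2 * l * z2"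
      by (rule mult_le_mono1[OF a(1)], rule mult_le_mono1[OF a(2)])
    then have "l * (z1 + z2) + 3 * (l div 2) * z1 + 3 * (l - l div 2) * z2 \<le> 3 * l * (z1 + z2)"
      unfolding mult.assoc add_mult_distrib2 by linarith
    then have "(l * (z1 + z2) + 3 * (l div 2) * z1 + 3 * (l - l div 2) * z2) * lg \<le> 3 * l * (z1 + z2) * lg"
      by (rule mult_le_mono1)
    then show ?thesis by (simp only: add_mult_distrib)
  qed
  ultimately show ?thesis unfolding seg_pot_def by linarith
qed

text \<open>The part of the walk that is still to be refined: \<open>hs\<close> are the linked
  positions after \<open>i\<close>, and between neighbours only the existence of some walk is known.
  The values of these walks add up to \<open>x\<close>, the potentials of their segments to
  \<open>\<phi>\<close>.\<close>

fun chain :: "nat \<Rightarrow> nat list \<Rightarrow> nat list \<Rightarrow> nat \<Rightarrow> nat list \<Rightarrow> real \<Rightarrow> nat \<Rightarrow> bool" where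
  "chain c cu nx i [] x \<phi> \<longleftrightarrow> i = c \<and> x = 0 \<and> \<phi> = 0"
| "chain c cu nx i (h # hs) x \<phi> \<longleftrightarrow> i < h \<and> h \<le> c \<and> nx ! i = h \<and> cu ! h \<le> Suc m \<and>
    (\<exists>y z \<psi>. walk (h - i) (cu ! i) (cu ! h) y \<and> chain c cu nx h hs z \<psi> \<and> x = y + z \<and>
      \<phi> = seg_pot (h - i) (width (cu ! i) (cu ! h)) + \<psi>)"

lemma chain_cong:
  assumes "chain c cu nx i hs x \<phi>" "\<And>p. i \<le> p \<Longrightarrow> cu' ! p = cu ! p \<and> nx' ! p = nx ! p"
  shows "chain c cu' nx' i hs x \<phi>"
  using assms
proof (induction hs arbitrary: i x \<phi>)
  case (Cons h hs)
  from Cons.prems(1) obtain y z \<psi> where h: "i < h" "h \<le> c" "nx ! i = h" "cu ! h \<le> Suc m"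
    "walk (h - i) (cu ! i) (cu ! h) y" "chain c cu nx h hs z \<psi>" "x = y + z"
    "\<phi> = seg_pot (h - i) (width (cu ! i) (cu ! h)) + \<psi>" by auto
  have "chain c cu' nx' h hs z \<psi>" by (rule Cons.IH[OF h(6)]) (use Cons.prems(2) h(1) in auto)
  moreover have "cu' ! i = cu ! i" "cu' ! h = cu ! h" "nx' ! i = nx ! i" using Cons.prems(2) h(1) by auto
  ultimately show ?case using h by auto
qed simp

definition traced :: "nat list \<Rightarrow> nat \<Rightarrow> real \<Rightarrow> bool" where
  "traced cu i x \<longleftrightarrow> (\<exists>y. (\<forall>p<i. walk (Suc 0) (cu ! p) (cu ! Suc p) (y p)) \<and> x = (\<Sum>p<i. y p))"

lemma traced_cong: "traced cu i x \<Longrightarrow> (\<And>p. p \<le> i \<Longrightarrow> cu' ! p = cu ! p) \<Longrightarrow> traced cu' i x"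
  unfolding traced_def by (elim exE conjE) (rule exI, auto)

lemma traced_Suc: "traced cu i x \<Longrightarrow> walk (Suc 0) (cu ! i) (cu ! Suc i) y \<Longrightarrow> traced cu (Suc i) (x + y)"
  unfolding traced_def
proof (elim exE conjE)
  fix f assume "walk (Suc 0) (cu ! i) (cu ! Suc i) y" "\<forall>p<i. walk (Suc 0) (cu ! p) (cu ! Suc p) (f p)" "x = (\<Sum>p<i. f p)"
  then show "\<exists>y'. (\<forall>p<Suc i. walk (Suc 0) (cu ! p) (cu ! Suc p) (y' p)) \<and> x + y = (\<Sum>p<Suc i. y' p)"
    by (intro exI[of _ "f(i := y)"]) (auto simp: less_Suc_eq)
qed

lemma traced_walk: "traced cu i x \<Longrightarrow> walk i (cu ! 0) (cu ! i) x"
proof (induction i arbitrary: x)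
  case (Suc i)
  then obtain y where y: "\<forall>p<Suc i. walk (Suc 0) (cu ! p) (cu ! Suc p) (y p)" "x = (\<Sum>p<Suc i. y p)"
    by (auto simp: traced_def)
  then have "traced cu i (\<Sum>p<i. y p)" unfolding traced_def by (intro exI[of _ y]) simp
  from walk_append[OF Suc.IH[OF this]] y show ?case by fastforce
qed (simp add: traced_def)

text \<open>An inequality suffices for \<open>V\<close>. A midpoint never lowers the value of the
  stored walk, and \<open>V\<close> will be the optimum, so equality follows at the end.\<close>

definition cut_inv :: "nat \<Rightarrow> real \<Rightarrow> nat \<Rightarrow> state \<Rightarrow> bool" where
  "cut_inv c V \<phi> s \<longleftrightarrow> ctx s \<and> nvar s ''c'' = c \<and> length (narr s ''cu'') = Suc c \<and> length (narr s ''nx'') = Suc c \<and>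
    narr s ''cu'' ! 0 = 0 \<and> narr s ''cu'' ! c = Suc m \<and> narr s ''cu'' ! nvar s ''i'' \<le> Suc m \<and> nvar s ''i'' \<le> c \<and>
    (\<exists>hs x0 x1. traced (narr s ''cu'') (nvar s ''i'') x0 \<and>
      chain c (narr s ''cu'') (narr s ''nx'') (nvar s ''i'') hs x1 \<phi> \<and> V \<le> x0 + x1)"

lemma wp_split_step:
  assumes c: "ctx s" and i: "nvar s ''i'' = i" "nvar s ''h'' = h" "i + 2 \<le> h" "h \<le> c" "c < W"
    and cu: "narr s ''cu'' = cu" "length cu = Suc c" "narr s ''nx'' = nx" "length nx = Suc c" "nx ! i = h"
    and um: "cu ! i \<le> Suc m" "cu ! h \<le> Suc m" and w: "walk (h - i) (cu ! i) (cu ! h) y"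
  shows "wp W Sp split_step s (\<lambda>t s'. \<exists>g x1 x2 md. md = (h - i) div 2 \<and>
    walk md (cu ! i) g x1 \<and> walk (h - i - md) g (cu ! h) x2 \<and> y \<le> x1 + x2 \<and>
    t \<le> 120 + m + (h - i) * (86 * 2 ^ L + 110 + width (cu ! i) (cu ! h) * lg) \<and> lens s s' \<and> ctx s' \<and>
    narr s' ''cu'' = cu[i + md := g] \<and> narr s' ''nx'' = nx[i + md := h, i := i + md])"
proof -
  let ?l = "h - i" and ?u = "cu ! i" and ?v = "cu ! h"
  let ?md = "?l div 2"
  have [simp]: "i < W" "h < W" "?l < W" "2 < W" "Suc 0 < W" "?md < W" "i + ?md < W" "i < Suc c" "h < Suc c" "i + ?md < Suc c"
    using i W mL by auto
  have le: "ps ! ?u \<le> ps ! ?v" using walk_le[OF w] by simp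
  define s1 where "s1 = s\<lparr>nvar := (nvar s)(''u0'' := ?u, ''u1'' := ?v, ''l'' := ?l, ''md'' := ?md)\<rparr>"
  have "wp W Sp solve s1 (\<lambda>t s2. t \<le> 30 + m + ?l * (86 * 2 ^ L + 110 + width ?u ?v * lg) \<and>
    wp W Sp (Seq (NPut ''cu'' (NAdd (NVar ''i'') (NVar ''md'')) (NSub (NGet ''B'' (NVar ''u1'')) (NLit 1)))
    (Seq (NPut ''nx'' (NAdd (NVar ''i'') (NVar ''md'')) (NVar ''h''))
    (NPut ''nx'' (NVar ''i'') (NAdd (NVar ''i'') (NVar ''md''))))) s2
    (\<lambda>t s'. t \<le> 30 \<and> (\<exists>g x1 x2.
      walk ?md ?u g x1 \<and> walk (?l - ?md) g ?v x2 \<and> y \<le> x1 + x2 \<and> lens s s' \<and> ctx s' \<and>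
      narr s' ''cu'' = cu[i + ?md := g] \<and> narr s' ''nx'' = nx[i + ?md := h, i := i + ?md])))"
  proof (rule wp_conseq[OF wp_solve[of s1 ?u ?v ?l ?md]], goal_cases)
    case (10 t s2)
    note f = frameD[OF 10(1), simplified]
    have ctx2: "ctx s2" and l2: "lens s s2" using 10(2) by (auto simp: s1_def)
    have sol: "sol ?md ?u ?l ?v (rarr s2 ''A'' ! ?v) (narr s2 ''B'' ! ?v)" using 10(2) by simp
    \<comment> \<open>The segment has a walk, so its tag is nonzero and the tag minus one, as
      computed by the program, is a genuine node.\<close>
    have g: "narr s2 ''B'' ! ?v \<noteq> 0" using sol_walk[OF sol] w by blast
    define g' where "g' = narr s2 ''B'' ! ?v - 1"
    have "min ?l ?md = ?md" by (rule min_absorb2) simp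
    then obtain x1 x2 where x: "walk ?md ?u g' x1" "walk (?l - ?md) g' ?v x2" "rarr s2 ''A'' ! ?v = x1 + x2"
      "\<forall>y. walk ?l ?u ?v y \<longrightarrow> y \<le> rarr s2 ''A'' ! ?v"
      using sol g unfolding sol_def g'_def by auto
    then have yx: "y \<le> x1 + x2" using w by auto
    have g'W: "g' < W" using walk_le[OF x(2)] um W mL by simp
    have v2: "nvar s2 ''i'' = i" "nvar s2 ''h'' = h" "nvar s2 ''md'' = ?md" "nvar s2 ''u1'' = ?v" "narr s2 ''cu'' = cu" "narr s2 ''nx'' = nx"
      using f i cu by (auto simp: s1_def)
    have lB: "?v < length (narr s2 ''B'')" using ctx2 um by (simp add: ctx_def)
    define s3 where "s3 = s2\<lparr>narr := (narr s2)(''cu'' := cu[i + ?md := g'], ''nx'' := nx[i + ?md := h, i := i + ?md])\<rparr>"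
    have l3: "lens s2 s3" using v2 by (simp add: lens_def s3_def)
    have "ctx s3" by (rule ctx_mono[OF ctx2 l3]) (auto simp: s3_def)
    then have "\<exists>g x1 x2. walk ?md ?u g x1 \<and> walk (?l - ?md) g ?v x2 \<and> y \<le> x1 + x2 \<and> lens s s3 \<and> ctx s3 \<and>
      narr s3 ''cu'' = cu[i + ?md := g] \<and> narr s3 ''nx'' = nx[i + ?md := h, i := i + ?md]"
      using x yx lens_trans[OF l2 l3] by (intro exI[of _ g'] exI[of _ x1] exI[of _ x2]) (simp add: s3_def)
    then have "wp W Sp (Seq (NPut ''cu'' (NAdd (NVar ''i'') (NVar ''md'')) (NSub (NGet ''B'' (NVar ''u1'')) (NLit 1)))
    (Seq (NPut ''nx'' (NAdd (NVar ''i'') (NVar ''md'')) (NVar ''h''))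
    (NPut ''nx'' (NVar ''i'') (NAdd (NVar ''i'') (NVar ''md''))))) s2
    (\<lambda>t s'. t \<le> 30 \<and> (\<exists>g x1 x2.
      walk ?md ?u g x1 \<and> walk (?l - ?md) g ?v x2 \<and> y \<le> x1 + x2 \<and> lens s s' \<and> ctx s' \<and>
      narr s' ''cu'' = cu[i + ?md := g] \<and> narr s' ''nx'' = nx[i + ?md := h, i := i + ?md]))"
      using v2 lB g'W[unfolded g'_def] cu unfolding s3_def g'_def by (simp add: wps)
    then show ?case using 10(2) unfolding width_def lg_def by blast
  qed (use c um le i in \<open>auto simp: s1_def\<close>)
  then show ?thesis unfolding split_step_def s1_def using i(1,2) cu
    apply (simp add: wp_Seq_eq[where c = "NSet x e" for x e] wp_Seq_eq[where c = solve] wp_NSet_eq eval_simps)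
    apply (erule wp_conseq)
    apply (elim conjE)
    apply (erule wp_conseq)
    apply simp
    done
qed

text \<open>If the next linked position is adjacent, the 30 units per step in \<open>seg_pot\<close>
  pay for advancing; otherwise a midpoint is inserted and \<open>seg_pot_split\<close> pays. The 4
  is the cost of the loop test.\<close>

lemma wp_bisect_step:
  assumes inv: "cut_inv c V \<phi> s" and i: "nvar s ''i'' < c" and c: "c + 2 < W"
  shows "wp W Sp bisect_step s (\<lambda>t s'. lens s s' \<and> (\<exists>\<phi>'. cut_inv c V \<phi>' s' \<and> t + 4 + \<phi>' \<le> \<phi>))"
proof -
  define i where "i = nvar s ''i''"
  define cu where "cu = narr s ''cu''"
  define nx where "nx = narr s ''nx''"
  obtain hs x0 x1 where tr: "traced cu i x0" and ch: "chain c cu nx i hs x1 \<phi>" and V: "V \<le> x0 + x1"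
    and ctx: "ctx s" and vc: "nvar s ''c'' = c" and len: "length cu = Suc c" "length nx = Suc c"
    and cu0: "cu ! 0 = 0" and cuc: "cu ! c = Suc m" and um: "cu ! i \<le> Suc m"
    using inv unfolding cut_inv_def i_def cu_def nx_def by blast
  obtain h hs' where hs: "hs = h # hs'" using ch i by (cases hs) (auto simp: i_def)
  obtain y z \<psi> where h: "i < h" "h \<le> c" "nx ! i = h" "cu ! h \<le> Suc m"
    and w: "walk (h - i) (cu ! i) (cu ! h) y" and ch': "chain c cu nx h hs' z \<psi>" and x1: "x1 = y + z"
    and \<phi>: "\<phi> = seg_pot (h - i) (width (cu ! i) (cu ! h)) + \<psi>" using ch hs by auto
  have [simp]: "i < W" "h < W" "Suc (Suc i) < W" "2 < W" "i < Suc c" using h c W by auto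
  define s1 where "s1 = s\<lparr>nvar := (nvar s)(''h'' := h)\<rparr>"
  have ctx1: "ctx s1" using ctx by (simp add: s1_def)
  show ?thesis
  proof (cases "h = Suc i")
    case True
    define s2 where "s2 = s1\<lparr>nvar := (nvar s1)(''i'' := h)\<rparr>"
    have "traced cu h (x0 + y)" using traced_Suc[OF tr] w True by simp
    moreover have "V \<le> (x0 + y) + z" using V x1 by simp
    ultimately have "cut_inv c V \<psi> s2"
      using ctx1 vc len cu0 cuc h ch' unfolding cut_inv_def by (auto simp: s1_def s2_def cu_def nx_def)
    moreover have "30 \<le> seg_pot (h - i) (width (cu ! i) (cu ! h))" using True by (simp add: seg_pot_def)
    ultimately show ?thesis unfolding bisect_step_def using True h len \<phi>
      apply (simp add: wps s1_def s2_def flip: i_def cu_def nx_def)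
      apply (intro exI[of _ \<psi>])
      apply simp
      done
  next
    case False
    then have ih: "i + 2 \<le> h" using h by simp
    let ?md = "(h - i) div 2"
    have split: "wp W Sp split_step s1 (\<lambda>t s'. t \<le> 120 + m + (h - i) * (86 * 2 ^ L + 110 + width (cu ! i) (cu ! h) * lg) \<and>
      lens s s' \<and> (\<exists>\<phi>'. cut_inv c V \<phi>' s' \<and> t + 30 + \<phi>' \<le> \<phi>))"
    proof (rule wp_conseq[OF wp_split_step[OF ctx1 _ _ ih h(2) _ _ len(1) _ len(2) h(3) um h(4) w]], goal_cases)
      case (6 t s')
      then obtain g x1' x2' where g: "walk ?md (cu ! i) g x1'" "walk (h - i - ?md) g (cu ! h) x2'" "y \<le> x1' + x2'"
        and t: "t \<le> 120 + m + (h - i) * (86 * 2 ^ L + 110 + width (cu ! i) (cu ! h) * lg)" and l: "lens s1 s'" and c': "ctx s'"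
        and n: "narr s' ''cu'' = cu[i + ?md := g]" "narr s' ''nx'' = nx[i + ?md := h, i := i + ?md]" by blast
      note f = frameD(1)[OF 6(1), simplified]
      have md: "0 < ?md" "i + ?md < h" using ih by auto
      let ?cu = "cu[i + ?md := g]" and ?nx = "nx[i + ?md := h, i := i + ?md]"
      have gm: "g \<le> Suc m" "ps ! (cu ! i) \<le> ps ! g" "ps ! g \<le> ps ! (cu ! h)"
        using walk_le[OF g(1)] walk_le[OF g(2)] h(4) by auto
      have wd: "width (cu ! i) (cu ! h) = width (cu ! i) g + width g (cu ! h)"
        by (rule width_add[OF gm(2,3)]) (use node_pos[OF h(4)] in simp)
      have ch2: "chain c ?cu ?nx h hs' z \<psi>" by (rule chain_cong[OF ch']) (use md in auto)
      have cg: "?cu ! (i + ?md) = g" using len md h(2) by simp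
      have hmd: "h - (i + ?md) = h - i - ?md" by simp
      let ?\<phi>2 = "seg_pot (h - i - ?md) (width g (cu ! h)) + \<psi>"
      have ch3: "chain c ?cu ?nx (i + ?md) (h # hs') (x2' + z) ?\<phi>2"
        unfolding chain.simps hmd cg using md h g(2) ch2 len by auto
      let ?\<phi>1 = "seg_pot ?md (width (cu ! i) g) + ?\<phi>2"
      have ch4: "chain c ?cu ?nx i ((i + ?md) # h # hs') (x1' + (x2' + z)) ?\<phi>1"
      proof (subst chain.simps(2), intro conjI exI)
        show "walk (i + ?md - i) (?cu ! i) (?cu ! (i + ?md)) x1'" using g(1) cg md by simp
        show "chain c ?cu ?nx (i + ?md) (h # hs') (x2' + z) ?\<phi>2" by (rule ch3)
        show "?\<phi>1 = seg_pot (i + ?md - i) (width (?cu ! i) (?cu ! (i + ?md))) + ?\<phi>2" using cg md by simp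
        show "?cu ! (i + ?md) \<le> Suc m" using cg gm by simp
      qed (use md h len in auto)
      have tr2: "traced ?cu i x0" by (rule traced_cong[OF tr]) (use md in auto)
      have inv': "cut_inv c V ?\<phi>1 s'" unfolding cut_inv_def
      proof (intro conjI exI)
        have i': "nvar s' ''i'' = i" using f by (simp add: s1_def i_def)
        show "traced (narr s' ''cu'') (nvar s' ''i'') x0" using tr2 by (simp add: i' n)
        show "chain c (narr s' ''cu'') (narr s' ''nx'') (nvar s' ''i'') ((i + ?md) # h # hs') (x1' + (x2' + z)) ?\<phi>1"
          using ch4 by (simp only: i' n)
        show "V \<le> x0 + (x1' + (x2' + z))" using V x1 g(3) by simp
        show "ctx s'" by (rule c')
        show "nvar s' ''c'' = c" using f vc by (simp add: s1_def)
        show "length (narr s' ''cu'') = Suc c" "length (narr s' ''nx'') = Suc c" using n len by auto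
        show "narr s' ''cu'' ! 0 = 0" using n cu0 md by simp
        show "narr s' ''cu'' ! c = Suc m" using n cuc md h(2) by simp
        show "narr s' ''cu'' ! nvar s' ''i'' \<le> Suc m" using n um md i' by simp
        show "nvar s' ''i'' \<le> c" using i' h by simp
      qed
      have "t + 30 + ?\<phi>1 \<le> \<phi>"
      proof -
        have hi: "2 \<le> h - i" using ih by simp
        have "t + 30 \<le> 150 + m + (h - i) * (86 * 2 ^ L + 110) + (h - i) * width (cu ! i) (cu ! h) * lg"
          using t by (simp add: algebra_simps)
        \<comment> \<open>At least two steps are split, so the overhead that does not depend on the
          segment can be spread over them.\<close>
        also have "150 + m \<le> (h - i) * (75 + m)" using mult_le_mono1[OF hi, of "75 + m"] by simp
        also have "(h - i) * (75 + m) + (h - i) * (86 * 2 ^ L + 110) \<le> (h - i) * lin"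
          using mL unfolding lin_def by (simp flip: add_mult_distrib2)
        finally have "t + 30 \<le> (h - i) * lin + (h - i) * width (cu ! i) (cu ! h) * lg" by simp
        then show ?thesis unfolding \<phi> wd using seg_pot_split[OF hi, of "width (cu ! i) g" "width g (cu ! h)"] by linarith
      qed
      then show ?case using inv' l t by (auto simp: s1_def)
    qed (use c in \<open>auto simp: s1_def i_def cu_def nx_def\<close>)
    then show ?thesis unfolding bisect_step_def s1_def using ih h len
      apply (simp add: wp_Seq_eq wp_If_eq wp_NSet_eq eval_simps flip: i_def cu_def nx_def)
      apply (erule wp_conseq)
      apply (elim conjE exE)
      apply (rule conjI, assumption)
      subgoal for t s' \<phi>' by (intro exI[of _ \<phi>']) simp
      done
  qed
qed

lemma wp_bisect:
  assumes ctx: "ctx s" and vc: "nvar s ''c'' = c" "0 < c" "c + 2 < W" "c \<le> 2 ^ L"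
    and len: "length (narr s ''cu'') = Suc c" "length (narr s ''nx'') = Suc c" and cu0: "narr s ''cu'' ! 0 = 0"
  shows "wp W Sp bisect s (\<lambda>t s'. t \<le> 200 + m + 30 * c + c * (L + 1) * lin + 4 * c * width 0 (Suc m) * lg \<and> lens s s' \<and>
    (\<forall>y. walk c 0 (Suc m) y \<longrightarrow> y \<le> rvar s' ''value'') \<and> traced (narr s' ''cu'') c (rvar s' ''value'') \<and>
    narr s' ''cu'' ! 0 = 0 \<and> narr s' ''cu'' ! c = Suc m)"
proof -
  have [simp]: "Suc m < W" "0 < W" "Suc 0 < W" "c < W" using mL W vc by auto
  define cu where "cu = (narr s ''cu'')[c := Suc m]"
  define nx where "nx = (narr s ''nx'')[0 := c]"
  define s1 where "s1 = s\<lparr>nvar := (nvar s)(''u0'' := 0, ''u1'' := Suc m, ''l'' := c, ''md'' := 0), narr := (narr s)(''cu'' := cu, ''nx'' := nx)\<rparr>"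
  have cc: "nvar s ''m'' = m" using ctx by (simp add: ctx_def)
  have l1: "lens s s1" by (auto simp: lens_def s1_def cu_def nx_def)
  have ctx1: "ctx s1" by (rule ctx_mono[OF ctx l1]) (auto simp: s1_def)
  have init: "wp W Sp (Seq (NPut ''cu'' (NVar ''c'') (NAdd (NVar ''m'') (NLit 1)))
    (Seq (NPut ''nx'' (NLit 0) (NVar ''c''))
    (Seq (NSet ''u0'' (NLit 0)) (Seq (NSet ''u1'' (NAdd (NVar ''m'') (NLit 1)))
    (Seq (NSet ''l'' (NVar ''c'')) (NSet ''md'' (NLit 0))))))) s (\<lambda>t s'. t \<le> 30 \<and> s' = s1)"
    using vc len cc by (simp add: wps s1_def cu_def nx_def)
  let ?T = "30 + m + c * (86 * 2 ^ L + 110 + width 0 (Suc m) * lg)"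
  define P where "P s' \<longleftrightarrow> lens s s' \<and> ctx s' \<and> nvar s' ''c'' = c \<and> nvar s' ''u1'' = Suc m \<and> narr s' ''cu'' = cu \<and> narr s' ''nx'' = nx \<and>
    (\<exists>V. rarr s' ''A'' ! Suc m = V \<and> walk c 0 (Suc m) V \<and> (\<forall>y. walk c 0 (Suc m) y \<longrightarrow> y \<le> V))" for s'
  have sv: "wp W Sp solve s2 (\<lambda>t s'. t \<le> ?T \<and> P s')" if "s2 = s1" for s2
    unfolding that
  proof (rule wp_conseq[OF wp_solve[of s1 0 "Suc m" c 0]], goal_cases)
    case (10 t s')
    note f = frameD[OF 10(1), simplified]
    have sol: "sol 0 0 c (Suc m) (rarr s' ''A'' ! Suc m) (narr s' ''B'' ! Suc m)" using 10(2) by simp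
    \<comment> \<open>The direct edge, i.e. the empty subset, guarantees a walk and hence a nonzero
      tag at the end node.\<close>
    have "edge 0 (Suc m)" by (simp add: edge_def)
    then have "walk (Suc 0) 0 (Suc m) (cost 0 (Suc m))" by (simp add: walk_1)
    then have "walk c 0 (Suc m) (cost 0 (Suc m))" by (rule walk_mono) (use vc in simp)
    then have "narr s' ''B'' ! Suc m \<noteq> 0" using sol_walk[OF sol] by blast
    then have "walk c 0 (Suc m) (rarr s' ''A'' ! Suc m) \<and> (\<forall>y. walk c 0 (Suc m) y \<longrightarrow> y \<le> rarr s' ''A'' ! Suc m)"
      using sol unfolding sol_def by auto
    then show ?case using 10(2) f l1 vc unfolding P_def width_def lg_def by (auto simp: s1_def intro: lens_trans)
  qed (use ctx1 vc in \<open>auto simp: s1_def\<close>)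
  define Q where "Q V s' \<longleftrightarrow> rvar s' ''value'' = V \<and> lens s s' \<and> (\<forall>y. walk c 0 (Suc m) y \<longrightarrow> y \<le> V)" for V and s' :: state
  let ?\<phi> = "seg_pot c (width 0 (Suc m))"
  have mid: "wp W Sp (Seq (RSet ''value'' (RGet ''A'' (NVar ''u1''))) (NSet ''i'' (NLit 0))) s2
     (\<lambda>t s'. t \<le> 10 \<and> (\<exists>V. Q V s' \<and> cut_inv c V ?\<phi> s'))" if P: "P s2" for s2
  proof -
    obtain V where V: "rarr s2 ''A'' ! Suc m = V" "walk c 0 (Suc m) V" "\<forall>y. walk c 0 (Suc m) y \<longrightarrow> y \<le> V"
      using P unfolding P_def by blast
    have lA: "Suc m < length (rarr s2 ''A'')" using P by (simp add: P_def ctx_def)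
    have P': "ctx s2" "nvar s2 ''c'' = c" "nvar s2 ''u1'' = Suc m" "narr s2 ''cu'' = cu" "narr s2 ''nx'' = nx" "lens s s2"
      using P by (auto simp: P_def)
    have cun: "length cu = Suc c" "length nx = Suc c" "cu ! 0 = 0" "cu ! c = Suc m" "nx ! 0 = c"
      using len cu0 vc by (auto simp: cu_def nx_def)
    have "traced cu 0 0" by (simp add: traced_def)
    moreover have "chain c cu nx 0 [c] V ?\<phi>" using V(2) cun vc by simp
    ultimately have ex: "\<exists>hs x0 x1. traced cu 0 x0 \<and> chain c cu nx 0 hs x1 ?\<phi> \<and> V \<le> x0 + x1"
      by (intro exI[of _ "[c]"] exI[of _ 0] exI[of _ V]) auto
    define s3 where "s3 = s2\<lparr>nvar := (nvar s2)(''i'' := 0), rvar := (rvar s2)(''value'' := V)\<rparr>"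
    have "cut_inv c V ?\<phi> s3" using P' cun ex unfolding cut_inv_def by (simp add: s3_def)
    moreover have "Q V s3" using V P' by (simp add: Q_def s3_def)
    ultimately show ?thesis using P' V(1) lA by (auto simp: wps s3_def)
  qed
  have loop: "wp W Sp (While (NLess (NVar ''i'') (NVar ''c'')) bisect_step) s2
     (\<lambda>t s'. t \<le> ?\<phi> + 4 \<and> (lens s s' \<and>
    (\<forall>y. walk c 0 (Suc m) y \<longrightarrow> y \<le> rvar s' ''value'') \<and> traced (narr s' ''cu'') c (rvar s' ''value'') \<and>
    narr s' ''cu'' ! 0 = 0 \<and> narr s' ''cu'' ! c = Suc m))" if Q: "\<exists>V. Q V s2 \<and> cut_inv c V ?\<phi> s2" for s2
  proof -
    obtain V where V: "Q V s2" "cut_inv c V ?\<phi> s2" using Q by blast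
    show ?thesis
    proof (rule wp_conseq[OF wp_potential[where I = "\<lambda>\<phi> s. cut_inv c V \<phi> s \<and> Q V s" and \<phi> = ?\<phi>]], goal_cases)
      case 1
      then show ?case using V by simp
    next
      case (2 \<phi> s3)
      then have inv: "cut_inv c V \<phi> s3" and q: "Q V s3" by auto
      have c3: "nvar s3 ''c'' = c" using inv by (simp add: cut_inv_def)
      show ?case
      proof (cases "nvar s3 ''i'' < c")
        case True
        have "wp W Sp bisect_step s3 (\<lambda>t s'. \<exists>\<phi>'. (cut_inv c V \<phi>' s' \<and> Q V s') \<and> t + 1 + bcost (NLess (NVar ''i'') (NVar ''c'')) + \<phi>' \<le> \<phi>)"
        proof (rule wp_conseq[OF wp_bisect_step[OF inv True vc(3)]], goal_cases)
          case (1 t s')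
          then have "Q V s'" using q frameD(2)[OF 1(1), of "''value''"] lens_trans by (auto simp: Q_def)
          then show ?case using 1(2) by auto
        qed
        then show ?thesis using True c3 by (simp add: eval_simps)
      next
        case False
        then show ?thesis using c3 by (simp add: eval_simps)
      qed
    next
      case (3 t s')
      then obtain \<phi> where inv: "cut_inv c V \<phi> s'" and q: "Q V s'" by blast
      have ge: "\<not> nvar s' ''i'' < c" using 3(2) inv by (auto simp: cut_inv_def eval_simps)
      then obtain hs x0 x1 where "nvar s' ''i'' = c" and tr: "traced (narr s' ''cu'') c x0"
        and ch: "chain c (narr s' ''cu'') (narr s' ''nx'') c hs x1 \<phi>" and V': "V \<le> x0 + x1"
        and cu': "narr s' ''cu'' ! 0 = 0" "narr s' ''cu'' ! c = Suc m"
        using inv unfolding cut_inv_def by (metis le_neq_implies_less)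
      have "x1 = 0" using ch by (cases hs) auto
      \<comment> \<open>The trace is itself a walk, so it cannot exceed the optimum; by the
        invariant it then attains it.\<close>
      moreover have "x0 \<le> V" using traced_walk[OF tr] cu' q by (simp add: Q_def)
      ultimately have "x0 = V" using V' by simp
      then show ?case using tr cu' q 3(2) by (simp add: Q_def)
    qed
  qed
  have "wp W Sp bisect s (\<lambda>t s'. t \<le> 30 + (?T + (10 + (?\<phi> + 4))) \<and> (lens s s' \<and>
    (\<forall>y. walk c 0 (Suc m) y \<longrightarrow> y \<le> rvar s' ''value'') \<and> traced (narr s' ''cu'') c (rvar s' ''value'') \<and>
    narr s' ''cu'' ! 0 = 0 \<and> narr s' ''cu'' ! c = Suc m))"
    using wp_seqI[OF init wp_seqI[OF sv wp_seqI[OF mid loop]]]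
    unfolding bisect_def by (simp only: wp_Seq_eq add.assoc cong del: wp_cong)
  then show ?thesis
  proof (rule wp_conseq, goal_cases)
    case (1 t s')
    have "halving c * lin \<le> c * L * lin" using halving_le[OF vc(4)] by simp
    moreover have "c * (86 * 2 ^ L + 110) \<le> c * lin" unfolding lin_def by simp
    moreover have "c * (L + 1) * lin = c * L * lin + c * lin" by (simp add: algebra_simps)
    moreover have "c * (86 * 2 ^ L + 110 + width 0 (Suc m) * lg) = c * (86 * 2 ^ L + 110) + c * width 0 (Suc m) * lg"
      by (simp add: algebra_simps)
    moreover have "4 * c * width 0 (Suc m) * lg = 3 * c * width 0 (Suc m) * lg + c * width 0 (Suc m) * lg"
      by (simp add: algebra_simps)
    ultimately have "t \<le> 200 + m + 30 * c + c * (L + 1) * lin + 4 * c * width 0 (Suc m) * lg"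
      using 1(2) unfolding seg_pot_def by linarith
    then show ?case using 1(2) by blast
  qed
qed

end

text \<open>Skips idle steps and the final step to the end node; every other step enters a new point
  of Q.\<close>

definition emit_cond :: bexp where
  "emit_cond = BAnd (NLess (NGet ''cu'' (NVar ''i'')) (NGet ''cu'' (NAdd (NVar ''i'') (NLit 1))))
     (NLess (NGet ''cu'' (NAdd (NVar ''i'') (NLit 1))) (NAdd (NVar ''m'') (NLit 1)))"

text \<open>The output is the whole array \<open>out\<close>, so a first pass counts the entries in
  order to allocate the exact length. \<open>yo\<close> turns the rank of a node into an index of
  the input.\<close>

definition emit :: com where
  "emit = Seq (NSet ''h'' (NLit 0)) (Seq (NSet ''i'' (NLit 0))
    (Seq (While (NLess (NVar ''i'') (NVar ''c''))
      (Seq (If emit_cond (NSet ''h'' (NAdd (NVar ''h'') (NLit 1))) Skip) (NSet ''i'' (NAdd (NVar ''i'') (NLit 1)))))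
    (Seq (NNew ''out'' (NVar ''h''))
    (Seq (NSet ''h'' (NLit 0)) (Seq (NSet ''i'' (NLit 0))
    (While (NLess (NVar ''i'') (NVar ''c''))
      (Seq (If emit_cond
         (Seq (NPut ''out'' (NVar ''h'') (NGet ''yo'' (NSub (NGet ''cu'' (NAdd (NVar ''i'') (NLit 1))) (NLit 1))))
           (NSet ''h'' (NAdd (NVar ''h'') (NLit 1)))) Skip)
       (NSet ''i'' (NAdd (NVar ''i'') (NLit 1))))))))))"

lemma wp_emit:
  assumes v: "nvar s ''c'' = c" "nvar s ''m'' = m" "narr s ''cu'' = cu" "length cu = Suc c"
    "narr s ''yo'' = yo" "length yo = m" "m + 2 < W" "c + 2 < W" and cu: "\<And>i. i \<le> c \<Longrightarrow> cu ! i \<le> Suc m"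
    and sp: "space s + c \<le> Sp"
  shows "wp W Sp emit s (\<lambda>t s'. t \<le> 100 * c + 50 \<and> rvar s' = rvar s \<and>
    narr s' ''out'' = map (\<lambda>i. yo ! (cu ! Suc i - 1)) (filter (\<lambda>i. cu ! i < cu ! Suc i \<and> cu ! Suc i \<le> m) [0..<c]))"
proof -
  define pk where "pk i \<longleftrightarrow> cu ! i < cu ! Suc i \<and> cu ! Suc i \<le> m" for i
  define n where "n i = length (filter pk [0..<i])" for i
  have nc: "n i \<le> i" for i unfolding n_def using length_filter_le[of pk "[0..<i]"] by simp
  have nS: "n (Suc i) = n i + (if pk i then 1 else 0)" for i by (simp add: n_def)
  have nmono: "n i \<le> n c" if "i \<le> c" for i
    using that upt_add_eq_append[of 0 i "c - i"] by (simp add: n_def)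
  have [simp]: "Suc 0 < W" "0 < W" "Suc m < W" "c < W" using v by auto
  have cond: "beval W s' emit_cond = Some (pk i)"
    if "nvar s' ''i'' = i" "narr s' ''cu'' = cu" "nvar s' ''m'' = m" "i < c" for s' i
    using that v unfolding emit_cond_def by (simp add: eval_simps pk_def less_Suc_eq_le)
  have cond_cost: "bcost emit_cond = 16" by (simp add: emit_cond_def)
  let ?sel = "\<lambda>i. map (\<lambda>i. yo ! (cu ! Suc i - 1)) (filter pk [0..<i])"
  define I where "I i s' \<longleftrightarrow> nvar s' ''i'' = i \<and> nvar s' ''h'' = n i \<and> nvar s' ''c'' = c \<and> nvar s' ''m'' = m \<and>
     narr s' ''cu'' = cu \<and> narr s' ''yo'' = yo \<and> rvar s' = rvar s \<and> space s' = space s" for i and s' :: state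
  define J where "J i s' \<longleftrightarrow> nvar s' ''i'' = i \<and> nvar s' ''h'' = n i \<and> nvar s' ''c'' = c \<and> nvar s' ''m'' = m \<and>
     narr s' ''cu'' = cu \<and> narr s' ''yo'' = yo \<and> rvar s' = rvar s \<and>
     length (narr s' ''out'') = n c \<and> take (n i) (narr s' ''out'') = ?sel i" for i and s' :: state
  have 1: "wp W Sp (Seq (NSet ''h'' (NLit 0)) (NSet ''i'' (NLit 0))) s (\<lambda>t s'. t \<le> 4 \<and> I 0 s')"
    using v by (simp add: wps I_def n_def space_def)
  have 2: "wp W Sp (While (NLess (NVar ''i'') (NVar ''c''))
      (Seq (If emit_cond (NSet ''h'' (NAdd (NVar ''h'') (NLit 1))) Skip) (NSet ''i'' (NAdd (NVar ''i'') (NLit 1))))) s1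
      (\<lambda>t s'. t \<le> c * 44 + 4 \<and> I c s')" if "I 0 s1" for s1
  proof (rule wp_conseq[OF wp_count[where I = I and N = c and T = "\<lambda>_. 40", OF that]], goal_cases)
    case (1 i s2)
    then have "n i < W" "Suc (n i) < W" "Suc i < W" using nc[of i] v by auto
    then show ?case using 1 cond[of s2 i] by (auto simp: wps I_def cond_cost nS space_def)
  next
    case (2 s2)
    then show ?case by (simp add: I_def eval_simps)
  qed simp
  have 3: "wp W Sp (Seq (NNew ''out'' (NVar ''h'')) (Seq (NSet ''h'' (NLit 0)) (NSet ''i'' (NLit 0)))) s1
      (\<lambda>t s'. t \<le> 10 + c \<and> J 0 s')" if "I c s1" for s1
    using that sp nc[of c] space_NNew[of s1 "''out''" "n c" 0] by (simp add: wps I_def J_def n_def[of 0])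
  have 4: "wp W Sp (While (NLess (NVar ''i'') (NVar ''c''))
      (Seq (If emit_cond
         (Seq (NPut ''out'' (NVar ''h'') (NGet ''yo'' (NSub (NGet ''cu'' (NAdd (NVar ''i'') (NLit 1))) (NLit 1))))
           (NSet ''h'' (NAdd (NVar ''h'') (NLit 1)))) Skip)
       (NSet ''i'' (NAdd (NVar ''i'') (NLit 1))))) s1
      (\<lambda>t s'. t \<le> c * 54 + 4 \<and> J c s')" if "J 0 s1" for s1
  proof (rule wp_conseq[OF wp_count[where I = J and N = c and T = "\<lambda>_. 50", OF that]], goal_cases)
    case (1 i s2)
    then have w: "n i < W" "Suc (n i) < W" "Suc i < W" using nc[of i] v by auto
    show ?case
    proof (cases "pk i")
      case True
      then have lt: "n i < n c" using nmono[of "Suc i"] 1(2) nS[of i] by simp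
      have ci: "cu ! Suc i - Suc 0 < m" "cu ! Suc i - Suc 0 < W" using True v by (auto simp: pk_def)
      show ?thesis using 1 cond[of s2 i] True w lt ci v
        by (auto simp: wps J_def cond_cost nS take_Suc_conv_app_nth)
    next
      case False
      then show ?thesis using 1 cond[of s2 i] w by (auto simp: wps J_def cond_cost nS)
    qed
  next
    case (2 s2)
    then show ?case by (simp add: J_def eval_simps)
  qed simp
  have "wp W Sp emit s (\<lambda>t s'. t \<le> 4 + ((c * 44 + 4) + ((10 + c) + (c * 54 + 4))) \<and> J c s')"
    using wp_seqI[OF 1 wp_seqI[OF 2 wp_seqI[OF 3 4]]]
    unfolding emit_def by (simp only: wp_Seq_eq add.assoc cong del: wp_cong)
  moreover have "pk = (\<lambda>i. cu ! i < cu ! Suc i \<and> cu ! Suc i \<le> m)" by (simp add: pk_def fun_eq_iff)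
  ultimately show ?thesis by (elim wp_conseq) (auto simp: J_def)
qed

section \<open>Ranks of the points\<close>

fun nnews :: "(vname \<times> nexp) list \<Rightarrow> com" where
  "nnews [] = Skip"
| "nnews ((a, e) # xs) = Seq (NNew a e) (nnews xs)"

fun rnews :: "(vname \<times> nexp) list \<Rightarrow> com" where
  "rnews [] = Skip"
| "rnews ((a, e) # xs) = Seq (RNew a e) (rnews xs)"

text \<open>The length expressions have to evaluate in every state with these word variables,
  because earlier allocations of the list change arrays only.\<close>

lemma wp_nnews:
  assumes "\<And>a e s'. (a, e) \<in> set xs \<Longrightarrow> nvar s' = nvar s \<Longrightarrow> neval W s' e = Some (f a) \<and> ncost e \<le> 9"
    "distinct (map fst xs)" "space s + (\<Sum>(a, e)\<leftarrow>xs. f a) \<le> Sp"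
  shows "wp W Sp (nnews xs) s (\<lambda>t s'. t \<le> 1 + (\<Sum>(a, e)\<leftarrow>xs. f a + 10) \<and> nvar s' = nvar s \<and> rvar s' = rvar s \<and>
     rarr s' = rarr s \<and> (\<forall>a. narr s' a = (if a \<in> fst ` set xs then replicate (f a) 0 else narr s a)) \<and>
     space s' \<le> space s + (\<Sum>(a, e)\<leftarrow>xs. f a))"
  using assms
proof (induction xs arbitrary: s)
  case Nil
  then show ?case unfolding nnews.simps by (simp add: wps)
next
  case (Cons x xs)
  obtain a e where x: "x = (a, e)" by (cases x)
  let ?s = "s\<lparr>narr := (narr s)(a := replicate (f a) 0)\<rparr>"
  have e: "neval W s e = Some (f a)" "ncost e \<le> 9" using Cons.prems(1)[of a e s] x by auto
  have sp: "space ?s \<le> space s + f a" by (rule space_NNew)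
  have "wp W Sp (nnews xs) ?s (\<lambda>t s'. t \<le> 1 + (\<Sum>(a, e)\<leftarrow>xs. f a + 10) \<and> nvar s' = nvar ?s \<and> rvar s' = rvar ?s \<and>
     rarr s' = rarr ?s \<and> (\<forall>a. narr s' a = (if a \<in> fst ` set xs then replicate (f a) 0 else narr ?s a)) \<and>
     space s' \<le> space ?s + (\<Sum>(a, e)\<leftarrow>xs. f a))"
    by (rule Cons.IH) (use Cons.prems x sp in auto)
  then have "wp W Sp (nnews xs) ?s (\<lambda>t s'. 1 + ncost e + f a + t \<le> 1 + (\<Sum>(a, e)\<leftarrow>x # xs. f a + 10) \<and> nvar s' = nvar s \<and> rvar s' = rvar s \<and>
     rarr s' = rarr s \<and> (\<forall>b. narr s' b = (if b \<in> fst ` set (x # xs) then replicate (f b) 0 else narr s b)) \<and>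
     space s' \<le> space s + (\<Sum>(a, e)\<leftarrow>x # xs. f a))"
    by (rule wp_conseq) (use sp e x Cons.prems(2) in auto)
  then show ?case using e sp Cons.prems(3) unfolding x nnews.simps wp_Seq_eq wp_NNew_eq by simp
qed

lemma wp_rnews:
  assumes "\<And>a e s'. (a, e) \<in> set xs \<Longrightarrow> nvar s' = nvar s \<Longrightarrow> neval W s' e = Some (f a) \<and> ncost e \<le> 9"
    "distinct (map fst xs)" "space s + (\<Sum>(a, e)\<leftarrow>xs. f a) \<le> Sp"
  shows "wp W Sp (rnews xs) s (\<lambda>t s'. t \<le> 1 + (\<Sum>(a, e)\<leftarrow>xs. f a + 10) \<and> nvar s' = nvar s \<and> rvar s' = rvar s \<and>
     narr s' = narr s \<and> (\<forall>a. rarr s' a = (if a \<in> fst ` set xs then replicate (f a) 0 else rarr s a)) \<and>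
     space s' \<le> space s + (\<Sum>(a, e)\<leftarrow>xs. f a))"
  using assms
proof (induction xs arbitrary: s)
  case Nil
  then show ?case unfolding rnews.simps by (simp add: wps)
next
  case (Cons x xs)
  obtain a e where x: "x = (a, e)" by (cases x)
  let ?s = "s\<lparr>rarr := (rarr s)(a := replicate (f a) 0)\<rparr>"
  have e: "neval W s e = Some (f a)" "ncost e \<le> 9" using Cons.prems(1)[of a e s] x by auto
  have sp: "space ?s \<le> space s + f a" by (rule space_RNew)
  have "wp W Sp (rnews xs) ?s (\<lambda>t s'. t \<le> 1 + (\<Sum>(a, e)\<leftarrow>xs. f a + 10) \<and> nvar s' = nvar ?s \<and> rvar s' = rvar ?s \<and>
     narr s' = narr ?s \<and> (\<forall>a. rarr s' a = (if a \<in> fst ` set xs then replicate (f a) 0 else rarr ?s a)) \<and>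
     space s' \<le> space ?s + (\<Sum>(a, e)\<leftarrow>xs. f a))"
    by (rule Cons.IH) (use Cons.prems x sp in auto)
  then have "wp W Sp (rnews xs) ?s (\<lambda>t s'. 1 + ncost e + f a + t \<le> 1 + (\<Sum>(a, e)\<leftarrow>x # xs. f a + 10) \<and> nvar s' = nvar s \<and> rvar s' = rvar s \<and>
     narr s' = narr s \<and> (\<forall>b. rarr s' b = (if b \<in> fst ` set (x # xs) then replicate (f b) 0 else rarr s b)) \<and>
     space s' \<le> space s + (\<Sum>(a, e)\<leftarrow>x # xs. f a))"
    by (rule wp_conseq) (use sp e x Cons.prems(2) in auto)
  then show ?case using e sp Cons.prems(3) unfolding x rnews.simps wp_Seq_eq wp_RNew_eq by simp
qed

text \<open>\<open>m + 2\<close> leaves are needed: the start node, the points of Q and the end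
  node.\<close>

definition size_tree :: com where
  "size_tree = Seq (NSet ''N'' (NLit 1))
    (While (NLess (NVar ''N'') (NAdd (NVar ''m'') (NLit 2))) (NSet ''N'' (NAdd (NVar ''N'') (NVar ''N''))))"

lemma wp_size_tree:
  assumes "nvar s ''m'' = m" "2 * m + 4 < W" and L: "m + 2 \<le> 2 ^ L" "2 ^ L < 2 * (m + 2)"
  shows "wp W Sp size_tree s (\<lambda>t s'. t \<le> 10 * L + 10 \<and> s' = s\<lparr>nvar := (nvar s)(''N'' := 2 ^ L)\<rparr>)"
proof -
  have [simp]: "Suc (Suc m) < W" "Suc 0 < W" "2 < W" using assms(2) by auto
  define I where "I i s' \<longleftrightarrow> s' = s\<lparr>nvar := (nvar s)(''N'' := 2 ^ i)\<rparr>" for i and s' :: state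
  have "wp W Sp (While (NLess (NVar ''N'') (NAdd (NVar ''m'') (NLit 2))) (NSet ''N'' (NAdd (NVar ''N'') (NVar ''N''))))
     (s\<lparr>nvar := (nvar s)(''N'' := 1)\<rparr>) (\<lambda>t s'. t \<le> 10 * L + 6 \<and> I L s')"
  proof (rule wp_conseq[OF wp_count[where I = I and N = L and T = "\<lambda>_. 4"]], goal_cases)
    case (2 i s2)
    have "(2::nat) ^ Suc i \<le> 2 ^ L" using 2(2) by (intro power_increasing) auto
    then have "(2::nat) ^ i < m + 2" using L(2) by simp
    then have "2 ^ i < W" "2 ^ i + 2 ^ i < W" "2 ^ i < Suc (Suc m)" "2 ^ i + 2 ^ i = (2::nat) ^ Suc i" using assms(2) by auto
    then show ?case using 2(1) assms(1) by (simp add: wps I_def del: power_Suc)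
  next
    case (3 s2)
    then show ?case using assms(1) L(1) by (simp add: I_def eval_simps)
  next
    case (4 t s')
    then show ?case by simp
  qed (simp add: I_def)
  then show ?thesis unfolding size_tree_def by (simp add: wps) (erule wp_conseq, simp add: I_def)
qed

text \<open>\<open>rk\<close> inverts \<open>yo\<close>. Times run against the x-order, hence
  \<open>m - i\<close>. The start node is at time 0 because the arrays are initially zero; the end
  node gets the last time \<open>m + 1\<close>.\<close>

definition rank_init :: com where
  "rank_init = Seq (NSet ''i'' (NLit 0))
    (Seq (While (NLess (NVar ''i'') (NVar ''m''))
       (Seq (NPut ''rk'' (NGet ''yo'' (NVar ''i'')) (NAdd (NVar ''i'') (NLit 1))) (NSet ''i'' (NAdd (NVar ''i'') (NLit 1)))))
    (Seq (NPut ''nd'' (NAdd (NVar ''m'') (NLit 1)) (NAdd (NVar ''m'') (NLit 1)))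
    (Seq (NPut ''ps'' (NAdd (NVar ''m'') (NLit 1)) (NAdd (NVar ''m'') (NLit 1)))
    (Seq (NSet ''i'' (NLit 0))
    (While (NLess (NVar ''i'') (NVar ''m''))
       (Seq (NSet ''j'' (NGet ''rk'' (NGet ''xo'' (NVar ''i''))))
       (Seq (NPut ''nd'' (NSub (NVar ''m'') (NVar ''i'')) (NVar ''j''))
       (Seq (NPut ''ps'' (NVar ''j'') (NSub (NVar ''m'') (NVar ''i'')))
         (NSet ''i'' (NAdd (NVar ''i'') (NLit 1)))))))))))"

lemma rank_init_mods [simp]:
  "nvars rank_init = {''i'', ''j''}" "rvars rank_init = {}" "narrs rank_init = {''rk'', ''nd'', ''ps''}" "rarrs rank_init = {}"
  "no_new rank_init"
  by (auto simp: rank_init_def)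

lemma wp_rank_init:
  assumes m: "nvar s ''m'' = m" "m + 2 < W" and xo: "narr s ''xo'' = xo" "length xo = m" "bij_betw ((!) xo) {..<m} {..<m}"
    and yo: "narr s ''yo'' = yo" "length yo = m" "bij_betw ((!) yo) {..<m} {..<m}"
    and z: "length (narr s ''rk'') = m" "narr s ''nd'' = replicate (m + 2) 0" "narr s ''ps'' = replicate (m + 2) 0"
  shows "wp W Sp rank_init s (\<lambda>t s'. t \<le> 50 * m + 50 \<and>
    length (narr s' ''nd'') = m + 2 \<and> length (narr s' ''ps'') = m + 2 \<and> narr s' ''nd'' ! 0 = 0 \<and> narr s' ''ps'' ! 0 = 0 \<and>
    narr s' ''nd'' ! Suc m = Suc m \<and> narr s' ''ps'' ! Suc m = Suc m \<and>
    (\<forall>i<m. \<forall>p<m. xo ! i = yo ! p \<longrightarrow> narr s' ''nd'' ! (m - i) = Suc p \<and> narr s' ''ps'' ! Suc p = m - i))"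
proof -
  have [simp]: "Suc 0 < W" "0 < W" "Suc m < W" "Suc m < Suc (Suc m)" using m by auto
  have xm: "xo ! i < m" if "i < m" for i using xo(3) that by (auto simp: bij_betw_def)
  have ym: "yo ! i < m" if "i < m" for i using yo(3) that by (auto simp: bij_betw_def)
  have xinj: "xo ! i = xo ! j \<longleftrightarrow> i = j" if "i < m" "j < m" for i j using xo(3) that by (auto simp: bij_betw_def inj_on_def)
  have yinj: "yo ! i = yo ! j \<longleftrightarrow> i = j" if "i < m" "j < m" for i j using yo(3) that by (auto simp: bij_betw_def inj_on_def)
  define I where "I i s' \<longleftrightarrow> nvar s' ''i'' = i \<and> nvar s' ''m'' = m \<and> narr s' ''xo'' = xo \<and> narr s' ''yo'' = yo \<and>
    narr s' ''nd'' = replicate (m + 2) 0 \<and> narr s' ''ps'' = replicate (m + 2) 0 \<and> length (narr s' ''rk'') = m \<and>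
    (\<forall>p<i. narr s' ''rk'' ! (yo ! p) = Suc p)" for i and s' :: state
  define J where "J i s' \<longleftrightarrow> nvar s' ''i'' = i \<and> nvar s' ''m'' = m \<and> narr s' ''xo'' = xo \<and> length (narr s' ''rk'') = m \<and>
    (\<forall>p<m. narr s' ''rk'' ! (yo ! p) = Suc p) \<and>
    length (narr s' ''nd'') = m + 2 \<and> length (narr s' ''ps'') = m + 2 \<and> narr s' ''nd'' ! 0 = 0 \<and> narr s' ''ps'' ! 0 = 0 \<and>
    narr s' ''nd'' ! Suc m = Suc m \<and> narr s' ''ps'' ! Suc m = Suc m \<and>
    (\<forall>q<i. \<forall>p<m. xo ! q = yo ! p \<longrightarrow> narr s' ''nd'' ! (m - q) = Suc p \<and> narr s' ''ps'' ! Suc p = m - q)" for i and s' :: state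
  have 1: "wp W Sp (NSet ''i'' (NLit 0)) s (\<lambda>t s'. t \<le> 2 \<and> I 0 s')"
    using assms by (simp add: wps I_def del: replicate.simps)
  have 2: "wp W Sp (While (NLess (NVar ''i'') (NVar ''m''))
       (Seq (NPut ''rk'' (NGet ''yo'' (NVar ''i'')) (NAdd (NVar ''i'') (NLit 1))) (NSet ''i'' (NAdd (NVar ''i'') (NLit 1)))))
     s1 (\<lambda>t s'. t \<le> m * 14 + 4 \<and> I m s')" if "I 0 s1" for s1
  proof (rule wp_conseq[OF wp_count[where I = I and N = m and T = "\<lambda>_. 10", OF that]], goal_cases)
    case (1 i s2)
    then have "Suc i < W" "i < W" "yo ! i < W" using m ym[of i] by auto
    then show ?case using 1 ym[of i] yo(2) yinj
      by (auto simp: wps I_def less_Suc_eq nth_list_update simp del: replicate.simps)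
  next
    case (2 s2)
    then show ?case by (simp add: I_def eval_simps)
  qed simp
  have 3: "wp W Sp (Seq (NPut ''nd'' (NAdd (NVar ''m'') (NLit 1)) (NAdd (NVar ''m'') (NLit 1)))
    (Seq (NPut ''ps'' (NAdd (NVar ''m'') (NLit 1)) (NAdd (NVar ''m'') (NLit 1)))
      (NSet ''i'' (NLit 0)))) s1 (\<lambda>t s'. t \<le> 20 \<and> J 0 s')" if "I m s1" for s1
    using that by (simp add: wps I_def J_def del: replicate.simps)
  have 4: "wp W Sp (While (NLess (NVar ''i'') (NVar ''m''))
       (Seq (NSet ''j'' (NGet ''rk'' (NGet ''xo'' (NVar ''i''))))
       (Seq (NPut ''nd'' (NSub (NVar ''m'') (NVar ''i'')) (NVar ''j''))
       (Seq (NPut ''ps'' (NVar ''j'') (NSub (NVar ''m'') (NVar ''i'')))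
         (NSet ''i'' (NAdd (NVar ''i'') (NLit 1))))))) s1 (\<lambda>t s'. t \<le> m * 28 + 4 \<and> J m s')" if "J 0 s1" for s1
  proof (rule wp_conseq[OF wp_count[where I = J and N = m and T = "\<lambda>_. 24", OF that]], goal_cases)
    case (1 i s2)
    obtain p where p: "p < m" "xo ! i = yo ! p" using yo(3) xm[OF 1(2)] unfolding bij_betw_def by (metis imageE lessThan_iff)
    have rk: "narr s2 ''rk'' ! (yo ! p) = Suc p" using 1(1) p by (simp add: J_def)
    have w: "Suc i < W" "m - i < W" "Suc p < W" "yo ! p < m" "yo ! p < W" "Suc p < Suc (Suc m)" "m - i < Suc (Suc m)" "0 < m - i" "m - i \<noteq> Suc m"
      "p \<noteq> m" using 1(2) m p ym[OF p(1)] by auto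
    have ne: "m - q \<noteq> m - i" if "q < i" for q using that 1(2) by simp
    have pu: "p' = p" if "p' < m" "xo ! i = yo ! p'" for p' using that p yinj by metis
    have po: "p' \<noteq> p" if "q < i" "p' < m" "xo ! q = yo ! p'" for q p' using that p xinj[of q i] 1(2) by auto
    define nd where "nd = narr s2 ''nd''"
    define ps where "ps = narr s2 ''ps''"
    define s3 where "s3 = s2\<lparr>nvar := (nvar s2)(''j'' := Suc p, ''i'' := Suc i),
      narr := (narr s2)(''nd'' := nd[m - i := Suc p], ''ps'' := ps[Suc p := m - i])\<rparr>"
    note inv = 1(1)[unfolded J_def, folded nd_def ps_def]
    have "nd[m - i := Suc p] ! (m - q) = Suc p' \<and> ps[Suc p := m - i] ! Suc p' = m - q"
      if q: "q < Suc i" and p': "p' < m" "xo ! q = yo ! p'" for q p'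
    proof (cases "q = i")
      case True
      then show ?thesis using pu[OF p'(1)] p'(2) w inv by simp
    next
      case False
      then have "q < i" using q by simp
      then show ?thesis using ne[of q] po[of q p'] p' inv by auto
    qed
    moreover have "nd[m - i := Suc p] ! 0 = 0" "nd[m - i := Suc p] ! Suc m = Suc m"
      "ps[Suc p := m - i] ! 0 = 0" "ps[Suc p := m - i] ! Suc m = Suc m" using w inv by auto
    ultimately have "J (Suc i) s3" using inv by (simp add: J_def s3_def)
    then show ?case using inv rk w p xo(2) 1(2)
      by (simp add: wps s3_def nd_def ps_def)
  next
    case (2 s2)
    then show ?case by (simp add: J_def eval_simps)
  qed simp
  have "wp W Sp rank_init s (\<lambda>t s'. t \<le> 2 + ((m * 14 + 4) + (20 + (m * 28 + 4))) \<and> J m s')"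
    using wp_seqI[OF 1 wp_seqI[OF 2 wp_seqI[OF 3 4]]]
    unfolding rank_init_def by (simp only: wp_Seq_eq add.assoc cong del: wp_cong)
  then show ?thesis by (rule wp_conseq) (simp add: J_def)
qed

text \<open>Tries to add decreasing powers of two to \<open>b\<close>. Throughout, the number of
  entries smaller than \<open>v\<close> is at least \<open>b\<close> and less than
  \<open>b + h\<close>, so at \<open>h = 1\<close> it equals \<open>b\<close>.\<close>

definition bsearch :: "vname \<Rightarrow> com" where
  "bsearch a = Seq (NSet ''b'' (NLit 0)) (Seq (NSet ''h'' (NVar ''N''))
    (While (NLess (NLit 1) (NVar ''h''))
      (Seq (NSet ''h'' (NDiv (NVar ''h'') (NLit 2)))
        (If (NLess (NAdd (NVar ''b'') (NVar ''h'')) (NAdd (NVar ''m'') (NLit 1)))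
          (If (RLess (RGet a (NSub (NAdd (NVar ''b'') (NVar ''h'')) (NLit 1))) (RVar ''v''))
             (NSet ''b'' (NAdd (NVar ''b'') (NVar ''h''))) Skip) Skip))))"

lemma bsearch_mods [simp]:
  "nvars (bsearch a) = {''b'', ''h''}" "rvars (bsearch a) = {}" "narrs (bsearch a) = {}" "rarrs (bsearch a) = {}" "no_new (bsearch a)"
  by (auto simp: bsearch_def)

lemma wp_bsearch:
  assumes v: "nvar s ''N'' = 2 ^ L" "nvar s ''m'' = m" "rarr s a = xs" "length xs = m" "m < 2 ^ L" "2 * 2 ^ L + 2 < W"
    and cnt: "cnt \<le> m" "\<And>i. i < m \<Longrightarrow> xs ! i < rvar s ''v'' \<longleftrightarrow> i < cnt"
  shows "wp W Sp (bsearch a) s (\<lambda>t s'. t \<le> 40 * L + 20 \<and> nvar s' ''b'' = cnt)"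
proof -
  have [simp]: "Suc 0 < W" "0 < W" "2 < W" "Suc m < W" using v by auto
  define I where "I i s' \<longleftrightarrow> nvar s' ''m'' = m \<and> rarr s' a = xs \<and> rvar s' ''v'' = rvar s ''v'' \<and> nvar s' ''h'' = 2 ^ (L - i) \<and>
     nvar s' ''b'' \<le> cnt \<and> cnt < nvar s' ''b'' + 2 ^ (L - i)" for i and s' :: state
  have 1: "wp W Sp (Seq (NSet ''b'' (NLit 0)) (NSet ''h'' (NVar ''N''))) s (\<lambda>t s'. t \<le> 4 \<and> I 0 s')"
    using v cnt(1) by (simp add: wps I_def)
  have 2: "wp W Sp (While (NLess (NLit 1) (NVar ''h''))
      (Seq (NSet ''h'' (NDiv (NVar ''h'') (NLit 2)))
        (If (NLess (NAdd (NVar ''b'') (NVar ''h'')) (NAdd (NVar ''m'') (NLit 1)))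
          (If (RLess (RGet a (NSub (NAdd (NVar ''b'') (NVar ''h'')) (NLit 1))) (RVar ''v''))
             (NSet ''b'' (NAdd (NVar ''b'') (NVar ''h''))) Skip) Skip))) s1 (\<lambda>t s'. t \<le> L * 34 + 4 \<and> I L s')" if "I 0 s1" for s1
  proof (rule wp_conseq[OF wp_count[where I = I and N = L and T = "\<lambda>_. 30", OF that]], goal_cases)
    case (1 i s2)
    define h :: nat where "h = 2 ^ (L - Suc i)"
    define b where "b = nvar s2 ''b''"
    have h2: "2 ^ (L - i) = 2 * h" using 1(2) by (simp add: h_def flip: power_Suc Suc_diff_Suc)
    have hpos: "0 < h" by (simp add: h_def)
    have hL: "2 * h \<le> 2 ^ L" unfolding h2[symmetric] by (intro power_increasing) auto
    have s2: "nvar s2 ''m'' = m" "rarr s2 a = xs" "rvar s2 ''v'' = rvar s ''v''" "nvar s2 ''h'' = 2 * h" "nvar s2 ''b'' = b"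
      "b \<le> cnt" "cnt < b + 2 * h" using 1(1) h2 by (auto simp: I_def b_def)
    have w: "h < W" "b + h < W" "b + h - Suc 0 < W" "1 < 2 * h" using hL hpos s2(5-7) cnt(1) v(5,6) by linarith+
    have c: "xs ! (b + h - Suc 0) < rvar s ''v'' \<longleftrightarrow> b + h \<le> cnt" if "b + h \<le> m"
      using cnt(2)[of "b + h - Suc 0"] that hpos by auto
    show ?case
    proof (cases "b + h \<le> m")
      case True
      then have "b + h - Suc 0 < length xs" using hpos v(4) by simp
      then show ?thesis using s2 w True c
        by (cases "b + h \<le> cnt"; simp add: wps I_def less_Suc_eq_le flip: h_def)
    next
      case False
      then have "cnt < b + h" using cnt(1) by simp
      then show ?thesis using s2 w False by (simp add: wps I_def less_Suc_eq_le flip: h_def)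
    qed
  next
    case (2 s2)
    then show ?case by (simp add: I_def eval_simps)
  qed simp
  have "wp W Sp (bsearch a) s (\<lambda>t s'. t \<le> 4 + (L * 34 + 4) \<and> I L s')"
    using wp_seqI[OF 1 2]
    unfolding bsearch_def by (simp only: wp_Seq_eq add.assoc cong del: wp_cong)
  then show ?thesis by (rule wp_conseq) (auto simp: I_def)
qed

text \<open>At time \<open>m - b\<close> exactly the points of Q at least as far right have arrived.
  The rank \<open>b + 1\<close> is the lowest node at least as high, or the end node if there is
  none. Counting strictly smaller coordinates makes dominance include equality.\<close>

definition locate_step :: com where
  "locate_step = Seq (RSet ''v'' (RGet ''px'' (NVar ''i''))) (Seq (bsearch ''xs'')
    (Seq (NPut ''pt'' (NVar ''i'') (NSub (NVar ''m'') (NVar ''b'')))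
    (Seq (RSet ''v'' (RGet ''py'' (NVar ''i''))) (Seq (bsearch ''ys'')
    (Seq (NPut ''pr'' (NVar ''i'') (NAdd (NVar ''b'') (NLit 1)))
      (NSet ''i'' (NAdd (NVar ''i'') (NLit 1))))))))"

definition locate :: com where
  "locate = Seq (NSet ''i'' (NLit 0)) (While (NLess (NVar ''i'') (NVar ''n'')) locate_step)"

lemma locate_mods [simp]:
  "nvars locate = {''i'', ''b'', ''h''}" "rvars locate = {''v''}" "narrs locate = {''pt'', ''pr''}" "rarrs locate = {}" "no_new locate"
  "nvars locate_step = {''i'', ''b'', ''h''}" "rvars locate_step = {''v''}" "narrs locate_step = {''pt'', ''pr''}" "rarrs locate_step = {}"
  by (auto simp: locate_step_def locate_def)

text \<open>In a sorted list the entries below \<open>v\<close> form an initial segment, so its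
  length decides every comparison with \<open>v\<close>.\<close>

lemma sorted_count:
  fixes xs :: "real list"
  assumes "\<And>i j. i \<le> j \<Longrightarrow> j < m \<Longrightarrow> xs ! i \<le> xs ! j"
  shows "card {i. i < m \<and> xs ! i < v} \<le> m" "i < m \<Longrightarrow> xs ! i < v \<longleftrightarrow> i < card {i. i < m \<and> xs ! i < v}"
proof -
  show "card {i. i < m \<and> xs ! i < v} \<le> m" using card_mono[of "{..<m}" "{i. i < m \<and> xs ! i < v}"] by auto
  assume i: "i < m"
  show "xs ! i < v \<longleftrightarrow> i < card {i. i < m \<and> xs ! i < v}"
  proof
    assume a: "xs ! i < v"
    have "{..i} \<subseteq> {i. i < m \<and> xs ! i < v}" using assms[of _ i] i a by (auto intro: le_less_trans)
    then have "card {..i} \<le> card {i. i < m \<and> xs ! i < v}" by (intro card_mono) auto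
    then show "i < card {i. i < m \<and> xs ! i < v}" by simp
  next
    assume a: "i < card {i. i < m \<and> xs ! i < v}"
    show "xs ! i < v"
    proof (rule ccontr)
      assume "\<not> xs ! i < v"
      then have "i' < i" if "i' < m" "xs ! i' < v" for i'
        using assms[of i i'] that by (meson leI le_less_trans)
      then have "{i. i < m \<and> xs ! i < v} \<subseteq> {..<i}" by auto
      then have "card {i. i < m \<and> xs ! i < v} \<le> card {..<i}" by (intro card_mono) auto
      then show False using a by simp
    qed
  qed
qed

lemma wp_locate:
  assumes v: "nvar s ''N'' = 2 ^ L" "nvar s ''m'' = m" "nvar s ''n'' = n" "rarr s ''xs'' = xs" "length xs = m"
    "rarr s ''ys'' = ys" "length ys = m" "m < 2 ^ L" "2 * 2 ^ L + 2 < W" "n < W"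
    "rarr s ''px'' = px" "rarr s ''py'' = py" "length px = n" "length py = n" "length (narr s ''pt'') = n" "length (narr s ''pr'') = n"
    and xs: "\<And>i j. i \<le> j \<Longrightarrow> j < m \<Longrightarrow> xs ! i \<le> xs ! j"
    and ys: "\<And>i j. i \<le> j \<Longrightarrow> j < m \<Longrightarrow> ys ! i \<le> ys ! j"
  shows "wp W Sp locate s (\<lambda>t s'. t \<le> n * (80 * L + 80) + 10 \<and> length (narr s' ''pt'') = n \<and> length (narr s' ''pr'') = n \<and>
    (\<forall>i<n. narr s' ''pt'' ! i = m - card {j. j < m \<and> xs ! j < px ! i} \<and> narr s' ''pr'' ! i = Suc (card {j. j < m \<and> ys ! j < py ! i})))"
proof -
  have [simp]: "Suc 0 < W" "0 < W" "2 < W" "Suc m < W" "m < W" using v by auto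
  have cx: "card {j. j < m \<and> xs ! j < v} \<le> m" "i < m \<Longrightarrow> xs ! i < v \<longleftrightarrow> i < card {j. j < m \<and> xs ! j < v}" for v i
    using sorted_count[of m xs] xs by blast+
  have cy: "card {j. j < m \<and> ys ! j < v} \<le> m" "i < m \<Longrightarrow> ys ! i < v \<longleftrightarrow> i < card {j. j < m \<and> ys ! j < v}" for v i
    using sorted_count[of m ys] ys by blast+
  define I where "I i s' \<longleftrightarrow> nvar s' ''i'' = i \<and> nvar s' ''m'' = m \<and> nvar s' ''n'' = n \<and> nvar s' ''N'' = 2 ^ L \<and> rarr s' = rarr s \<and>
    length (narr s' ''pt'') = n \<and> length (narr s' ''pr'') = n \<and>
    (\<forall>i'<i. narr s' ''pt'' ! i' = m - card {j. j < m \<and> xs ! j < px ! i'} \<and> narr s' ''pr'' ! i' = Suc (card {j. j < m \<and> ys ! j < py ! i'}))" for i and s' :: state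
  have step: "wp W Sp locate_step s2 (\<lambda>t s'. t \<le> 80 * L + 70 \<and> I (Suc i) s')" if s2: "I i s2" "i < n" for i s2
  proof -
    let ?c = "card {j. j < m \<and> xs ! j < px ! i}" and ?d = "card {j. j < m \<and> ys ! j < py ! i}"
    have iW: "i < W" "Suc i < W" using s2(2) v by auto
    have cW: "?c < W" "m - ?c < W" "?d < W" "Suc ?d < W"
      using cx(1)[of "px ! i"] cy(1)[of "py ! i"] v(8,9) by linarith+
    note s2' = s2(1)[unfolded I_def]
    define P1 where "P1 s' \<longleftrightarrow> I i s' \<and> rvar s' ''v'' = px ! i" for s'
    define P2 where "P2 s' \<longleftrightarrow> I i s' \<and> nvar s' ''b'' = ?c" for s'
    define P3 where "P3 s' \<longleftrightarrow> I i s' \<and> narr s' ''pt'' ! i = m - ?c \<and> rvar s' ''v'' = py ! i" for s'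
    define P4 where "P4 s' \<longleftrightarrow> I i s' \<and> narr s' ''pt'' ! i = m - ?c \<and> nvar s' ''b'' = ?d" for s'
    have 1: "wp W Sp (RSet ''v'' (RGet ''px'' (NVar ''i''))) s2 (\<lambda>t s'. t \<le> 5 \<and> P1 s')"
      using s2' s2(2) v by (simp add: wps P1_def I_def)
    have 2: "wp W Sp (bsearch ''xs'') s3 (\<lambda>t s'. t \<le> 40 * L + 20 \<and> P2 s')" if P: "P1 s3" for s3
    proof -
      have I: "I i s3" and vv: "rvar s3 ''v'' = px ! i" using P by (auto simp: P1_def)
      have s3: "nvar s3 ''N'' = 2 ^ L" "nvar s3 ''m'' = m" "rarr s3 ''xs'' = xs" using I v by (auto simp: I_def)
      show ?thesis
      proof (rule wp_conseq[OF wp_bsearch[OF s3 v(5,8,9) cx(1)[of "px ! i"]]], goal_cases)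
        case (1 j)
        then show ?case unfolding vv by (rule cx(2))
      next
        case (2 t s')
        then show ?case using I vv frameD[OF 2(1)] by (simp add: P2_def I_def fun_eq_iff)
      qed
    qed
    have 3: "wp W Sp (Seq (NPut ''pt'' (NVar ''i'') (NSub (NVar ''m'') (NVar ''b''))) (RSet ''v'' (RGet ''py'' (NVar ''i'')))) s3
       (\<lambda>t s'. t \<le> 12 \<and> P3 s')" if P: "P2 s3" for s3
      using P s2(2) v cW by (auto simp: wps P2_def P3_def I_def)
    have 4: "wp W Sp (bsearch ''ys'') s3 (\<lambda>t s'. t \<le> 40 * L + 20 \<and> P4 s')" if P: "P3 s3" for s3
    proof -
      have I: "I i s3" and vv: "rvar s3 ''v'' = py ! i" and pt: "narr s3 ''pt'' ! i = m - ?c" using P by (auto simp: P3_def)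
      have s3: "nvar s3 ''N'' = 2 ^ L" "nvar s3 ''m'' = m" "rarr s3 ''ys'' = ys" using I v by (auto simp: I_def)
      show ?thesis
      proof (rule wp_conseq[OF wp_bsearch[OF s3 v(7,8,9) cy(1)[of "py ! i"]]], goal_cases)
        case (1 j)
        then show ?case unfolding vv by (rule cy(2))
      next
        case (2 t s')
        then show ?case using I vv pt frameD[OF 2(1)] by (simp add: P4_def I_def fun_eq_iff)
      qed
    qed
    have 5: "wp W Sp (Seq (NPut ''pr'' (NVar ''i'') (NAdd (NVar ''b'') (NLit 1))) (NSet ''i'' (NAdd (NVar ''i'') (NLit 1)))) s3
       (\<lambda>t s'. t \<le> 12 \<and> I (Suc i) s')" if P: "P4 s3" for s3
      using P s2(2) cW iW by (auto simp: wps P4_def I_def less_Suc_eq)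
    have "wp W Sp locate_step s2 (\<lambda>t s'. t \<le> 5 + ((40 * L + 20) + (12 + ((40 * L + 20) + 12))) \<and> I (Suc i) s')"
      using wp_seqI[OF 1 wp_seqI[OF 2 wp_seqI[OF 3 wp_seqI[OF 4 5]]]]
      unfolding locate_step_def by (simp only: wp_Seq_eq add.assoc cong del: wp_cong)
    then show ?thesis by (rule wp_conseq) auto
  qed
  have "I 0 (s\<lparr>nvar := (nvar s)(''i'' := 0)\<rparr>)" using v by (simp add: I_def)
  then have "wp W Sp (While (NLess (NVar ''i'') (NVar ''n'')) locate_step) (s\<lparr>nvar := (nvar s)(''i'' := 0)\<rparr>)
     (\<lambda>t s'. t \<le> n * (80 * L + 74) + 4 \<and> I n s')"
  proof (rule wp_conseq[OF wp_count[where I = I and N = n and T = "\<lambda>_. 80 * L + 70"]], goal_cases)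
    case (1 i s2)
    then show ?case using step[of i s2] by (simp add: I_def eval_simps)
  next
    case (2 s2)
    then show ?case by (simp add: I_def eval_simps)
  next
    case (3 t s')
    then show ?case by (simp add: algebra_simps)
  qed
  then have "wp W Sp locate s (\<lambda>t s'. t \<le> 2 + (n * (80 * L + 74) + 4) \<and> I n s')"
    unfolding locate_def by (simp add: wps) (erule wp_conseq, simp)
  then show ?thesis by (rule wp_conseq) (auto simp: I_def algebra_simps)
qed

section \<open>Bucketing and grid compression of the weighted points\<close>

text \<open>Serves both ways of storing points: a grid cell is hit repeatedly but always with its
  own rank, whereas a bucket slot has weight 0 until it receives its point.\<close>

lemma gain_add:
  assumes "e < length ew" "length er = length ew" "a \<le> e \<longrightarrow> e < b \<longrightarrow> ew ! e = 0 \<or> er ! e = r"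
  shows "gain (er[e := r]) (ew[e := ew ! e + w]) a b u = gain er ew a b u + (if a \<le> e \<and> e < b \<and> r \<le> u then w else 0)"
proof -
  have "gain (er[e := r]) (ew[e := ew ! e + w]) a b u =
     (\<Sum>x\<in>{a..<b}. (if er ! x \<le> u then ew ! x else 0) + (if x = e then if r \<le> u then w else 0 else 0))"
    unfolding gain_def
  proof (rule sum.cong[OF refl])
    fix x assume "x \<in> {a..<b}"
    then show "(if er[e := r] ! x \<le> u then ew[e := ew ! e + w] ! x else 0) =
      (if er ! x \<le> u then ew ! x else 0) + (if x = e then if r \<le> u then w else 0 else 0)"
      using assms by (cases "x = e") auto
  qed
  also have "\<dots> = gain er ew a b u + (if a \<le> e \<and> e < b \<and> r \<le> u then w else 0)"
    by (simp add: sum.distrib gain_def)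
  finally show ?thesis .
qed

definition arrived :: "nat list \<Rightarrow> nat list \<Rightarrow> real list \<Rightarrow> nat \<Rightarrow> nat \<Rightarrow> nat \<Rightarrow> real" where
  "arrived pt pr pw i t u = (\<Sum>x<i. if pt ! x = t \<and> pr ! x \<le> u then pw ! x else 0)"

lemma arrived_Suc: "arrived pt pr pw (Suc i) t u = arrived pt pr pw i t u + (if pt ! i = t \<and> pr ! i \<le> u then pw ! i else 0)"
  by (simp add: arrived_def)

text \<open>Cell \<open>t * h + r\<close> collects the points of time \<open>t\<close> and rank
  \<open>r\<close>. Ranks are below \<open>h = m + 2\<close>, so the remainder recovers the rank,
  and the cells of one time are contiguous as required for the sweeps.\<close>

definition grid :: com where
  "grid = Seq (NSet ''h'' (NAdd (NVar ''m'') (NLit 2)))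
    (Seq (NSet ''x'' (NMul (NVar ''h'') (NAdd (NVar ''m'') (NLit 1))))
    (Seq (NNew ''er'' (NVar ''x'')) (Seq (RNew ''ew'' (NVar ''x''))
    (Seq (NSet ''i'' (NLit 0))
    (Seq (While (NLess (NVar ''i'') (NVar ''h''))
       (Seq (NPut ''of'' (NVar ''i'') (NMul (NVar ''i'') (NVar ''h''))) (NSet ''i'' (NAdd (NVar ''i'') (NLit 1)))))
    (Seq (NSet ''i'' (NLit 0))
    (Seq (While (NLess (NVar ''i'') (NVar ''x''))
       (Seq (NPut ''er'' (NVar ''i'') (NMod (NVar ''i'') (NVar ''h''))) (NSet ''i'' (NAdd (NVar ''i'') (NLit 1)))))
    (Seq (NSet ''i'' (NLit 0))
    (While (NLess (NVar ''i'') (NVar ''n''))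
       (Seq (NSet ''e'' (NAdd (NMul (NGet ''pt'' (NVar ''i'')) (NVar ''h'')) (NGet ''pr'' (NVar ''i''))))
       (Seq (RPut ''ew'' (NVar ''e'') (RAdd (RGet ''ew'' (NVar ''e'')) (RGet ''pw'' (NVar ''i''))))
         (NSet ''i'' (NAdd (NVar ''i'') (NLit 1))))))))))))))"

lemma grid_mods [simp]:
  "nvars grid = {''h'', ''x'', ''i'', ''e''}" "rvars grid = {}" "narrs grid = {''er'', ''of''}" "rarrs grid = {''ew''}"
  by (auto simp: grid_def)

lemma wp_grid:
  assumes v: "nvar s ''m'' = m" "nvar s ''n'' = n" "narr s ''pt'' = pt" "narr s ''pr'' = pr" "rarr s ''pw'' = pw"
    "length pt = n" "length pr = n" "length pw = n" "length (narr s ''of'') = m + 2"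
    and p: "\<And>i. i < n \<Longrightarrow> pt ! i \<le> m" "\<And>i. i < n \<Longrightarrow> pr ! i \<le> Suc m"
    and W: "(m + 2) * (m + 2) < W" "n < W" and Sp: "space s + 2 * ((m + 2) * (m + 1)) \<le> Sp"
  shows "wp W Sp grid s (\<lambda>t s'. t \<le> 20 * ((m + 2) * (m + 2)) + 30 * n + 60 \<and> space s' \<le> space s + 2 * ((m + 2) * (m + 1)) \<and>
     length (narr s' ''er'') = (m + 2) * (m + 1) \<and> length (rarr s' ''ew'') = (m + 2) * (m + 1) \<and>
     (\<forall>e<(m + 2) * (m + 1). narr s' ''er'' ! e \<le> Suc m) \<and> length (narr s' ''of'') = m + 2 \<and>
     (\<forall>t\<le>Suc m. narr s' ''of'' ! t = t * (m + 2)) \<and>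
     (\<forall>t\<le>m. \<forall>u. gain (narr s' ''er'') (rarr s' ''ew'') (narr s' ''of'' ! t) (narr s' ''of'' ! Suc t) u = arrived pt pr pw n t u))"
proof -
  define h where "h = m + 2"
  define E where "E = h * (m + 1)"
  have hE: "(m + 2) * (m + 1) = E" "(m + 2) * (m + 2) = E + h" by (auto simp: E_def h_def)
  have EW: "E < W" "h < W" "E + h < W" using W(1) unfolding hE by auto
  have hm: "h = Suc (Suc m)" by (simp add: h_def)
  have [simp]: "Suc 0 < W" "0 < W" "2 < W" "Suc m < W" "m < W" "Suc (Suc m) < W" "0 < h" "h < W" "E < W" using EW hm mult_le_mono[of 2 "m + 2" 2 "m + 2"] W by auto
  have pos: "t * h + r < E" if "t \<le> m" "r \<le> Suc m" for t r
  proof -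
    have "t * h \<le> m * h" using that by simp
    moreover have "E = m * h + h" by (simp add: E_def algebra_simps)
    ultimately show ?thesis using that hm by linarith
  qed
  define B where "B i s' \<longleftrightarrow> space s' \<le> space s + 2 * E \<and> nvar s' ''i'' = i \<and> nvar s' ''m'' = m \<and> nvar s' ''n'' = n \<and> nvar s' ''h'' = h \<and> nvar s' ''x'' = E \<and>
     narr s' ''pt'' = pt \<and> narr s' ''pr'' = pr \<and> rarr s' ''pw'' = pw \<and>
     length (narr s' ''er'') = E \<and> length (narr s' ''of'') = h" for i and s' :: state
  define I where "I i s' \<longleftrightarrow> B i s' \<and> rarr s' ''ew'' = replicate E 0 \<and> (\<forall>t<i. narr s' ''of'' ! t = t * h)" for i and s' :: state
  define J where "J i s' \<longleftrightarrow> B i s' \<and> rarr s' ''ew'' = replicate E 0 \<and> (\<forall>t\<le>Suc m. narr s' ''of'' ! t = t * h) \<and>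
     (\<forall>e<i. narr s' ''er'' ! e = e mod h)" for i and s' :: state
  define K where "K i s' \<longleftrightarrow> B i s' \<and> length (rarr s' ''ew'') = E \<and> (\<forall>t\<le>Suc m. narr s' ''of'' ! t = t * h) \<and>
     (\<forall>e<E. narr s' ''er'' ! e = e mod h) \<and>
     (\<forall>t\<le>m. \<forall>u. gain (narr s' ''er'') (rarr s' ''ew'') (t * h) (t * h + h) u = arrived pt pr pw i t u)" for i and s' :: state
  have space: "space (s'\<lparr>narr := (narr s')(a := (narr s' a)[j := x])\<rparr>) = space s'"
     "space (s'\<lparr>rarr := (rarr s')(a := (rarr s' a)[j := y])\<rparr>) = space s'"
     "space (nvar_update f s') = space s'" "space (narr_update g (nvar_update f s')) = space (narr_update g s')"
     "space (rarr_update h (nvar_update f s')) = space (rarr_update h s')"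
     "space (rarr_update h (narr_update g (nvar_update f s'))) = space (rarr_update h (narr_update g s'))" for s' a j x y f g h
    by (rule space_lens, simp add: lens_def)+
  have 1: "wp W Sp (Seq (NSet ''h'' (NAdd (NVar ''m'') (NLit 2)))
    (Seq (NSet ''x'' (NMul (NVar ''h'') (NAdd (NVar ''m'') (NLit 1))))
    (Seq (NNew ''er'' (NVar ''x'')) (Seq (RNew ''ew'' (NVar ''x''))
     (NSet ''i'' (NLit 0)))))) s (\<lambda>t s'. t \<le> 30 + 2 * E \<and> I 0 s')"
  proof -
    define s1 where "s1 = s\<lparr>nvar := (nvar s)(''h'' := h, ''x'' := E)\<rparr>"
    define s2 where "s2 = s1\<lparr>narr := (narr s1)(''er'' := replicate E 0)\<rparr>"
    define s3 where "s3 = s2\<lparr>rarr := (rarr s2)(''ew'' := replicate E 0)\<rparr>"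
    have s1: "space s1 = space s" by (simp add: s1_def space)
    have sp: "space s2 \<le> space s + E" "space s3 \<le> space s + 2 * E"
      using space_NNew[of s1 "''er''" E 0] space_RNew[of s2 "''ew''" E 0] s1 unfolding s2_def s3_def by auto
    have st: "s2 = s\<lparr>nvar := (nvar s)(''h'' := h, ''x'' := E), narr := (narr s)(''er'' := replicate E 0)\<rparr>"
      "s3 = s\<lparr>nvar := (nvar s)(''h'' := h, ''x'' := E), narr := (narr s)(''er'' := replicate E 0), rarr := (rarr s)(''ew'' := replicate E 0)\<rparr>"
      by (auto simp: s1_def s2_def s3_def)
    have "I 0 (s3\<lparr>nvar := (nvar s3)(''i'' := 0)\<rparr>)"
      using v sp hm by (auto simp: I_def B_def st space lens_def)
    moreover have "h * Suc m = E" by (simp add: E_def)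
    ultimately show ?thesis using v sp[unfolded st] Sp[unfolded hE] hm
      by (simp add: wps st)
  qed
  have 2: "wp W Sp (While (NLess (NVar ''i'') (NVar ''h''))
       (Seq (NPut ''of'' (NVar ''i'') (NMul (NVar ''i'') (NVar ''h''))) (NSet ''i'' (NAdd (NVar ''i'') (NLit 1))))) s1
     (\<lambda>t s'. t \<le> h * 14 + 4 \<and> I h s')" if "I 0 s1" for s1
  proof (rule wp_conseq[OF wp_count[where I = I and N = h and T = "\<lambda>_. 10", OF that]], goal_cases)
    case (1 i s2)
    have "i * h \<le> (m + 1) * h" using 1(2) hm by (intro mult_le_mono1) simp
    then have w: "i * h < W" "i < W" "Suc i < W" using EW 1(2) hm unfolding E_def by auto
    have sp: "space (s2\<lparr>nvar := (nvar s2)(''i'' := Suc i), narr := (narr s2)(''of'' := (narr s2 ''of'')[i := i * h])\<rparr>) = space s2"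
      by (rule space_lens) (simp add: lens_def)
    show ?case using 1 w sp by (auto simp: wps I_def B_def less_Suc_eq nth_list_update lens_def)
  next
    case (2 s2)
    then show ?case by (simp add: I_def B_def eval_simps)
  qed simp
  have 3: "wp W Sp (NSet ''i'' (NLit 0)) s1 (\<lambda>t s'. t \<le> 2 \<and> J 0 s')" if "I h s1" for s1
    using that hm by (auto simp: wps I_def J_def B_def space lens_def)
  have 4: "wp W Sp (While (NLess (NVar ''i'') (NVar ''x''))
       (Seq (NPut ''er'' (NVar ''i'') (NMod (NVar ''i'') (NVar ''h''))) (NSet ''i'' (NAdd (NVar ''i'') (NLit 1))))) s1
     (\<lambda>t s'. t \<le> E * 14 + 4 \<and> J E s')" if "J 0 s1" for s1
  proof (rule wp_conseq[OF wp_count[where I = J and N = E and T = "\<lambda>_. 10", OF that]], goal_cases)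
    case (1 i s2)
    have "i mod h < h" by simp
    then have w: "i mod h < W" "i < W" "Suc i < W" using EW 1(2) by linarith+
    have sp: "space (s2\<lparr>nvar := (nvar s2)(''i'' := Suc i), narr := (narr s2)(''er'' := (narr s2 ''er'')[i := i mod h])\<rparr>) = space s2"
      by (rule space_lens) (simp add: lens_def)
    show ?case using 1 w sp by (auto simp: wps J_def B_def less_Suc_eq nth_list_update lens_def)
  next
    case (2 s2)
    then show ?case by (simp add: J_def B_def eval_simps)
  qed simp
  have 5: "wp W Sp (NSet ''i'' (NLit 0)) s1 (\<lambda>t s'. t \<le> 2 \<and> K 0 s')" if J: "J E s1" for s1
  proof -
    have "gain er (replicate E 0) (t * h) (t * h + h) u = 0" if "t \<le> m" for er t u
      unfolding gain_def
    proof (rule sum.neutral, rule ballI)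
      fix x assume "x \<in> {t * h..<t * h + h}"
      then have "x < E" using pos[OF that, of "x - t * h"] hm by auto
      then show "(if er ! x \<le> u then replicate E 0 ! x else 0) = (0::real)" by simp
    qed
    then show ?thesis using J by (auto simp: wps J_def K_def B_def space lens_def arrived_def)
  qed
  have 6: "wp W Sp (While (NLess (NVar ''i'') (NVar ''n''))
       (Seq (NSet ''e'' (NAdd (NMul (NGet ''pt'' (NVar ''i'')) (NVar ''h'')) (NGet ''pr'' (NVar ''i''))))
       (Seq (RPut ''ew'' (NVar ''e'') (RAdd (RGet ''ew'' (NVar ''e'')) (RGet ''pw'' (NVar ''i''))))
         (NSet ''i'' (NAdd (NVar ''i'') (NLit 1)))))) s1
     (\<lambda>t s'. t \<le> n * 28 + 4 \<and> K n s')" if "K 0 s1" for s1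
  proof (rule wp_conseq[OF wp_count[where I = K and N = n and T = "\<lambda>_. 24", OF that]], goal_cases)
    case (1 i s2)
    define e where "e = pt ! i * h + pr ! i"
    define ew where "ew = rarr s2 ''ew''"
    define er where "er = narr s2 ''er''"
    have eE: "e < E" unfolding e_def by (rule pos) (use p 1(2) in auto)
    have lens: "length ew = E" "length er = E" using 1(1) by (auto simp: K_def B_def ew_def er_def)
    have prh: "pr ! i < h" using p(2)[OF 1(2)] hm by simp
    have ere: "er ! e = pr ! i" using 1(1) eE prh by (simp add: K_def er_def e_def)
    have w: "e < W" "i < W" "Suc i < W" "pt ! i * h < W" using eE EW 1(2) W(2) by (auto simp: e_def)
    have g: "gain er (ew[e := ew ! e + pw ! i]) (t * h) (t * h + h) u = arrived pt pr pw (Suc i) t u" if "t \<le> m" for t u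
    proof -
      have "t * h \<le> e \<and> e < t * h + h \<longleftrightarrow> pt ! i = t"
      proof
        assume "t * h \<le> e \<and> e < t * h + h"
        then have "e div h = t" by (intro div_nat_eqI) (auto simp: ac_simps)
        then show "pt ! i = t" using prh by (simp add: e_def)
      qed (use prh in \<open>auto simp: e_def\<close>)
      moreover have "er[e := pr ! i] = er" using ere by (metis list_update_id)
      ultimately show ?thesis using gain_add[of e ew er "t * h" "t * h + h" "pr ! i" "pw ! i" u] 1(1) that lens eE ere
        by (auto simp: K_def arrived_Suc er_def ew_def)
    qed
    have sp: "space (s2\<lparr>nvar := (nvar s2)(''e'' := e, ''i'' := Suc i), rarr := (rarr s2)(''ew'' := ew[e := ew ! e + pw ! i])\<rparr>) = space s2"
      by (rule space_lens) (auto simp: lens_def ew_def)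
    have fr: "narr s2 ''pt'' = pt" "narr s2 ''pr'' = pr" "rarr s2 ''pw'' = pw" "nvar s2 ''h'' = h" "nvar s2 ''i'' = i" "nvar s2 ''n'' = n"
      using 1(1) by (auto simp: K_def B_def)
    have "K (Suc i) (s2\<lparr>nvar := (nvar s2)(''e'' := e, ''i'' := Suc i), rarr := (rarr s2)(''ew'' := ew[e := ew ! e + pw ! i])\<rparr>)"
      using 1(1) g sp lens unfolding K_def B_def by (auto simp: lens_def er_def[symmetric])
    then show ?case using fr w v 1(2) eE lens p
      by (simp add: wps flip: e_def ew_def er_def)
  next
    case (2 s2)
    then show ?case by (simp add: K_def B_def eval_simps)
  qed simp
  have "wp W Sp grid s (\<lambda>t s'. t \<le> (30 + 2 * E) + ((h * 14 + 4) + (2 + ((E * 14 + 4) + (2 + (n * 28 + 4))))) \<and> K n s')"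
    using wp_seqI[OF 1 wp_seqI[OF 2 wp_seqI[OF 3 wp_seqI[OF 4 wp_seqI[OF 5 6]]]]]
    unfolding grid_def by (simp only: wp_Seq_eq add.assoc cong del: wp_cong)
  then show ?thesis
  proof (rule wp_conseq, goal_cases)
    case (1 t s')
    have "e mod h \<le> Suc m" for e using mod_less_divisor[of h e] hm by simp
    then show ?case using 1(2) hm unfolding hE K_def B_def by (auto simp: algebra_simps)
  qed
qed

text \<open>Counting sort by arrival time. Counts are stored one position ahead, so that summing in
  place turns \<open>of\<close> into the starting slots; \<open>fi\<close> holds the next free slot
  of each time.\<close>

definition bucket :: com where
  "bucket = Seq (NNew ''er'' (NVar ''n'')) (Seq (RNew ''ew'' (NVar ''n'')) (Seq (NNew ''fi'' (NAdd (NVar ''m'') (NLit 2)))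
    (Seq (NSet ''i'' (NLit 0))
    (Seq (While (NLess (NVar ''i'') (NVar ''n''))
       (Seq (NSet ''e'' (NAdd (NGet ''pt'' (NVar ''i'')) (NLit 1)))
       (Seq (NPut ''of'' (NVar ''e'') (NAdd (NGet ''of'' (NVar ''e'')) (NLit 1))) (NSet ''i'' (NAdd (NVar ''i'') (NLit 1))))))
    (Seq (NSet ''i'' (NLit 0))
    (Seq (While (NLess (NVar ''i'') (NAdd (NVar ''m'') (NLit 1)))
       (Seq (NSet ''e'' (NGet ''of'' (NVar ''i'')))
       (Seq (NPut ''fi'' (NVar ''i'') (NVar ''e''))
       (Seq (NSet ''i'' (NAdd (NVar ''i'') (NLit 1)))
         (NPut ''of'' (NVar ''i'') (NAdd (NVar ''e'') (NGet ''of'' (NVar ''i''))))))))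
    (Seq (NSet ''i'' (NLit 0))
    (While (NLess (NVar ''i'') (NVar ''n''))
       (Seq (NSet ''h'' (NGet ''pt'' (NVar ''i'')))
       (Seq (NSet ''e'' (NGet ''fi'' (NVar ''h'')))
       (Seq (NPut ''er'' (NVar ''e'') (NGet ''pr'' (NVar ''i'')))
       (Seq (RPut ''ew'' (NVar ''e'') (RAdd (RGet ''ew'' (NVar ''e'')) (RGet ''pw'' (NVar ''i''))))
       (Seq (NPut ''fi'' (NVar ''h'') (NAdd (NVar ''e'') (NLit 1)))
         (NSet ''i'' (NAdd (NVar ''i'') (NLit 1))))))))))))))))"

lemma bucket_mods [simp]:
  "nvars bucket = {''h'', ''i'', ''e''}" "rvars bucket = {}" "narrs bucket = {''er'', ''of'', ''fi''}" "rarrs bucket = {''ew''}"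
  by (auto simp: bucket_def)

definition cnt :: "nat list \<Rightarrow> nat \<Rightarrow> nat \<Rightarrow> nat" where
  "cnt pt i t = (\<Sum>x<i. if pt ! x = t then 1 else 0)"

lemma cnt_Suc: "cnt pt (Suc i) t = cnt pt i t + (if pt ! i = t then 1 else 0)"
  by (simp add: cnt_def)

lemma cnt_le: "cnt pt i t \<le> i"
  by (induction i) (simp_all add: cnt_Suc, simp add: cnt_def)

lemma cnt_mono: "i \<le> j \<Longrightarrow> cnt pt i t \<le> cnt pt j t"
  unfolding cnt_def by (rule sum_mono2) auto

definition offs :: "nat list \<Rightarrow> nat \<Rightarrow> nat \<Rightarrow> nat" where
  "offs pt n t = (\<Sum>x<t. cnt pt n x)"

lemma offs_Suc: "offs pt n (Suc t) = offs pt n t + cnt pt n t"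
  by (simp add: offs_def)

lemma offs_mono: "t \<le> t' \<Longrightarrow> offs pt n t \<le> offs pt n t'"
  unfolding offs_def by (rule sum_mono2) auto

text \<open>Double counting: each point arrives at exactly one of the times 0 to
  \<open>m\<close>.\<close>

lemma offs_total:
  assumes "\<And>i. i < n \<Longrightarrow> pt ! i \<le> m"
  shows "offs pt n (Suc m) = n"
proof -
  have "offs pt n (Suc m) = (\<Sum>x<n. \<Sum>t<Suc m. if pt ! x = t then 1 else 0)"
    unfolding offs_def cnt_def by (rule sum.swap)
  also have "\<dots> = (\<Sum>x<n. 1)" using assms by (intro sum.cong) (auto simp: less_Suc_eq_le simp del: sum.lessThan_Suc)
  finally show ?thesis by simp
qed

lemma wp_bucket:
  assumes v: "nvar s ''m'' = m" "nvar s ''n'' = n" "narr s ''pt'' = pt" "narr s ''pr'' = pr" "rarr s ''pw'' = pw"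
    "length pt = n" "length pr = n" "length pw = n" "narr s ''of'' = replicate (m + 2) 0"
    and p: "\<And>i. i < n \<Longrightarrow> pt ! i \<le> m" "\<And>i. i < n \<Longrightarrow> pr ! i \<le> Suc m"
    and W: "m + 2 < W" "n + 1 < W" and Sp: "space s + 2 * n + m + 2 \<le> Sp"
  shows "wp W Sp bucket s (\<lambda>t s'. t \<le> 70 * n + 50 * m + 100 \<and> space s' \<le> space s + 2 * n + m + 2 \<and>
     length (narr s' ''er'') = n \<and> length (rarr s' ''ew'') = n \<and>
     (\<forall>e<n. narr s' ''er'' ! e \<le> Suc m) \<and> length (narr s' ''of'') = m + 2 \<and>
     (\<forall>t\<le>Suc m. narr s' ''of'' ! t = offs pt n t) \<and>
     (\<forall>t\<le>m. \<forall>u. gain (narr s' ''er'') (rarr s' ''ew'') (narr s' ''of'' ! t) (narr s' ''of'' ! Suc t) u = arrived pt pr pw n t u))"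
proof -
  have [simp]: "Suc 0 < W" "0 < W" "2 < W" "Suc m < W" "m < W" "Suc (Suc m) < W" "n < W" using W by linarith+
  have ocn: "offs pt n t \<le> n" if "t \<le> Suc m" for t
    using offs_mono[OF that, of pt n] offs_total[of n pt m] p(1) by simp
  define B where "B i s' \<longleftrightarrow> space s' \<le> space s + 2 * n + m + 2 \<and> nvar s' ''i'' = i \<and> nvar s' ''m'' = m \<and> nvar s' ''n'' = n \<and>
     narr s' ''pt'' = pt \<and> narr s' ''pr'' = pr \<and> rarr s' ''pw'' = pw \<and>
     length (narr s' ''er'') = n \<and> length (rarr s' ''ew'') = n \<and> length (narr s' ''of'') = m + 2 \<and> length (narr s' ''fi'') = m + 2" for i and s' :: state
  define Z where "Z s' \<longleftrightarrow> narr s' ''er'' = replicate n 0 \<and> rarr s' ''ew'' = replicate n 0" for s' :: state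
  define I where "I i s' \<longleftrightarrow> B i s' \<and> Z s' \<and> narr s' ''of'' ! 0 = 0 \<and> (\<forall>t\<le>m. narr s' ''of'' ! Suc t = cnt pt i t)" for i and s' :: state
  \<comment> \<open>Up to position \<open>i\<close> the array \<open>of\<close> holds starting
    slots, beyond it still the count of the preceding time.\<close>
  define J where "J i s' \<longleftrightarrow> B i s' \<and> Z s' \<and> (\<forall>t\<le>i. narr s' ''of'' ! t = offs pt n t) \<and>
     (\<forall>t\<ge>i. t \<le> m \<longrightarrow> narr s' ''of'' ! Suc t = cnt pt n t) \<and> (\<forall>t<i. narr s' ''fi'' ! t = offs pt n t)" for i and s' :: state
  define K where "K i s' \<longleftrightarrow> B i s' \<and> (\<forall>t\<le>Suc m. narr s' ''of'' ! t = offs pt n t) \<and>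
     (\<forall>t\<le>m. narr s' ''fi'' ! t = offs pt n t + cnt pt i t) \<and> (\<forall>e<n. narr s' ''er'' ! e \<le> Suc m) \<and>
     (\<forall>t\<le>m. \<forall>e. narr s' ''fi'' ! t \<le> e \<longrightarrow> e < offs pt n (Suc t) \<longrightarrow> rarr s' ''ew'' ! e = 0) \<and>
     (\<forall>t\<le>m. \<forall>u. gain (narr s' ''er'') (rarr s' ''ew'') (offs pt n t) (offs pt n (Suc t)) u = arrived pt pr pw i t u)" for i and s' :: state
  have 1: "wp W Sp (Seq (NNew ''er'' (NVar ''n'')) (Seq (RNew ''ew'' (NVar ''n'')) (Seq (NNew ''fi'' (NAdd (NVar ''m'') (NLit 2)))
      (NSet ''i'' (NLit 0))))) s (\<lambda>t s'. t \<le> 30 + 2 * n + m \<and> I 0 s')"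
  proof -
    define s1 where "s1 = s\<lparr>narr := (narr s)(''er'' := replicate n 0)\<rparr>"
    define s2 where "s2 = s1\<lparr>rarr := (rarr s1)(''ew'' := replicate n 0)\<rparr>"
    define s3 where "s3 = s2\<lparr>narr := (narr s2)(''fi'' := replicate (Suc (Suc m)) 0)\<rparr>"
    have sp: "space s1 \<le> space s + n" "space s2 \<le> space s + 2 * n" "space s3 \<le> space s + 2 * n + m + 2"
      using space_NNew[of s "''er''" n 0] space_RNew[of s1 "''ew''" n 0] space_NNew[of s2 "''fi''" "Suc (Suc m)" 0]
      unfolding s1_def[symmetric] s2_def[symmetric] s3_def[symmetric] by auto
    have of0: "replicate (m + 2) 0 ! t = (0::nat)" if "t \<le> Suc m" for t using that by (simp del: replicate.simps)
    have sp4: "space (s3\<lparr>nvar := (nvar s3)(''i'' := 0)\<rparr>) = space s3" by (rule space_lens) simp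
    have I0: "I 0 (s3\<lparr>nvar := (nvar s3)(''i'' := 0)\<rparr>)"
      unfolding I_def B_def Z_def sp4 using v sp(3) of0[of 0] of0[of "Suc _"]
      by (simp add: s1_def s2_def s3_def cnt_def del: replicate.simps)
    have nm: "nvar s1 ''n'' = n" "nvar s2 ''m'' = m" using v by (auto simp: s1_def s2_def)
    have a: "wp W Sp (NNew ''er'' (NVar ''n'')) s (\<lambda>t s'. t \<le> 2 + n \<and> s' = s1)"
      using v sp(1) Sp unfolding wp_NNew_eq by (simp add: s1_def)
    have b: "wp W Sp (RNew ''ew'' (NVar ''n'')) s' (\<lambda>t s'. t \<le> 2 + n \<and> s' = s2)" if "s' = s1" for s'
      using nm sp(2) Sp unfolding wp_RNew_eq that s2_def[symmetric] by (simp add: s2_def)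
    have c: "wp W Sp (NNew ''fi'' (NAdd (NVar ''m'') (NLit 2))) s' (\<lambda>t s'. t \<le> 6 + m \<and> s' = s3)" if "s' = s2" for s'
    proof -
      have "neval W s2 (NAdd (NVar ''m'') (NLit 2)) = Some (Suc (Suc m))" using nm W by (simp add: eval_simps)
      then show ?thesis using sp(3) Sp unfolding wp_NNew_eq that by (simp add: s3_def del: neval.simps)
    qed
    have d: "wp W Sp (NSet ''i'' (NLit 0)) s' (\<lambda>t s'. t \<le> 2 \<and> I 0 s')" if "s' = s3" for s'
      using I0 unfolding that by (simp add: wps)
    show ?thesis by (rule wp_conseq[OF wp_seqI[OF a wp_seqI[OF b wp_seqI[OF c d]]]]) auto
  qed
  have 2: "wp W Sp (While (NLess (NVar ''i'') (NVar ''n''))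
       (Seq (NSet ''e'' (NAdd (NGet ''pt'' (NVar ''i'')) (NLit 1)))
       (Seq (NPut ''of'' (NVar ''e'') (NAdd (NGet ''of'' (NVar ''e'')) (NLit 1))) (NSet ''i'' (NAdd (NVar ''i'') (NLit 1)))))) s1
     (\<lambda>t s'. t \<le> n * 24 + 4 \<and> I n s')" if "I 0 s1" for s1
  proof (rule wp_conseq[OF wp_count[where I = I and N = n and T = "\<lambda>_. 20", OF that]], goal_cases)
    case (1 i s2)
    define r where "r = pt ! i"
    have rm: "r \<le> m" using p(1)[OF 1(2)] by (simp add: r_def)
    have c: "cnt pt i r \<le> n" using cnt_le[of pt i r] 1(2) by simp
    have w: "i < W" "Suc i < W" "Suc r < W" "Suc (cnt pt i r) < W" "Suc r < Suc (Suc m)" "r < W" using 1(2) rm c W by linarith+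
    have ri: "pt ! i = r" by (simp add: r_def)
    have f: "narr s2 ''of'' ! Suc r = cnt pt i r" "narr s2 ''pt'' = pt" "nvar s2 ''i'' = i" "nvar s2 ''n'' = n" "length (narr s2 ''of'') = Suc (Suc m)"
      using 1(1) rm by (auto simp: I_def B_def)
    let ?s = "s2\<lparr>nvar := (nvar s2)(''e'' := Suc r, ''i'' := Suc i), narr := (narr s2)(''of'' := (narr s2 ''of'')[Suc r := Suc (cnt pt i r)])\<rparr>"
    have sp: "space ?s = space s2" by (rule space_lens) (simp add: lens_def)
    have "I (Suc i) ?s" using 1(1) rm f ri unfolding I_def B_def Z_def sp by (auto simp: cnt_Suc nth_list_update)
    then show ?case using f w ri v(6) 1(2) by (simp add: wps)
  next
    case (2 s2)
    then show ?case by (simp add: I_def B_def eval_simps)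
  qed simp
  have 3: "wp W Sp (NSet ''i'' (NLit 0)) s1 (\<lambda>t s'. t \<le> 2 \<and> J 0 s')" if I: "I n s1" for s1
  proof -
    have "space (s1\<lparr>nvar := (nvar s1)(''i'' := 0)\<rparr>) = space s1" by (rule space_lens) simp
    then show ?thesis using I by (simp add: wps I_def J_def B_def Z_def offs_def)
  qed
  have 4: "wp W Sp (While (NLess (NVar ''i'') (NAdd (NVar ''m'') (NLit 1)))
       (Seq (NSet ''e'' (NGet ''of'' (NVar ''i'')))
       (Seq (NPut ''fi'' (NVar ''i'') (NVar ''e''))
       (Seq (NSet ''i'' (NAdd (NVar ''i'') (NLit 1)))
         (NPut ''of'' (NVar ''i'') (NAdd (NVar ''e'') (NGet ''of'' (NVar ''i'')))))))) s1
     (\<lambda>t s'. t \<le> (m + 1) * 26 + 6 \<and> J (Suc m) s')" if "J 0 s1" for s1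
  proof (rule wp_conseq[OF wp_count[where I = J and N = "Suc m" and T = "\<lambda>_. 20", OF that]], goal_cases)
    case (1 i s2)
    have im: "i \<le> m" using 1(2) by simp
    have f: "narr s2 ''of'' ! i = offs pt n i" "narr s2 ''of'' ! Suc i = cnt pt n i" "nvar s2 ''i'' = i" "nvar s2 ''m'' = m"
        "length (narr s2 ''of'') = Suc (Suc m)" "length (narr s2 ''fi'') = Suc (Suc m)"
      using 1(1) im by (auto simp: J_def B_def)
    have w: "i < W" "Suc i < W" "offs pt n i < W" "offs pt n i + cnt pt n i < W"
      using im W ocn[of i] ocn[of "Suc i"] unfolding offs_Suc by linarith+
    let ?s = "s2\<lparr>nvar := (nvar s2)(''e'' := offs pt n i, ''i'' := Suc i),
      narr := (narr s2)(''fi'' := (narr s2 ''fi'')[i := offs pt n i], ''of'' := (narr s2 ''of'')[Suc i := offs pt n i + cnt pt n i])\<rparr>"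
    have sp: "space ?s = space s2" by (rule space_lens) (simp add: lens_def)
    have l: "Suc i < length (narr s2 ''of'')" "i < length (narr s2 ''fi'')" using f im by auto
    note inv = 1(1)[unfolded J_def B_def Z_def]
    have a: "(narr s2 ''of'')[Suc i := offs pt n i + cnt pt n i] ! t = offs pt n t" if "t \<le> Suc i" for t
      using inv l that by (cases "t = Suc i") (auto simp: offs_Suc)
    have b: "(narr s2 ''of'')[Suc i := offs pt n i + cnt pt n i] ! Suc t = cnt pt n t" if "Suc i \<le> t" "t \<le> m" for t
      using inv that by auto
    have c: "(narr s2 ''fi'')[i := offs pt n i] ! t = offs pt n t" if "t < Suc i" for t
      using inv l that by (cases "t = i") auto
    have "J (Suc i) ?s" unfolding J_def B_def Z_def sp using inv a b c by simp
    then show ?case using f w im by (simp add: wps)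
  next
    case (2 s2)
    then show ?case by (simp add: J_def B_def eval_simps)
  qed simp
  have 5: "wp W Sp (NSet ''i'' (NLit 0)) s1 (\<lambda>t s'. t \<le> 2 \<and> K 0 s')" if J: "J (Suc m) s1" for s1
  proof -
    have sp: "space (s1\<lparr>nvar := (nvar s1)(''i'' := 0)\<rparr>) = space s1" by (rule space_lens) simp
    have lt: "e < n" if "e < offs pt n (Suc t)" "t \<le> m" for e t using ocn[of "Suc t"] that by simp
    have "gain (replicate n 0) (replicate n 0) (offs pt n t) (offs pt n (Suc t)) u = 0" if "t \<le> m" for t u
      unfolding gain_def using lt that by (intro sum.neutral) auto
    then show ?thesis using J sp lt by (auto simp: wps J_def K_def B_def Z_def arrived_def cnt_def)
  qed
  have 6: "wp W Sp (While (NLess (NVar ''i'') (NVar ''n''))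
       (Seq (NSet ''h'' (NGet ''pt'' (NVar ''i'')))
       (Seq (NSet ''e'' (NGet ''fi'' (NVar ''h'')))
       (Seq (NPut ''er'' (NVar ''e'') (NGet ''pr'' (NVar ''i'')))
       (Seq (RPut ''ew'' (NVar ''e'') (RAdd (RGet ''ew'' (NVar ''e'')) (RGet ''pw'' (NVar ''i''))))
       (Seq (NPut ''fi'' (NVar ''h'') (NAdd (NVar ''e'') (NLit 1)))
         (NSet ''i'' (NAdd (NVar ''i'') (NLit 1))))))))) s1
     (\<lambda>t s'. t \<le> n * 38 + 4 \<and> K n s')" if "K 0 s1" for s1
  proof (rule wp_conseq[OF wp_count[where I = K and N = n and T = "\<lambda>_. 34", OF that]], goal_cases)
    case (1 i s2)
    define r where "r = pt ! i"
    define e where "e = offs pt n r + cnt pt i r"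
    define ew where "ew = rarr s2 ''ew''"
    define er where "er = narr s2 ''er''"
    define fi where "fi = narr s2 ''fi''"
    have rm: "r \<le> m" using p(1)[OF 1(2)] by (simp add: r_def)
    note inv = 1(1)[unfolded K_def B_def, folded ew_def er_def fi_def]
    have fir: "fi ! r = e" using inv rm by (simp add: e_def)
    have "cnt pt (Suc i) r \<le> cnt pt n r" by (rule cnt_mono) (use 1(2) in simp)
    then have eo: "e < offs pt n (Suc r)" by (simp add: e_def offs_Suc cnt_Suc r_def)
    have en: "e < n" using eo ocn[of "Suc r"] rm by simp
    have e0: "ew ! e = 0" using inv rm eo fir by auto
    have lens: "length ew = n" "length er = n" "length fi = Suc (Suc m)" using inv by auto
    \<comment> \<open>The slot ranges of different times are disjoint, so filling slot
      \<open>e\<close> concerns time \<open>r\<close> alone.\<close>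
    have iv: "offs pt n t \<le> e \<and> e < offs pt n (Suc t) \<longleftrightarrow> r = t" for t
    proof
      assume a: "offs pt n t \<le> e \<and> e < offs pt n (Suc t)"
      show "r = t"
      proof (rule ccontr)
        assume "r \<noteq> t"
        then consider "Suc r \<le> t" | "Suc t \<le> r" by linarith
        then show False
        proof cases
          case 1
          then show False using offs_mono[OF 1, of pt n] eo a by simp
        next
          case 2
          have "offs pt n r \<le> e" by (simp add: e_def)
          then show False using offs_mono[OF 2, of pt n] a by simp
        qed
      qed
    qed (use eo in \<open>auto simp: e_def\<close>)
    have g: "gain (er[e := pr ! i]) (ew[e := ew ! e + pw ! i]) (offs pt n t) (offs pt n (Suc t)) u = arrived pt pr pw (Suc i) t u" if "t \<le> m" for t u
      using gain_add[of e ew er "offs pt n t" "offs pt n (Suc t)" "pr ! i" "pw ! i" u] iv[of t] inv that lens en e0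
      by (auto simp: arrived_Suc r_def)
    have z: "ew[e := ew ! e + pw ! i] ! e' = 0" if "t \<le> m" "fi[r := Suc e] ! t \<le> e'" "e' < offs pt n (Suc t)" for t e'
    proof (cases "t = r")
      case True
      then have "e < e'" using that lens rm by simp
      then show ?thesis using inv rm that True fir by auto
    next
      case False
      then have fe: "fi ! t \<le> e'" using that by simp
      then have "offs pt n t \<le> e'" using inv that by auto
      then have "e' \<noteq> e" using iv[of t] that False by auto
      then show ?thesis using inv that fe by auto
    qed
    have f: "narr s2 ''pt'' = pt" "narr s2 ''pr'' = pr" "rarr s2 ''pw'' = pw" "nvar s2 ''i'' = i" "nvar s2 ''n'' = n" using inv by auto
    have w: "i < W" "Suc i < W" "r < W" "e < W" "Suc e < W" "r < Suc (Suc m)" using 1(2) rm en W by linarith+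
    have ri: "pt ! i = r" by (simp add: r_def)
    let ?s = "s2\<lparr>nvar := (nvar s2)(''h'' := r, ''e'' := e, ''i'' := Suc i),
      narr := (narr s2)(''er'' := er[e := pr ! i], ''fi'' := fi[r := Suc e]), rarr := (rarr s2)(''ew'' := ew[e := ew ! e + pw ! i])\<rparr>"
    have sp: "space ?s = space s2" by (rule space_lens) (auto simp: lens_def er_def fi_def ew_def)
    have fi': "fi[r := Suc e] ! t = offs pt n t + cnt pt (Suc i) t" if "t \<le> m" for t
      using inv that lens by (cases "t = r") (auto simp: cnt_Suc ri e_def)
    have er': "er[e := pr ! i] ! x \<le> Suc m" if "x < n" for x
      using inv that lens p(2)[OF 1(2)] by (cases "x = e") auto
    have "K (Suc i) ?s" unfolding K_def B_def sp using inv lens g z fi' er' by simp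
    then show ?case using f w ri v(6-8) 1(2) fir en lens
      by (simp add: wps flip: ew_def er_def fi_def)
  next
    case (2 s2)
    then show ?case by (simp add: K_def B_def eval_simps)
  qed simp
  have "wp W Sp bucket s (\<lambda>t s'. t \<le> (30 + 2 * n + m) + ((n * 24 + 4) + (2 + (((m + 1) * 26 + 6) + (2 + (n * 38 + 4))))) \<and> K n s')"
    using wp_seqI[OF 1 wp_seqI[OF 2 wp_seqI[OF 3 wp_seqI[OF 4 wp_seqI[OF 5 6]]]]]
    unfolding bucket_def by (simp only: wp_Seq_eq add.assoc cong del: wp_cong)
  then show ?thesis
    by (rule wp_conseq) (auto simp: K_def B_def)
qed

section \<open>Staircases and dominance regions\<close>

context sweep
begin

text \<open>The upper boundary of the dominated region at time \<open>t\<close>, with the start node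
  0 for an empty region.\<close>

definition height :: "nat set \<Rightarrow> nat \<Rightarrow> nat" where
  "height A t = Max (insert 0 {u\<in>A. pos u \<le> t})"

definition worth :: "nat set \<Rightarrow> real" where
  "worth A = (\<Sum>t<Suc m. wt t (height A t))"

lemma height_eqI:
  assumes "finite A" "u = 0 \<or> u \<in> A \<and> pos u \<le> t" "\<And>v. v \<in> A \<Longrightarrow> pos v \<le> t \<Longrightarrow> v \<le> u"
  shows "height A t = u"
  unfolding height_def using assms by (intro Max_eqI) auto

lemma height_cases:
  assumes "finite A"
  shows "height A t = 0 \<or> height A t \<in> A \<and> pos (height A t) \<le> t" "v \<in> A \<Longrightarrow> pos v \<le> t \<Longrightarrow> v \<le> height A t"
proof -
  have "height A t \<in> insert 0 {u\<in>A. pos u \<le> t}" unfolding height_def using assms by (intro Max_in) auto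
  then show "height A t = 0 \<or> height A t \<in> A \<and> pos (height A t) \<le> t" by auto
  show "v \<in> A \<Longrightarrow> pos v \<le> t \<Longrightarrow> v \<le> height A t" unfolding height_def using assms by (intro Max_ge) auto
qed

lemma pos_pos: "0 < u \<Longrightarrow> u \<le> Suc m \<Longrightarrow> 0 < pos u"
  using pos_inj[of u 0] by (cases "pos u") auto

text \<open>The staircase of \<open>A\<close> visits the successive values of
  \<open>height A\<close>. Each change is caused by a node of \<open>A\<close> that has just
  arrived, and one more step leads to the end node.\<close>

lemma walk_of_set:
  assumes A: "A \<subseteq> {1..m}"
  shows "walk (Suc (card A)) 0 (Suc m) (worth A)"
proof -
  have fin: "finite A" using A finite_subset by blast
  have pt: "pos (height A t) \<le> t" for t using height_cases(1)[OF fin, of t] by auto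
  have tm: "height A t \<le> m" for t using height_cases(1)[OF fin, of t] A by auto
  \<comment> \<open>The highest node at time \<open>t\<close> was the highest ever since its own
    arrival, as fewer nodes were present before.\<close>
  have const: "height A t' = height A t" if "pos (height A t) \<le> t'" "t' \<le> t" for t t'
    by (rule height_eqI[OF fin]) (use height_cases[OF fin, where t = t] that in auto)
  have cost: "(\<Sum>t'<pos (height A t). wt t' (height A t')) + cost (height A t) v = (\<Sum>t'<Suc t. wt t' (height A t'))"
    if "pos v = Suc t" for t v
  proof -
    have "cost (height A t) v = (\<Sum>t'\<in>{pos (height A t)..<Suc t}. wt t' (height A t'))"
      unfolding cost_def that by (rule sum.cong) (auto simp: const)
    moreover have "(\<Sum>t'<Suc t. wt t' (height A t')) = (\<Sum>t'<pos (height A t). wt t' (height A t')) + (\<Sum>t'\<in>{pos (height A t)..<Suc t}. wt t' (height A t'))"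
      unfolding lessThan_atLeast0 by (rule sum.atLeastLessThan_concat[symmetric]) (use pt[of t] in auto)
    ultimately show ?thesis by simp
  qed
  have main: "walk (card {u\<in>A. pos u \<le> t}) 0 (height A t) (\<Sum>t'<pos (height A t). wt t' (height A t'))" if "t \<le> m" for t
    using that
  proof (induction t)
    case 0
    have "height A 0 = 0" using height_cases(1)[OF fin, of 0] pos_pos[of "height A 0"] tm[of 0] by fastforce
    then show ?case by simp
  next
    case (Suc t)
    then have IH: "walk (card {u\<in>A. pos u \<le> t}) 0 (height A t) (\<Sum>t'<pos (height A t). wt t' (height A t'))" by simp
    define v where "v = node (Suc t)"
    have v: "v \<le> Suc m" "pos v = Suc t" using pos_node[of "Suc t"] Suc.prems by (auto simp: v_def)
    have others: "pos u \<le> Suc t \<longleftrightarrow> pos u \<le> t \<or> u = v" if "u \<in> A" for u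
      using that A v pos_inj[of u v] by (auto simp: le_Suc_eq)
    show ?case
    proof (cases "v \<in> A \<and> height A t < v")
      case True
      have "height A (Suc t) = v"
        by (rule height_eqI[OF fin]) (use True v others height_cases(2)[OF fin, of _ t] in \<open>auto intro: less_imp_le le_less_trans\<close>)
      moreover have "edge (height A t) v" using True v pt[of t] by (simp add: edge_def le_imp_less_Suc)
      moreover have "{u\<in>A. pos u \<le> Suc t} = insert v {u\<in>A. pos u \<le> t}" using others True v by auto
      moreover have "v \<notin> {u\<in>A. pos u \<le> t}" using v by simp
      ultimately show ?thesis using walk_Suc_step[OF IH, of v] cost[OF v(2)] v fin by (simp del: sum.lessThan_Suc)
    next
      case False
      have "height A (Suc t) = height A t"
        by (rule height_eqI[OF fin]) (use False others height_cases[OF fin, where t = t] in \<open>auto simp: not_less\<close>)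
      moreover have "card {u\<in>A. pos u \<le> t} \<le> card {u\<in>A. pos u \<le> Suc t}" using fin by (intro card_mono) auto
      ultimately show ?thesis using walk_mono[OF IH] by simp
    qed
  qed
  have "card {u\<in>A. pos u \<le> m} \<le> card A" using fin by (intro card_mono) auto
  then have w: "walk (card A) 0 (height A m) (\<Sum>t'<pos (height A m). wt t' (height A t'))" using walk_mono[OF main[of m]] by simp
  have "edge (height A m) (Suc m)" using tm[of m] pt[of m] by (simp add: edge_def le_imp_less_Suc)
  from walk_Suc_step[OF w this] show ?thesis unfolding worth_def cost[OF pos_end] .
qed

lemma trace_mono:
  assumes "\<forall>p<c. walk (Suc 0) (cu ! p) (cu ! Suc p) (y p)" "p \<le> q" "q \<le> c"
  shows "cu ! p \<le> cu ! q \<and> pos (cu ! p) \<le> pos (cu ! q)"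
  using assms(2,3)
proof (induction q rule: dec_induct)
  case (step q)
  then show ?case using walk_le[of "Suc 0" "cu ! q" "cu ! Suc q"] assms(1) by (meson Suc_leD Suc_le_lessD order_trans)
qed simp

text \<open>Converse of \<open>walk_of_set\<close>. A trace increases in rank and time alike, so its
  last visited node is the height until the next one arrives, and each edge cost is a section of the
  sum \<open>worth A\<close>.\<close>

lemma worth_of_trace:
  assumes tr: "\<forall>p<c. walk (Suc 0) (cu ! p) (cu ! Suc p) (y p)" and cu: "cu ! 0 = 0" "cu ! c = Suc m"
    and A: "A = (\<lambda>p. cu ! p) ` {..c} \<inter> {1..m}"
  shows "(\<Sum>p<c. y p) = worth A"
proof -
  have fin: "finite A" using A by auto
  note mono = trace_mono[OF tr]
  have cm: "cu ! p \<le> Suc m" if "p \<le> c" for p using mono[OF that order_refl] cu by simp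
  have "(\<Sum>p<i. y p) = (\<Sum>t<pos (cu ! i). wt t (height A t))" if "i \<le> c" for i
    using that
  proof (induction i)
    case (Suc i)
    then have IH: "(\<Sum>p<i. y p) = (\<Sum>t<pos (cu ! i). wt t (height A t))" and ic: "i < c" by auto
    from tr ic consider "cu ! i = cu ! Suc i" "y i = 0" | "edge (cu ! i) (cu ! Suc i)" "y i = cost (cu ! i) (cu ! Suc i)"
      using walk_1 by blast
    then show ?case
    proof cases
      case 1
      then show ?thesis using IH by simp
    next
      case 2
      have e: "cu ! i < cu ! Suc i" "pos (cu ! i) < pos (cu ! Suc i)" using 2 by (auto simp: edge_def)
      have im: "cu ! i \<le> m" using e cm[of "Suc i"] ic by simp
      have "height A t = cu ! i" if t: "t \<in> {pos (cu ! i)..<pos (cu ! Suc i)}" for t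
      proof (rule height_eqI[OF fin])
        show "cu ! i = 0 \<or> cu ! i \<in> A \<and> pos (cu ! i) \<le> t" using t ic im A by auto
        fix v assume "v \<in> A" "pos v \<le> t"
        then obtain q where q: "q \<le> c" "v = cu ! q" "pos (cu ! q) < pos (cu ! Suc i)" using A t by auto
        then have "q \<le> i" using mono[of "Suc i" q] by (auto simp: not_less_eq_eq[symmetric])
        then show "v \<le> cu ! i" using mono[of q i] q ic by simp
      qed
      then have "y i = (\<Sum>t\<in>{pos (cu ! i)..<pos (cu ! Suc i)}. wt t (height A t))"
        using 2(2) unfolding cost_def by simp
      moreover have "(\<Sum>t<pos (cu ! Suc i). wt t (height A t)) = (\<Sum>t<pos (cu ! i). wt t (height A t)) + (\<Sum>t\<in>{pos (cu ! i)..<pos (cu ! Suc i)}. wt t (height A t))"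
        unfolding lessThan_atLeast0 by (rule sum.atLeastLessThan_concat[symmetric]) (use e in auto)
      ultimately show ?thesis using IH by simp
    qed
  qed (simp add: cu)
  from this[of c] show ?thesis by (simp add: cu worth_def)
qed

lemma selected_nodes:
  assumes tr: "\<forall>p<c. walk (Suc 0) (cu ! p) (cu ! Suc p) (y p)" and cu: "cu ! 0 = 0" "cu ! c = Suc m"
    and sel: "sel = filter (\<lambda>i. cu ! i < cu ! Suc i \<and> cu ! Suc i \<le> m) [0..<c]"
  shows "(\<lambda>i. cu ! Suc i) ` set sel = (\<lambda>p. cu ! p) ` {..c} \<inter> {1..m}"
    "inj_on (\<lambda>i. cu ! Suc i) (set sel)" "distinct sel" "length sel \<le> c - 1"
proof -
  note mono = trace_mono[OF tr]
  show "(\<lambda>i. cu ! Suc i) ` set sel = (\<lambda>p. cu ! p) ` {..c} \<inter> {1..m}"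
  proof (intro equalityI subsetI)
    fix u assume "u \<in> (\<lambda>p. cu ! p) ` {..c} \<inter> {1..m}"
    then have ex: "\<exists>p. p \<le> c \<and> cu ! p = u" and u: "1 \<le> u" "u \<le> m" by auto
    \<comment> \<open>The first position at which \<open>u\<close> is visited, so that the step
      leading there is not idle.\<close>
    define p where "p = (LEAST p. p \<le> c \<and> cu ! p = u)"
    have p: "p \<le> c" "cu ! p = u" using LeastI_ex[OF ex] by (auto simp: p_def)
    have lst: "cu ! q \<noteq> u" if "q < p" for q using not_less_Least[of q "\<lambda>p. p \<le> c \<and> cu ! p = u"] that p(1) by (auto simp: p_def)
    have "p \<noteq> 0" using p u cu by (cases p) auto
    then obtain i where i: "p = Suc i" by (cases p) auto
    have "cu ! i < cu ! Suc i" using lst[of i] mono[of i "Suc i"] p i by auto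
    then have "i \<in> set sel" using sel p u i by auto
    then show "u \<in> (\<lambda>i. cu ! Suc i) ` set sel" using p i by auto
  qed (auto simp: sel)
  show "distinct sel" using sel by simp
  have lt: "cu ! Suc i < cu ! Suc j" if "i \<in> set sel" "j \<in> set sel" "i < j" for i j
    using that mono[of "Suc i" j] sel by auto
  show "inj_on (\<lambda>i. cu ! Suc i) (set sel)"
  proof (rule inj_onI)
    fix i j assume a: "i \<in> set sel" "j \<in> set sel" "cu ! Suc i = cu ! Suc j"
    show "i = j" using lt[of i j] lt[of j i] a by (cases i j rule: linorder_cases) auto
  qed
  \<comment> \<open>The last step ends at the end node and is never selected, which saves
    one.\<close>
  have "set sel \<subseteq> {..<c - 1}"
  proof
    fix i assume "i \<in> set sel"
    then have "i < c" "cu ! Suc i \<le> m" using sel by auto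
    moreover from this have "Suc i \<noteq> c" using cu by auto
    ultimately show "i \<in> {..<c - 1}" by auto
  qed
  then have "card (set sel) \<le> card {..<c - 1}" by (rule card_mono[rotated]) simp
  then show "length sel \<le> c - 1" using \<open>distinct sel\<close> by (simp add: distinct_card)
qed

end

text \<open>Among the nodes of \<open>A\<close> that have arrived, the highest decides whether a
  point of P is dominated. So the point counts iff its rank is at most the height at its arrival
  time, and grouping the points by these times yields \<open>worth\<close>.\<close>

lemma (in sweep) region_worth:
  assumes wt: "\<And>t u. t \<le> m \<Longrightarrow> wt t u = arrived pt pr (map w pl) (length pl) t u"
    and pl: "distinct pl" "set pl = P"
    and pt: "\<And>i. i < length pl \<Longrightarrow> pt ! i \<le> m" "\<And>i. i < length pl \<Longrightarrow> 0 < pr ! i"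
    and dom: "\<And>i u. i < length pl \<Longrightarrow> u \<in> {1..m} \<Longrightarrow> pl ! i \<in> dom_point (q u) \<longleftrightarrow> pos u \<le> pt ! i \<and> pr ! i \<le> u"
    and A: "A \<subseteq> {1..m}"
  shows "region_weight P w (dom_set (q ` A)) = worth A"
proof -
  let ?n = "length pl"
  have fin: "finite A" using A finite_subset by blast
  have "finite P" using pl(2) by auto
  have in_dom: "pl ! i \<in> dom_set (q ` A) \<longleftrightarrow> pr ! i \<le> height A (pt ! i)" if i: "i < ?n" for i
  proof -
    have "pl ! i \<in> dom_set (q ` A) \<longleftrightarrow> (\<exists>u\<in>A. pos u \<le> pt ! i \<and> pr ! i \<le> u)"
      using dom[OF i] A unfolding dom_set_def by blast
    also have "\<dots> \<longleftrightarrow> pr ! i \<le> height A (pt ! i)"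
      using height_cases[OF fin, where t = "pt ! i"] pt(2)[OF i] by (auto intro: order_trans)
    finally show ?thesis .
  qed
  have "region_weight P w (dom_set (q ` A)) = (\<Sum>p\<in>P. if p \<in> dom_set (q ` A) then w p else 0)"
    unfolding region_weight_def using \<open>finite P\<close> by (simp add: sum.inter_restrict)
  also have "\<dots> = (\<Sum>i<?n. if pl ! i \<in> dom_set (q ` A) then w (pl ! i) else 0)"
    using pl by (intro sum.reindex_bij_betw[symmetric] bij_betw_nth) auto
  also have "\<dots> = (\<Sum>i<?n. \<Sum>t<Suc m. if pt ! i = t \<and> pr ! i \<le> height A t then map w pl ! i else 0)"
  proof (rule sum.cong[OF refl])
    fix i assume "i \<in> {..<?n}"
    then have i: "i < ?n" by simp
    have "(\<Sum>t<Suc m. if pt ! i = t \<and> pr ! i \<le> height A t then map w pl ! i else 0) =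
      (\<Sum>t<Suc m. if pt ! i = t then (if pr ! i \<le> height A (pt ! i) then map w pl ! i else 0) else 0)"
      by (rule sum.cong) auto
    also have "\<dots> = (if pr ! i \<le> height A (pt ! i) then map w pl ! i else 0)"
      using pt(1)[OF i] by (simp del: sum.lessThan_Suc add: less_Suc_eq_le)
    finally show "(if pl ! i \<in> dom_set (q ` A) then w (pl ! i) else 0) =
      (\<Sum>t<Suc m. if pt ! i = t \<and> pr ! i \<le> height A t then map w pl ! i else 0)"
      using in_dom[OF i] i by simp
  qed
  also have "\<dots> = (\<Sum>t<Suc m. \<Sum>i<?n. if pt ! i = t \<and> pr ! i \<le> height A t then map w pl ! i else 0)"
    by (rule sum.swap)
  also have "\<dots> = worth A"
    unfolding worth_def by (rule sum.cong) (simp_all add: wt arrived_def del: sum.lessThan_Suc)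
  finally show ?thesis .
qed

text \<open>Every point of Q has one position \<open>i\<close> in the x-order and one position
  \<open>p\<close> in the y-order, tied by \<open>xo ! i = yo ! p\<close>; hence times and ranks
  determine each other.\<close>

lemma sweep_ranks:
  assumes xo: "bij_betw ((!) xo) {..<m} {..<m}" and yo: "bij_betw ((!) yo) {..<m} {..<m}"
    and nd0: "nd ! 0 = 0" "ps ! 0 = 0" "nd ! Suc m = Suc m" "ps ! Suc m = Suc m"
    and nd: "\<forall>i<m. \<forall>p<m. xo ! i = yo ! p \<longrightarrow> nd ! (m - i) = Suc p \<and> ps ! Suc p = m - i"
  shows "sweep m ((!) nd) ((!) ps)"
proof
  show "ps ! 0 = 0" "ps ! Suc m = Suc m" using nd0 by auto
  fix t assume t: "t \<le> Suc m"
  consider "t = 0" | "t = Suc m" | "1 \<le> t" "t \<le> m" using t by linarith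
  then show "nd ! t \<le> Suc m \<and> ps ! (nd ! t) = t"
  proof cases
    case 3
    define i where "i = m - t"
    have i: "i < m" "t = m - i" using 3 by (auto simp: i_def)
    have "xo ! i < m" using xo i by (auto simp: bij_betw_def)
    then obtain p where "p < m" "xo ! i = yo ! p" using yo unfolding bij_betw_def by (metis imageE lessThan_iff)
    then show ?thesis using nd i by auto
  qed (use nd0 in auto)
next
  fix u assume u: "u \<le> Suc m"
  consider "u = 0" | "u = Suc m" | p where "p < m" "u = Suc p" using u by (cases u) (auto simp: le_Suc_eq)
  then show "ps ! u \<le> Suc m \<and> nd ! (ps ! u) = u"
  proof cases
    case 3
    then have "yo ! p < m" using yo by (auto simp: bij_betw_def)
    then obtain i where "i < m" "yo ! p = xo ! i" using xo unfolding bij_betw_def by (metis imageE lessThan_iff)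
    then show ?thesis using nd 3 by auto
  qed (use nd0 in auto)
qed

text \<open>A coordinate of Q is strictly smaller than that of \<open>p\<close> iff its sorted
  position lies below the number of such coordinates. Equal coordinates thus count as dominating, in
  whatever order the sort has put them.\<close>

lemma dominance_ranks:
  fixes qs :: "point list"
  assumes m: "length qs = m" and xo: "bij_betw ((!) xo) {..<m} {..<m}" and yo: "bij_betw ((!) yo) {..<m} {..<m}"
    and nd: "\<forall>i<m. \<forall>p<m. xo ! i = yo ! p \<longrightarrow> nd ! (m - i) = Suc p \<and> ps ! Suc p = m - i"
    and xs: "\<forall>i<m. xs ! i = fst (qs ! (xo ! i))" "\<forall>i j. i \<le> j \<longrightarrow> j < m \<longrightarrow> xs ! i \<le> xs ! j"
    and ys: "\<forall>i<m. ys ! i = snd (qs ! (yo ! i))" "\<forall>i j. i \<le> j \<longrightarrow> j < m \<longrightarrow> ys ! i \<le> ys ! j"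
    and u: "u \<in> {1..m}"
    and pt: "pt = m - card {j. j < m \<and> xs ! j < fst p}" and pr: "pr = Suc (card {j. j < m \<and> ys ! j < snd p})"
  shows "p \<in> dom_point (qs ! (yo ! (u - 1))) \<longleftrightarrow> ps ! u \<le> pt \<and> pr \<le> u"
proof -
  obtain v where v: "u = Suc v" "v < m" using u by (cases u) auto
  have "yo ! v < m" using yo v by (auto simp: bij_betw_def)
  then obtain a where a: "a < m" "xo ! a = yo ! v" using xo unfolding bij_betw_def by (metis imageE lessThan_iff)
  have pu: "ps ! u = m - a" using nd a v by auto
  let ?c = "card {j. j < m \<and> xs ! j < fst p}" and ?d = "card {j. j < m \<and> ys ! j < snd p}"
  have c: "?c \<le> m" "xs ! a < fst p \<longleftrightarrow> a < ?c" using sorted_count[where m = m and xs = xs and v = "fst p"] xs(2) a by blast+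
  have d: "ys ! v < snd p \<longleftrightarrow> v < ?d" using sorted_count[where m = m and xs = ys and v = "snd p"] ys(2) v by blast
  have "p \<in> dom_point (qs ! (yo ! v)) \<longleftrightarrow> \<not> xs ! a < fst p \<and> \<not> ys ! v < snd p"
    using xs(1) ys(1) a v by (auto simp: dom_point_def mem_Times_iff not_less)
  also have "\<dots> \<longleftrightarrow> ps ! u \<le> pt \<and> pr \<le> u"
    unfolding c d pt pr pu unfolding v using c(1) a by auto
  finally show ?thesis using v by simp
qed

text \<open>Since \<open>worth A\<close> is the region weight of the points of Q indexed by \<open>A\<close>, an optimal walk is an optimal subset of Q.\<close>

lemma (in sweep) optimal_output:
  fixes qs :: "point list" and yo :: "nat list"
  assumes region: "\<And>A. A \<subseteq> {1..m} \<Longrightarrow> region_weight P w (dom_set ((\<lambda>u. qs ! (yo ! (u - 1))) ` A)) = worth A"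
    and yo: "bij_betw ((!) yo) {..<m} {..<m}" and qs: "distinct qs" "length qs = m" "set qs = Q"
    and c: "c = Suc (min k m)"
    and opt: "\<forall>y. walk c 0 (Suc m) y \<longrightarrow> y \<le> V"
    and tr: "\<forall>p<c. walk (Suc 0) (cu ! p) (cu ! Suc p) (y p)" "V = (\<Sum>p<c. y p)" and cu: "cu ! 0 = 0" "cu ! c = Suc m"
    and out: "output_indices s = map (\<lambda>i. yo ! (cu ! Suc i - 1)) (filter (\<lambda>i. cu ! i < cu ! Suc i \<and> cu ! Suc i \<le> m) [0..<c])"
    and val: "output_value s = V"
  shows "correct_output P w Q qs k s"
proof -
  define sel where "sel = filter (\<lambda>i. cu ! i < cu ! Suc i \<and> cu ! Suc i \<le> m) [0..<c]"
  define A where "A = (\<lambda>i. cu ! Suc i) ` set sel"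
  let ?q = "\<lambda>u. qs ! (yo ! (u - 1))"
  note selp = selected_nodes[OF tr(1) cu sel_def]
  have A: "A = (\<lambda>p. cu ! p) ` {..c} \<inter> {1..m}" using selp(1) by (simp add: A_def)
  then have A1: "A \<subseteq> {1..m}" by auto
  have V: "V = worth A" using worth_of_trace[OF tr(1) cu A] tr(2) by simp
  have yo_lt: "yo ! (u - 1) < m" if "u \<in> {1..m}" for u
    using yo that by (auto simp: bij_betw_def)
  have yo_inj: "inj_on (\<lambda>u. yo ! (u - 1)) {1..m}"
  proof (rule inj_onI)
    fix u v assume "u \<in> {1..m}" "v \<in> {1..m}" "yo ! (u - 1) = yo ! (v - 1)"
    then have "u - 1 = v - 1" using inj_onD[OF bij_betw_imp_inj_on[OF yo], of "u - 1" "v - 1"] by auto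
    then show "u = v" using \<open>u \<in> {1..m}\<close> \<open>v \<in> {1..m}\<close> by auto
  qed
  have q_inj: "inj_on ?q {1..m}"
  proof (rule inj_onI)
    fix u v assume uv: "u \<in> {1..m}" "v \<in> {1..m}" "?q u = ?q v"
    then have "yo ! (u - 1) = yo ! (v - 1)" using qs(1,2) yo_lt by (simp add: nth_eq_iff_index_eq)
    then show "u = v" using inj_onD[OF yo_inj _ uv(1,2)] by simp
  qed
  have q_surj: "?q ` {1..m} = Q"
  proof -
    have "(\<lambda>u. u - 1) ` {1..m} = {..<m}"
    proof (intro equalityI subsetI)
      fix x assume "x \<in> {..<m}"
      then show "x \<in> (\<lambda>u. u - 1) ` {1..m}" by (intro image_eqI[of _ _ "Suc x"]) auto
    qed auto
    moreover have "?q ` {1..m} = (!) qs ` (!) yo ` (\<lambda>u. u - 1) ` {1..m}" by (simp only: image_image)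
    ultimately have "?q ` {1..m} = (!) qs ` {..<m}" using bij_betw_imp_surj_on[OF yo] by simp
    then show ?thesis using qs by (auto simp: set_conv_nth)
  qed
  have oi: "output_indices s = map (\<lambda>u. yo ! (u - 1)) (map (\<lambda>i. cu ! Suc i) sel)"
    using out by (simp add: sel_def)
  have sels: "set (map (\<lambda>i. cu ! Suc i) sel) = A" by (simp add: A_def)
  have dist: "distinct (output_indices s)"
    unfolding oi using selp(2,3) yo_inj A1 unfolding distinct_map sels by (auto intro: inj_on_subset)
  have lt: "\<forall>i\<in>set (output_indices s). i < length qs"
    unfolding oi set_map[of "\<lambda>u. yo ! (u - 1)"] sels using yo_lt A1 qs(2) by auto
  have os: "output_set qs s = ?q ` A"
    unfolding output_set_def oi set_map[of "\<lambda>u. yo ! (u - 1)"] sels by (simp add: image_image)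
  have "card (output_set qs s) \<le> card A" unfolding os using A1 finite_subset by (intro card_image_le) blast
  also have "\<dots> \<le> length sel" unfolding A_def by (metis card_image_le card_length finite_set order_trans)
  also have "\<dots> \<le> k" using selp(4) c by simp
  finally have cardk: "card (output_set qs s) \<le> k" .
  have rw: "region_weight P w (dom_set (output_set qs s)) = V" using region[OF A1] V os by simp
  have "maxDominance P w Q k = V"
    unfolding maxDominance_def
  proof (rule Max_eqI)
    have "{region_weight P w (dom_set Q') |Q'. Q' \<subseteq> Q \<and> card Q' \<le> k} \<subseteq> (\<lambda>Q'. region_weight P w (dom_set Q')) ` Pow Q" by auto
    moreover have "finite Q" using qs by auto
    ultimately show "finite {region_weight P w (dom_set Q') |Q'. Q' \<subseteq> Q \<and> card Q' \<le> k}"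
      using finite_subset by blast
    show "V \<in> {region_weight P w (dom_set Q') |Q'. Q' \<subseteq> Q \<and> card Q' \<le> k}"
      using rw cardk A1 q_surj unfolding os by blast
    fix x assume "x \<in> {region_weight P w (dom_set Q') |Q'. Q' \<subseteq> Q \<and> card Q' \<le> k}"
    then obtain Q' where Q': "Q' \<subseteq> Q" "card Q' \<le> k" "x = region_weight P w (dom_set Q')" by blast
    \<comment> \<open>Any competitor is the image of a set of ranks of the same size, whose
      staircase is a walk of at most \<open>c\<close> steps.\<close>
    then obtain A' where A': "A' \<subseteq> {1..m}" "Q' = ?q ` A'" using q_surj subset_imageE by metis
    have "card A' = card Q'" unfolding A'(2) using q_inj A'(1) inj_on_subset by (metis card_image)
    moreover have "card A' \<le> card {1..m}" using A'(1) by (intro card_mono) auto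
    ultimately have "Suc (card A') \<le> c" using Q'(2) c by simp
    then have "walk c 0 (Suc m) (worth A')" using walk_of_set[OF A'(1)] walk_mono by blast
    then show "x \<le> V" using opt region[OF A'(1)] Q'(3) A'(2) by simp
  qed
  then show ?thesis unfolding correct_output_def using dist lt cardk rw val by simp
qed

section \<open>The program\<close>

definition word_arrays :: "(vname \<times> nexp) list" where
  "word_arrays = [(''G'', NAdd (NVar ''N'') (NVar ''N'')), (''xo'', NVar ''m''), (''yo'', NVar ''m''), (''rk'', NVar ''m''),
      (''nd'', NAdd (NVar ''m'') (NLit 2)), (''ps'', NAdd (NVar ''m'') (NLit 2)), (''of'', NAdd (NVar ''m'') (NLit 2)),
      (''B'', NAdd (NVar ''m'') (NLit 2)), (''pt'', NVar ''n''), (''pr'', NVar ''n''),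
      (''cu'', NAdd (NVar ''c'') (NLit 1)), (''nx'', NAdd (NVar ''c'') (NLit 1))]"

definition real_arrays :: "(vname \<times> nexp) list" where
  "real_arrays = [(''S'', NAdd (NVar ''N'') (NVar ''N'')), (''M'', NAdd (NVar ''N'') (NVar ''N'')), (''xs'', NVar ''m''), (''ys'', NVar ''m''),
      (''A'', NAdd (NVar ''m'') (NLit 2))]"

definition allocate :: com where
  "allocate = Seq (nnews word_arrays)
    (rnews real_arrays)"

text \<open>One step for each point and one to the end node; more than \<open>m\<close> points
  cannot be chosen.\<close>

definition set_levels :: com where
  "set_levels = If (NLess (NVar ''k'') (NVar ''m'')) (NSet ''c'' (NAdd (NVar ''k'') (NLit 1))) (NSet ''c'' (NAdd (NVar ''m'') (NLit 1)))"

definition events :: com where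
  "events = If (NLess (NMul (NVar ''m'') (NVar ''m'')) (NVar ''n'')) grid bucket"

text \<open>Without candidates the initial state is already a correct output: \<open>value\<close>
  is 0 and \<open>out\<close> is empty.\<close>

definition max_dominance :: com where
  "max_dominance = If (NLess (NLit 0) (NVar ''m''))
    (Seq size_tree (Seq set_levels (Seq allocate
    (Seq (tournament_sort ''qx'' ''xo'' ''xs'') (Seq (tournament_sort ''qy'' ''yo'' ''ys'')
    (Seq rank_init (Seq locate (Seq events (Seq bisect emit)))))))))
    Skip"

lemma space_input: "space (input_state pl w qs k) \<le> 3 * length pl + 2 * length qs"
proof -
  let ?s0 = "\<lparr>nvar = nvar (input_state pl w qs k), rvar = (\<lambda>_. 0), narr = (\<lambda>_. []), rarr = (\<lambda>_. [])\<rparr>"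
  let ?r = "rarr (input_state pl w qs k)"
  have "(\<Sum>a | ?r a \<noteq> []. length (?r a)) \<le> (\<Sum>a\<in>{''px'', ''py'', ''pw'', ''qx'', ''qy''}. length (?r a))"
    by (rule sum_mono2) (auto simp: input_state_def split: if_splits)
  also have "\<dots> = 3 * length pl + 2 * length qs" by (simp add: input_state_def)
  finally show ?thesis by (simp add: space_def) (simp add: input_state_def)
qed

text \<open>\<open>W\<close> leaves room to number all grid cells, and \<open>Sp\<close> for a
  constant number of arrays of linear length. \<open>L\<close> is the height of the smallest
  sufficient tree.\<close>

locale inst =
  fixes pl qs :: "point list" and w :: "point \<Rightarrow> real" and k m n c L W Sp :: nat
  assumes n: "length pl = n" and m: "length qs = m" "0 < m" and k: "0 < k" and c: "c = Suc (min k m)"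
    and L: "m + 2 \<le> 2 ^ L" "2 ^ L < 2 * (m + 2)"
    and W: "16 * (m + 2) * (m + 2) + n + k + 10 < W"
    and Sp: "100 * (n + m + 1) \<le> Sp"
begin

lemma bounds: "2 * 2 ^ L + 2 < W" "m + 2 < W" "n + 1 < W" "c + 2 < W" "k + 1 < W" "(m + 2) * (m + 2) < W" "c \<le> 2 ^ L" "m * m < W"
proof -
  define q where "q = (m + 2) * (m + 2)"
  define r where "r = m * m"
  define N :: nat where "N = 2 ^ L"
  have q: "m + 2 \<le> q" "r \<le> q" unfolding q_def r_def by (simp, intro mult_le_mono) auto
  have W': "16 * q + n + k + 10 < W" using W unfolding q_def mult.assoc .
  have c': "c \<le> Suc m" "c \<le> Suc k" using c by auto
  show "2 * 2 ^ L + 2 < W" "c \<le> 2 ^ L" using q(1) W' L c' unfolding N_def[symmetric] by simp_all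
  show "(m + 2) * (m + 2) < W" "m * m < W" using q(2) W' unfolding q_def[symmetric] r_def[symmetric] by simp_all
  show "m + 2 < W" "n + 1 < W" "c + 2 < W" "k + 1 < W" using q(1) W' c' by simp_all
qed

text \<open>The input takes \<open>3 * n + 2 * m\<close>; the rest are the word and real arrays,
  with \<open>2 ^ L < 2 * (m + 2)\<close> and \<open>c \<le> m + 1\<close> inserted.\<close>

definition space1 :: nat where "space1 = 5 * n + 26 * m + 40"

definition core :: "state \<Rightarrow> bool" where
  "core s \<longleftrightarrow> nvar s ''N'' = 2 ^ L \<and> nvar s ''m'' = m \<and> nvar s ''n'' = n \<and> nvar s ''c'' = c \<and>
    rarr s ''px'' = map fst pl \<and> rarr s ''py'' = map snd pl \<and> rarr s ''pw'' = map w pl \<and>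
    rarr s ''qx'' = map fst qs \<and> rarr s ''qy'' = map snd qs \<and>
    narr s ''of'' = replicate (m + 2) 0 \<and> narr s ''cu'' ! 0 = 0 \<and>
    length (rarr s ''S'') = 2 * 2 ^ L \<and> length (rarr s ''M'') = 2 * 2 ^ L \<and> length (narr s ''G'') = 2 * 2 ^ L \<and>
    length (narr s ''xo'') = m \<and> length (narr s ''yo'') = m \<and> length (narr s ''rk'') = m \<and>
    length (narr s ''nd'') = m + 2 \<and> length (narr s ''ps'') = m + 2 \<and> length (narr s ''B'') = m + 2 \<and>
    length (narr s ''pt'') = n \<and> length (narr s ''pr'') = n \<and> length (narr s ''cu'') = Suc c \<and> length (narr s ''nx'') = Suc c \<and>
    length (rarr s ''xs'') = m \<and> length (rarr s ''ys'') = m \<and> length (rarr s ''A'') = m + 2 \<and> space s \<le> space1"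

lemma core_mono:
  assumes "core s" "lens s s'" "nvar s' ''N'' = nvar s ''N''" "nvar s' ''m'' = nvar s ''m''" "nvar s' ''n'' = nvar s ''n''"
    "nvar s' ''c'' = nvar s ''c''" "rarr s' ''px'' = rarr s ''px''" "rarr s' ''py'' = rarr s ''py''" "rarr s' ''pw'' = rarr s ''pw''"
    "rarr s' ''qx'' = rarr s ''qx''" "rarr s' ''qy'' = rarr s ''qy''" "narr s' ''of'' = narr s ''of''" "narr s' ''cu'' = narr s ''cu''"
  shows "core s'"
  using assms(1) lensD[OF assms(2)] space_lens[OF assms(2)] unfolding core_def assms(3-13) by simp

text \<open>These two arrays stay zero during the sorts; \<open>rank_init\<close> relies on it for
  the start node.\<close>

definition blank :: "state \<Rightarrow> bool" where
  "blank s \<longleftrightarrow> narr s ''nd'' = replicate (m + 2) 0 \<and> narr s ''ps'' = replicate (m + 2) 0"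

lemma space1_le: "space1 \<le> Sp"
  using Sp by (simp add: space1_def)

lemma wp_start:
  assumes s: "s = input_state pl w qs k"
  shows "wp W Sp (Seq size_tree (Seq set_levels allocate)) s (\<lambda>t s'. t \<le> 10 * L + 2 * n + 30 * m + 250 \<and> (core s' \<and> blank s'))"
proof -
  note b = bounds
  have [simp]: "Suc 0 < W" "2 < W" "m < W" "k < W" "Suc m < W" "Suc k < W" "Suc c < W" "Suc (Suc m) < W" "c < W" "n < W" "2 ^ L + 2 ^ L < W" using b by auto
  define s1 where "s1 = s\<lparr>nvar := (nvar s)(''N'' := 2 ^ L)\<rparr>"
  define s2 where "s2 = s\<lparr>nvar := (nvar s)(''N'' := 2 ^ L, ''c'' := c)\<rparr>"
  have sp2: "space s2 \<le> 3 * n + 2 * m" using space_input[of pl w qs k] n m s by (simp add: s2_def space_def)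
  have v2: "nvar s2 ''N'' = 2 ^ L" "nvar s2 ''m'' = m" "nvar s2 ''n'' = n" "nvar s2 ''c'' = c"
    using n m by (auto simp: s s2_def input_state_def)
  have 1: "wp W Sp size_tree s (\<lambda>t s'. t \<le> 10 * L + 10 \<and> s' = s1)"
    unfolding s1_def by (rule wp_size_tree[where m = m]) (use L b m in \<open>auto simp: s input_state_def\<close>)
  have 2: "wp W Sp set_levels s' (\<lambda>t s'. t \<le> 20 \<and> s' = s2)" if "s' = s1" for s'
    unfolding that set_levels_def using m n c by (auto simp: wps s1_def s2_def s input_state_def min_def)
  define f where "f a = (if a = ''G'' \<or> a = ''S'' \<or> a = ''M'' then 2 ^ L + 2 ^ L else if a \<in> {''xo'', ''yo'', ''rk'', ''xs'', ''ys''} then m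
     else if a \<in> {''pt'', ''pr''} then n else if a \<in> {''cu'', ''nx''} then Suc c else m + 2)" for a :: vname
  define P3 where "P3 s' \<longleftrightarrow> nvar s' = nvar s2 \<and> rvar s' = rvar s2 \<and> rarr s' = rarr s2 \<and>
     (\<forall>a\<in>{''G'', ''xo'', ''yo'', ''rk'', ''nd'', ''ps'', ''of'', ''B'', ''pt'', ''pr'', ''cu'', ''nx''}. narr s' a = replicate (f a) 0) \<and>
     space s' \<le> space s2 + 2 * 2 ^ L + 3 * m + 4 * (m + 2) + 2 * n + 2 * Suc c" for s'
  have cm: "c \<le> Suc m" using c by simp
  have 3: "wp W Sp (nnews word_arrays) s'
      (\<lambda>t s'. t \<le> 2 * 2 ^ L + 3 * m + 4 * (m + 2) + 2 * n + 2 * Suc c + 121 \<and> P3 s')" if s': "s' = s2" for s'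
    unfolding s'
  proof (rule wp_conseq[OF wp_nnews[where f = f]], goal_cases)
    case (1 a e s')
    have "\<forall>(a, e)\<in>set word_arrays. \<forall>s'. nvar s' = nvar s2 \<longrightarrow> neval W s' e = Some (f a) \<and> ncost e \<le> 9"
      using v2 by (simp add: word_arrays_def f_def eval_simps)
    then show ?case using 1 by blast
  next
    case 3
    then show ?case using sp2 Sp L(2) cm by (simp add: f_def word_arrays_def)
  next
    case (4 t s')
    then show ?case by (simp add: f_def P3_def word_arrays_def)
  qed (simp add: word_arrays_def)
  have 4: "wp W Sp (rnews real_arrays) s'
      (\<lambda>t s'. t \<le> 4 * 2 ^ L + 2 * m + m + 2 + 60 \<and> (core s' \<and> blank s'))" if P: "P3 s'" for s'
  proof (rule wp_conseq[OF wp_rnews[where f = f]], goal_cases)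
    case (1 a e s')
    have "\<forall>(a, e)\<in>set real_arrays. \<forall>s'. nvar s' = nvar s2 \<longrightarrow> neval W s' e = Some (f a) \<and> ncost e \<le> 9"
      using v2 by (simp add: real_arrays_def f_def eval_simps)
    then show ?case using 1 P unfolding P3_def by auto
  next
    case 3
    then show ?case using sp2 Sp L(2) cm P by (simp add: f_def P3_def real_arrays_def)
  next
    case (4 t s3)
    have r2: "rarr s2 ''px'' = map fst pl" "rarr s2 ''py'' = map snd pl" "rarr s2 ''pw'' = map w pl"
        "rarr s2 ''qx'' = map fst qs" "rarr s2 ''qy'' = map snd qs" by (auto simp: s s2_def input_state_def)
    have "space s3 \<le> space1" using 4(2) P sp2 L(2) cm by (simp add: f_def P3_def space1_def real_arrays_def)
    moreover have "replicate (Suc c) (0::nat) ! 0 = 0" by simp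
    ultimately show ?case using 4(2) P v2 r2 unfolding core_def blank_def P3_def by (simp add: f_def real_arrays_def del: replicate.simps)
  qed (simp add: real_arrays_def)
  have "wp W Sp (Seq size_tree (Seq set_levels allocate)) s (\<lambda>t s'. t \<le> (10 * L + 10) + (20 + ((2 * 2 ^ L + 3 * m + 4 * (m + 2) + 2 * n + 2 * Suc c + 121) +
     (4 * 2 ^ L + 2 * m + m + 2 + 60))) \<and> (core s' \<and> blank s'))"
    unfolding allocate_def by (rule wp_seqI[OF 1 wp_seqI[OF 2 wp_seqI[OF 3 4]]])
  then show ?thesis by (rule wp_conseq) (use L(2) cm in auto)
qed

section \<open>Orders, ranks and arrival times\<close>

definition ranked :: "state \<Rightarrow> bool" where
  "ranked s \<longleftrightarrow> bij_betw ((!) (narr s ''xo'')) {..<m} {..<m} \<and> bij_betw ((!) (narr s ''yo'')) {..<m} {..<m} \<and>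
     (\<forall>i<m. rarr s ''xs'' ! i = fst (qs ! (narr s ''xo'' ! i))) \<and> (\<forall>i j. i \<le> j \<longrightarrow> j < m \<longrightarrow> rarr s ''xs'' ! i \<le> rarr s ''xs'' ! j) \<and>
     (\<forall>i<m. rarr s ''ys'' ! i = snd (qs ! (narr s ''yo'' ! i))) \<and> (\<forall>i j. i \<le> j \<longrightarrow> j < m \<longrightarrow> rarr s ''ys'' ! i \<le> rarr s ''ys'' ! j)"

lemma ranked_mono:
  "narr s' ''xo'' = narr s ''xo'' \<Longrightarrow> narr s' ''yo'' = narr s ''yo'' \<Longrightarrow> rarr s' ''xs'' = rarr s ''xs'' \<Longrightarrow>
    rarr s' ''ys'' = rarr s ''ys'' \<Longrightarrow> ranked s' = ranked s"
  unfolding ranked_def by (simp only:)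

definition placed :: "state \<Rightarrow> bool" where
  "placed s \<longleftrightarrow> narr s ''nd'' ! 0 = 0 \<and> narr s ''ps'' ! 0 = 0 \<and> narr s ''nd'' ! Suc m = Suc m \<and> narr s ''ps'' ! Suc m = Suc m \<and>
    (\<forall>i<m. \<forall>p<m. narr s ''xo'' ! i = narr s ''yo'' ! p \<longrightarrow> narr s ''nd'' ! (m - i) = Suc p \<and> narr s ''ps'' ! Suc p = m - i)"

definition located :: "state \<Rightarrow> bool" where
  "located s \<longleftrightarrow> (\<forall>i<n. narr s ''pt'' ! i = m - card {j. j < m \<and> rarr s ''xs'' ! j < fst (pl ! i)} \<and>
     narr s ''pr'' ! i = Suc (card {j. j < m \<and> rarr s ''ys'' ! j < snd (pl ! i)}))"

definition half_ranked :: "state \<Rightarrow> bool" where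
  "half_ranked s \<longleftrightarrow> bij_betw ((!) (narr s ''xo'')) {..<m} {..<m} \<and>
     (\<forall>i<m. rarr s ''xs'' ! i = fst (qs ! (narr s ''xo'' ! i))) \<and> (\<forall>i j. i \<le> j \<longrightarrow> j < m \<longrightarrow> rarr s ''xs'' ! i \<le> rarr s ''xs'' ! j)"

lemma wp_sort_x:
  assumes "core s" "blank s"
  shows "wp W Sp (tournament_sort ''qx'' ''xo'' ''xs'') s
    (\<lambda>t s'. t \<le> 6 * 2 ^ L + 40 + m * (160 * L + 120) \<and> (core s' \<and> blank s' \<and> half_ranked s'))"
proof (rule wp_conseq[OF wp_sort[where L = L and m = m and key = "map fst qs"]], goal_cases)
  case (18 t s')
  note f = frameD[OF 18(1), simplified]
  have "core s'" by (rule core_mono[OF assms(1)]) (use 18(2) f in auto)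
  moreover have "blank s'" using assms(2) f by (simp add: blank_def)
  moreover have "narr s' ''xo'' ! i < m" if "i < m" for i using 18(2) that by (auto simp: bij_betw_def)
  then have "\<forall>i<m. rarr s' ''xs'' ! i = fst (qs ! (narr s' ''xo'' ! i))" using 18(2) m by simp
  ultimately show ?case using 18(2) unfolding half_ranked_def by blast
qed (use assms bounds(1) L m space1_le in \<open>auto simp: core_def\<close>)

lemma wp_sort_y:
  assumes "core s" "blank s" "half_ranked s"
  shows "wp W Sp (tournament_sort ''qy'' ''yo'' ''ys'') s
    (\<lambda>t s'. t \<le> 6 * 2 ^ L + 40 + m * (160 * L + 120) \<and> (core s' \<and> blank s' \<and> ranked s'))"
proof (rule wp_conseq[OF wp_sort[where L = L and m = m and key = "map snd qs"]], goal_cases)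
  case (18 t s')
  note f = frameD[OF 18(1), simplified]
  have "core s'" by (rule core_mono[OF assms(1)]) (use 18(2) f in auto)
  moreover have "blank s'" using assms(2) f by (simp add: blank_def)
  moreover have "narr s' ''yo'' ! i < m" if "i < m" for i using 18(2) that by (auto simp: bij_betw_def)
  then have "\<forall>i<m. rarr s' ''ys'' ! i = snd (qs ! (narr s' ''yo'' ! i))" using 18(2) m by simp
  moreover have x: "narr s' ''xo'' = narr s ''xo''" "rarr s' ''xs'' = rarr s ''xs''" using f by auto
  ultimately show ?case using 18(2) assms(3) unfolding ranked_def half_ranked_def x by blast
qed (use assms bounds(1) L m space1_le in \<open>auto simp: core_def\<close>)

lemma wp_ranks:
  assumes s: "core s \<and> blank s \<and> ranked s"
  shows "wp W Sp rank_init s (\<lambda>t s'. t \<le> 50 * m + 50 \<and> (core s' \<and> ranked s' \<and> placed s'))"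
proof (rule wp_conseq[OF wp_no_new[OF wp_rank_init[where s = s and m = m and xo = "narr s ''xo''" and yo = "narr s ''yo''"]]], goal_cases)
  case (13 t s')
  note f = frameD[OF 13(1), simplified]
  have "core s'" by (rule core_mono[of s]) (use s 13(2) f in auto)
  moreover have "ranked s'" using s f by (simp add: ranked_mono[of s' s])
  ultimately show ?case using 13(2) f by (simp add: placed_def)
qed (use s bounds in \<open>auto simp: core_def blank_def ranked_def simp del: replicate.simps\<close>)

lemma wp_locates:
  assumes s: "core s \<and> ranked s \<and> placed s"
  shows "wp W Sp locate s (\<lambda>t s'. t \<le> n * (80 * L + 80) + 10 \<and> (core s' \<and> ranked s' \<and> placed s' \<and> located s'))"
proof (rule wp_conseq[OF wp_no_new[OF wp_locate[where s = s and m = m and n = n and L = L and px = "map fst pl" and py = "map snd pl"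
     and xs = "rarr s ''xs''" and ys = "rarr s ''ys''"]]], goal_cases)
  case (20 t s')
  note f = frameD[OF 20(1), simplified]
  have "core s'" by (rule core_mono[of s]) (use s 20(2) f in auto)
  moreover have "ranked s'" using s f by (simp add: ranked_mono[of s' s])
  moreover have "placed s'" using s f by (simp add: placed_def)
  ultimately show ?case using 20(2) f n by (simp add: located_def)
qed (use s bounds n L in \<open>auto simp: core_def ranked_def\<close>)

end

context inst
begin

definition cells :: nat where "cells = (if m * m < n then (m + 2) * (m + 1) else n)"

text \<open>The common interface of \<open>grid\<close> and \<open>bucket\<close> towards
  \<open>dp_data\<close>: merged or not, the slots of each time carry exactly the weights of the
  points arriving then. The \<open>12 * n\<close> is two arrays of at most \<open>6 * n\<close>
  cells.\<close>

definition event_arrays :: "state \<Rightarrow> state \<Rightarrow> bool" where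
  "event_arrays s s' \<longleftrightarrow> length (rarr s' ''ew'') = length (narr s' ''er'') \<and> length (narr s' ''er'') = cells \<and>
    (\<forall>e<cells. narr s' ''er'' ! e \<le> Suc m) \<and> length (narr s' ''of'') = m + 2 \<and>
    (\<forall>t t'. t \<le> t' \<longrightarrow> t' \<le> Suc m \<longrightarrow> narr s' ''of'' ! t \<le> narr s' ''of'' ! t') \<and> narr s' ''of'' ! Suc m \<le> cells \<and>
    (\<forall>t\<le>m. \<forall>u. gain (narr s' ''er'') (rarr s' ''ew'') (narr s' ''of'' ! t) (narr s' ''of'' ! Suc t) u =
      arrived (narr s ''pt'') (narr s ''pr'') (map w pl) n t u) \<and>
    space s' \<le> space1 + 12 * n + m + 2"

lemma event_arraysI:
  assumes "cells = C" and "\<And>t t'. t \<le> t' \<Longrightarrow> t' \<le> Suc m \<Longrightarrow> narr s' ''of'' ! t \<le> narr s' ''of'' ! t'"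
    and "narr s' ''of'' ! Suc m \<le> cells" and "space s' \<le> space1 + 12 * n + m + 2"
    and "length (narr s' ''er'') = C" "length (rarr s' ''ew'') = C" "\<forall>e<C. narr s' ''er'' ! e \<le> Suc m" "length (narr s' ''of'') = m + 2"
    and "\<forall>t\<le>m. \<forall>u. gain (narr s' ''er'') (rarr s' ''ew'') (narr s' ''of'' ! t) (narr s' ''of'' ! Suc t) u =
      arrived (narr s ''pt'') (narr s ''pr'') (map w pl) n t u"
  shows "event_arrays s s'"
  unfolding event_arrays_def assms(1,5,6,8) by (intro conjI allI impI refl) (use assms in \<open>simp_all only:\<close>)

text \<open>The constants 9 and 6 are attained at \<open>m = 1\<close>. The grid is used only if
  \<open>m * m < n\<close>, so its cells stay within linear space.\<close>

lemma grid_le: "m * m < n \<Longrightarrow> (m + 2) * (m + 1) \<le> 6 * n" "(m + 2) * (m + 2) \<le> 9 * (m * m)" "(m + 2) * (m + 1) \<le> 6 * (m * m)"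
proof -
  obtain j where j: "m = Suc j" using m by (cases m) auto
  show "(m + 2) * (m + 2) \<le> 9 * (m * m)" and 6: "(m + 2) * (m + 1) \<le> 6 * (m * m)"
    unfolding j by (simp_all add: algebra_simps)
  show "(m + 2) * (m + 1) \<le> 6 * n" if "m * m < n"
    by (rule order_trans[OF 6]) (use that in simp)
qed

lemma cells_W: "cells < W"
proof -
  have "(m + 2) * (m + 1) \<le> (m + 2) * (m + 2)" by (rule mult_le_mono2) simp
  from le_less_trans[OF this bounds(6)] show ?thesis using bounds(3) unfolding cells_def by simp
qed

lemma wp_all_events:
  assumes s: "core s" "located s"
  shows "wp W Sp events s (\<lambda>t s'. t \<le> 250 * n + 50 * m + 120 \<and> frame events s s' \<and> event_arrays s s')"
proof -
  have core: "nvar s ''m'' = m" "nvar s ''n'' = n" "rarr s ''pw'' = map w pl" "length (narr s ''pt'') = n" "length (narr s ''pr'') = n"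
    "narr s ''of'' = replicate (m + 2) 0" "space s \<le> space1" using s(1) by (auto simp: core_def)
  have pt: "narr s ''pt'' ! i \<le> m" "narr s ''pr'' ! i \<le> Suc m" if "i < n" for i
  proof -
    have "card {j. j < m \<and> rarr s ''ys'' ! j < snd (pl ! i)} \<le> card {..<m}" by (rule card_mono) auto
    then show "narr s ''pt'' ! i \<le> m" "narr s ''pr'' ! i \<le> Suc m" using s(2) that by (auto simp: located_def)
  qed
  have lw: "length (map w pl) = n" using n by simp
  have "wp W Sp events s (\<lambda>t s'. t \<le> 250 * n + 50 * m + 120 \<and> event_arrays s s')"
  proof (cases "m * m < n")
    case True
    define q where "q = (m + 2) * (m + 1)"
    have q: "q \<le> 6 * n" using grid_le(1)[OF True] by (simp only: q_def)
    have sp: "space s + 2 * ((m + 2) * (m + 1)) \<le> Sp"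
      using core(7) q Sp[unfolded distrib_left] unfolding space1_def q_def[symmetric] by linarith
    have nW: "n < W" using bounds(3) by simp
    have lof: "length (narr s ''of'') = m + 2" using core(6) by simp
    have "wp W Sp grid s (\<lambda>t s'. t \<le> 20 * (9 * n) + 30 * n + 60 \<and> event_arrays s s')"
    proof (rule wp_conseq[OF wp_grid[OF core(1,2) refl refl core(3,4,5) lw lof pt bounds(6) nW sp]], goal_cases)
      case (3 t s')
      have "(m + 2) * (m + 2) \<le> 9 * n" by (rule order_trans[OF grid_le(2)]) (use True in simp)
      moreover have "t \<le> 20 * ((m + 2) * (m + 2)) + 30 * n + 60" using 3(2) by blast
      ultimately have t: "t \<le> 20 * (9 * n) + 30 * n + 60"
        by (meson add_le_mono1 mult_le_mono2 order_trans)
      have cells: "cells = (m + 2) * (m + 1)" using True by (simp add: cells_def)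
      have off: "narr s' ''of'' ! t = t * (m + 2)" if "t \<le> Suc m" for t using 3(2) that by blast
      have mono: "narr s' ''of'' ! t \<le> narr s' ''of'' ! t'" if "t \<le> t'" "t' \<le> Suc m" for t t'
        using off[of t] off[of t'] that mult_le_mono1[of t t' "m + 2"] by simp
      have last: "narr s' ''of'' ! Suc m \<le> cells" using off[of "Suc m"] cells by (simp add: algebra_simps)
      have "space s' \<le> space s + 2 * q" using 3(2) unfolding q_def by blast
      then have sp': "space s' \<le> space1 + 12 * n + m + 2" using core(7) q by linarith
      from 3(2) show ?case
        by (elim conjE) (intro conjI t, rule event_arraysI[OF cells mono last sp']; assumption)
    qed auto
    then show ?thesis using core True bounds unfolding events_def
      by (simp add: wp_If_eq eval_simps) (erule wp_conseq, simp)
  next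
    case False
    have sp: "space s + 2 * n + m + 2 \<le> Sp" using core(7) Sp by (simp add: space1_def)
    have "wp W Sp bucket s (\<lambda>t s'. t \<le> 70 * n + 50 * m + 100 \<and> event_arrays s s')"
    proof (rule wp_conseq[OF wp_bucket[OF core(1,2) refl refl core(3,4,5) lw core(6) pt bounds(2,3) sp]], goal_cases)
      case (3 t s')
      have cells: "cells = n" using False by (simp add: cells_def)
      have pt': "narr s ''pt'' ! i \<le> m" if "i < n" for i using pt that by blast
      have off: "narr s' ''of'' ! t = offs (narr s ''pt'') n t" if "t \<le> Suc m" for t using 3(2) that by blast
      have mono: "narr s' ''of'' ! t \<le> narr s' ''of'' ! t'" if "t \<le> t'" "t' \<le> Suc m" for t t'
        using off[of t] off[of t'] that offs_mono[of t t'] by simp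
      have last: "narr s' ''of'' ! Suc m \<le> cells" using off[of "Suc m"] cells offs_total[of n "narr s ''pt''" m] pt' by simp
      have sp': "space s' \<le> space1 + 12 * n + m + 2" using 3(2) core(7) by linarith
      from 3(2) show ?case
        by (elim conjE) (intro conjI, assumption, rule event_arraysI[OF cells mono last sp']; assumption)
    qed auto
    then show ?thesis using core False bounds unfolding events_def
      by (simp add: wp_If_eq eval_simps) (erule wp_conseq, simp)
  qed
  then show ?thesis by (rule wp_conseq) blast
qed

lemma events_mods [simp]:
  "nvars events = {''h'', ''x'', ''i'', ''e''}" "rvars events = {}" "narrs events = {''er'', ''of'', ''fi''}" "rarrs events = {''ew''}"
  by (auto simp: events_def)

section \<open>Optimal walk, output and total time\<close>

definition finish_time :: nat where
  "finish_time = 200 + m + 30 * c + c * (L + 1) * (87 * 2 ^ L + 300) + 4 * c * (cells + m + 1) * (160 * L + 170) + (100 * c + 50)"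

lemma wp_finish:
  assumes s: "core s" "ranked s" "placed s" "located s" and fr: "frame events s s1" and ea: "event_arrays s s1"
    and dist: "distinct pl" "distinct qs"
  shows "wp W Sp (Seq bisect emit) s1 (\<lambda>t s'. t \<le> finish_time \<and> correct_output (set pl) w (set qs) qs k s')"
proof -
  let ?nd = "narr s ''nd''" and ?ps = "narr s ''ps''" and ?off = "narr s1 ''of''" and ?er = "narr s1 ''er''" and ?ew = "rarr s1 ''ew''"
  let ?xo = "narr s ''xo''" and ?yo = "narr s ''yo''" and ?pt = "narr s ''pt''" and ?pr = "narr s ''pr''"
  note f = frameD[OF fr, simplified]
  note r = s(2)[unfolded ranked_def]
  note p = s(3)[unfolded placed_def]
  note e = ea[unfolded event_arrays_def]
  have sw: "sweep m ((!) ?nd) ((!) ?ps)"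
    by (rule sweep_ranks[of ?xo m ?yo]) (use r p in blast)+
  \<comment> \<open>All arrays read by the sweeps are final now, so the abstract sweep is
    instantiated with their actual contents.\<close>
  interpret dp_data m ?nd ?ps ?off ?er ?ew L W Sp
  proof (intro dp_data.intro dp_data_axioms.intro sw)
    show "length ?nd = m + 2" "length ?ps = m + 2" using s(1) by (auto simp: core_def)
    show "length ?off = m + 2" "length ?ew = length ?er" using e by auto
    show "?off ! t \<le> ?off ! t'" if "t \<le> t'" "t' \<le> Suc m" for t t' using e that by blast
    show "?off ! Suc m \<le> length ?er" using e by simp
    show "?er ! i < 2 ^ L" if "i < length ?er" for i
    proof -
      have "?er ! i \<le> Suc m" using e that by auto
      then show ?thesis using L(1) by linarith
    qed
    show "m + 2 \<le> 2 ^ L" by (rule L)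
    show "2 * 2 ^ L + 2 < W" by (rule bounds)
    show "length ?er < W" using e cells_W by simp
  qed
  have spc: "space s1 + c \<le> Sp"
  proof -
    have "space s1 \<le> space1 + 12 * n + m + 2" "c \<le> Suc m" using e c by auto
    then show ?thesis using Sp unfolding space1_def distrib_left by linarith
  qed
  have core1: "nvar s1 ''N'' = 2 ^ L" "nvar s1 ''m'' = m" "nvar s1 ''c'' = c" "narr s1 ''cu'' ! 0 = 0"
      "length (narr s1 ''cu'') = Suc c" "length (narr s1 ''nx'') = Suc c" "narr s1 ''yo'' = ?yo" "length ?yo = m"
    using s(1) f by (auto simp: core_def)
  have ctx1: "ctx s1" unfolding ctx_def using s(1) f spc by (simp add: core_def)
  have c0: "0 < c" using c by simp
  have loc: "?pt ! i = m - card {j. j < m \<and> rarr s ''xs'' ! j < fst (pl ! i)}"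
    "?pr ! i = Suc (card {j. j < m \<and> rarr s ''ys'' ! j < snd (pl ! i)})" if "i < n" for i
    using s(4) that unfolding located_def by blast+
  have r1: "bij_betw ((!) ?xo) {..<m} {..<m}" and r2: "bij_betw ((!) ?yo) {..<m} {..<m}"
    and r3: "\<forall>i<m. rarr s ''xs'' ! i = fst (qs ! (?xo ! i))" and r4: "\<forall>i j. i \<le> j \<longrightarrow> j < m \<longrightarrow> rarr s ''xs'' ! i \<le> rarr s ''xs'' ! j"
    and r5: "\<forall>i<m. rarr s ''ys'' ! i = snd (qs ! (?yo ! i))" and r6: "\<forall>i j. i \<le> j \<longrightarrow> j < m \<longrightarrow> rarr s ''ys'' ! i \<le> rarr s ''ys'' ! j"
    using r by blast+
  have p5: "\<forall>i<m. \<forall>p<m. ?xo ! i = ?yo ! p \<longrightarrow> ?nd ! (m - i) = Suc p \<and> ?ps ! Suc p = m - i" using p by blast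
  have gn: "gain ?er ?ew (?off ! t) (?off ! Suc t) u = arrived ?pt ?pr (map w pl) n t u" if "t \<le> m" for t u
    using e that by blast
  define R where "R s' \<longleftrightarrow> lens s1 s' \<and> nvar s' ''c'' = c \<and> nvar s' ''m'' = m \<and> narr s' ''yo'' = ?yo \<and>
    (\<forall>y. walk c 0 (Suc m) y \<longrightarrow> y \<le> rvar s' ''value'') \<and> traced (narr s' ''cu'') c (rvar s' ''value'') \<and>
    narr s' ''cu'' ! 0 = 0 \<and> narr s' ''cu'' ! c = Suc m" for s'
  let ?T = "200 + m + 30 * c + c * (L + 1) * lin + 4 * c * width 0 (Suc m) * lg"
  have 1: "wp W Sp bisect s1 (\<lambda>t s'. t \<le> ?T \<and> R s')"
  proof (rule wp_conseq[OF wp_bisect[OF ctx1 core1(3) c0 bounds(4,7) core1(5,6,4)]], goal_cases)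
    case (1 t s')
    have "nvar s' ''c'' = c" "nvar s' ''m'' = m" "narr s' ''yo'' = ?yo" using frameD[OF 1(1), simplified] core1 by auto
    then show ?case using 1(2) unfolding R_def by blast
  qed
  have 2: "wp W Sp emit s2 (\<lambda>t s'. t \<le> 100 * c + 50 \<and> correct_output (set pl) w (set qs) qs k s')" if R: "R s2" for s2
  proof -
    define cu where "cu = narr s2 ''cu''"
    define V where "V = rvar s2 ''value''"
    have V: "\<forall>y. walk c 0 (Suc m) y \<longrightarrow> y \<le> V" and cu: "cu ! 0 = 0" "cu ! c = Suc m" and l: "lens s1 s2"
      using R unfolding R_def V_def cu_def by blast+
    obtain y where y: "\<forall>p<c. walk (Suc 0) (cu ! p) (cu ! Suc p) (y p)" "V = (\<Sum>p<c. y p)"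
      using R unfolding R_def traced_def V_def cu_def by blast
    have lcu: "length cu = Suc c" using lensD(1)[OF l, of "''cu''"] core1(5) by (simp add: cu_def)
    have cule: "cu ! i \<le> Suc m" if "i \<le> c" for i using trace_mono[OF y(1) that order_refl] cu by simp
    have sp2: "space s2 + c \<le> Sp" using spc space_lens[OF l] by simp
    have v2: "nvar s2 ''c'' = c" "nvar s2 ''m'' = m" "narr s2 ''yo'' = ?yo" using R unfolding R_def by blast+
    have region: "region_weight (set pl) w (dom_set ((\<lambda>u. qs ! (?yo ! (u - 1))) ` A)) = worth A" if A: "A \<subseteq> {1..m}" for A
    proof (rule region_worth[where pl = pl and pt = ?pt and pr = ?pr, OF _ dist(1) refl _ _ _ A])
      show "gain ?er ?ew (?off ! t) (?off ! Suc t) u = arrived ?pt ?pr (map w pl) (length pl) t u" if "t \<le> m" for t u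
        using gn[OF that] unfolding n by simp
      show "?pt ! i \<le> m" "0 < ?pr ! i" if "i < length pl" for i using loc that n by simp_all
      show "pl ! i \<in> dom_point (qs ! (?yo ! (u - 1))) \<longleftrightarrow> ?ps ! u \<le> ?pt ! i \<and> ?pr ! i \<le> u"
        if i: "i < length pl" and u: "u \<in> {1..m}" for i u
        by (rule dominance_ranks[OF m(1) r1 r2 p5 r3 r4 r5 r6 u]) (use loc i n in simp_all)
    qed
    show ?thesis
    proof (rule wp_conseq[OF wp_emit[OF v2(1,2) cu_def[symmetric] lcu v2(3) core1(8) bounds(2,4) cule sp2]], goal_cases)
      case (2 t s')
      have "correct_output (set pl) w (set qs) qs k s'"
        by (rule optimal_output[OF region r2 dist(2) m(1) refl c V y cu])
          (use 2(2) in \<open>simp_all add: output_indices_def output_value_def V_def\<close>)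
      then show ?case using 2(2) by blast
    qed auto
  qed
  have "?off ! Suc m \<le> cells" using e by blast
  then have "width 0 (Suc m) \<le> cells + m + 1" unfolding width_def pos_0 pos_end by linarith
  then have "4 * c * width 0 (Suc m) * lg \<le> 4 * c * (cells + m + 1) * lg" by (intro mult_le_mono1 mult_le_mono2)
  then have T: "?T + (100 * c + 50) \<le> finish_time" unfolding finish_time_def lin_def lg_def by linarith
  show ?thesis by (rule wp_conseq[OF wp_seqI[OF 1 2]]) (use T in auto)
qed

definition total_time :: nat where
  "total_time = 10 + (10 * L + 2 * n + 30 * m + 250) + 2 * (6 * 2 ^ L + 40 + m * (160 * L + 120)) + (50 * m + 50) + (n * (80 * L + 80) + 10) +
    (250 * n + 50 * m + 120) + finish_time"

lemma wp_max_dominance: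
  assumes dist: "distinct pl" "distinct qs"
  shows "wp W Sp max_dominance (input_state pl w qs k) (\<lambda>t s'. t \<le> total_time \<and> correct_output (set pl) w (set qs) qs k s')"
proof -
  let ?s = "input_state pl w qs k"
  define P where "P s' \<longleftrightarrow> (\<exists>s. core s \<and> ranked s \<and> placed s \<and> located s \<and> frame events s s' \<and> event_arrays s s')" for s'
  have ev: "wp W Sp events s (\<lambda>t s'. t \<le> 250 * n + 50 * m + 120 \<and> P s')" if s: "core s \<and> ranked s \<and> placed s \<and> located s" for s
    by (rule wp_conseq[OF wp_all_events]) (use s in \<open>auto simp: P_def\<close>)
  have fin: "wp W Sp (Seq bisect emit) s (\<lambda>t s'. t \<le> finish_time \<and> correct_output (set pl) w (set qs) qs k s')" if "P s" for s
    using that wp_finish dist unfolding P_def by blast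
  have sx: "wp W Sp (tournament_sort ''qx'' ''xo'' ''xs'') s (\<lambda>t s'. t \<le> 6 * 2 ^ L + 40 + m * (160 * L + 120) \<and> (core s' \<and> blank s' \<and> half_ranked s'))"
    if "core s \<and> blank s" for s using wp_sort_x that by blast
  have sy: "wp W Sp (tournament_sort ''qy'' ''yo'' ''ys'') s (\<lambda>t s'. t \<le> 6 * 2 ^ L + 40 + m * (160 * L + 120) \<and> (core s' \<and> blank s' \<and> ranked s'))"
    if "core s \<and> blank s \<and> half_ranked s" for s using wp_sort_y that by blast
  note all = wp_seqI[OF wp_start[OF refl] wp_seqI[OF sx wp_seqI[OF sy wp_seqI[OF wp_ranks wp_seqI[OF wp_locates wp_seqI[OF ev fin]]]]]]
  have "wp W Sp (Seq size_tree (Seq set_levels (Seq allocate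
    (Seq (tournament_sort ''qx'' ''xo'' ''xs'') (Seq (tournament_sort ''qy'' ''yo'' ''ys'')
    (Seq rank_init (Seq locate (Seq events (Seq bisect emit))))))))) ?s (\<lambda>t s'. t + 10 \<le> total_time \<and> correct_output (set pl) w (set qs) qs k s')"
  proof -
    have "wp W Sp (Seq (Seq size_tree (Seq set_levels allocate))
    (Seq (tournament_sort ''qx'' ''xo'' ''xs'') (Seq (tournament_sort ''qy'' ''yo'' ''ys'')
    (Seq rank_init (Seq locate (Seq events (Seq bisect emit))))))) ?s (\<lambda>t s'. t + 10 \<le> total_time \<and> correct_output (set pl) w (set qs) qs k s')"
      by (rule wp_conseq[OF all]) (auto simp: total_time_def)
    then show ?thesis by (simp only: wp_Seq_eq add.assoc cong del: wp_cong)
  qed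
  moreover have "nvar ?s ''m'' = m" using m by (simp add: input_state_def)
  ultimately show ?thesis unfolding max_dominance_def using m bounds(2)
    by (simp add: wp_If_eq eval_simps) (erule wp_conseq, simp)
qed

end

text \<open>\<open>E\<close> stands for the number of leaves, \<open>q\<close> for the number of
  event slots and \<open>K\<close> for \<open>min k m\<close>. Every term is at most a constant
  times \<open>L\<close>, \<open>L * n\<close>, \<open>L * K * m\<close> or
  \<open>L * K * q\<close>, up to additive constants; naming these products leaves linear
  arithmetic.\<close>

lemma total_time_arith:
  fixes L m K c E n q :: nat
  assumes "1 \<le> L" "1 \<le> m" "1 \<le> K" and c: "c \<le> 2 * K" and E: "E \<le> 6 * m"
  shows "10 + (10 * L + 2 * n + 30 * m + 250) + 2 * (6 * E + 40 + m * (160 * L + 120)) + (50 * m + 50) + (n * (80 * L + 80) + 10) +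
      (250 * n + 50 * m + 120) +
      (200 + m + 30 * c + c * (L + 1) * (87 * E + 300) + 4 * c * (q + m + 1) * (160 * L + 170) + (100 * c + 50))
    \<le> 20000 * (L * (n + K * (q + m)))"
proof -
  define a b d e where "a = L * n" and "b = L * (K * m)" and "d = L * (K * q)" and "e = L * m"
  have a: "n \<le> a" using assms(1) by (simp add: a_def)
  have "m \<le> K * m" "K \<le> K * m" using assms by simp_all
  moreover have "K * m \<le> b" using assms(1) by (simp add: b_def)
  moreover have e: "e \<le> b" unfolding e_def b_def by (rule mult_le_mono2) fact
  moreover have "L \<le> e" using assms(2) by (simp add: e_def)
  ultimately have b: "m \<le> b" "K \<le> b" "e \<le> b" "L \<le> b" by linarith+
  have "c * (L + 1) * (87 * E + 300) \<le> (2 * K) * (2 * L) * (822 * m)"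
    by (intro mult_le_mono) (use assms in linarith)+
  also have "\<dots> = 3288 * b" by (simp add: b_def)
  finally have 1: "c * (L + 1) * (87 * E + 300) \<le> 3288 * b" .
  have "4 * c * (q + m + 1) * (160 * L + 170) \<le> 4 * (2 * K) * (2 * (q + m)) * (330 * L)"
    by (intro mult_le_mono) (use assms in simp_all)
  also have "\<dots> = 5280 * d + 5280 * b" by (simp add: b_def d_def algebra_simps)
  finally have 2: "4 * c * (q + m + 1) * (160 * L + 170) \<le> 5280 * d + 5280 * b" .
  have 3: "m * (160 * L + 120) = 160 * e + 120 * m" "n * (80 * L + 80) = 80 * a + 80 * n"
    by (simp_all add: e_def a_def algebra_simps)
  define f g where "f = c * (L + 1) * (87 * E + 300)" and "g = 4 * c * (q + m + 1) * (160 * L + 170)"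
  have 4: "L * (n + K * (q + m)) = a + b + d" by (simp add: a_def b_def d_def algebra_simps)
  show ?thesis using 1 2 a b c E assms(2) unfolding 3 4 f_def[symmetric] g_def[symmetric] by simp
qed

text \<open>Whichever branch stored the events, their number is at most \<open>6 * n\<close> and at
  most \<open>6 * m^2\<close>. So the single quantity \<open>X\<close> lies below both arms of the
  minimum, up to the factor 8.\<close>

lemma (in inst) total_time_le: "real total_time \<le> 1000000 * time_bound n m k"
proof -
  define K where "K = min k m"
  define X where "X = n + K * (cells + m)"
  have K: "1 \<le> K" "K \<le> k" using k m by (auto simp: K_def)
  have L1: "1 \<le> L" using L(1) by (cases L) auto
  have cells: "cells \<le> 6 * n" "cells \<le> 6 * (m * m)" using grid_le by (auto simp: cells_def)
  have "c \<le> 2 * K" using c K by (simp add: K_def[symmetric])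
  moreover have "2 ^ L \<le> 6 * m" using L m by simp
  ultimately have T: "total_time \<le> 20000 * (L * X)"
    unfolding total_time_def finish_time_def X_def using total_time_arith[OF L1 _ K(1)] m by simp
  have 1: "X \<le> 8 * (k * (n + m))"
  proof -
    have "n \<le> k * n" using k by simp
    moreover have "K * m \<le> k * m" using K by simp
    moreover have "K * cells \<le> k * (6 * n)" by (intro mult_le_mono K cells)
    ultimately show ?thesis unfolding X_def distrib_left by linarith
  qed
  have 2: "X \<le> 8 * (n + k * (m * m))"
  proof -
    have "K * m \<le> k * (m * m)" using K m by (intro mult_le_mono) simp_all
    moreover have "K * cells \<le> k * (6 * (m * m))" by (intro mult_le_mono K cells)
    ultimately show ?thesis unfolding X_def distrib_left by linarith
  qed
  define Z where "Z = real k * min (real n + real m) (real n / real k + (real m)\<^sup>2)"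
  have "Z = min (real (k * (n + m))) (real (n + k * (m * m)))"
    using k by (simp add: Z_def min_mult_distrib_left distrib_left power2_eq_square)
  then have X: "real X \<le> 8 * Z" using of_nat_mono[OF 1, where 'a = real] of_nat_mono[OF 2, where 'a = real] by (simp add: min_def)
  \<comment> \<open>Turns the height of the tree into \<open>3 * log 2 (m + 1)\<close>; the cube
    exceeds \<open>2 * (m + 2)\<close> from \<open>m = 1\<close> on.\<close>
  have "2 ^ L \<le> (m + 1) ^ 3"
  proof -
    obtain j where "m = Suc j" using m by (cases m) auto
    then have "2 * (m + 2) \<le> (m + 1) ^ 3" by (simp add: power3_eq_cube algebra_simps)
    then show ?thesis using L(2) by simp
  qed
  from of_nat_mono[OF this, where 'a = real] have "(2::real) ^ L \<le> (real m + 1) ^ 3" by (simp add: add.commute)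
  then have "log 2 (2 ^ L) \<le> log 2 ((real m + 1) ^ 3)" by (subst log_le_cancel_iff) auto
  then have Ll: "real L \<le> 3 * log 2 (real m + 1)" by (simp add: log_nat_power)
  have "real total_time \<le> 20000 * (real L * real X)" using of_nat_mono[OF T, where 'a = real] by simp
  also have "\<dots> \<le> 20000 * ((3 * log 2 (real m + 1)) * (8 * Z))"
    using X Ll by (intro mult_left_mono mult_mono) auto
  also have "\<dots> = 480000 * (Z * log 2 (real m + 1))" by simp
  also have "\<dots> \<le> 1000000 * (1 + Z * log 2 (real m + 1))"
  proof -
    have "0 \<le> Z * log 2 (real m + 1)" using X by (intro mult_nonneg_nonneg) auto
    then show ?thesis by simp
  qed
  finally show ?thesis by (simp add: time_bound_def Z_def)
qed

section \<open>No candidates, and the machine limits\<close>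

lemma maxDominance_empty: "maxDominance P w {} k = 0"
proof -
  have "{region_weight P w (dom_set Q') | Q'. Q' \<subseteq> {} \<and> card Q' \<le> k} = {0}"
    by (auto simp: region_weight_def dom_set_def)
  then show ?thesis by (simp add: maxDominance_def)
qed

lemma max_dominance_no_candidates:
  assumes "0 < W"
  shows "wp W S max_dominance (input_state ps w [] k) (\<lambda>t s. t \<le> 5 \<and> correct_output P w {} [] k s)"
  unfolding max_dominance_def using assms
  by (simp add: wp_If_eq wp_Skip_eq eval_simps input_state_def correct_output_def
      output_value_def output_set_def output_indices_def maxDominance_empty region_weight_def dom_set_def)

text \<open>With \<open>x = n + m + k + 2 \<ge> 4\<close>, eight of the ten factors provide
  \<open>4 ^ 8 = 65536\<close>, so that \<open>65536 * x^2\<close> amply covers the quadratic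
  requirement.\<close>

lemma word_limit_sufficient:
  assumes "0 < m" "0 < k"
  shows "16 * (m + 2) * (m + 2) + n + k + 10 < word_limit 10 n m k"
proof -
  define x where "x = n + m + k + 2"
  have x: "4 \<le> x" "m + 2 \<le> x" "n + k + 2 \<le> x" using assms by (auto simp: x_def)
  have "(4::nat) ^ 8 \<le> x ^ 8" using x by (intro power_mono) auto
  then have 1: "65536 * (x * x) \<le> x ^ 8 * (x * x)" by (intro mult_le_mono1) simp
  have "(m + 2) * (m + 2) \<le> x * x" by (intro mult_le_mono x)
  moreover have "4 * x \<le> x * x" using x by (intro mult_le_mono1)
  ultimately have "16 * (m + 2) * (m + 2) + n + k + 10 < 65536 * (x * x)" using x unfolding mult.assoc by linarith
  also have "\<dots> \<le> x ^ 10" using 1 power_add[of x 8 2] by (simp add: power2_eq_square)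
  finally show ?thesis by (simp add: word_limit_def x_def)
qed

lemma ex_tree_height:
  fixes m :: nat
  obtains L :: nat where "m + 2 \<le> 2 ^ L" "2 ^ L < 2 * (m + 2)"
proof -
  define L where "L = (LEAST L. m + 2 \<le> 2 ^ L)"
  have "m + 2 \<le> 2 ^ (m + 2)" by (rule less_imp_le) (rule less_exp)
  then have 1: "m + 2 \<le> 2 ^ L" unfolding L_def by (rule LeastI)
  obtain j where j: "L = Suc j" using 1 by (cases L) auto
  have "\<not> m + 2 \<le> 2 ^ j" using j unfolding L_def by (intro not_less_Least) simp
  then show ?thesis using that[of L] 1 j by simp
qed

text \<open>One constant has to serve both limits. 1000000 is dictated by the time bound and far
  exceeds the 100 that \<open>inst\<close> asks for the space.\<close>

lemma wp_max_dominance_bounds: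
  assumes dist: "distinct ps" "distinct qs" and k: "0 < k"
  shows "wp (word_limit 10 (length ps) (length qs) k) (space_limit 1000000 (length ps) (length qs)) max_dominance (input_state ps w qs k)
    (\<lambda>t s. real t \<le> real 1000000 * time_bound (length ps) (length qs) k \<and> correct_output (set ps) w (set qs) qs k s)"
    (is "wp ?W ?S _ _ _")
proof (cases "length qs")
  case 0
  then have q: "qs = []" by simp
  have "0 < ?W" by (simp add: word_limit_def)
  from max_dominance_no_candidates[OF this, of ?S ps w k "set ps"] show ?thesis
    unfolding q by (rule wp_conseq) (auto simp: time_bound_def)
next
  case (Suc j)
  obtain L where L: "length qs + 2 \<le> 2 ^ L" "2 ^ L < 2 * (length qs + 2)" by (rule ex_tree_height)
  interpret inst ps qs w k "length qs" "length ps" "Suc (min k (length qs))" L ?W ?S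
    by unfold_locales (use Suc k L word_limit_sufficient[of "length qs" k] in \<open>auto simp: space_limit_def\<close>)
  show ?thesis
  proof (rule wp_conseq[OF wp_max_dominance[OF dist]], goal_cases)
    case (1 t s)
    then have "real t \<le> real total_time" by simp
    then show ?case using total_time_le 1 by simp
  qed
qed

theorem theorem2:
  "\<exists>(prog :: com) (C :: nat) (d :: nat).
     \<forall>(P :: point set) (w :: point \<Rightarrow> real) (Q :: point set) (n :: nat) (m :: nat) (k :: nat)
      (ps :: point list) (qs :: point list).
       finite P \<and> card P = n \<and> finite Q \<and> card Q = m \<and> 0 < k \<and>
       distinct ps \<and> set ps = P \<and> distinct qs \<and> set qs = Q \<longrightarrow>
       (\<exists>t s. exec (word_limit d n m k) (space_limit C n m) prog (input_state ps w qs k) t s \<and>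
              real t \<le> real C * time_bound n m k \<and>
              correct_output P w Q qs k s)"
proof (rule exI[of _ max_dominance], rule exI[of _ 1000000], rule exI[of _ 10], intro allI impI, elim conjE)
  fix P Q :: "point set" and w :: "point \<Rightarrow> real" and n m k :: nat and ps qs :: "point list"
  assume n: "card P = n" and m: "card Q = m" and "0 < k" and ps: "distinct ps" "set ps = P" and qs: "distinct qs" "set qs = Q"
  have "length ps = n" "length qs = m"
    using distinct_card[OF ps(1)] distinct_card[OF qs(1)] n m ps(2) qs(2) by simp_all
  with wp_max_dominance_bounds[OF ps(1) qs(1) \<open>0 < k\<close>, of w]
  show "\<exists>t s. exec (word_limit 10 n m k) (space_limit 1000000 n m) max_dominance (input_state ps w qs k) t s \<and>
      real t \<le> real 1000000 * time_bound n m k \<and> correct_output P w Q qs k s"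
    unfolding wp_def ps(2) qs(2) by simp
qed

end
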